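(* Let $\beta>0$, $\beta'=\beta/2$, and let $\mathrm d\in\mathbb C$ with $\Re\,\mathrm d\ge0$. For $n\in\mathbb N$ and $(\zeta_1,\dots,\zeta_n)\in\mathbb T^n$ let $$h(\zeta_1,\dots,\zeta_n)=\prod_{k=1}^n(1-\zeta_k)^{\bar{\mathrm d}\beta'n}(1-\bar\zeta_k)^{\mathrm d\beta'n}\prod_{j<k}|\zeta_j-\zeta_k|^{2\beta'}$$ and let $\mathbb P^{(n)}_{\mathrm d}$ be the distribution on $\mathbb T^n$ having density $\frac1{\mathcal Z_{\mathrm d}(n)}h(\zeta_1,\dots,\zeta_n)$, where $\mathcal Z_{\mathrm d}(n)$ is the normalization constant. (1) We have $$\lim_{n\to\infty}\frac1{n^2\beta'}\log\mathcal Z_{\mathrm d}(n)=B(\mathrm d),$$ where $$B(\mathrm d)=\int_0^1\big[x\log x+(x+2\Re\,\mathrm d)\log(x+2\Re\,\mathrm d)\big]dx-\int_0^1\big[(x+\mathrm d)\log(x+\mathrm d)+(x+\bar{\mathrm d})\log(x+\bar{\mathrm d})\big]dx.$$ (2) The sequence of distributions of $\mu^{(n)}_{\mathtt{esd}}=\frac{\delta_{\zeta_1}+\dots+\delta_{\zeta_n}}n$ under $\mathbb P^{(n)}_{\mathrm d}$ satisfies the large deviation principle in $\mathcal M_1(\mathbb T)$ at scale $\beta'n^2$ with (good) rate function $$I_{\mathrm d}(\mu)=-\Sigma(\mu)+\int_{\mathbb T}Q_{\mathrm d}(\zeta)\,d\mu(\zeta)+B(\mathrm d).$$ (3) The rate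 function vanishes only at $\mu=\mu_{\mathrm d}$.
   Context: $\mathbb T=\{|z|=1\}$; $\mathcal M_1(\mathbb T)$ is the space of probability measures on $\mathbb T$ with the weak topology. Complex powers and $\log$ are principal. Densities on $\mathbb T^n$ are with respect to the $n$-fold product of normalized Haar measure $d\theta/2\pi$. Voiculescu entropy: $\Sigma(\mu)=\iint\log|\zeta-\zeta'|\,d\mu(\zeta)d\mu(\zeta')\in[-\infty,\infty)$. Potential: $Q_{\mathrm d}(\zeta)=-2(\Re\,\mathrm d)\log\big(2\sin\frac\theta2\big)-(\Im\,\mathrm d)(\theta-\pi)$ if $\zeta=e^{\mathrm i\theta}$, $\theta\in(0,2\pi)$; $Q_{\mathrm d}(1)=+\infty$ if $\Re\,\mathrm d>0$; $Q_{\mathrm d}(1)=-|\Im\,\mathrm d|\pi$ if $\Re\,\mathrm d=0$. Large deviation principle: a sequence $(P_n)$ of probability measures on a Hausdorff measurable space $\mathcal X$ satisfies the LDP at scale $u_n\to\infty$ with rate function $I:\mathcal X\to[0,\infty]$ (lower semicontinuous) if $\limsup\frac1{u_n}\log P_n(F)\le-\inf_FI$ for every closed $F$ and $\liminf\frac1{u_n}\log P_n(G)\ge-\inf_GI$ for every open $G$. $I$ is good if its level sets are compact. The measure $\mu_{\mathrm d}$: put $\alpha_{\mathrm d}=-\frac{\bar{\mathrm d}}{1+\bar{\mathrm d}}$, let $\theta_{\mathrm d}\in[0,\pi)$ and $\xi_{\mathrm d}\in[-\theta_{\mathrm d},\theta_{\mathrm d}]$ be such that $\sin\frac{\theta_{\mathrm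 d}}2=\left|\frac{\mathrm d}{1+\mathrm d}\right|$ and $e^{\mathrm i\xi_{\mathrm d}}=\frac{1+\mathrm d}{1+\bar{\mathrm d}}$. If $\mathrm d\ne0$, $d\mu_{\mathrm d}(\zeta)=w_{\mathrm d}(\theta)\frac{d\theta}{2\pi}$ ($\zeta=e^{\mathrm i\theta}$), with $$w_{\mathrm d}(\theta)=\frac{\sqrt{\sin^2((\theta-\xi_{\mathrm d})/2)-\sin^2(\theta_{\mathrm d}/2)}}{|1+\alpha_{\mathrm d}|\sin(\theta/2)}\quad\text{if }\theta\in(\theta_{\mathrm d}+\xi_{\mathrm d},\,2\pi-\theta_{\mathrm d}+\xi_{\mathrm d}),$$ and $w_{\mathrm d}(\theta)=0$ otherwise; $\mu_0$ is the normalized Haar measure on $\mathbb T$. *)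

theory Defs
  imports "HOL-Probability.Probability"
begin

section \<open>Extended-real conventions\<close>

definition elog :: "real \<Rightarrow> ereal"
  where "elog x = (if x > 0 then ereal (ln x) else - \<infinity>)"

text \<open>The integral of an extended-real function as the difference of the integrals of its positive
  and negative parts (\<open>e2ennreal\<close> cuts negative values off at 0). In every use below at least one of
  the two parts is finite.\<close>

definition eintegral :: "'a measure \<Rightarrow> ('a \<Rightarrow> ereal) \<Rightarrow> ereal"
  where "eintegral M f =
    enn2ereal (\<integral>\<^sup>+x. e2ennreal (f x) \<partial>M) - enn2ereal (\<integral>\<^sup>+x. e2ennreal (- f x) \<partial>M)"


section \<open>Large deviation principles\<close>

definition borel_of :: "'a topology \<Rightarrow> 'a measure"
  where "borel_of X = sigma (topspace X) {U. openin X U}"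

definition rate_function :: "'a topology \<Rightarrow> ('a \<Rightarrow> ereal) \<Rightarrow> bool"
  where "rate_function X I \<longleftrightarrow>
    (\<forall>x\<in>topspace X. 0 \<le> I x) \<and> (\<forall>a::real. closedin X {x \<in> topspace X. I x \<le> ereal a})"

definition good_rate_function :: "'a topology \<Rightarrow> ('a \<Rightarrow> ereal) \<Rightarrow> bool"
  where "good_rate_function X I \<longleftrightarrow>
    rate_function X I \<and> (\<forall>a::real. compactin X {x \<in> topspace X. I x \<le> ereal a})"

text \<open>Sequences are indexed by \<open>n \<ge> 1\<close>; the value \<open>P 0\<close> is irrelevant. The space carries its Borel
  \<open>\<sigma>\<close>-algebra.\<close>

definition LDP :: "'a topology \<Rightarrow> (nat \<Rightarrow> 'a measure) \<Rightarrow> (nat \<Rightarrow> real) \<Rightarrow> ('a \<Rightarrow> ereal) \<Rightarrow> bool"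
  where "LDP X P u I \<longleftrightarrow>
    Hausdorff_space X \<and>
    (\<forall>n\<ge>1. prob_space (P n) \<and> sets (P n) = sets (borel_of X)) \<and>
    filterlim u at_top sequentially \<and>
    rate_function X I \<and>
    (\<forall>F. closedin X F \<longrightarrow>
      limsup (\<lambda>n. elog (measure (P n) F) / ereal (u n)) \<le> - (INF x\<in>F. I x)) \<and>
    (\<forall>G. openin X G \<longrightarrow>
      - (INF x\<in>G. I x) \<le> liminf (\<lambda>n. elog (measure (P n) G) / ereal (u n)))"


section \<open>Probability measures on the unit circle\<close>

abbreviation circle :: "complex set" where "circle \<equiv> sphere 0 1"

definition circle_borel :: "complex measure"
  where "circle_borel = restrict_space borel circle"

definition haar :: "complex measure"
  where "haar = distr (uniform_measure lborel {0..<2*pi}) circle_borel cis"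

abbreviation M1 :: "complex measure set"
  where "M1 \<equiv> space (prob_algebra circle_borel)"

definition weak_topology :: "complex measure topology"
  where "weak_topology = topology_generated_by
    {{\<mu> \<in> M1. (\<integral>z. f z \<partial>\<mu>) \<in> U} | f U. continuous_on circle (f :: complex \<Rightarrow> real) \<and> open U}"

lemma topspace_weak_topology: "topspace weak_topology = M1"
proof -
  have "M1 \<in> {{\<mu> \<in> M1. (\<integral>z. f z \<partial>\<mu>) \<in> U} | f U. continuous_on circle (f :: complex \<Rightarrow> real) \<and> open U}"
    by (rule CollectI, rule exI[of _ "\<lambda>_. 0"], rule exI[of _ UNIV]) auto
  then show ?thesis
    unfolding weak_topology_def topology_generated_by_topspace by blast
qed

definition voiculescu_entropy :: "complex measure \<Rightarrow> ereal"
  where "voiculescu_entropy \<mu> = eintegral (\<mu> \<Otimes>\<^sub>M \<mu>) (\<lambda>(z, z'). elog (cmod (z - z')))"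

text \<open>\<open>Arg2pi\<close> takes values in \<open>[0, 2\<pi>)\<close>.\<close>

definition potential :: "complex \<Rightarrow> complex \<Rightarrow> ereal"
  where "potential d z =
    (if z = 1 then (if Re d > 0 then \<infinity> else ereal (- \<bar>Im d\<bar> * pi))
     else let \<theta> = Arg2pi z in ereal (- 2 * Re d * ln (2 * sin (\<theta> / 2)) - Im d * (\<theta> - pi)))"


section \<open>The equilibrium measure\<close>

definition alpha_d :: "complex \<Rightarrow> complex"
  where "alpha_d d = - (cnj d / (1 + cnj d))"

definition theta_d :: "complex \<Rightarrow> real"
  where "theta_d d = (THE t. 0 \<le> t \<and> t < pi \<and> sin (t / 2) = cmod (d / (1 + d)))"

definition xi_d :: "complex \<Rightarrow> real"
  where "xi_d d = (THE x. - theta_d d \<le> x \<and> x \<le> theta_d d \<and> cis x = (1 + d) / (1 + cnj d))"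

definition w_d :: "complex \<Rightarrow> real \<Rightarrow> real"
  where "w_d d \<theta> =
    (if theta_d d + xi_d d < \<theta> \<and> \<theta> < 2 * pi - theta_d d + xi_d d
     then sqrt ((sin ((\<theta> - xi_d d) / 2))\<^sup>2 - (sin (theta_d d / 2))\<^sup>2)
            / (cmod (1 + alpha_d d) * sin (\<theta> / 2))
     else 0)"

definition mu_d :: "complex \<Rightarrow> complex measure"
  where "mu_d d = (if d = 0 then haar else density haar (\<lambda>z. ennreal (w_d d (Arg2pi z))))"

text \<open>The definite descriptions above are well defined.\<close>

lemma cmod_d_less:
  assumes "Re d \<ge> 0"
  shows "cmod (d / (1 + d)) < 1"
proof -
  have "(cmod d)\<^sup>2 < (cmod (1 + d))\<^sup>2"
    using assms by (simp only: cmod_power2) (simp add: power2_eq_square algebra_simps)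
  then have "cmod d < cmod (1 + d)"
    by (rule power2_less_imp_less) simp
  moreover from this have "0 < cmod (1 + d)"
    using norm_ge_zero[of d] by linarith
  ultimately show ?thesis
    by (simp only: norm_divide divide_less_eq_1_pos)
qed

lemma theta_d_eq:
  assumes "Re d \<ge> 0"
  shows "theta_d d = 2 * arcsin (cmod (d / (1 + d)))"
    and "0 \<le> theta_d d" "theta_d d < pi" "sin (theta_d d / 2) = cmod (d / (1 + d))"
proof -
  let ?r = "cmod (d / (1 + d))"
  have r: "0 \<le> ?r" "?r < 1" using cmod_d_less[OF assms] by auto
  have a: "0 \<le> arcsin ?r" using r arcsin_le_arcsin[of 0 ?r] by simp
  have b: "arcsin ?r < pi / 2" using r arcsin_lt_bounded[of ?r] by linarith
  have c: "sin (arcsin ?r) = ?r" using r by (intro sin_arcsin) linarith+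
  show eq: "theta_d d = 2 * arcsin ?r"
    unfolding theta_d_def
  proof (rule the_equality)
    show "0 \<le> 2 * arcsin ?r \<and> 2 * arcsin ?r < pi \<and> sin (2 * arcsin ?r / 2) = ?r"
      using a b c by simp
  next
    fix t assume t: "0 \<le> t \<and> t < pi \<and> sin (t / 2) = ?r"
    then have "arcsin (sin (t / 2)) = t / 2" by (intro arcsin_sin) auto
    with t show "t = 2 * arcsin ?r" by simp
  qed
  show "0 \<le> theta_d d" "theta_d d < pi" "sin (theta_d d / 2) = ?r"
    using a b c by (simp_all add: eq)
qed

lemma xi_d_eq:
  assumes "Re d \<ge> 0"
  shows "xi_d d = 2 * Arg (1 + d)"
    and "- theta_d d \<le> xi_d d" "xi_d d \<le> theta_d d" "cis (xi_d d) = (1 + d) / (1 + cnj d)"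
proof -
  let ?A = "Arg (1 + d)"
  have nz: "1 + d \<noteq> 0" using assms by (auto simp: complex_eq_iff)
  have polar: "1 + d = of_real (cmod (1 + d)) * cis ?A"
    using nz by (metis rcis_cmod_Arg rcis_def)
  have Apm: "\<bar>?A\<bar> < pi / 2"
    using assms Re_Ln_pos_lt[of "1 + d"] nz by (simp add: Arg_eq_Im_Ln)
  have quot: "(1 + d) / (1 + cnj d) = cis (2 * ?A)"
  proof -
    have "1 + cnj d = cnj (1 + d)" by simp
    also have "\<dots> = of_real (cmod (1 + d)) * cis (- ?A)"
      by (subst polar) (simp add: cis_cnj)
    finally have "(1 + d) / (1 + cnj d) = cis ?A / cis (- ?A)"
      using nz by (subst (1) polar) simp
    then show ?thesis by (simp add: cis_divide)
  qed
  have "\<bar>sin ?A\<bar> \<le> cmod (d / (1 + d))"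
  proof -
    have "cmod (1 + d) * sin ?A = Im d"
      using arg_cong[OF polar, of Im] by simp
    then have "cmod (1 + d) * \<bar>sin ?A\<bar> = \<bar>Im d\<bar>"
      by (metis abs_mult abs_norm_cancel)
    then show ?thesis
      using nz abs_Im_le_cmod[of d] by (simp add: norm_divide field_simps)
  qed
  then have "sin \<bar>?A\<bar> \<le> sin (theta_d d / 2)"
    using theta_d_eq(4)[OF assms] by (simp add: abs_if split: if_splits)
  then have bd: "\<bar>?A\<bar> \<le> theta_d d / 2"
    using sin_mono_le_eq[of "\<bar>?A\<bar>" "theta_d d / 2"] Apm theta_d_eq(2,3)[OF assms] by auto
  show eq: "xi_d d = 2 * ?A"
    unfolding xi_d_def
  proof (rule the_equality)
    show "- theta_d d \<le> 2 * ?A \<and> 2 * ?A \<le> theta_d d \<and> cis (2 * ?A) = (1 + d) / (1 + cnj d)"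
      using bd quot by auto
  next
    fix x assume x: "- theta_d d \<le> x \<and> x \<le> theta_d d \<and> cis x = (1 + d) / (1 + cnj d)"
    have "Arg (cis x) = x" using x theta_d_eq(3)[OF assms] by (intro Arg_cis) auto
    moreover have "Arg (cis (2 * ?A)) = 2 * ?A"
      using bd theta_d_eq(3)[OF assms] by (intro Arg_cis) auto
    moreover have "cis x = cis (2 * ?A)"
      by (rule trans[OF conjunct2[OF conjunct2[OF x]] quot])
    ultimately show "x = 2 * ?A" by metis
  qed
  show "- theta_d d \<le> xi_d d" "xi_d d \<le> theta_d d" "cis (xi_d d) = (1 + d) / (1 + cnj d)"
    using bd quot by (auto simp: eq)
qed


section \<open>The circular ensemble\<close>

text \<open>A point of \<open>\<bbbT>\<^sup>n\<close> is a function whose values at \<open>0, \<dots>, n - 1\<close> are the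
  coordinates; \<open>b\<close> stands for \<open>\<beta>' = \<beta>/2\<close>. The weight is kept complex-valued as in
  its defining formula; it is real and nonnegative on \<open>\<bbbT>\<^sup>n\<close>, so taking real parts afterwards
  loses nothing.\<close>

definition hweight :: "real \<Rightarrow> complex \<Rightarrow> nat \<Rightarrow> (nat \<Rightarrow> complex) \<Rightarrow> complex"
  where "hweight b d n z =
    (\<Prod>k<n. (1 - z k) powr (cnj d * of_real b * of_nat n)
            * (1 - cnj (z k)) powr (d * of_real b * of_nat n))
    * (\<Prod>k<n. \<Prod>j<k. of_real (cmod (z j - z k) powr (2 * b)))"

lemma hweight_nonneg:
  assumes "\<And>k. k < n \<Longrightarrow> cmod (z k) = 1"
  shows "hweight b d n z = of_real (Re (hweight b d n z))" and "0 \<le> Re (hweight b d n z)"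
proof -
  have powr_cnj: "(1 - cnj v) powr cnj a = cnj ((1 - v) powr a)" if "cmod v = 1" for v a
  proof (cases "v = 1")
    case False
    have "Re v < 1"
    proof (rule ccontr)
      assume "\<not> Re v < 1"
      moreover have "(Re v)\<^sup>2 + (Im v)\<^sup>2 = 1" using that by (simp add: cmod_def)
      moreover have "Re v \<le> 1" using complex_Re_le_cmod[of v] that by simp
      ultimately show False using False by (auto simp: complex_eq_iff)
    qed
    then have "1 - v \<notin> \<real>\<^sub>\<le>\<^sub>0" by (auto simp: complex_nonpos_Reals_iff)
    then have "Ln (cnj (1 - v)) = cnj (Ln (1 - v))" by (intro cnj_Ln[symmetric])
    then have "cnj (Ln (1 - v)) = Ln (1 - cnj v)" by simp
    then show ?thesis using False by (simp add: powr_def exp_cnj)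
  qed simp
  let ?x = "(\<Prod>k<n. (cmod ((1 - z k) powr (cnj d * of_real b * of_nat n)))\<^sup>2)
            * (\<Prod>k<n. \<Prod>j<k. cmod (z j - z k) powr (2 * b))"
  have "(1 - z k) powr (cnj d * of_real b * of_nat n) * (1 - cnj (z k)) powr (d * of_real b * of_nat n)
      = of_real ((cmod ((1 - z k) powr (cnj d * of_real b * of_nat n)))\<^sup>2)" if "k < n" for k
  proof -
    have "d * of_real b * of_nat n = cnj (cnj d * of_real b * of_nat n)" by simp
    then show ?thesis
      by (simp only: powr_cnj[OF assms[OF that]] complex_norm_square)
  qed
  then have *: "hweight b d n z = of_real ?x"
    unfolding hweight_def by (simp add: of_real_prod)
  have "0 \<le> ?x" by (intro mult_nonneg_nonneg prod_nonneg) auto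
  then show "hweight b d n z = of_real (Re (hweight b d n z))" "0 \<le> Re (hweight b d n z)"
    unfolding * by (simp_all only: Re_complex_of_real)
qed

definition haar_n :: "nat \<Rightarrow> (nat \<Rightarrow> complex) measure"
  where "haar_n n = Pi\<^sub>M {..<n} (\<lambda>_. haar)"

definition Znorm :: "real \<Rightarrow> complex \<Rightarrow> nat \<Rightarrow> real"
  where "Znorm b d n = (\<integral>z. Re (hweight b d n z) \<partial>haar_n n)"

definition P_d :: "real \<Rightarrow> complex \<Rightarrow> nat \<Rightarrow> (nat \<Rightarrow> complex) measure"
  where "P_d b d n = density (haar_n n) (\<lambda>z. ennreal (Re (hweight b d n z) / Znorm b d n))"

definition esd :: "nat \<Rightarrow> (nat \<Rightarrow> complex) \<Rightarrow> complex measure"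
  where "esd n z = measure_of circle (sets circle_borel)
    (\<lambda>A. (\<Sum>k<n. emeasure (return circle_borel (z k)) A) / of_nat n)"

lemma emeasure_esd:
  assumes "n \<ge> 1" "\<And>k. k < n \<Longrightarrow> z k \<in> circle" "A \<in> sets circle_borel"
  shows "emeasure (esd n z) A = of_nat (card {k. k < n \<and> z k \<in> A}) / of_nat n"
proof -
  let ?f = "\<lambda>A. (\<Sum>k<n. emeasure (return circle_borel (z k)) A) / of_nat n"
  have sp: "space circle_borel = circle" by (simp add: circle_borel_def space_restrict_space)
  have ca: "countably_additive (sets circle_borel) ?f"
    unfolding countably_additive_def
  proof (intro allI impI)
    fix F :: "nat \<Rightarrow> complex set"
    assume F: "range F \<subseteq> sets circle_borel" "disjoint_family F"
    have "(\<Sum>i. ?f (F i)) = (\<Sum>i. \<Sum>k<n. emeasure (return circle_borel (z k)) (F i)) / of_nat n"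
      by (simp add: divide_ennreal_def)
    also have "(\<Sum>i. \<Sum>k<n. emeasure (return circle_borel (z k)) (F i))
        = (\<Sum>k<n. \<Sum>i. emeasure (return circle_borel (z k)) (F i))"
      by (intro suminf_sum) auto
    also have "\<dots> = (\<Sum>k<n. emeasure (return circle_borel (z k)) (\<Union> (range F)))"
      using F by (intro sum.cong refl suminf_emeasure) auto
    finally show "(\<Sum>i. ?f (F i)) = ?f (\<Union> (range F))" .
  qed
  have "emeasure (esd n z) A = ?f A"
  proof (rule emeasure_measure_of[where \<mu> = ?f and \<Omega> = circle and A = "sets circle_borel"])
    show "sets circle_borel \<subseteq> Pow circle" using sets.space_closed[of circle_borel] sp by simp
    have *: "sets (esd n z) = sets circle_borel"
      unfolding esd_def using sets.sets_measure_of_eq[of circle_borel] sp by simp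
    show "A \<in> sets (esd n z)" using * assms(3) by simp
    show "positive (sets (esd n z)) ?f" by (simp add: positive_def)
    show "countably_additive (sets (esd n z)) ?f" using ca * by simp
  qed (simp add: esd_def)
  also have "\<dots> = of_nat (card {k. k < n \<and> z k \<in> A}) / of_nat n"
  proof -
    have "(\<Sum>k<n. emeasure (return circle_borel (z k)) A) = (\<Sum>k<n. indicator A (z k))"
      using assms(3) by simp
    also have "\<dots> = (\<Sum>k\<in>{k. k < n \<and> z k \<in> A}. 1)"
      by (intro sum.mono_neutral_cong_right) (auto simp: indicator_def)
    finally show ?thesis by simp
  qed
  finally show ?thesis .
qed

definition esd_law :: "real \<Rightarrow> complex \<Rightarrow> nat \<Rightarrow> complex measure measure"
  where "esd_law b d n = distr (P_d b d n) (borel_of weak_topology) (esd n)"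

text \<open>The second integrand is a sum of two conjugate numbers, so \<open>Re\<close> only changes the type.
  At \<open>x = 0\<close> the convention \<open>ln 0 = 0\<close> gives \<open>0 log 0 = 0\<close>.\<close>

definition B_d :: "complex \<Rightarrow> real"
  where "B_d d =
    integral {0..1} (\<lambda>x::real. x * ln x + (x + 2 * Re d) * ln (x + 2 * Re d))
    - Re (integral {0..1} (\<lambda>x::real. (of_real x + d) * ln (of_real x + d)
                                   + (of_real x + cnj d) * ln (of_real x + cnj d)))"

definition I_d :: "complex \<Rightarrow> complex measure \<Rightarrow> ereal"
  where "I_d d \<mu> = - voiculescu_entropy \<mu> + eintegral \<mu> (potential d) + ereal (B_d d)"

end

theory Submission
  imports Defs "HOL-Complex_Analysis.Complex_Analysis"
begin

text \<open>The weight of a configuration is \<open>exp (- \<beta>' n\<^sup>2 H)\<close>, where the Hamiltonian \<open>H\<close> is, up to the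
  self-interaction of the points, the functional \<open>J = - \<Sigma> + \<integral> Q\<close> at the empirical measure. The
  large deviation principle for the unnormalised laws with the functional \<open>J\<close> is therefore a matter of
  semicontinuity and approximation, and what remains is to minimise \<open>J\<close>.

  Everything is expressed by Fourier coefficients. Expanding \<open>Ln (1 - z cnj w)\<close> gives
  \<open>- \<Sigma>(\<mu>) = \<Sum>k\<ge>1. |fc \<mu> k|\<^sup>2 / k\<close> (\<open>voiculescu_entropy_fourier\<close>), and the weak topology is the
  one induced by the Fourier coefficients, in which the space of probability measures is compact. Abel
  regularisation at radius \<open>rr i\<close> writes \<open>J\<close> as the supremum of an increasing sequence of continuous
  functionals \<open>Ji\<close>. The Hamiltonian dominates each of them up to \<open>O(1/n)\<close>, and by compactness one of
  them exceeds any given level on a closed set where \<open>J\<close> does; this is the upper bound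
  (\<open>Zset_upper_bound\<close>). For the lower bound (\<open>Zset_lower_bound\<close>) a measure is replaced by its convolution
  with a Poisson kernel, which has a bounded density and no larger energy. Independent samples from
  such a measure have, for large \<open>n\<close> and with probability at least \<open>1/2\<close>, an empirical measure close to it and a
  Hamiltonian not much larger than \<open>J\<close>, and their law is at most \<open>C\<^sup>n\<close> times Haar measure.

  The equilibrium measure is identified through the function \<open>Fd\<close>, explicit with one square root and
  holomorphic in the disc, whose real part has the density of \<open>mu_d\<close> as boundary values; hence the
  Taylor coefficients of \<open>Fd\<close> give the Fourier coefficients of \<open>mu_d\<close> (\<open>fc_mu_d\<close>), and the integrated
  series \<open>Lam\<close> is its complex logarithmic potential. Up to sign, the angular derivative of the total potential
  is the imaginary part of a function whose boundary values are real on the support and have the correct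
  signs on the two sides of the gap; so the total potential is constant on the support and not smaller
  elsewhere (\<open>equilibrium_condition\<close>). Boundary values of \<open>Lam\<close> exist and are bounded because \<open>Lam\<close> is
  an average over \<open>s\<close> in \<open>[0, 1]\<close> of logarithms with explicit arguments (\<open>Lam_superposition\<close>): the
  potentials of equilibrium measures of arcs, which describe how the measure grows with its mass.
  Completing the square in the Fourier coefficients then shows that \<open>J\<close> exceeds its value at \<open>mu_d\<close> by
  at least \<open>|fc \<mu> k - fc (mu_d d) k|\<^sup>2 / k\<close> for each \<open>k\<close> (\<open>energy_gap\<close>), which contains uniqueness.

  The minimum of \<open>J\<close> is found by scaling the field to \<open>t d\<close> with \<open>t\<close> from 0 to 1. As an infimum of affine
  functions of \<open>t\<close> it has as derivative the integral of \<open>Q\<close> against the minimiser, which is given by the boundary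
  value of \<open>Lam\<close> at 1 and known in closed form by the superposition; it agrees with the derivative of
  \<open>- B_d (t d)\<close>, and both functions vanish at \<open>t = 0\<close> (\<open>minimal_energy\<close>).\<close>

section \<open>Probability measures on the circle and their Fourier coefficients\<close>

lemma space_circle_borel [simp]: "space circle_borel = circle"
  by (simp add: circle_borel_def space_restrict_space)

lemma
  assumes "\<mu> \<in> M1"
  shows M1_prob_space: "prob_space \<mu>" and M1_sets: "sets \<mu> = sets circle_borel"
    and M1_space: "space \<mu> = circle"
proof -
  show "prob_space \<mu>" "sets \<mu> = sets circle_borel"
    using assms by (auto simp: space_prob_algebra)
  then show "space \<mu> = circle" by (metis sets_eq_imp_space_eq space_circle_borel)
qed

lemma M1_I: "prob_space \<mu> \<Longrightarrow> sets \<mu> = sets circle_borel \<Longrightarrow> \<mu> \<in> M1"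
  by (auto simp: space_prob_algebra)

lemma borel_measurable_circle:
  fixes f :: "complex \<Rightarrow> 'b::topological_space"
  shows "continuous_on circle f \<Longrightarrow> f \<in> borel_measurable circle_borel"
  unfolding circle_borel_def by (rule borel_measurable_continuous_on_restrict)

lemma measurable_circle_restrict:
  "f \<in> borel_measurable borel \<Longrightarrow> f \<in> borel_measurable circle_borel"
  unfolding circle_borel_def by (rule measurable_restrict_space1)

lemma M1_measurable_cong: "\<mu> \<in> M1 \<Longrightarrow> measurable \<mu> N = measurable circle_borel N"
  by (rule measurable_cong_sets) (auto simp: M1_sets)

lemma M1_integrable_bounded:
  fixes f :: "complex \<Rightarrow> 'b::{banach, second_countable_topology}"
  assumes "\<mu> \<in> M1" "f \<in> borel_measurable circle_borel" "\<And>z. z \<in> circle \<Longrightarrow> norm (f z) \<le> B"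
  shows "integrable \<mu> f"
proof -
  interpret prob_space \<mu> using assms(1) by (rule M1_prob_space)
  show ?thesis
    using assms by (intro integrable_const_bound[where B = B]) (auto simp: M1_measurable_cong M1_space)
qed

lemma M1_integrable_continuous:
  fixes f :: "complex \<Rightarrow> 'b::{banach, second_countable_topology}"
  assumes "\<mu> \<in> M1" "continuous_on circle f"
  shows "integrable \<mu> f"
proof -
  have "bounded (f ` circle)"
    using assms(2) by (intro compact_imp_bounded compact_continuous_image) auto
  then obtain B where "\<forall>z\<in>circle. norm (f z) \<le> B" unfolding bounded_iff by auto
  then show ?thesis using assms by (intro M1_integrable_bounded[where B = B] borel_measurable_circle) auto
qed

text \<open>Nonnegative frequencies suffice: the others are the conjugates.\<close>

definition fc :: "complex measure \<Rightarrow> nat \<Rightarrow> complex"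
  where "fc \<mu> k = (\<integral>z. z ^ k \<partial>\<mu>)"

lemma fc_0: "\<mu> \<in> M1 \<Longrightarrow> fc \<mu> 0 = 1"
  using prob_space.prob_space[OF M1_prob_space, of \<mu>] by (simp add: fc_def)

lemma norm_fc_le_1:
  assumes "\<mu> \<in> M1" shows "cmod (fc \<mu> k) \<le> 1"
proof -
  interpret prob_space \<mu> using assms by (rule M1_prob_space)
  have "cmod (fc \<mu> k) \<le> (\<integral>z. cmod (z ^ k) \<partial>\<mu>)" unfolding fc_def by (rule integral_norm_bound)
  also have "\<dots> = (\<integral>z. 1 \<partial>\<mu>)"
    by (intro Bochner_Integration.integral_cong) (auto simp: norm_power M1_space[OF assms])
  finally show ?thesis by (simp add: prob_space)
qed

text \<open>On the circle \<open>cnj z = 1 / z\<close>, so the real parts of polynomials in \<open>z\<close> form an algebra there: a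
  product of two of them is half the real part of \<open>p q + p cnj q\<close>, and \<open>p cnj q\<close> has, up to
  conjugating the negative powers, the real part of a polynomial.\<close>

lemma Re_poly_mult_cnj_poly:
  "\<exists>r. \<forall>z\<in>circle. Re (poly p z * cnj (poly q z)) = Re (poly r z)"
proof (induction p arbitrary: q)
  case 0
  show ?case by (rule exI[of _ 0]) simp
next
  case (pCons a p)
  obtain c q' where q: "q = pCons c q'" by (cases q)
  obtain r where r: "\<And>z. z \<in> circle \<Longrightarrow> Re (poly p z * cnj (poly q' z)) = Re (poly r z)"
    using pCons.IH[of q'] by blast
  show ?case
  proof (intro exI ballI)
    fix z :: complex assume z: "z \<in> circle"
    then have zz: "z * cnj z = 1" by (simp add: complex_norm_square[symmetric])
    have 1: "poly (pCons a p) z * cnj (poly q z)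
        = (a + z * poly p z) * cnj c + a * cnj (z * poly q' z) + (z * cnj z) * (poly p z * cnj (poly q' z))"
      by (simp add: q algebra_simps)
    have 2: "Re (a * cnj (z * poly q' z)) = Re (cnj a * (z * poly q' z))" by (simp add: algebra_simps)
    show "Re (poly (pCons a p) z * cnj (poly q z))
        = Re (poly (smult (cnj c) (pCons a p) + smult (cnj a) (pCons 0 q') + r) z)"
      unfolding 1 zz plus_complex.sel(1) 2 mult_1 r[OF z] by (simp add: algebra_simps)
  qed
qed

lemma Re_poly_mult_Re_poly:
  "\<exists>r. \<forall>z\<in>circle. Re (poly p z) * Re (poly q z) = Re (poly r z)"
proof -
  obtain r where r: "\<And>z. z \<in> circle \<Longrightarrow> Re (poly p z * cnj (poly q z)) = Re (poly r z)"
    using Re_poly_mult_cnj_poly[of p q] by blast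
  have "Re (poly p z) * Re (poly q z) = Re (poly (smult (1/2) (p * q + r)) z)" if "z \<in> circle" for z
  proof -
    have "Re (poly p z) * Re (poly q z) = (Re (poly p z * poly q z) + Re (poly p z * cnj (poly q z))) / 2"
      by (simp add: field_simps)
    then show ?thesis unfolding r[OF that] by simp
  qed
  then show ?thesis by blast
qed

lemma Re_poly_dense:
  fixes f :: "complex \<Rightarrow> real"
  assumes "continuous_on circle f" "0 < e"
  obtains p where "\<And>z. z \<in> circle \<Longrightarrow> \<bar>f z - Re (poly p z)\<bar> < e"
proof -
  let ?P = "\<lambda>f::complex \<Rightarrow> real. \<exists>p. \<forall>z\<in>circle. f z = Re (poly p z)"
  have "\<exists>g. ?P g \<and> (\<forall>x\<in>circle. \<bar>f x - g x\<bar> < e)"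
  proof (rule Stone_Weierstrass_HOL[where P = ?P])
    show "?P (\<lambda>x. c)" for c by (rule exI[of _ "[:of_real c:]"]) simp
    show "continuous_on circle g" if "?P g" for g
    proof -
      from that obtain p where "\<forall>z\<in>circle. g z = Re (poly p z)" by blast
      then show ?thesis
        by (subst continuous_on_cong[OF refl, of _ _ "\<lambda>z. Re (poly p z)"]) (auto intro!: continuous_intros)
    qed
    show "?P (\<lambda>x. g x + h x)" if "?P g \<and> ?P h" for g h
    proof -
      from that obtain p q where "\<forall>z\<in>circle. g z = Re (poly p z)" "\<forall>z\<in>circle. h z = Re (poly q z)"
        by blast
      then show ?thesis by (intro exI[of _ "p + q"]) simp
    qed
    show "?P (\<lambda>x. g x * h x)" if "?P g \<and> ?P h" for g h
    proof -
      from that obtain p q where "\<forall>z\<in>circle. g z = Re (poly p z)" "\<forall>z\<in>circle. h z = Re (poly q z)"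
        by blast
      moreover obtain r where "\<forall>z\<in>circle. Re (poly p z) * Re (poly q z) = Re (poly r z)"
        using Re_poly_mult_Re_poly[of p q] by blast
      ultimately show ?thesis by (intro exI[of _ r]) simp
    qed
    show "\<exists>f. ?P f \<and> f x \<noteq> f y" if "x \<in> circle \<and> y \<in> circle \<and> x \<noteq> y" for x y
    proof (cases "Re x = Re y")
      case False
      then show ?thesis by (intro exI[of _ Re] conjI exI[of _ "[:0, 1:]"]) auto
    next
      case True
      then have "Im x \<noteq> Im y" using that by (auto simp: complex_eq_iff)
      then show ?thesis by (intro exI[of _ Im] conjI exI[of _ "[:0, -\<i>:]"]) auto
    qed
  qed (use assms in auto)
  then show ?thesis using that by (metis (no_types, lifting))
qed

lemma integral_Re_poly:
  assumes "\<mu> \<in> M1"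
  shows "(\<integral>z. Re (poly p z) \<partial>\<mu>) = Re (\<Sum>k\<le>degree p. coeff p k * fc \<mu> k)"
proof -
  have i: "integrable \<mu> (\<lambda>z. coeff p k * z ^ k)" for k
    using assms by (intro M1_integrable_continuous continuous_intros)
  have "(\<integral>z. Re (poly p z) \<partial>\<mu>) = Re (\<integral>z. poly p z \<partial>\<mu>)"
    by (rule integral_Re, rule M1_integrable_continuous[OF assms]) (intro continuous_intros)
  also have "(\<integral>z. poly p z \<partial>\<mu>) = (\<Sum>k\<le>degree p. coeff p k * fc \<mu> k)"
    unfolding poly_altdef using i by (simp add: Bochner_Integration.integral_sum fc_def)
  finally show ?thesis .
qed

text \<open>A trigonometric polynomial that approximates \<open>f\<close> uniformly involves finitely
  many Fourier coefficients.\<close>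

lemma fc_controls_integral:
  fixes f :: "complex \<Rightarrow> real"
  assumes "continuous_on circle f" "0 < e"
  obtains N \<delta> where "\<delta> > 0"
    "\<And>\<mu> \<nu>. \<mu> \<in> M1 \<Longrightarrow> \<nu> \<in> M1 \<Longrightarrow> (\<And>k. k \<le> N \<Longrightarrow> cmod (fc \<mu> k - fc \<nu> k) < \<delta>) \<Longrightarrow>
       \<bar>(\<integral>z. f z \<partial>\<mu>) - (\<integral>z. f z \<partial>\<nu>)\<bar> < e"
proof -
  obtain p where p: "\<And>z. z \<in> circle \<Longrightarrow> \<bar>f z - Re (poly p z)\<bar> < e / 4"
    using Re_poly_dense[OF assms(1), of "e / 4"] assms(2) by auto
  define s where "s = (\<Sum>k\<le>degree p. cmod (coeff p k))"
  have s: "s \<ge> 0" unfolding s_def by (intro sum_nonneg) auto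
  have close: "\<bar>(\<integral>z. f z \<partial>\<mu>) - (\<integral>z. Re (poly p z) \<partial>\<mu>)\<bar> \<le> e / 4" if "\<mu> \<in> M1" for \<mu>
  proof -
    interpret prob_space \<mu> using that by (rule M1_prob_space)
    have i: "integrable \<mu> f" "integrable \<mu> (\<lambda>z. Re (poly p z))"
      using that assms(1) by (auto intro!: M1_integrable_continuous continuous_intros)
    have "\<bar>(\<integral>z. f z \<partial>\<mu>) - (\<integral>z. Re (poly p z) \<partial>\<mu>)\<bar> = \<bar>\<integral>z. f z - Re (poly p z) \<partial>\<mu>\<bar>"
      using i by simp
    also have "\<dots> \<le> (\<integral>z. \<bar>f z - Re (poly p z)\<bar> \<partial>\<mu>)" by (rule integral_abs_bound)
    also have "\<dots> \<le> (\<integral>z. e / 4 \<partial>\<mu>)"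
      using i p by (intro integral_mono) (auto simp: M1_space[OF that] less_imp_le)
    finally show ?thesis by (simp add: prob_space)
  qed
  show ?thesis
  proof (rule that[of "e / (4 * (s + 1))" "degree p"])
    fix \<mu> \<nu> assume m: "\<mu> \<in> M1" "\<nu> \<in> M1"
      and c: "\<And>k. k \<le> degree p \<Longrightarrow> cmod (fc \<mu> k - fc \<nu> k) < e / (4 * (s + 1))"
    have "\<bar>(\<integral>z. Re (poly p z) \<partial>\<mu>) - (\<integral>z. Re (poly p z) \<partial>\<nu>)\<bar>
        = \<bar>Re (\<Sum>k\<le>degree p. coeff p k * (fc \<mu> k - fc \<nu> k))\<bar>"
      using m by (simp add: integral_Re_poly sum_subtractf[symmetric] algebra_simps)
    also have "\<dots> \<le> (\<Sum>k\<le>degree p. cmod (coeff p k * (fc \<mu> k - fc \<nu> k)))"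
      by (rule order_trans[OF abs_Re_le_cmod norm_sum])
    also have "\<dots> \<le> (\<Sum>k\<le>degree p. cmod (coeff p k) * (e / (4 * (s + 1))))"
      unfolding norm_mult by (intro sum_mono mult_left_mono[OF less_imp_le[OF c]]) auto
    also have "\<dots> = s * (e / (4 * (s + 1)))" by (simp only: s_def sum_distrib_right[symmetric])
    also have "\<dots> \<le> e / 4" using s assms(2) by (simp add: field_simps)
    finally show "\<bar>(\<integral>z. f z \<partial>\<mu>) - (\<integral>z. f z \<partial>\<nu>)\<bar> < e"
      using close[OF m(1)] close[OF m(2)] assms(2) by linarith
  qed (use s assms in auto)
qed

text \<open>Equal Fourier coefficients give equal integrals of continuous functions, and the functions
  \<open>max 0 (1 - m infdist z C)\<close> decrease to the indicator of a closed set \<open>C\<close>.\<close>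

lemma fc_inj:
  assumes "\<mu> \<in> M1" "\<nu> \<in> M1" "fc \<mu> = fc \<nu>"
  shows "\<mu> = \<nu>"
proof -
  have eq: "(\<integral>z. f z \<partial>\<mu>) = (\<integral>z. f z \<partial>\<nu>)" if f: "continuous_on circle f" for f :: "complex \<Rightarrow> real"
  proof (rule ccontr)
    assume "\<not> ?thesis"
    then have "0 < \<bar>(\<integral>z. f z \<partial>\<mu>) - (\<integral>z. f z \<partial>\<nu>)\<bar>" by simp
    from fc_controls_integral[OF f this] obtain N \<delta> where "\<delta> > 0"
      "\<And>\<mu>' \<nu>'. \<mu>' \<in> M1 \<Longrightarrow> \<nu>' \<in> M1 \<Longrightarrow> (\<And>k. k \<le> N \<Longrightarrow> cmod (fc \<mu>' k - fc \<nu>' k) < \<delta>) \<Longrightarrow>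
       \<bar>(\<integral>z. f z \<partial>\<mu>') - (\<integral>z. f z \<partial>\<nu>')\<bar> < \<bar>(\<integral>z. f z \<partial>\<mu>) - (\<integral>z. f z \<partial>\<nu>)\<bar>" by metis
    from this(2)[OF assms(1,2)] this(1) assms(3) show False by simp
  qed
  have lim: "(\<lambda>m. \<integral>z. max 0 (1 - real m * infdist z C) \<partial>\<rho>) \<longlonglongrightarrow> measure \<rho> (C \<inter> circle)"
    if C: "closed C" "C \<noteq> {}" and r: "\<rho> \<in> M1" for C \<rho>
  proof -
    interpret prob_space \<rho> using r by (rule M1_prob_space)
    have *: "C \<inter> circle \<in> sets \<rho>"
      using C by (simp add: M1_sets[OF r] circle_borel_def sets_restrict_space_iff)
    have "(\<lambda>m. \<integral>z. max 0 (1 - real m * infdist z C) \<partial>\<rho>) \<longlonglongrightarrow> (\<integral>z. indicator (C \<inter> circle) z \<partial>\<rho>)"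
    proof (rule integral_dominated_convergence[where w = "\<lambda>_. 1"])
      show "(\<lambda>z. max 0 (1 - real m * infdist z C)) \<in> borel_measurable \<rho>" for m
        unfolding M1_measurable_cong[OF r] by (intro borel_measurable_circle continuous_intros)
      show "AE z in \<rho>. (\<lambda>m. max 0 (1 - real m * infdist z C)) \<longlonglongrightarrow> indicator (C \<inter> circle) z"
      proof (rule AE_I2)
        fix z assume z: "z \<in> space \<rho>"
        show "(\<lambda>m. max 0 (1 - real m * infdist z C)) \<longlonglongrightarrow> indicator (C \<inter> circle) z"
        proof (cases "z \<in> C")
          case True
          then show ?thesis using z by (simp add: M1_space[OF r])
        next
          case False
          then have pos: "infdist z C > 0" using C by (metis in_closed_iff_infdist_zero infdist_nonneg less_eq_real_def)
          obtain M where M: "real M * infdist z C > 1" using reals_Archimedean3[OF pos] by blast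
          have "max 0 (1 - real m * infdist z C) = 0" if "m \<ge> M" for m
          proof -
            have "real M * infdist z C \<le> real m * infdist z C" using that pos by simp
            then show ?thesis using M by simp
          qed
          then have "eventually (\<lambda>m. max 0 (1 - real m * infdist z C) = 0) sequentially"
            using eventually_sequentially by blast
          then show ?thesis using False by (simp add: tendsto_eventually)
        qed
      qed
    qed (use * in \<open>auto simp: infdist_nonneg\<close>)
    then show ?thesis using * by simp
  qed
  have closed_eq: "emeasure \<mu> (C \<inter> circle) = emeasure \<nu> (C \<inter> circle)" if "closed C" for C
  proof (cases "C = {}")
    case False
    have "(\<integral>z. max 0 (1 - real m * infdist z C) \<partial>\<mu>) = (\<integral>z. max 0 (1 - real m * infdist z C) \<partial>\<nu>)" for m
      by (intro eq continuous_intros)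
    then have "measure \<mu> (C \<inter> circle) = measure \<nu> (C \<inter> circle)"
      using lim[OF that False assms(1)] lim[OF that False assms(2)] LIMSEQ_unique by auto
    then show ?thesis
      using assms by (simp add: finite_measure.emeasure_eq_measure prob_space.finite_measure M1_prob_space)
  qed simp
  have meas: "(\<lambda>z. z) \<in> borel_measurable circle_borel"
    by (intro borel_measurable_circle continuous_intros)
  have em: "emeasure (distr \<rho> borel (\<lambda>z. z)) A = emeasure \<rho> (A \<inter> circle)" if "\<rho> \<in> M1" "A \<in> sets borel" for \<rho> A
    using that meas by (subst emeasure_distr) (auto simp: M1_measurable_cong M1_space)
  have d: "distr \<mu> borel (\<lambda>z. z) = distr \<nu> borel (\<lambda>z. z)"
  proof (rule measure_eqI_generator_eq[where E = "Collect closed" and \<Omega> = UNIV and A = "\<lambda>_. UNIV"])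
    show "Int_stable (Collect closed :: complex set set)" by (auto simp: Int_stable_def)
    show "emeasure (distr \<mu> borel (\<lambda>z. z)) X = emeasure (distr \<nu> borel (\<lambda>z. z)) X"
      if "X \<in> Collect closed" for X using that closed_eq assms by (simp add: em)
    show "emeasure (distr \<mu> borel (\<lambda>z. z)) UNIV \<noteq> \<infinity>"
      using assms by (simp add: em prob_space.finite_measure finite_measure.emeasure_finite M1_prob_space)
  qed (auto simp: borel_eq_closed)
  show ?thesis
  proof (rule measure_eqI)
    fix A assume "A \<in> sets \<mu>"
    then have "A \<in> sets borel" "A \<inter> circle = A"
      by (auto simp: M1_sets[OF assms(1)] circle_borel_def sets_restrict_space_iff)
    then show "emeasure \<mu> A = emeasure \<nu> A" using em[OF assms(1), of A] em[OF assms(2), of A] d by simp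
  qed (simp add: M1_sets assms)
qed


section \<open>The weak topology is compact, and is determined by the Fourier coefficients\<close>

lemma Arg2pi_measurable_circle: "Arg2pi \<in> borel_measurable circle_borel"
proof -
  have "Arg2pi z = (if z = 1 then 0 else Im (Ln (- z)) + pi)" if "z \<in> circle" for z
  proof (cases "z = 1")
    case False
    have "Arg2pi z \<noteq> 0"
    proof
      assume "Arg2pi z = 0"
      then have "z \<in> \<real>" "0 \<le> Re z" by (auto simp: Arg2pi_eq_0)
      then obtain x where "z = of_real x" "0 \<le> x" by (auto elim: Reals_cases)
      then show False using that False by simp
    qed
    then have "0 < Arg2pi z" using Arg2pi_ge_0[of z] by linarith
    then show ?thesis using False Arg2pi_Ln by simp
  qed (simp add: Arg2pi_of_real[of 1, simplified])
  moreover have "(\<lambda>z::complex. if z = 1 then 0 else Im (Ln (- z)) + pi) \<in> borel_measurable circle_borel"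
    by (rule measurable_circle_restrict) measurable
  ultimately show ?thesis by (subst measurable_cong) auto
qed

lemma cis_Arg2pi: "z \<in> circle \<Longrightarrow> cis (Arg2pi z) = z"
  using Arg2pi_eq[of z] by (simp add: cis_conv_exp)

lemma cis_measurable: "cis \<in> borel \<rightarrow>\<^sub>M circle_borel"
  unfolding circle_borel_def
  by (intro measurable_restrict_space2 borel_measurable_continuous_onI continuous_intros) auto

text \<open>Unrolled along the angle, the measures live on a bounded interval, where Helly's selection
  theorem yields a weakly convergent subsequence; Fourier coefficients are characteristic functions
  at integers.\<close>

lemma fc_convergent_subsequence:
  fixes X :: "nat \<Rightarrow> complex measure"
  assumes X: "\<And>n. X n \<in> M1"
  obtains \<mu> r where "\<mu> \<in> M1" "strict_mono (r :: nat \<Rightarrow> nat)" "\<And>k. (\<lambda>n. fc (X (r n)) k) \<longlonglongrightarrow> fc \<mu> k"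
proof -
  define N where "N n = distr (X n) borel Arg2pi" for n
  have A[measurable]: "Arg2pi \<in> borel_measurable (X n)" for n
    using Arg2pi_measurable_circle by (simp add: M1_measurable_cong X)
  have rd: "real_distribution (N n)" for n
    unfolding N_def using X[of n] by (intro prob_space.real_distribution_distr A) (rule M1_prob_space)
  have full: "measure (N n) {-1<..2 * pi} = 1" for n
  proof -
    interpret prob_space "X n" using X by (rule M1_prob_space)
    have "Arg2pi -` {-1<..2 * pi} \<inter> space (X n) = space (X n)"
      using Arg2pi_lt_2pi Arg2pi_ge_0 by (force intro: less_imp_le less_le_trans[of "-1" 0])
    then show ?thesis unfolding N_def by (subst measure_distr) (auto simp: prob_space)
  qed
  have "tight N"
    unfolding tight_def
  proof (intro conjI allI impI rd)
    fix e :: real assume "e > 0"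
    then show "\<exists>a b. a < b \<and> (\<forall>n. 1 - e < measure (N n) {a<..b})"
      by (intro exI[of _ "-1"] exI[of _ "2 * pi"]) (simp add: full less_trans[of "-1" 0 "2 * pi"])
  qed
  from tight_imp_convergent_subsubsequence[OF this, of id] obtain r M where
    r: "strict_mono r" and M: "real_distribution M" and w: "weak_conv_m (N \<circ> r) M"
    by (auto simp: strict_mono_id)
  interpret M: real_distribution M by fact
  define \<mu> where "\<mu> = distr M circle_borel cis"
  have cM: "cis \<in> M \<rightarrow>\<^sub>M circle_borel"
    using cis_measurable by (simp add: measurable_cong_sets[OF M.events_eq_borel refl])
  have "\<mu> \<in> M1"
    by (rule M1_I) (auto simp: \<mu>_def cM M.prob_space_distr)
  moreover have pm: "(\<lambda>z. z ^ k) \<in> borel_measurable circle_borel" for k :: nat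
    by (intro borel_measurable_circle continuous_intros)
  have "fc \<mu> k = char M (real k)" for k
    unfolding \<mu>_def fc_def char_def using cM pm
    by (subst integral_distr[OF cM pm]) (simp only: Complex.DeMoivre, simp only: cis_conv_exp)
  moreover have "fc (X n) k = char (N n) (real k)" for n k
  proof -
    have "char (N n) (real k) = (\<integral>z. iexp (real k * Arg2pi z) \<partial>X n)"
      unfolding N_def char_def by (subst integral_distr) auto
    also have "\<dots> = (\<integral>z. z ^ k \<partial>X n)"
    proof (rule Bochner_Integration.integral_cong)
      fix z assume "z \<in> space (X n)"
      then have "z \<in> circle" by (simp add: M1_space[OF X])
      then show "iexp (real k * Arg2pi z) = z ^ k"
        by (metis cis_Arg2pi cis_conv_exp Complex.DeMoivre)
    qed simp
    finally show ?thesis by (simp add: fc_def)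
  qed
  moreover have "(\<lambda>n. char ((N \<circ> r) n) (real k)) \<longlonglongrightarrow> char M (real k)" for k
    by (rule levy_continuity1[OF _ M w]) (simp add: rd)
  ultimately show ?thesis using that[of \<mu> r] r by simp
qed

lemma continuous_map_integral:
  fixes f :: "complex \<Rightarrow> real"
  assumes "continuous_on circle f"
  shows "continuous_map weak_topology euclideanreal (\<lambda>\<mu>. \<integral>z. f z \<partial>\<mu>)"
  unfolding continuous_map_def topspace_weak_topology
proof (intro conjI allI impI)
  fix U :: "real set" assume "openin euclideanreal U"
  then show "openin weak_topology {\<mu> \<in> M1. (\<integral>z. f z \<partial>\<mu>) \<in> U}"
    unfolding weak_topology_def using assms by (intro topology_generated_by_Basis) auto
qed auto

lemma continuous_map_fc: "continuous_map weak_topology euclidean (\<lambda>\<mu>. fc \<mu> k)"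
proof -
  have 1: "continuous_map weak_topology (prod_topology euclideanreal euclideanreal)
      (\<lambda>\<mu>. (\<integral>z. Re (z ^ k) \<partial>\<mu>, \<integral>z. Im (z ^ k) \<partial>\<mu>))"
    by (intro continuous_map_pairedI continuous_map_integral continuous_intros)
  have 2: "continuous_map euclidean euclidean (\<lambda>p. Complex (fst p) (snd p))"
    unfolding Complex_eq by (auto intro!: continuous_intros)
  have "continuous_map weak_topology euclidean ((\<lambda>p. Complex (fst p) (snd p)) \<circ>
      (\<lambda>\<mu>. (\<integral>z. Re (z ^ k) \<partial>\<mu>, \<integral>z. Im (z ^ k) \<partial>\<mu>)))"
    using 1 2 by (intro continuous_map_compose) (auto simp: prod_topology_euclidean)
  then show ?thesis
  proof (rule continuous_map_eq)
    fix \<mu> assume "\<mu> \<in> topspace weak_topology"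
    then have "integrable \<mu> (\<lambda>z. z ^ k)"
      by (intro M1_integrable_continuous continuous_intros) (simp add: topspace_weak_topology)
    then show "((\<lambda>p. Complex (fst p) (snd p)) \<circ> (\<lambda>\<mu>. (\<integral>z. Re (z ^ k) \<partial>\<mu>, \<integral>z. Im (z ^ k) \<partial>\<mu>))) \<mu> = fc \<mu> k"
      by (simp add: fc_def integral_Re integral_Im complex_eq_iff)
  qed
qed

text \<open>This embeds the space of measures in a countable product of planes, which is metrisable, so
  that compactness can be checked with sequences.\<close>

lemma weak_topology_eq_pullback: "weak_topology = pullback_topology M1 fc euclidean"
  unfolding topology_eq
proof (intro allI iffI)
  fix U assume "openin weak_topology U"
  then show "openin (pullback_topology M1 fc euclidean) U"
    unfolding weak_topology_def openin_topology_generated_by_iff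
  proof (rule generate_topology_on_coarsest[OF istopology_openin, rotated])
    fix S assume "S \<in> {{\<mu> \<in> M1. (\<integral>z. f z \<partial>\<mu>) \<in> U} | f U. continuous_on circle (f :: complex \<Rightarrow> real) \<and> open U}"
    then obtain f U where S: "S = {\<mu> \<in> M1. (\<integral>z. f z \<partial>\<mu>) \<in> U}"
      and f: "continuous_on circle (f :: complex \<Rightarrow> real)" and U: "open U" by blast
    have "\<exists>V. open V \<and> fc \<mu> \<in> V \<and> fc -` V \<inter> M1 \<subseteq> S" if m: "\<mu> \<in> S" for \<mu>
    proof -
      have mM: "\<mu> \<in> M1" and mU: "(\<integral>z. f z \<partial>\<mu>) \<in> U" using m S by auto
      obtain e where e: "e > 0" "\<And>y. \<bar>y - (\<integral>z. f z \<partial>\<mu>)\<bar> < e \<Longrightarrow> y \<in> U"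
        using U mU unfolding open_dist dist_real_def by blast
      obtain N \<delta> where d: "\<delta> > 0"
        "\<And>\<mu> \<nu>. \<mu> \<in> M1 \<Longrightarrow> \<nu> \<in> M1 \<Longrightarrow> (\<And>k. k \<le> N \<Longrightarrow> cmod (fc \<mu> k - fc \<nu> k) < \<delta>) \<Longrightarrow>
         \<bar>(\<integral>z. f z \<partial>\<mu>) - (\<integral>z. f z \<partial>\<nu>)\<bar> < e"
        using fc_controls_integral[OF f e(1)] by metis
      define V where "V = (\<Inter>k\<in>{..N}. {c :: nat \<Rightarrow> complex. cmod (c k - fc \<mu> k) < \<delta>})"
      have "open V" unfolding V_def
        by (intro open_INT ballI open_Collect_less continuous_intros) auto
      moreover have "fc \<mu> \<in> V" using d(1) by (simp add: V_def)
      moreover have "fc -` V \<inter> M1 \<subseteq> S"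
        unfolding S V_def using d(2)[OF _ mM] e(2) by auto
      ultimately show ?thesis by blast
    qed
    then obtain V where V: "\<And>\<mu>. \<mu> \<in> S \<Longrightarrow> open (V \<mu>) \<and> fc \<mu> \<in> V \<mu> \<and> fc -` V \<mu> \<inter> M1 \<subseteq> S" by metis
    have "S = fc -` (\<Union>\<mu>\<in>S. V \<mu>) \<inter> M1" using V unfolding S by blast
    moreover have "open (\<Union>\<mu>\<in>S. V \<mu>)" using V by blast
    ultimately show "openin (pullback_topology M1 fc euclidean) S"
      unfolding openin_pullback_topology by (intro exI[of _ "\<Union>\<mu>\<in>S. V \<mu>"]) auto
  qed
next
  fix U assume "openin (pullback_topology M1 fc euclidean) U"
  then obtain V where V: "open V" "U = fc -` V \<inter> M1" unfolding openin_pullback_topology by auto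
  have "continuous_map weak_topology (euclidean :: (nat \<Rightarrow> complex) topology) fc"
    unfolding euclidean_product_topology[symmetric] continuous_map_componentwise_UNIV
    by (intro allI continuous_map_fc)
  then have "openin weak_topology {\<mu> \<in> topspace weak_topology. fc \<mu> \<in> V}"
    using V(1) by (intro openin_continuous_map_preimage) auto
  moreover have "{\<mu> \<in> topspace weak_topology. fc \<mu> \<in> V} = U"
    using V(2) by (auto simp: topspace_weak_topology)
  ultimately show "openin weak_topology U" by simp
qed

lemma Hausdorff_weak_topology: "Hausdorff_space weak_topology"
proof (rule Hausdorff_space_injective_preimage)
  show "Hausdorff_space (euclidean :: (nat \<Rightarrow> complex) topology)" by simp
  show "continuous_map weak_topology (euclidean :: (nat \<Rightarrow> complex) topology) fc"
    unfolding euclidean_product_topology[symmetric] continuous_map_componentwise_UNIV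
    by (intro allI continuous_map_fc)
  show "inj_on fc (topspace weak_topology)"
    unfolding topspace_weak_topology by (auto intro!: inj_onI fc_inj)
qed

lemma compact_fc_image: "compact (fc ` M1)"
  unfolding compact_eq_seq_compact_metric seq_compact_def
proof (intro allI impI)
  fix x :: "nat \<Rightarrow> nat \<Rightarrow> complex" assume x: "\<forall>n. x n \<in> fc ` M1"
  define X where "X n = inv_into M1 fc (x n)" for n
  have X: "X n \<in> M1" "fc (X n) = x n" for n
    using inv_into_into[of "x n" fc M1] f_inv_into_f[of "x n" fc M1] x by (simp_all only: X_def)
  obtain \<mu> r where *: "\<mu> \<in> M1" "strict_mono (r :: nat \<Rightarrow> nat)" "\<And>k. (\<lambda>n. fc (X (r n)) k) \<longlonglongrightarrow> fc \<mu> k"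
    by (rule fc_convergent_subsequence[of X, OF X(1)]) blast
  have "limitin (product_topology (\<lambda>i. euclidean) UNIV) (x \<circ> r) (fc \<mu>) sequentially"
    using *(3) by (simp add: limitin_componentwise extensional_def X(2))
  then have "(x \<circ> r) \<longlonglongrightarrow> fc \<mu>"
    unfolding euclidean_product_topology by simp
  then show "\<exists>l\<in>fc ` M1. \<exists>r. strict_mono r \<and> (x \<circ> r) \<longlonglongrightarrow> l" using * by blast
qed

lemma compact_space_weak_topology: "compact_space weak_topology"
proof -
  define g where "g = inv_into M1 fc"
  have g: "g c \<in> M1" "fc (g c) = c" if "c \<in> fc ` M1" for c
    using that by (auto simp: g_def inv_into_into f_inv_into_f)
  have gf: "g (fc \<mu>) = \<mu>" if "\<mu> \<in> M1" for \<mu>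
    unfolding g_def using that by (intro inv_into_f_f inj_onI fc_inj)
  have "continuous_map (top_of_set (fc ` M1)) weak_topology g"
    unfolding weak_topology_eq_pullback
  proof (rule continuous_map_pullback')
    show "continuous_map (top_of_set (fc ` M1)) euclidean (fc \<circ> g)"
      by (rule continuous_map_eq[OF continuous_map_from_subtopology[OF continuous_map_id[of euclidean]]]) (auto simp: g)
  qed (use g in auto)
  moreover have "compactin (top_of_set (fc ` M1)) (fc ` M1)"
    using compact_fc_image by (simp add: compactin_subtopology)
  ultimately have "compactin weak_topology (g ` fc ` M1)" by (rule image_compactin[rotated])
  moreover have "g ` fc ` M1 = M1" using gf by (force simp: image_image)
  ultimately show ?thesis by (simp add: compact_space_def topspace_weak_topology)
qed

lemma weak_neighbourhood:
  assumes "openin weak_topology G" "\<mu> \<in> G"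
  obtains N \<delta> where "\<delta> > 0"
    "\<And>\<nu>. \<nu> \<in> M1 \<Longrightarrow> (\<And>k. k \<le> N \<Longrightarrow> cmod (fc \<nu> k - fc \<mu> k) < \<delta>) \<Longrightarrow> \<nu> \<in> G"
proof -
  obtain V where V: "open V" "G = fc -` V \<inter> M1"
    using assms(1) unfolding weak_topology_eq_pullback openin_pullback_topology by auto
  have "openin (product_topology (\<lambda>i::nat. euclidean) UNIV) V"
    using V(1) by (simp add: euclidean_product_topology)
  from product_topology_open_contains_basis[OF this, of "fc \<mu>"] obtain X where
    X: "fc \<mu> \<in> Pi\<^sub>E UNIV X" "\<And>i. open (X i)" "finite {i. X i \<noteq> UNIV}" "Pi\<^sub>E UNIV X \<subseteq> V"
    using assms(2) V(2) by auto
  define I where "I = {i. X i \<noteq> UNIV}"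
  have "\<exists>e>0. \<forall>y. cmod (y - fc \<mu> i) < e \<longrightarrow> y \<in> X i" for i
  proof -
    have "fc \<mu> i \<in> X i" using X(1) by auto
    then show ?thesis using X(2)[of i] unfolding open_dist dist_norm by blast
  qed
  then obtain e where e: "\<And>i. e i > (0::real)" "\<And>i y. cmod (y - fc \<mu> i) < e i \<Longrightarrow> y \<in> X i" by metis
  define \<delta> where "\<delta> = Min (insert 1 (e ` I))"
  have fin: "finite I" using X(3) by (simp add: I_def)
  show ?thesis
  proof (rule that[of \<delta> "Max (insert 0 I)"])
    show "\<delta> > 0" unfolding \<delta>_def using fin e(1) by (subst Min_gr_iff) auto
    fix \<nu> assume n: "\<nu> \<in> M1" and c: "\<And>k. k \<le> Max (insert 0 I) \<Longrightarrow> cmod (fc \<nu> k - fc \<mu> k) < \<delta>"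
    have "fc \<nu> i \<in> X i" for i
    proof (cases "i \<in> I")
      case True
      then have "i \<le> Max (insert 0 I)" "\<delta> \<le> e i" using fin by (auto simp: \<delta>_def)
      then show ?thesis using c[of i] e(2)[of "fc \<nu> i" i] by linarith
    qed (auto simp: I_def)
    then show "\<nu> \<in> G" using V(2) X(4) n by (auto simp: PiE_def Pi_def extensional_def)
  qed
qed

lemma sets_borel_of: "sets (borel_of X) = sigma_sets (topspace X) {U. openin X U}"
  and space_borel_of: "space (borel_of X) = topspace X"
  unfolding borel_of_def by (auto intro!: sets_measure_of dest: openin_subset simp: space_measure_of_conv)

lemma measurable_borel_of_weak:
  assumes "\<And>x. x \<in> space M \<Longrightarrow> g x \<in> M1" "\<And>k. (\<lambda>x. fc (g x) k) \<in> borel_measurable M"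
  shows "g \<in> M \<rightarrow>\<^sub>M borel_of weak_topology"
  unfolding borel_of_def
proof (rule measurable_measure_of)
  show "g \<in> space M \<rightarrow> topspace weak_topology" using assms(1) by (auto simp: topspace_weak_topology)
  fix U assume "U \<in> {U. openin weak_topology U}"
  then obtain V where V: "open V" "U = fc -` V \<inter> M1"
    unfolding weak_topology_eq_pullback openin_pullback_topology by auto
  have "(\<lambda>x. fc (g x)) \<in> borel_measurable M"
    by (rule measurable_coordinatewise_then_product) (rule assms(2))
  then have "(\<lambda>x. fc (g x)) -` V \<inter> space M \<in> sets M" using V(1) by (intro measurable_sets) auto
  also have "(\<lambda>x. fc (g x)) -` V \<inter> space M = g -` U \<inter> space M" using V(2) assms(1) by auto
  finally show "g -` U \<inter> space M \<in> sets M" .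
qed (auto dest: openin_subset)

section \<open>Haar measure, and termwise integration of series\<close>

lemma haar_eq: "haar = distr (density lborel (\<lambda>\<theta>. ennreal (indicator {0..2*pi} \<theta> / (2*pi)))) circle_borel cis"
proof -
  have "AE x in lborel. x \<noteq> 2 * pi" by (rule AE_lborel_singleton)
  then have "AE x in lborel. indicator {0..<2*pi} x / emeasure lborel {0..<2*pi}
      = ennreal (indicator {0..2*pi} x / (2*pi))"
    by eventually_elim (auto simp: indicator_def divide_ennreal[symmetric])
  then have "uniform_measure lborel {0..<2*pi} = density lborel (\<lambda>\<theta>. ennreal (indicator {0..2*pi} \<theta> / (2*pi)))"
    unfolding uniform_measure_def by (intro density_cong) auto
  then show ?thesis unfolding haar_def by simp
qed

lemma cis_measurable_density: "cis \<in> density lborel f \<rightarrow>\<^sub>M circle_borel"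
  using cis_measurable by (simp add: measurable_cong_sets[of "density lborel f" borel])

lemma haar_M1: "haar \<in> M1"
proof (rule M1_I)
  have "prob_space (uniform_measure lborel {0..<2*pi})"
    by (rule prob_space_uniform_measure) auto
  then show "prob_space haar" unfolding haar_def
    using cis_measurable by (intro prob_space.prob_space_distr)
      (auto simp: measurable_cong_sets[of "uniform_measure lborel {0..<2*pi}" borel])
qed (simp add: haar_def)

lemma integral_haar:
  fixes f :: "complex \<Rightarrow> 'b::{banach, second_countable_topology}"
  assumes "f \<in> borel_measurable circle_borel"
  shows "(\<integral>z. f z \<partial>haar) = (1 / (2*pi)) *\<^sub>R (\<integral>\<theta>. indicator {0..2*pi} \<theta> *\<^sub>R f (cis \<theta>) \<partial>lborel)"
proof -
  have [measurable]: "(\<lambda>\<theta>. f (cis \<theta>)) \<in> borel_measurable borel"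
    using measurable_compose[OF cis_measurable assms] .
  have "(\<integral>z. f z \<partial>haar) = (\<integral>\<theta>. (indicator {0..2*pi} \<theta> / (2*pi)) *\<^sub>R f (cis \<theta>) \<partial>lborel)"
    unfolding haar_eq
    by (subst integral_distr[OF cis_measurable_density assms], subst integral_density) auto
  also have "\<dots> = (\<integral>\<theta>. (1 / (2*pi)) *\<^sub>R (indicator {0..2*pi} \<theta> *\<^sub>R f (cis \<theta>)) \<partial>lborel)"
    by (intro Bochner_Integration.integral_cong) auto
  finally show ?thesis by (simp only: integral_scaleR_right)
qed

lemma nn_integral_haar:
  assumes "f \<in> borel_measurable circle_borel"
  shows "(\<integral>\<^sup>+z. f z \<partial>haar) = ennreal (1 / (2*pi)) * (\<integral>\<^sup>+\<theta>. indicator {0..2*pi} \<theta> * f (cis \<theta>) \<partial>lborel)"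
proof -
  have [measurable]: "(\<lambda>\<theta>. f (cis \<theta>)) \<in> borel_measurable borel"
    using measurable_compose[OF cis_measurable assms] .
  have "(\<integral>\<^sup>+z. f z \<partial>haar) = (\<integral>\<^sup>+\<theta>. ennreal (indicator {0..2*pi} \<theta> / (2*pi)) * f (cis \<theta>) \<partial>lborel)"
    unfolding haar_eq
    by (subst nn_integral_distr[OF cis_measurable_density], use assms in simp, subst nn_integral_density) auto
  also have "\<dots> = (\<integral>\<^sup>+\<theta>. ennreal (1 / (2*pi)) * (indicator {0..2*pi} \<theta> * f (cis \<theta>)) \<partial>lborel)"
    by (intro nn_integral_cong) (auto simp: indicator_def)
  finally show ?thesis by (simp add: nn_integral_cmult)
qed

lemma fc_haar: "fc haar k = (if k = 0 then 1 else 0)"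
proof (cases "k = 0")
  case False
  have pm: "(\<lambda>z. z ^ k) \<in> borel_measurable circle_borel"
    by (intro borel_measurable_circle continuous_intros)
  have "((\<lambda>\<theta>. cis (real k * \<theta>) / (\<i> * k)) has_vector_derivative cis (real k * \<theta>)) (at \<theta> within A)" for \<theta> A
  proof -
    have "((\<lambda>z. exp (\<i> * (of_nat k * z)) / (\<i> * k)) has_field_derivative exp (\<i> * (of_nat k * of_real \<theta>))) (at (of_real \<theta>))"
      using False by (auto intro!: derivative_eq_intros simp: algebra_simps)
    then have "((\<lambda>x. exp (\<i> * (of_nat k * of_real x)) / (\<i> * k)) has_vector_derivative exp (\<i> * (of_nat k * of_real \<theta>))) (at \<theta> within A)"
      by (rule has_vector_derivative_real_field)
    then show ?thesis by (simp add: cis_conv_exp)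
  qed
  then have "(LBINT \<theta>. indicator {0..2*pi} \<theta> *\<^sub>R cis (real k * \<theta>))
      = cis (real k * (2*pi)) / (\<i> * k) - cis (real k * 0) / (\<i> * k)"
    by (intro integral_FTC_Icc) (auto intro!: continuous_intros)
  moreover have "cis (real k * (2*pi)) = 1"
    by (metis Complex.DeMoivre cis_2pi power_one)
  ultimately show ?thesis
    using False unfolding fc_def integral_haar[OF pm] Complex.DeMoivre by simp
qed (simp add: fc_0 haar_M1)

lemma M1_sums_integral:
  fixes f :: "nat \<Rightarrow> complex \<Rightarrow> 'b::{banach, second_countable_topology}"
  assumes "\<mu> \<in> M1" "\<And>k. f k \<in> borel_measurable circle_borel"
    and "\<And>k z. z \<in> circle \<Longrightarrow> norm (f k z) \<le> b k" "summable b"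
  shows "(\<lambda>k. \<integral>z. f k z \<partial>\<mu>) sums (\<integral>z. (\<Sum>k. f k z) \<partial>\<mu>)"
    and "integrable \<mu> (\<lambda>z. \<Sum>k. f k z)"
proof -
  interpret prob_space \<mu> using assms(1) by (rule M1_prob_space)
  have i: "integrable \<mu> (f k)" for k
    using assms by (intro M1_integrable_bounded[where B = "b k"])
  have 1: "AE z in \<mu>. summable (\<lambda>k. norm (f k z))"
    using assms by (intro AE_I2 summable_comparison_test[OF _ assms(4)] exI[of _ 0]) (auto simp: M1_space)
  have "norm (\<integral>z. norm (f k z) \<partial>\<mu>) \<le> b k" for k
  proof -
    have "(\<integral>z. norm (f k z) \<partial>\<mu>) \<le> (\<integral>z. b k \<partial>\<mu>)"
      using i[of k] assms(3) by (intro integral_mono) (auto simp: M1_space[OF assms(1)])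
    then show ?thesis by (simp add: prob_space)
  qed
  then have 2: "summable (\<lambda>k. \<integral>z. norm (f k z) \<partial>\<mu>)"
    by (intro summable_comparison_test[OF _ assms(4)]) auto
  show "(\<lambda>k. \<integral>z. f k z \<partial>\<mu>) sums (\<integral>z. (\<Sum>k. f k z) \<partial>\<mu>)" by (rule sums_integral[OF i 1 2])
  show "integrable \<mu> (\<lambda>z. \<Sum>k. f k z)" by (rule integrable_suminf[OF i 1 2])
qed


section \<open>Logarithmic energy in terms of Fourier coefficients\<close>

text \<open>The radii along which all Abel-type limits are taken.\<close>

definition rr :: "nat \<Rightarrow> real" where "rr i = 1 - 1 / (real i + 2)"

lemma rr_bounds: "1/2 \<le> rr i" "rr i < 1" "0 < rr i" "0 \<le> rr i"
  by (auto simp: rr_def field_simps)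

lemma rr_mono: "i \<le> j \<Longrightarrow> rr i \<le> rr j"
  by (auto simp: rr_def intro!: divide_left_mono)

lemma rr_tendsto: "rr \<longlonglongrightarrow> 1"
proof -
  have "(\<lambda>i. 1 / (real i + 2)) \<longlonglongrightarrow> 0"
    using LIMSEQ_ignore_initial_segment[OF lim_1_over_n[where 'a = real], of 2] by (simp add: add.commute)
  then have "(\<lambda>i. 1 - 1 / (real i + 2)) \<longlonglongrightarrow> 1 - 0" by (intro tendsto_intros)
  then show ?thesis unfolding rr_def[abs_def] by simp
qed

lemma summable_rr: "summable (\<lambda>k. rr i ^ k)"
  using rr_bounds[of i] by (intro summable_geometric) auto

lemma Ln_one_minus_sums: "cmod u < 1 \<Longrightarrow> (\<lambda>k. - (u ^ k) / of_nat k) sums Ln (1 - u)"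
  using Ln_series'[of "- u"] by simp

text \<open>The energy of the kernel \<open>ln |1 - r z cnj w|\<close>, up to sign. The term at \<open>k
  = 0\<close> is a division by 0 and so vanishes, as the logarithmic series requires.\<close>

definition Er :: "complex measure \<Rightarrow> real \<Rightarrow> real"
  where "Er \<mu> r = (\<Sum>k. r ^ k * (cmod (fc \<mu> k))\<^sup>2 / real k)"

definition en :: "complex measure \<Rightarrow> ennreal"
  where "en \<mu> = (\<Sum>k. ennreal ((cmod (fc \<mu> k))\<^sup>2 / real k))"

lemma en_haar: "en haar = 0"
proof -
  have "ennreal ((cmod (fc haar k))\<^sup>2 / real k) = 0" for k by (simp add: fc_haar)
  then show ?thesis unfolding en_def by (simp only: suminf_zero)
qed

lemma Er_term_le:
  assumes "\<mu> \<in> M1" "0 \<le> r" shows "r ^ k * (cmod (fc \<mu> k))\<^sup>2 / real k \<le> r ^ k"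
proof (cases "k = 0")
  case False
  have "(cmod (fc \<mu> k))\<^sup>2 \<le> 1" using norm_fc_le_1[OF assms(1)] by (simp add: power_le_one)
  also have "1 \<le> real k" using False by simp
  finally have "(cmod (fc \<mu> k))\<^sup>2 / real k \<le> 1" using False by simp
  then have "r ^ k * ((cmod (fc \<mu> k))\<^sup>2 / real k) \<le> r ^ k * 1" using assms by (intro mult_left_mono) auto
  then show ?thesis by simp
qed auto

lemma Er_summable:
  assumes "\<mu> \<in> M1" "0 \<le> r" "r < 1"
  shows "summable (\<lambda>k. r ^ k * (cmod (fc \<mu> k))\<^sup>2 / real k)"
  using assms Er_term_le[OF assms(1,2)]
  by (intro summable_comparison_test[OF _ summable_geometric[of r]]) auto

lemma measurable_id_circle [measurable]: "(\<lambda>z. z) \<in> borel_measurable circle_borel"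
  by (intro borel_measurable_circle continuous_intros)

lemma cnj_measurable [measurable]: "cnj \<in> borel_measurable borel"
  by (intro borel_measurable_continuous_onI continuous_intros)

lemma measurable_fst_circle [measurable]: "fst \<in> borel_measurable (circle_borel \<Otimes>\<^sub>M N)"
  by (rule measurable_compose[OF measurable_fst measurable_id_circle])

lemma measurable_snd_circle [measurable]: "snd \<in> borel_measurable (N \<Otimes>\<^sub>M circle_borel)"
  by (rule measurable_compose[OF measurable_snd measurable_id_circle])

lemma M1_pair_sets: "\<mu> \<in> M1 \<Longrightarrow> \<nu> \<in> M1 \<Longrightarrow> sets (\<mu> \<Otimes>\<^sub>M \<nu>) = sets (circle_borel \<Otimes>\<^sub>M circle_borel)"
  by (intro sets_pair_measure_cong M1_sets)

lemma M1_pair_measurable: "\<mu> \<in> M1 \<Longrightarrow> \<nu> \<in> M1 \<Longrightarrow> measurable (\<mu> \<Otimes>\<^sub>M \<nu>) N = measurable (circle_borel \<Otimes>\<^sub>M circle_borel) N"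
  by (intro measurable_cong_sets M1_pair_sets refl)

lemma M1_pair_prob: "\<mu> \<in> M1 \<Longrightarrow> \<nu> \<in> M1 \<Longrightarrow> pair_prob_space \<mu> \<nu>"
  by (auto simp: pair_prob_space_def pair_sigma_finite_def M1_prob_space prob_space_imp_sigma_finite)

lemma one_minus_notin_nonpos:
  assumes "cmod u < 1" shows "0 < Re (1 - u)" "1 - u \<notin> \<real>\<^sub>\<le>\<^sub>0" "1 - u \<noteq> 0"
proof -
  show "0 < Re (1 - u)" using complex_Re_le_cmod[of u] assms by simp
  then show "1 - u \<notin> \<real>\<^sub>\<le>\<^sub>0" "1 - u \<noteq> 0" by (auto simp: complex_nonpos_Reals_iff)
qed

text \<open>Expanding \<open>Ln (1 - r z cnj w)\<close> in powers of \<open>z cnj w\<close> diagonalises the regularised energy.\<close>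

lemma regularised_energy:
  assumes "\<mu> \<in> M1" "0 \<le> r" "r < 1"
  shows "(\<integral>p. ln (cmod (1 - of_real r * fst p * cnj (snd p))) \<partial>(\<mu> \<Otimes>\<^sub>M \<mu>)) = - Er \<mu> r"
proof -
  interpret pair_prob_space \<mu> \<mu> using assms(1) by (intro M1_pair_prob)
  define f where "f p = Ln (1 - of_real r * fst p * cnj (snd p))" for p :: "complex \<times> complex"
  have lt: "cmod (of_real r * z * cnj w) < 1" if "z \<in> circle" "w \<in> circle" for z w
    using that assms by (simp add: norm_mult)
  have f_sums: "(\<lambda>k. - ((of_real r * z * cnj w) ^ k) / of_nat k) sums f (z, w)" if "z \<in> circle" "w \<in> circle" for z w
    unfolding f_def using Ln_one_minus_sums[OF lt[OF that]] by simp
  have bnd: "cmod (- ((of_real r * z * cnj w) ^ k) / of_nat k) \<le> r ^ k" if "z \<in> circle" "w \<in> circle" for z w k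
    using that assms by (cases "k = 0") (auto simp: norm_divide norm_power norm_mult power_mult_distrib field_simps
        intro: mult_right_mono[of 1 "real k" "r ^ k", simplified])
  have bnd': "cmod (f (z, w)) \<le> 1 / (1 - r)" if "z \<in> circle" "w \<in> circle" for z w
  proof -
    have "cmod (f (z, w)) \<le> (\<Sum>k. r ^ k)"
      unfolding sums_unique[OF f_sums[OF that]] using assms
      by (intro norm_suminf_le bnd that summable_geometric) auto
    then show ?thesis using assms by (simp add: suminf_geometric)
  qed
  have f_int: "integrable (\<mu> \<Otimes>\<^sub>M \<mu>) f"
  proof (rule P.integrable_const_bound[where B = "1 / (1 - r)"])
    show "f \<in> borel_measurable (\<mu> \<Otimes>\<^sub>M \<mu>)"
      unfolding M1_pair_measurable[OF assms(1,1)] f_def by measurable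
  qed (auto simp: space_pair_measure M1_space[OF assms(1)] bnd'[simplified])
  have inner: "(\<integral>w. f (z, w) \<partial>\<mu>) = (\<Sum>k. - ((of_real r * z) ^ k) / of_nat k * cnj (fc \<mu> k))"
    if z: "z \<in> circle" for z
  proof -
    have coef: "(\<integral>w. - ((of_real r * z * cnj w) ^ k) / of_nat k \<partial>\<mu>) = - ((of_real r * z) ^ k) / of_nat k * cnj (fc \<mu> k)" for k
    proof -
      have "(\<integral>w. - ((of_real r * z * cnj w) ^ k) / of_nat k \<partial>\<mu>) = (\<integral>w. (- ((of_real r * z) ^ k) / of_nat k) * cnj (w ^ k) \<partial>\<mu>)"
        by (intro Bochner_Integration.integral_cong) (auto simp: power_mult_distrib)
      also have "\<dots> = (- ((of_real r * z) ^ k) / of_nat k) * (\<integral>w. cnj (w ^ k) \<partial>\<mu>)" by (rule integral_mult_right_zero)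
      also have "(\<integral>w. cnj (w ^ k) \<partial>\<mu>) = cnj (fc \<mu> k)" unfolding fc_def by (rule Bochner_Integration.integral_cnj)
      finally show ?thesis .
    qed
    have "(\<lambda>k. \<integral>w. - ((of_real r * z * cnj w) ^ k) / of_nat k \<partial>\<mu>) sums
        (\<integral>w. (\<Sum>k. - ((of_real r * z * cnj w) ^ k) / of_nat k) \<partial>\<mu>)"
      using assms z bnd[OF z]
      by (intro M1_sums_integral[where b = "\<lambda>k. r ^ k"] summable_geometric) auto
    also have "(\<integral>w. (\<Sum>k. - ((of_real r * z * cnj w) ^ k) / of_nat k) \<partial>\<mu>) = (\<integral>w. f (z, w) \<partial>\<mu>)"
      using f_sums[OF z] by (intro Bochner_Integration.integral_cong) (auto simp: M1_space[OF assms(1)] sums_iff)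
    finally show ?thesis unfolding coef by (simp add: sums_iff)
  qed
  have b2: "cmod (- ((of_real r * z) ^ k) / of_nat k * cnj (fc \<mu> k)) \<le> r ^ k" if "z \<in> circle" for z k
  proof -
    have "cmod (- ((of_real r * z * cnj 1) ^ k) / of_nat k) * cmod (cnj (fc \<mu> k)) \<le> r ^ k * 1"
      using norm_fc_le_1[OF assms(1)] assms bnd[of z 1] that by (intro mult_mono) auto
    then show ?thesis by (simp only: norm_mult) simp
  qed
  have "(\<lambda>k. \<integral>z. - ((of_real r * z) ^ k) / of_nat k * cnj (fc \<mu> k) \<partial>\<mu>) sums
      (\<integral>z. (\<Sum>k. - ((of_real r * z) ^ k) / of_nat k * cnj (fc \<mu> k)) \<partial>\<mu>)"
    using assms b2
    by (intro M1_sums_integral[where b = "\<lambda>k. r ^ k"] summable_geometric) auto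
  also have "(\<integral>z. (\<Sum>k. - ((of_real r * z) ^ k) / of_nat k * cnj (fc \<mu> k)) \<partial>\<mu>) = (\<integral>z. (\<integral>w. f (z, w) \<partial>\<mu>) \<partial>\<mu>)"
    by (intro Bochner_Integration.integral_cong) (auto simp: M1_space[OF assms(1)] inner)
  also have "\<dots> = (\<integral>p. f p \<partial>(\<mu> \<Otimes>\<^sub>M \<mu>))" using integral_fst'[OF f_int] by simp
  also have "(\<lambda>k. \<integral>z. - ((of_real r * z) ^ k) / of_nat k * cnj (fc \<mu> k) \<partial>\<mu>)
      = (\<lambda>k. of_real (- (r ^ k * (cmod (fc \<mu> k))\<^sup>2 / real k)))"
  proof
    fix k
    have "(\<integral>z. - ((of_real r * z) ^ k) / of_nat k * cnj (fc \<mu> k) \<partial>\<mu>)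
        = (\<integral>z. (- (of_real r ^ k) / of_nat k * cnj (fc \<mu> k)) * z ^ k \<partial>\<mu>)"
      by (intro Bochner_Integration.integral_cong) (auto simp: power_mult_distrib)
    also have "\<dots> = (- (of_real r ^ k) / of_nat k * cnj (fc \<mu> k)) * fc \<mu> k"
      unfolding fc_def[of \<mu> k] by (rule integral_mult_right_zero)
    also have "\<dots> = (- (of_real r ^ k) / of_nat k) * (fc \<mu> k * cnj (fc \<mu> k))" by (simp add: algebra_simps)
    also have "\<dots> = of_real (- (r ^ k * (cmod (fc \<mu> k))\<^sup>2 / real k))"
      by (simp only: complex_norm_square[symmetric]) simp
    finally show "(\<integral>z. - ((of_real r * z) ^ k) / of_nat k * cnj (fc \<mu> k) \<partial>\<mu>)
      = of_real (- (r ^ k * (cmod (fc \<mu> k))\<^sup>2 / real k))" .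
  qed
  finally have "(\<lambda>k. Re (of_real (- (r ^ k * (cmod (fc \<mu> k))\<^sup>2 / real k)))) sums Re (\<integral>p. f p \<partial>(\<mu> \<Otimes>\<^sub>M \<mu>))"
    by (rule sums_Re)
  then have "Re (\<integral>p. f p \<partial>(\<mu> \<Otimes>\<^sub>M \<mu>)) = - Er \<mu> r"
    using sums_minus[of "\<lambda>k. - (r ^ k * (cmod (fc \<mu> k))\<^sup>2 / real k)"] unfolding Er_def by (simp add: sums_iff suminf_minus Er_summable assms)
  also have "Re (\<integral>p. f p \<partial>(\<mu> \<Otimes>\<^sub>M \<mu>)) = (\<integral>p. Re (f p) \<partial>(\<mu> \<Otimes>\<^sub>M \<mu>))"
    using f_int by (rule integral_Re[symmetric])
  also have "\<dots> = (\<integral>p. ln (cmod (1 - of_real r * fst p * cnj (snd p))) \<partial>(\<mu> \<Otimes>\<^sub>M \<mu>))"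
  proof (intro Bochner_Integration.integral_cong refl)
    fix p assume "p \<in> space (\<mu> \<Otimes>\<^sub>M \<mu>)"
    then have "cmod (of_real r * fst p * cnj (snd p)) < 1"
      by (intro lt) (auto simp: space_pair_measure M1_space[OF assms(1)])
    then show "Re (f p) = ln (cmod (1 - of_real r * fst p * cnj (snd p)))"
      unfolding f_def by (intro Re_Ln one_minus_notin_nonpos(3))
  qed
  finally show ?thesis .
qed

text \<open>On the circle \<open>|1 - r z cnj w|\<^sup>2 = (1 - r)\<^sup>2 + r |z - w|\<^sup>2\<close>. Dividing by \<open>r\<close> makes the
  regularised kernel an upper bound of the logarithm that decreases to it as \<open>r\<close> grows to 1.\<close>

definition ker :: "nat \<Rightarrow> complex \<Rightarrow> real"
  where "ker i u = ln ((1 - rr i)\<^sup>2 / rr i + (cmod u)\<^sup>2) / 2"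

lemma rr_defect: "0 < (1 - rr i)\<^sup>2 / rr i" "(1 - rr i)\<^sup>2 / rr i \<le> 1/2"
  and rr_defect_mono: "i \<le> j \<Longrightarrow> (1 - rr j)\<^sup>2 / rr j \<le> (1 - rr i)\<^sup>2 / rr i"
  and rr_defect_tendsto: "(\<lambda>i. (1 - rr i)\<^sup>2 / rr i) \<longlonglongrightarrow> 0"
proof -
  show "0 < (1 - rr i)\<^sup>2 / rr i" using rr_bounds[of i] by simp
  have "(1 - rr i)\<^sup>2 \<le> (1/2)\<^sup>2" using rr_bounds[of i] by (intro power_mono) auto
  then have "(1 - rr i)\<^sup>2 / rr i \<le> (1/2)\<^sup>2 / (1/2)" using rr_bounds[of i] by (intro frac_le) auto
  then show "(1 - rr i)\<^sup>2 / rr i \<le> 1/2" by (simp add: power2_eq_square)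
  show "(1 - rr j)\<^sup>2 / rr j \<le> (1 - rr i)\<^sup>2 / rr i" if "i \<le> j"
    using rr_bounds[of i] rr_bounds[of j] rr_mono[OF that] by (intro frac_le power_mono) auto
  have "(\<lambda>i. (1 - rr i)\<^sup>2 / rr i) \<longlonglongrightarrow> (1 - 1)\<^sup>2 / 1" by (intro tendsto_intros rr_tendsto) auto
  then show "(\<lambda>i. (1 - rr i)\<^sup>2 / rr i) \<longlonglongrightarrow> 0" by simp
qed

lemma norm_one_minus_sq:
  assumes "z \<in> circle" "w \<in> circle"
  shows "(cmod (1 - of_real r * z * cnj w))\<^sup>2 = (1 - r)\<^sup>2 + r * (cmod (z - w))\<^sup>2"
proof -
  have 1: "(Re z)\<^sup>2 + (Im z)\<^sup>2 = 1" "(Re w)\<^sup>2 + (Im w)\<^sup>2 = 1" using assms by (auto simp: cmod_def)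
  have A: "(cmod (1 - of_real r * z * cnj w))\<^sup>2 = 1 - 2 * r * (Re z * Re w + Im z * Im w) + r\<^sup>2 * (((Re z)\<^sup>2 + (Im z)\<^sup>2) * ((Re w)\<^sup>2 + (Im w)\<^sup>2))"
    unfolding cmod_power2 by (simp add: power2_eq_square algebra_simps)
  have B: "(cmod (z - w))\<^sup>2 = ((Re z)\<^sup>2 + (Im z)\<^sup>2) + ((Re w)\<^sup>2 + (Im w)\<^sup>2) - 2 * (Re z * Re w + Im z * Im w)"
    unfolding cmod_power2 by (simp add: power2_eq_square algebra_simps)
  show ?thesis unfolding A B 1 by (simp add: power2_eq_square algebra_simps)
qed

lemma ker_eq:
  assumes "z \<in> circle" "w \<in> circle"
  shows "ker i (z - w) = ln (cmod (1 - of_real (rr i) * z * cnj w)) - ln (rr i) / 2"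
proof -
  have "cmod (of_real (rr i) * z * cnj w) < 1" using assms rr_bounds[of i] by (simp add: norm_mult)
  then have pos: "cmod (1 - of_real (rr i) * z * cnj w) > 0" using one_minus_notin_nonpos(3) by simp
  have "(1 - rr i)\<^sup>2 / rr i + (cmod (z - w))\<^sup>2 = (cmod (1 - of_real (rr i) * z * cnj w))\<^sup>2 / rr i"
    unfolding norm_one_minus_sq[OF assms] using rr_bounds[of i] by (simp add: field_simps)
  then have "ker i (z - w) = ln ((cmod (1 - of_real (rr i) * z * cnj w))\<^sup>2 / rr i) / 2" by (simp add: ker_def)
  also have "\<dots> = (ln ((cmod (1 - of_real (rr i) * z * cnj w))\<^sup>2) - ln (rr i)) / 2"
    using pos rr_bounds[of i] by (subst ln_div) auto
  also have "\<dots> = ln (cmod (1 - of_real (rr i) * z * cnj w)) - ln (rr i) / 2"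
    using pos by (simp add: ln_realpow)
  finally show ?thesis .
qed

lemma ker_mono: "i \<le> j \<Longrightarrow> ker j u \<le> ker i u"
  unfolding ker_def using rr_defect(1)[of j] rr_defect_mono[of i j]
  by (intro divide_right_mono ln_mono add_right_mono) (auto intro: add_pos_nonneg)

lemma ln_le_ker: "u \<noteq> 0 \<Longrightarrow> ln (cmod u) \<le> ker i u"
proof -
  assume u: "u \<noteq> 0"
  have "ln ((cmod u)\<^sup>2) \<le> ln ((1 - rr i)\<^sup>2 / rr i + (cmod u)\<^sup>2)"
    using u rr_defect(1)[of i] by (intro ln_mono) (auto intro: add_pos_nonneg)
  then show ?thesis using u by (simp add: ker_def ln_realpow)
qed

lemma ker_tendsto:
  "u \<noteq> 0 \<Longrightarrow> (\<lambda>i. ker i u) \<longlonglongrightarrow> ln (cmod u)"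
  "filterlim (\<lambda>i. - ker i 0) at_top sequentially"
proof -
  assume u: "u \<noteq> 0"
  have "(\<lambda>i. ker i u) \<longlonglongrightarrow> ln (0 + (cmod u)\<^sup>2) / 2"
    unfolding ker_def using u by (intro tendsto_intros rr_defect_tendsto) auto
  then show "(\<lambda>i. ker i u) \<longlonglongrightarrow> ln (cmod u)" using u by (simp add: ln_realpow)
next
  have "filterlim (\<lambda>i. (1 - rr i)\<^sup>2 / rr i) (at_right 0) sequentially"
    by (intro tendsto_imp_filterlim_at_right rr_defect_tendsto always_eventually allI rr_defect(1))
  then have "filterlim (\<lambda>i. ln ((1 - rr i)\<^sup>2 / rr i)) at_bot sequentially"
    by (rule filterlim_compose[OF ln_at_0])
  then have "filterlim (\<lambda>i. - ln ((1 - rr i)\<^sup>2 / rr i)) at_top sequentially"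
    by (simp add: filterlim_uminus_at_bot)
  then have "filterlim (\<lambda>i. (1/2) * - ln ((1 - rr i)\<^sup>2 / rr i)) at_top sequentially"
    by (intro filterlim_tendsto_pos_mult_at_top[OF tendsto_const]) auto
  then show "filterlim (\<lambda>i. - ker i 0) at_top sequentially" by (simp add: ker_def)
qed

lemma ker_le_1: "cmod u \<le> 2 \<Longrightarrow> ker i u \<le> 1"
proof -
  assume u: "cmod u \<le> 2"
  have "(cmod u)\<^sup>2 \<le> 2\<^sup>2" using u by (intro power_mono) auto
  then have "(cmod u)\<^sup>2 \<le> 4" by simp
  then have "(1 - rr i)\<^sup>2 / rr i + (cmod u)\<^sup>2 \<le> 5" using rr_defect(2)[of i] by linarith
  moreover have "0 < (1 - rr i)\<^sup>2 / rr i + (cmod u)\<^sup>2" using rr_defect(1)[of i] by (intro add_pos_nonneg) auto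
  ultimately have "ln ((1 - rr i)\<^sup>2 / rr i + (cmod u)\<^sup>2) \<le> ln 5" by simp
  also have "\<dots> \<le> ln (exp 2)"
  proof -
    have "1 + 2 + 2\<^sup>2 / 2 \<le> exp (2::real)" by (rule exp_lower_Taylor_quadratic) simp
    then show ?thesis by (intro ln_mono) auto
  qed
  finally show ?thesis by (simp add: ker_def)
qed

text \<open>Shifting by the bound turns the difference of two integrals into the integral of one
  nonnegative function, to which monotone convergence applies.\<close>

lemma eintegral_upper_bounded:
  assumes "prob_space M" "f \<in> borel_measurable M" "\<And>x. x \<in> space M \<Longrightarrow> f x \<le> ereal c" "0 \<le> c"
  shows "eintegral M f = ereal c - enn2ereal (\<integral>\<^sup>+x. e2ennreal (ereal c - f x) \<partial>M)"
proof -
  interpret prob_space M by fact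
  note [measurable] = assms(2)
  define X P N where "X = (\<integral>\<^sup>+x. e2ennreal (ereal c - f x) \<partial>M)" "P = (\<integral>\<^sup>+x. e2ennreal (f x) \<partial>M)"
    "N = (\<integral>\<^sup>+x. e2ennreal (- f x) \<partial>M)"
  have pt: "e2ennreal (ereal c - f x) + e2ennreal (f x) = ennreal c + e2ennreal (- f x)" if "x \<in> space M" for x
  proof (cases "f x")
    case (real y)
    then show ?thesis using assms(3)[OF that] assms(4)
      by (cases "y \<ge> 0") (auto simp: ennreal_neg ennreal_plus[symmetric] simp del: ennreal_plus)
  qed (use assms(3)[OF that] in auto)
  have "X + P = (\<integral>\<^sup>+x. e2ennreal (ereal c - f x) + e2ennreal (f x) \<partial>M)"
    unfolding X_P_N_def by (rule nn_integral_add[symmetric]) measurable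
  also have "\<dots> = (\<integral>\<^sup>+x. ennreal c + e2ennreal (- f x) \<partial>M)" by (intro nn_integral_cong pt)
  also have "\<dots> = ennreal c + N" unfolding X_P_N_def by (subst nn_integral_add) (auto simp: emeasure_space_1)
  finally have eq: "X + P = ennreal c + N" .
  have "P \<le> (\<integral>\<^sup>+x. ennreal c \<partial>M)" unfolding X_P_N_def
    by (intro nn_integral_mono) (use assms(3) e2ennreal_mono in fastforce)
  then have Pf: "P \<le> ennreal c" by (simp add: emeasure_space_1)
  then obtain p where p: "P = ennreal p" "0 \<le> p" by (cases P) (auto simp: top_unique)
  have "eintegral M f = enn2ereal P - enn2ereal N" by (simp add: eintegral_def X_P_N_def)
  also have "\<dots> = ereal c - enn2ereal X"
  proof (cases X)
    case (real x)
    then have "ennreal c + N = ennreal (x + p)" using eq p by simp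
    then obtain n where n: "N = ennreal n" "0 \<le> n" by (cases N) auto
    then have "x + p = c + n" using eq real p assms(4)
      by (simp add: ennreal_plus[symmetric] del: ennreal_plus)
    then show ?thesis using real n p by (simp add: enn2ereal_ennreal)
  next
    case top
    then have "ennreal c + N = top" using eq by simp
    then have "N = top" by (simp add: ennreal_add_eq_top)
    then show ?thesis using top p by (simp add: enn2ereal_ennreal)
  qed
  finally show ?thesis by (simp add: X_P_N_def)
qed

lemma eintegral_lower_bounded:
  assumes "prob_space M" "f \<in> borel_measurable M" "\<And>x. x \<in> space M \<Longrightarrow> ereal (- c) \<le> f x" "0 \<le> c"
  shows "eintegral M f = enn2ereal (\<integral>\<^sup>+x. e2ennreal (ereal c + f x) \<partial>M) - ereal c"
proof -
  interpret prob_space M by fact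
  note [measurable] = assms(2)
  define X P N where "X = (\<integral>\<^sup>+x. e2ennreal (ereal c + f x) \<partial>M)" "P = (\<integral>\<^sup>+x. e2ennreal (f x) \<partial>M)"
    "N = (\<integral>\<^sup>+x. e2ennreal (- f x) \<partial>M)"
  have pt: "e2ennreal (ereal c + f x) + e2ennreal (- f x) = ennreal c + e2ennreal (f x)" if "x \<in> space M" for x
  proof (cases "f x")
    case (real y)
    then show ?thesis using assms(3)[OF that] assms(4)
      by (cases "y \<ge> 0") (auto simp: ennreal_neg ennreal_plus[symmetric] simp del: ennreal_plus)
  qed (use assms(3)[OF that] in auto)
  have "X + N = (\<integral>\<^sup>+x. e2ennreal (ereal c + f x) + e2ennreal (- f x) \<partial>M)"
    unfolding X_P_N_def by (rule nn_integral_add[symmetric]) measurable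
  also have "\<dots> = (\<integral>\<^sup>+x. ennreal c + e2ennreal (f x) \<partial>M)" by (intro nn_integral_cong pt)
  also have "\<dots> = ennreal c + P" unfolding X_P_N_def by (subst nn_integral_add) (auto simp: emeasure_space_1)
  finally have eq: "X + N = ennreal c + P" .
  have "N \<le> (\<integral>\<^sup>+x. ennreal c \<partial>M)" unfolding X_P_N_def
  proof (intro nn_integral_mono)
    fix x assume "x \<in> space M"
    then have "- f x \<le> ereal c" using assms(3)[of x] by (simp add: ereal_uminus_le_reorder)
    then show "e2ennreal (- f x) \<le> ennreal c" using e2ennreal_mono by fastforce
  qed
  then have "N \<le> ennreal c" by (simp add: emeasure_space_1)
  then obtain n where n: "N = ennreal n" "0 \<le> n" by (cases N) (auto simp: top_unique)
  have "eintegral M f = enn2ereal P - enn2ereal N" by (simp add: eintegral_def X_P_N_def)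
  also have "\<dots> = enn2ereal X - ereal c"
  proof (cases X)
    case (real x)
    then have "ennreal c + P = ennreal (x + n)" using eq n by simp
    then obtain p where p: "P = ennreal p" "0 \<le> p" by (cases P) auto
    then have "x + n = c + p" using eq real n assms(4)
      by (simp add: ennreal_plus[symmetric] del: ennreal_plus)
    then show ?thesis using real n p by (simp add: enn2ereal_ennreal)
  next
    case top
    then have "ennreal c + P = top" using eq by simp
    then have "P = top" by (simp add: ennreal_add_eq_top)
    then show ?thesis using top n by (simp add: enn2ereal_ennreal)
  qed
  finally show ?thesis by (simp add: X_P_N_def)
qed

lemma Er_rr_tendsto:
  assumes "\<mu> \<in> M1"
  shows "(\<lambda>i. ennreal (Er \<mu> (rr i))) \<longlonglongrightarrow> en \<mu>"
proof -
  have "ennreal (Er \<mu> (rr i)) = (\<integral>\<^sup>+k. ennreal (rr i ^ k * (cmod (fc \<mu> k))\<^sup>2 / real k) \<partial>count_space UNIV)" for i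
    unfolding Er_def nn_integral_count_space_nat using rr_bounds[of i]
    by (intro suminf_ennreal2[symmetric] Er_summable assms) auto
  moreover have "en \<mu> = (\<integral>\<^sup>+k. ennreal ((cmod (fc \<mu> k))\<^sup>2 / real k) \<partial>count_space UNIV)"
    by (simp add: en_def nn_integral_count_space_nat)
  moreover have "(\<lambda>i. \<integral>\<^sup>+k. ennreal (rr i ^ k * (cmod (fc \<mu> k))\<^sup>2 / real k) \<partial>count_space UNIV) \<longlonglongrightarrow>
      (\<integral>\<^sup>+k. ennreal ((cmod (fc \<mu> k))\<^sup>2 / real k) \<partial>count_space UNIV)"
  proof (rule nn_integral_LIMSEQ)
    show "incseq (\<lambda>i k. ennreal (rr i ^ k * (cmod (fc \<mu> k))\<^sup>2 / real k))"
      unfolding incseq_def le_fun_def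
      using rr_mono rr_bounds by (intro allI impI ennreal_leI divide_right_mono mult_right_mono power_mono) auto
    fix k
    have "(\<lambda>i. rr i ^ k) \<longlonglongrightarrow> 1 ^ k" by (intro tendsto_intros rr_tendsto)
    from tendsto_mult[OF this tendsto_const[of "(cmod (fc \<mu> k))\<^sup>2 / real k"]]
    have "(\<lambda>i. rr i ^ k * (cmod (fc \<mu> k))\<^sup>2 / real k) \<longlonglongrightarrow> (cmod (fc \<mu> k))\<^sup>2 / real k" by simp
    then show "(\<lambda>i. ennreal (rr i ^ k * (cmod (fc \<mu> k))\<^sup>2 / real k)) \<longlonglongrightarrow> ennreal ((cmod (fc \<mu> k))\<^sup>2 / real k)"
      by (intro tendsto_ennrealI) simp
  qed auto
  ultimately show ?thesis by simp
qed

lemma ln_rr_tendsto: "(\<lambda>i. ln (rr i)) \<longlonglongrightarrow> 0"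
  using tendsto_ln[OF rr_tendsto] by simp

lemma ln_rr_ge: "- 1 \<le> ln (rr i) / 2" "ln (rr i) \<le> 0"
proof -
  have "- ln 2 \<le> ln (rr i)" using rr_bounds[of i] ln_mono[of "1/2" "rr i"] by (simp add: ln_div)
  then show "- 1 \<le> ln (rr i) / 2" using ln_2_less_1 by simp
qed (use rr_bounds(2,3)[of i] in simp)

lemma ker_diff_le_1: "z \<in> circle \<Longrightarrow> w \<in> circle \<Longrightarrow> ker i (z - w) \<le> 1"
  using norm_triangle_ineq4[of z w] by (intro ker_le_1) auto

lemma
  assumes "\<mu> \<in> M1"
  shows integrable_ker: "integrable (\<mu> \<Otimes>\<^sub>M \<mu>) (\<lambda>p. ker i (fst p - snd p))"
    and integral_ker: "(\<integral>p. ker i (fst p - snd p) \<partial>(\<mu> \<Otimes>\<^sub>M \<mu>)) = - Er \<mu> (rr i) - ln (rr i) / 2"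
proof -
  interpret pair_prob_space \<mu> \<mu> using assms(1) by (intro M1_pair_prob)
  have sp: "space (\<mu> \<Otimes>\<^sub>M \<mu>) = circle \<times> circle" by (simp add: space_pair_measure M1_space[OF assms])
  have km: "(\<lambda>p. ker i (fst p - snd p)) \<in> borel_measurable (\<mu> \<Otimes>\<^sub>M \<mu>)" 
    unfolding M1_pair_measurable[OF assms assms] ker_def by measurable
    have ge: "ln ((1 - rr i)\<^sup>2 / rr i) / 2 \<le> ker i u" for u
      unfolding ker_def using rr_defect(1)[of i]
      by (intro divide_right_mono ln_mono) auto
    show int: "integrable (\<mu> \<Otimes>\<^sub>M \<mu>) (\<lambda>p. ker i (fst p - snd p))"
    proof (rule P.integrable_const_bound[where B = "\<bar>ln ((1 - rr i)\<^sup>2 / rr i) / 2\<bar> + 1"])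
      show "AE p in \<mu> \<Otimes>\<^sub>M \<mu>. norm (ker i (fst p - snd p)) \<le> \<bar>ln ((1 - rr i)\<^sup>2 / rr i) / 2\<bar> + 1"
      proof (rule AE_I2)
        fix p assume "p \<in> space (\<mu> \<Otimes>\<^sub>M \<mu>)"
        then show "norm (ker i (fst p - snd p)) \<le> \<bar>ln ((1 - rr i)\<^sup>2 / rr i) / 2\<bar> + 1"
          using ker_diff_le_1[of "fst p" "snd p" i] ge[of "fst p - snd p"] unfolding sp real_norm_def by auto
      qed
    qed (rule km)
    have "(\<integral>p. ker i (fst p - snd p) \<partial>(\<mu> \<Otimes>\<^sub>M \<mu>))
        = (\<integral>p. ln (cmod (1 - of_real (rr i) * fst p * cnj (snd p))) - ln (rr i) / 2 \<partial>(\<mu> \<Otimes>\<^sub>M \<mu>))"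
      by (intro Bochner_Integration.integral_cong) (auto simp: sp ker_eq)
    also have "\<dots> = - Er \<mu> (rr i) - ln (rr i) / 2"
    proof (subst Bochner_Integration.integral_diff)
      have "integrable (\<mu> \<Otimes>\<^sub>M \<mu>) (\<lambda>p. ker i (fst p - snd p) + ln (rr i) / 2)" using int by simp
      then show "integrable (\<mu> \<Otimes>\<^sub>M \<mu>) (\<lambda>p. ln (cmod (1 - of_real (rr i) * fst p * cnj (snd p))))"
        by (subst Bochner_Integration.integrable_cong[OF refl, of _ _ "\<lambda>p. ker i (fst p - snd p) + ln (rr i) / 2"])
          (auto simp: sp ker_eq)
    qed (use rr_bounds[of i] in \<open>auto simp: regularised_energy[OF assms] P.prob_space\<close>)
    finally show "(\<integral>p. ker i (fst p - snd p) \<partial>(\<mu> \<Otimes>\<^sub>M \<mu>)) = - Er \<mu> (rr i) - ln (rr i) / 2" .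
qed

text \<open>Monotone convergence along the decreasing kernels; all of them are at most 1, so that the
  differences are nonnegative.\<close>

lemma nn_energy:
  assumes "\<mu> \<in> M1"
  shows "(\<integral>\<^sup>+p. e2ennreal (1 - elog (cmod (fst p - snd p))) \<partial>(\<mu> \<Otimes>\<^sub>M \<mu>)) = 1 + en \<mu>"
proof -
  interpret pair_prob_space \<mu> \<mu> using assms(1) by (intro M1_pair_prob)
  have sp: "space (\<mu> \<Otimes>\<^sub>M \<mu>) = circle \<times> circle" by (simp add: space_pair_measure M1_space[OF assms])
  have km: "(\<lambda>p. ker i (fst p - snd p)) \<in> borel_measurable (\<mu> \<Otimes>\<^sub>M \<mu>)" for i
    unfolding M1_pair_measurable[OF assms assms] ker_def by measurable
  have ki: "(\<integral>\<^sup>+p. ennreal (1 - ker i (fst p - snd p)) \<partial>(\<mu> \<Otimes>\<^sub>M \<mu>)) = ennreal (1 + ln (rr i) / 2 + Er \<mu> (rr i))" for i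
  proof -
    have "(\<integral>p. 1 - ker i (fst p - snd p) \<partial>(\<mu> \<Otimes>\<^sub>M \<mu>)) = 1 + ln (rr i) / 2 + Er \<mu> (rr i)"
      using integrable_ker[OF assms] by (simp add: integral_ker[OF assms] P.prob_space)
    moreover have "(\<integral>\<^sup>+p. ennreal (1 - ker i (fst p - snd p)) \<partial>(\<mu> \<Otimes>\<^sub>M \<mu>)) = ennreal (\<integral>p. 1 - ker i (fst p - snd p) \<partial>(\<mu> \<Otimes>\<^sub>M \<mu>))"
      using integrable_ker[OF assms] ker_diff_le_1 by (intro nn_integral_eq_integral) (auto simp: sp)
    ultimately show ?thesis by simp
  qed
  have "(\<lambda>i. \<integral>\<^sup>+p. ennreal (1 - ker i (fst p - snd p)) \<partial>(\<mu> \<Otimes>\<^sub>M \<mu>)) \<longlonglongrightarrow>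
      (\<integral>\<^sup>+p. e2ennreal (1 - elog (cmod (fst p - snd p))) \<partial>(\<mu> \<Otimes>\<^sub>M \<mu>))"
  proof (rule nn_integral_LIMSEQ)
    show "incseq (\<lambda>i (p :: complex \<times> complex). ennreal (1 - ker i (fst p - snd p)))"
      unfolding incseq_def le_fun_def by (auto intro!: ennreal_leI ker_mono)
    show "(\<lambda>p. ennreal (1 - ker i (fst p - snd p))) \<in> borel_measurable (\<mu> \<Otimes>\<^sub>M \<mu>)" for i
      using km[of i] by measurable
    fix p :: "complex \<times> complex"
    show "(\<lambda>i. ennreal (1 - ker i (fst p - snd p))) \<longlonglongrightarrow> e2ennreal (1 - elog (cmod (fst p - snd p)))"
    proof (cases "fst p = snd p")
      case True
      have "filterlim (\<lambda>i. 1 + - ker i 0) at_top sequentially"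
        by (rule filterlim_tendsto_add_at_top[OF tendsto_const ker_tendsto(2)])
      then show ?thesis using True by (simp add: elog_def ennreal_tendsto_top_eq_at_top)
    next
      case False
      then have "(\<lambda>i. ennreal (1 - ker i (fst p - snd p))) \<longlonglongrightarrow> ennreal (1 - ln (cmod (fst p - snd p)))"
        by (intro tendsto_ennrealI tendsto_intros ker_tendsto) auto
      then show ?thesis using False by (simp add: elog_def one_ereal_def)
    qed
  qed
  moreover have "(\<lambda>i. ennreal (1 + ln (rr i) / 2 + Er \<mu> (rr i))) \<longlonglongrightarrow> 1 + en \<mu>"
  proof -
    have "(\<lambda>i. ennreal (1 + ln (rr i) / 2) + ennreal (Er \<mu> (rr i))) \<longlonglongrightarrow> ennreal (1 + 0 / 2) + en \<mu>"
      by (intro tendsto_add tendsto_ennrealI tendsto_intros ln_rr_tendsto Er_rr_tendsto assms) auto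
    moreover have "Er \<mu> (rr i) \<ge> 0" for i
      unfolding Er_def using rr_bounds[of i] by (intro suminf_nonneg Er_summable assms) auto
    then have "ennreal (1 + ln (rr i) / 2) + ennreal (Er \<mu> (rr i)) = ennreal (1 + ln (rr i) / 2 + Er \<mu> (rr i))" for i
      using ln_rr_ge[of i] by (intro ennreal_plus[symmetric]) auto
    ultimately show ?thesis by simp
  qed
  ultimately show ?thesis unfolding ki by (rule LIMSEQ_unique)
qed

lemma elog_measurable [measurable]: "elog \<in> borel_measurable borel"
  unfolding elog_def by measurable

lemma ln_diff_le: "z \<in> circle \<Longrightarrow> w \<in> circle \<Longrightarrow> ln (cmod (z - w)) \<le> 1"
proof (cases "z = w")
  case False
  assume "z \<in> circle" "w \<in> circle"
  then have "cmod (z - w) \<le> 2" using norm_triangle_ineq4[of z w] by auto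
  then have "ker 0 (z - w) \<le> 1" by (rule ker_le_1)
  moreover have "ln (cmod (z - w)) \<le> ker 0 (z - w)" using False by (intro ln_le_ker) simp
  ultimately show ?thesis by simp
qed simp

lemma elog_diff_le: "z \<in> circle \<Longrightarrow> w \<in> circle \<Longrightarrow> elog (cmod (z - w)) \<le> 1"
  using ln_diff_le[of z w] by (simp add: elog_def one_ereal_def)

text \<open>In this form lower semicontinuity, convexity and monotonicity under smoothing of the energy
  can be read off term by term.\<close>

theorem voiculescu_entropy_fourier:
  assumes "\<mu> \<in> M1"
  shows "- voiculescu_entropy \<mu> = enn2ereal (en \<mu>)"
proof -
  interpret pair_prob_space \<mu> \<mu> using assms(1) by (intro M1_pair_prob)
  have "voiculescu_entropy \<mu> = ereal 1 - enn2ereal (\<integral>\<^sup>+p. e2ennreal (ereal 1 - elog (cmod (fst p - snd p))) \<partial>(\<mu> \<Otimes>\<^sub>M \<mu>))"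
    unfolding voiculescu_entropy_def case_prod_beta
  proof (rule eintegral_upper_bounded)
    show "(\<lambda>p. elog (cmod (fst p - snd p))) \<in> borel_measurable (\<mu> \<Otimes>\<^sub>M \<mu>)"
      unfolding M1_pair_measurable[OF assms assms] by measurable
  qed (use elog_diff_le in \<open>auto simp: space_pair_measure M1_space[OF assms] one_ereal_def P.prob_space_axioms\<close>)
  also have "\<dots> = 1 - (1 + enn2ereal (en \<mu>))"
    using nn_energy[OF assms] by (simp add: one_ereal_def[symmetric] plus_ennreal.rep_eq one_ennreal.rep_eq)
  finally show ?thesis by (cases "enn2ereal (en \<mu>)") (auto simp: one_ereal_def)
qed

text \<open>The energy as a real number; it carries no information when the series diverges.\<close>

definition energy :: "complex measure \<Rightarrow> real"
  where "energy \<mu> = enn2real (en \<mu>)"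

lemma en_eq_energy: "en \<mu> \<noteq> \<infinity> \<Longrightarrow> en \<mu> = ennreal (energy \<mu>)"
  by (simp add: energy_def less_top)

lemma energy_nonneg: "0 \<le> energy \<mu>" by (simp add: energy_def)

lemma
  assumes "\<mu> \<in> M1" "en \<mu> \<noteq> \<infinity>"
  shows AE_distinct: "AE p in \<mu> \<Otimes>\<^sub>M \<mu>. fst p \<noteq> snd p"
    and integrable_ln_diff: "integrable (\<mu> \<Otimes>\<^sub>M \<mu>) (\<lambda>p. ln (cmod (fst p - snd p)))"
    and integral_ln_diff: "(\<integral>p. ln (cmod (fst p - snd p)) \<partial>(\<mu> \<Otimes>\<^sub>M \<mu>)) = - energy \<mu>"
proof -
  interpret pair_prob_space \<mu> \<mu> using assms(1) by (intro M1_pair_prob)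
  have m: "(\<lambda>p. e2ennreal (1 - elog (cmod (fst p - snd p)))) \<in> borel_measurable (\<mu> \<Otimes>\<^sub>M \<mu>)"
    "(\<lambda>p. ln (cmod (fst p - snd p))) \<in> borel_measurable (\<mu> \<Otimes>\<^sub>M \<mu>)"
    unfolding M1_pair_measurable[OF assms(1,1)] by measurable
  have "AE p in \<mu> \<Otimes>\<^sub>M \<mu>. e2ennreal (1 - elog (cmod (fst p - snd p))) \<noteq> \<infinity>"
    using nn_energy[OF assms(1)] assms(2) m by (intro nn_integral_noteq_infinite) auto
  then show ae: "AE p in \<mu> \<Otimes>\<^sub>M \<mu>. fst p \<noteq> snd p"
    by eventually_elim (auto simp: elog_def)
  have le: "AE p in \<mu> \<Otimes>\<^sub>M \<mu>. 0 \<le> 1 - ln (cmod (fst p - snd p))"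
    using ln_diff_le by (intro AE_I2) (auto simp: space_pair_measure M1_space[OF assms(1)])
  have nn: "(\<integral>\<^sup>+p. ennreal (1 - ln (cmod (fst p - snd p))) \<partial>(\<mu> \<Otimes>\<^sub>M \<mu>)) = ennreal (1 + energy \<mu>)"
  proof -
    have "(\<integral>\<^sup>+p. ennreal (1 - ln (cmod (fst p - snd p))) \<partial>(\<mu> \<Otimes>\<^sub>M \<mu>))
        = (\<integral>\<^sup>+p. e2ennreal (1 - elog (cmod (fst p - snd p))) \<partial>(\<mu> \<Otimes>\<^sub>M \<mu>))"
      by (rule nn_integral_cong_AE) (use ae in eventually_elim, auto simp: elog_def one_ereal_def)
    then show ?thesis unfolding nn_energy[OF assms(1)] using en_eq_energy[OF assms(2)] energy_nonneg[of \<mu>] by simp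
  qed
  have int: "integrable (\<mu> \<Otimes>\<^sub>M \<mu>) (\<lambda>p. 1 - ln (cmod (fst p - snd p)))"
    using m nn le by (intro integrableI_nonneg) auto
  then have "integrable (\<mu> \<Otimes>\<^sub>M \<mu>) (\<lambda>p. 1 - (1 - ln (cmod (fst p - snd p))))"
    by (intro Bochner_Integration.integrable_diff[OF P.integrable_const int])
  then show int': "integrable (\<mu> \<Otimes>\<^sub>M \<mu>) (\<lambda>p. ln (cmod (fst p - snd p)))"
    by (simp only: diff_diff_eq2 add_diff_cancel_left')
  have "(\<integral>p. 1 - ln (cmod (fst p - snd p)) \<partial>(\<mu> \<Otimes>\<^sub>M \<mu>)) = 1 + energy \<mu>"
    using int le nn energy_nonneg[of \<mu>] by (subst integral_eq_nn_integral) auto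
  then show "(\<integral>p. ln (cmod (fst p - snd p)) \<partial>(\<mu> \<Otimes>\<^sub>M \<mu>)) = - energy \<mu>"
    using int' by (simp add: P.prob_space)
qed

text \<open>An atom would charge the diagonal of the product space, where the kernel is infinite.\<close>

lemma finite_energy_no_atom:
  assumes "\<mu> \<in> M1" "en \<mu> \<noteq> \<infinity>"
  shows "AE z in \<mu>. z \<noteq> c"
proof (cases "c \<in> circle")
  case False
  then show ?thesis by (intro AE_I2) (auto simp: M1_space[OF assms(1)])
next
  case True
  interpret pair_prob_space \<mu> \<mu> using assms(1) by (intro M1_pair_prob)
  have c: "{c} \<in> sets \<mu>" using True by (auto simp: M1_sets[OF assms(1)] circle_borel_def sets_restrict_space_iff)
  have "AE p in \<mu> \<Otimes>\<^sub>M \<mu>. p \<notin> {c} \<times> {c}" using AE_distinct[OF assms] by eventually_elim auto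
  then have "emeasure (\<mu> \<Otimes>\<^sub>M \<mu>) ({c} \<times> {c}) = 0"
    using pair_measureI[OF c c] by (subst (asm) AE_iff_null_sets[symmetric]) (auto simp: null_sets_def)
  then have "emeasure \<mu> {c} = 0" unfolding M1.emeasure_pair_measure_Times[OF c c] by auto
  then have "{c} \<in> null_sets \<mu>" using c by auto
  then show ?thesis using AE_not_in by fastforce
qed

section \<open>The potential and its regularisations\<close>

lemma one_minus_cis: "1 - cis \<theta> = of_real (2 * sin (\<theta> / 2)) * cis ((\<theta> - pi) / 2)"
proof -
  define x where "x = \<theta> / 2"
  have t: "\<theta> = 2 * x" "(2 * x - pi) / 2 = x - pi / 2" by (auto simp: x_def field_simps)
  show ?thesis unfolding t
    by (auto simp: complex_eq_iff cos_diff sin_diff cos_double_sin sin_double power2_eq_square)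
qed

lemma Ln_one_minus_cis:
  assumes "0 < \<theta>" "\<theta> < 2 * pi"
  shows "Ln (1 - cis \<theta>) = Complex (ln (2 * sin (\<theta> / 2))) ((\<theta> - pi) / 2)"
proof (rule Ln_unique)
  have "sin (\<theta> / 2) > 0" using assms by (intro sin_gt_zero) auto
  then show "exp (Complex (ln (2 * sin (\<theta> / 2))) ((\<theta> - pi) / 2)) = 1 - cis \<theta>"
    unfolding one_minus_cis exp_eq_polar by simp
qed (use assms in auto)

lemma circle_cases_cis:
  assumes "z \<in> circle" "z \<noteq> 1"
  obtains "0 < Arg2pi z" "Arg2pi z < 2 * pi" "z = cis (Arg2pi z)"
proof -
  have c: "z = cis (Arg2pi z)" using assms(1) by (simp add: cis_Arg2pi)
  then have "Arg2pi z \<noteq> 0" using assms(2) by (metis cis_zero)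
  then show ?thesis using that c Arg2pi_ge_0[of z] Arg2pi_lt_2pi[of z] by linarith
qed

text \<open>The potential away from the point 1, extended harmonically to the disc.\<close>

definition Qr :: "complex \<Rightarrow> complex \<Rightarrow> real"
  where "Qr d z = - 2 * Re (cnj d * Ln (1 - z))"

lemma potential_eq_Qr:
  assumes "z \<in> circle" "z \<noteq> 1"
  shows "potential d z = ereal (Qr d z)"
proof -
  obtain "0 < Arg2pi z" "Arg2pi z < 2 * pi" "z = cis (Arg2pi z)" using circle_cases_cis[OF assms] .
  then have "Ln (1 - z) = Complex (ln (2 * sin (Arg2pi z / 2))) ((Arg2pi z - pi) / 2)"
    using Ln_one_minus_cis by metis
  then show ?thesis using assms(2) by (simp add: potential_def Qr_def Let_def field_simps)
qed

lemma Re_one_minus_pos: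
  assumes "cmod z \<le> 1" "z \<noteq> 1"
  shows "0 < Re (1 - z)" "1 - z \<notin> \<real>\<^sub>\<le>\<^sub>0" "1 - z \<noteq> 0"
proof -
  have "Re z \<noteq> 1"
  proof
    assume r: "Re z = 1"
    have "(Re z)\<^sup>2 + (Im z)\<^sup>2 \<le> 1" using assms(1) by (simp add: cmod_def)
    then have "Im z = 0" using r by simp
    then show False using r assms(2) by (simp add: complex_eq_iff)
  qed
  moreover have "Re z \<le> 1" using complex_Re_le_cmod[of z] assms(1) by linarith
  ultimately show "0 < Re (1 - z)" by simp
  then show "1 - z \<notin> \<real>\<^sub>\<le>\<^sub>0" "1 - z \<noteq> 0" by (auto simp: complex_nonpos_Reals_iff)
qed

lemma abs_Im_Ln_one_minus:
  assumes "cmod z \<le> 1" "z \<noteq> 1" shows "\<bar>Im (Ln (1 - z))\<bar> \<le> pi / 2"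
  using Re_one_minus_pos[OF assms] Re_Ln_pos_lt[of "1 - z"] by simp

lemma Qr_eq: "Qr d z = - 2 * Re d * Re (Ln (1 - z)) - 2 * Im d * Im (Ln (1 - z))"
  by (simp add: Qr_def algebra_simps)

lemma Im_part_bounds:
  assumes "cmod z \<le> 1" "z \<noteq> 1"
  shows "0 \<le> \<bar>Im d\<bar> * pi - 2 * Im d * Im (Ln (1 - z))" "\<bar>Im d\<bar> * pi - 2 * Im d * Im (Ln (1 - z)) \<le> 2 * (\<bar>Im d\<bar> * pi)"
proof -
  define p q where "p = Im d * Im (Ln (1 - z))" "q = \<bar>Im d\<bar> * pi"
  have "\<bar>p\<bar> \<le> \<bar>Im d\<bar> * (pi / 2)"
    unfolding p_q_def abs_mult using abs_Im_Ln_one_minus[OF assms] by (intro mult_left_mono) auto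
  then have "\<bar>p\<bar> \<le> q / 2" by (simp add: p_q_def)
  then have "0 \<le> q - 2 * p" "q - 2 * p \<le> 2 * q" by auto
  then show "0 \<le> \<bar>Im d\<bar> * pi - 2 * Im d * Im (Ln (1 - z))" "\<bar>Im d\<bar> * pi - 2 * Im d * Im (Ln (1 - z)) \<le> 2 * (\<bar>Im d\<bar> * pi)"
    by (simp_all add: p_q_def)
qed

text \<open>Continuous functions increasing to the potential: the logarithm is regularised as in the energy,
  and the jump of the argument at 1 is replaced by a ramp starting from the lower one-sided limit.\<close>

definition Qa :: "nat \<Rightarrow> complex \<Rightarrow> complex \<Rightarrow> real"
  where "Qa i d z = - 2 * Re d * ker i (1 - z)
    + (\<bar>Im d\<bar> * pi - 2 * Im d * Im (Ln (1 - z))) * min 1 (real i * cmod (1 - z)) - \<bar>Im d\<bar> * pi"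

definition cQ :: "complex \<Rightarrow> real"
  where "cQ d = 2 * Re d + \<bar>Im d\<bar> * pi"

lemma cmod_one_minus_le: "z \<in> circle \<Longrightarrow> cmod (1 - z) \<le> 2"
  using norm_triangle_ineq4[of 1 z] by simp

lemma cQ_nonneg: "0 \<le> Re d \<Longrightarrow> 0 \<le> cQ d" by (simp add: cQ_def)

lemma Qa_mono:
  assumes "0 \<le> Re d" "z \<in> circle" "i \<le> j" shows "Qa i d z \<le> Qa j d z"
proof -
  have "2 * Re d * ker j (1 - z) \<le> 2 * Re d * ker i (1 - z)" using assms by (intro mult_left_mono ker_mono) auto
  moreover have "(\<bar>Im d\<bar> * pi - 2 * Im d * Im (Ln (1 - z))) * min 1 (real i * cmod (1 - z))
      \<le> (\<bar>Im d\<bar> * pi - 2 * Im d * Im (Ln (1 - z))) * min 1 (real j * cmod (1 - z))"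
    using assms Im_part_bounds[of z d]
    by (cases "z = 1", simp, intro mult_left_mono min.mono mult_right_mono) auto
  ultimately show ?thesis by (simp add: Qa_def)
qed

lemma Qa_ge:
  assumes "0 \<le> Re d" "z \<in> circle" shows "- cQ d \<le> Qa i d z"
proof -
  have "2 * Re d * ker i (1 - z) \<le> 2 * Re d * 1"
    using assms by (intro mult_left_mono ker_le_1 cmod_one_minus_le) auto
  moreover have "0 \<le> (\<bar>Im d\<bar> * pi - 2 * Im d * Im (Ln (1 - z))) * min 1 (real i * cmod (1 - z))"
    using assms Im_part_bounds[of z d] by (cases "z = 1", simp, intro mult_nonneg_nonneg) auto
  ultimately show ?thesis by (simp add: Qa_def cQ_def)
qed

lemma Qa_tendsto:
  assumes "z \<in> circle" "z \<noteq> 1" shows "(\<lambda>i. Qa i d z) \<longlonglongrightarrow> Qr d z"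
proof -
  have pos: "cmod (1 - z) > 0" using assms by simp
  obtain N where N: "real N * cmod (1 - z) > 1" using reals_Archimedean3[OF pos] by blast
  have "min 1 (real i * cmod (1 - z)) = 1" if "i \<ge> N" for i
  proof -
    have "real N * cmod (1 - z) \<le> real i * cmod (1 - z)" using that by (intro mult_right_mono) auto
    then show ?thesis using N by simp
  qed
  then have "eventually (\<lambda>i. min 1 (real i * cmod (1 - z)) = 1) sequentially"
    using eventually_sequentially by blast
  then have "(\<lambda>i. min 1 (real i * cmod (1 - z))) \<longlonglongrightarrow> 1" by (rule tendsto_eventually)
  then have "(\<lambda>i. Qa i d z) \<longlonglongrightarrow> - 2 * Re d * ln (cmod (1 - z))
      + (\<bar>Im d\<bar> * pi - 2 * Im d * Im (Ln (1 - z))) * 1 - \<bar>Im d\<bar> * pi"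
    unfolding Qa_def using assms by (intro tendsto_intros ker_tendsto) auto
  moreover have "- 2 * Re d * ln (cmod (1 - z)) + (\<bar>Im d\<bar> * pi - 2 * Im d * Im (Ln (1 - z))) * 1 - \<bar>Im d\<bar> * pi = Qr d z"
    using assms by (simp add: Qr_eq Re_Ln algebra_simps)
  ultimately show ?thesis by simp
qed

lemma Qa_le_Qr:
  assumes "0 \<le> Re d" "z \<in> circle" "z \<noteq> 1" shows "Qa i d z \<le> Qr d z"
  using Qa_tendsto[OF assms(2,3)] Qa_mono[OF assms(1,2)]
  by (intro incseq_le[of "\<lambda>i. Qa i d z"]) (auto simp: incseq_def)

lemma Qr_ge: assumes "0 \<le> Re d" "z \<in> circle" "z \<noteq> 1" shows "- cQ d \<le> Qr d z"
  using Qa_ge[OF assms(1,2), of 0] Qa_le_Qr[OF assms, of 0] by linarith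

lemma Qa_continuous: "continuous_on circle (Qa i d)"
proof -
  define g where "g z = (\<bar>Im d\<bar> * pi - 2 * Im d * Im (Ln (1 - z))) * min 1 (real i * cmod (1 - z))" for z
  have "continuous (at z within circle) g" if z: "z \<in> circle" for z
  proof (cases "z = 1")
    case False
    then show ?thesis unfolding g_def
      by (intro continuous_intros continuous_Im continuous_at_imp_continuous_at_within[OF isCont_Ln']) (use Re_one_minus_pos[of z] z in auto)
  next
    case True
    have "(g \<longlongrightarrow> 0) (at 1 within circle)"
    proof (rule Lim_null_comparison)
      show "\<forall>\<^sub>F z in at 1 within circle. norm (g z) \<le> 2 * (\<bar>Im d\<bar> * pi) * (real i * cmod (1 - z))"
        unfolding eventually_at_filter
      proof (intro always_eventually allI impI)
        fix z :: complex assume "z \<in> circle"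
        then have "\<bar>\<bar>Im d\<bar> * pi - 2 * Im d * Im (Ln (1 - z))\<bar> * \<bar>min 1 (real i * cmod (1 - z))\<bar>
            \<le> 2 * (\<bar>Im d\<bar> * pi) * (real i * cmod (1 - z))"
          using Im_part_bounds[of z d] by (cases "z = 1", simp, intro mult_mono) auto
        then show "norm (g z) \<le> 2 * (\<bar>Im d\<bar> * pi) * (real i * cmod (1 - z))"
          by (simp add: g_def abs_mult)
      qed
      have "((\<lambda>z. 2 * (\<bar>Im d\<bar> * pi) * (real i * cmod (1 - z))) \<longlongrightarrow> 2 * (\<bar>Im d\<bar> * pi) * (real i * cmod (1 - 1))) (at 1 within circle)"
        by (intro tendsto_intros)
      then show "((\<lambda>z. 2 * (\<bar>Im d\<bar> * pi) * (real i * cmod (1 - z))) \<longlongrightarrow> 0) (at 1 within circle)" by simp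
    qed
    moreover have "g 1 = 0" by (simp add: g_def)
    ultimately show ?thesis using True by (simp add: continuous_within)
  qed
  then have "continuous_on circle g" by (simp add: continuous_on_eq_continuous_within)
  moreover have "continuous_on circle (\<lambda>z. ker i (1 - z))"
  proof -
    have "(1 - rr i)\<^sup>2 / rr i + (cmod (1 - z))\<^sup>2 \<noteq> 0" for z :: complex
      using add_pos_nonneg[OF rr_defect(1)[of i], of "(cmod (1 - z))\<^sup>2"] by simp
    then show ?thesis unfolding ker_def by (intro continuous_intros) auto
  qed
  ultimately have "continuous_on circle (\<lambda>z. - 2 * Re d * ker i (1 - z) + g z - \<bar>Im d\<bar> * pi)"
    by (intro continuous_intros)
  then show ?thesis by (simp add: Qa_def[abs_def] g_def)
qed

lemma Qr_measurable [measurable]: "Qr d \<in> borel_measurable circle_borel"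
  unfolding Qr_def[abs_def] by measurable

lemma potential_measurable: "potential d \<in> borel_measurable circle_borel"
proof -
  have "(\<lambda>z. if z = 1 then (if Re d > 0 then \<infinity> else ereal (- \<bar>Im d\<bar> * pi)) else ereal (Qr d z)) \<in> borel_measurable circle_borel"
    by measurable
  then show ?thesis
    by (subst measurable_cong[of _ _ "\<lambda>z. if z = 1 then (if Re d > 0 then \<infinity> else ereal (- \<bar>Im d\<bar> * pi)) else ereal (Qr d z)"])
      (auto simp: potential_eq_Qr, auto simp: potential_def)
qed

lemma potential_ge:
  assumes "0 \<le> Re d" "z \<in> circle" shows "ereal (- cQ d) \<le> potential d z"
proof (cases "z = 1")
  case True
  then show ?thesis using assms by (auto simp: potential_def cQ_def)
qed (use assms Qr_ge potential_eq_Qr in auto)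

lemma Qa_tendsto_potential:
  assumes "0 \<le> Re d" "z \<in> circle"
  shows "(\<lambda>i. ennreal (cQ d + Qa i d z)) \<longlonglongrightarrow> e2ennreal (ereal (cQ d) + potential d z)"
proof (cases "z = 1")
  case False
  then show ?thesis using assms Qa_tendsto[of z d] by (auto simp: potential_eq_Qr intro!: tendsto_ennrealI tendsto_intros)
next
  case True
  have Qa1: "Qa i d 1 = 2 * Re d * - ker i 0 - \<bar>Im d\<bar> * pi" for i by (simp add: Qa_def)
  show ?thesis
  proof (cases "Re d > 0")
    case False
    then show ?thesis using True assms by (simp add: Qa1 potential_def cQ_def)
  next
    case pos: True
    have "filterlim (\<lambda>i. 2 * Re d * - ker i 0) at_top sequentially"
      using pos by (intro filterlim_tendsto_pos_mult_at_top[OF tendsto_const] ker_tendsto) auto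
    then have "filterlim (\<lambda>i. (cQ d - \<bar>Im d\<bar> * pi) + 2 * Re d * - ker i 0) at_top sequentially"
      by (rule filterlim_tendsto_add_at_top[OF tendsto_const])
    then show ?thesis using True pos by (simp add: Qa1 potential_def ennreal_tendsto_top_eq_at_top algebra_simps)
  qed
qed

text \<open>The shift by the lower bound of the potential makes the integrand nonnegative.\<close>

definition pot_nn :: "complex \<Rightarrow> complex measure \<Rightarrow> ennreal"
  where "pot_nn d \<mu> = (\<integral>\<^sup>+z. e2ennreal (ereal (cQ d) + potential d z) \<partial>\<mu>)"

lemma eintegral_potential:
  assumes "0 \<le> Re d" "\<mu> \<in> M1"
  shows "eintegral \<mu> (potential d) = enn2ereal (pot_nn d \<mu>) - ereal (cQ d)"
  unfolding pot_nn_def using assms potential_measurable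
  by (intro eintegral_lower_bounded cQ_nonneg) (auto simp: M1_prob_space M1_measurable_cong M1_space intro!: potential_ge)

lemma integral_Qa_tendsto:
  assumes "0 \<le> Re d" "\<mu> \<in> M1"
  shows "(\<lambda>i. ennreal (cQ d + (\<integral>z. Qa i d z \<partial>\<mu>))) \<longlonglongrightarrow> pot_nn d \<mu>"
proof -
  interpret prob_space \<mu> using assms(2) by (rule M1_prob_space)
  have "(\<lambda>i. \<integral>\<^sup>+z. ennreal (cQ d + Qa i d z) * indicator circle z \<partial>\<mu>) \<longlonglongrightarrow>
      (\<integral>\<^sup>+z. e2ennreal (ereal (cQ d) + potential d z) * indicator circle z \<partial>\<mu>)"
  proof (rule nn_integral_LIMSEQ)
    show "incseq (\<lambda>i z. ennreal (cQ d + Qa i d z) * indicator circle z)"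
      using assms Qa_mono by (auto simp: incseq_def le_fun_def indicator_def intro!: ennreal_leI)
    have [measurable]: "circle \<in> sets circle_borel" using sets.top[of circle_borel] by simp
    have [measurable]: "Qa i d \<in> borel_measurable circle_borel" for i by (rule borel_measurable_circle[OF Qa_continuous])
    show "(\<lambda>z. ennreal (cQ d + Qa i d z) * indicator circle z) \<in> borel_measurable \<mu>" for i
      unfolding M1_measurable_cong[OF assms(2)] by measurable
    show "(\<lambda>i. ennreal (cQ d + Qa i d z) * indicator circle z) \<longlonglongrightarrow> e2ennreal (ereal (cQ d) + potential d z) * indicator circle z" for z
      using Qa_tendsto_potential[OF assms(1), of z] by (cases "z \<in> circle") auto
  qed
  moreover have "(\<integral>\<^sup>+z. e2ennreal (ereal (cQ d) + potential d z) * indicator circle z \<partial>\<mu>) = pot_nn d \<mu>"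
    unfolding pot_nn_def by (intro nn_integral_cong) (simp add: M1_space[OF assms(2)])
  moreover have "(\<integral>\<^sup>+z. ennreal (cQ d + Qa i d z) * indicator circle z \<partial>\<mu>) = ennreal (cQ d + (\<integral>z. Qa i d z \<partial>\<mu>))" for i
  proof -
    have int: "integrable \<mu> (Qa i d)" by (rule M1_integrable_continuous[OF assms(2) Qa_continuous])
    have "(\<integral>\<^sup>+z. ennreal (cQ d + Qa i d z) * indicator circle z \<partial>\<mu>) = (\<integral>\<^sup>+z. ennreal (cQ d + Qa i d z) \<partial>\<mu>)"
      by (intro nn_integral_cong) (simp add: M1_space[OF assms(2)])
    also have "\<dots> = ennreal (\<integral>z. cQ d + Qa i d z \<partial>\<mu>)"
    proof (intro nn_integral_eq_integral AE_I2)
      fix z assume "z \<in> space \<mu>"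
      then show "0 \<le> cQ d + Qa i d z" using Qa_ge[OF assms(1), of z i] by (simp add: M1_space[OF assms(2)])
    qed (use int in simp)
    finally show ?thesis using int by (simp add: prob_space)
  qed
  ultimately show ?thesis by simp
qed


section \<open>The energy functional is a supremum of continuous functionals\<close>

text \<open>The rate function up to its additive constant.\<close>

definition J :: "complex \<Rightarrow> complex measure \<Rightarrow> ereal"
  where "J d \<mu> = - voiculescu_entropy \<mu> + eintegral \<mu> (potential d)"

text \<open>Cutting off the series leaves finitely many Fourier coefficients, hence a weakly continuous
  functional; letting the radius and the cut-off grow together keeps it increasing.\<close>

definition Ep :: "nat \<Rightarrow> complex measure \<Rightarrow> real"
  where "Ep i \<mu> = (\<Sum>k<i. rr i ^ k * (cmod (fc \<mu> k))\<^sup>2 / real k)"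

text \<open>The term \<open>ln (rr i) / 2\<close> stems from the division by \<open>rr i\<close> in the
  regularised kernel.\<close>

definition Ji :: "nat \<Rightarrow> complex \<Rightarrow> complex measure \<Rightarrow> real"
  where "Ji i d \<mu> = Ep i \<mu> + ln (rr i) / 2 + (\<integral>z. Qa i d z \<partial>\<mu>)"

lemma Ep_mono: "i \<le> j \<Longrightarrow> Ep i \<mu> \<le> Ep j \<mu>"
proof -
  assume "i \<le> j"
  then have "Ep i \<mu> \<le> (\<Sum>k<i. rr j ^ k * (cmod (fc \<mu> k))\<^sup>2 / real k)"
    unfolding Ep_def using rr_bounds(4) by (intro sum_mono divide_right_mono mult_right_mono power_mono rr_mono) auto
  also have "\<dots> \<le> Ep j \<mu>" unfolding Ep_def using \<open>i \<le> j\<close> rr_bounds(4) by (intro sum_mono2) auto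
  finally show ?thesis .
qed

lemma Ep_nonneg: "0 \<le> Ep i \<mu>"
  unfolding Ep_def using rr_bounds(4) by (intro sum_nonneg) auto

lemma Ep_le_Er: "\<mu> \<in> M1 \<Longrightarrow> Ep i \<mu> \<le> Er \<mu> (rr i)"
  unfolding Ep_def Er_def using rr_bounds[of i] by (intro sum_le_suminf Er_summable) auto

lemma Ep_tendsto: "(\<lambda>i. ennreal (Ep i \<mu>)) \<longlonglongrightarrow> en \<mu>"
proof -
  have "(\<lambda>i. \<integral>\<^sup>+k. ennreal (rr i ^ k * (cmod (fc \<mu> k))\<^sup>2 / real k) * indicator {..<i} k \<partial>count_space UNIV) \<longlonglongrightarrow>
      (\<integral>\<^sup>+k. ennreal ((cmod (fc \<mu> k))\<^sup>2 / real k) \<partial>count_space UNIV)"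
  proof (rule nn_integral_LIMSEQ)
    show "incseq (\<lambda>i k. ennreal (rr i ^ k * (cmod (fc \<mu> k))\<^sup>2 / real k) * indicator {..<i} k)"
      unfolding incseq_def le_fun_def
      using rr_mono rr_bounds(4) by (intro allI impI mult_mono ennreal_leI divide_right_mono mult_right_mono power_mono) (auto simp: indicator_def)
    fix k
    have "(\<lambda>i. rr i ^ k) \<longlonglongrightarrow> 1 ^ k" by (intro tendsto_intros rr_tendsto)
    from tendsto_mult[OF this tendsto_const[of "(cmod (fc \<mu> k))\<^sup>2 / real k"]]
    have 1: "(\<lambda>i. ennreal (rr i ^ k * (cmod (fc \<mu> k))\<^sup>2 / real k)) \<longlonglongrightarrow> ennreal ((cmod (fc \<mu> k))\<^sup>2 / real k)"
      by (intro tendsto_ennrealI) simp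
    have "eventually (\<lambda>i. ennreal (rr i ^ k * (cmod (fc \<mu> k))\<^sup>2 / real k) = ennreal (rr i ^ k * (cmod (fc \<mu> k))\<^sup>2 / real k) * indicator {..<i} k) sequentially"
      using eventually_gt_at_top[of k] by eventually_elim simp
    with 1 show "(\<lambda>i. ennreal (rr i ^ k * (cmod (fc \<mu> k))\<^sup>2 / real k) * indicator {..<i} k) \<longlonglongrightarrow> ennreal ((cmod (fc \<mu> k))\<^sup>2 / real k)"
      by (rule Lim_transform_eventually)
  qed auto
  moreover have "(\<integral>\<^sup>+k. ennreal (rr i ^ k * (cmod (fc \<mu> k))\<^sup>2 / real k) * indicator {..<i} k \<partial>count_space UNIV) = ennreal (Ep i \<mu>)" for i
  proof -
    have "(\<integral>\<^sup>+k. ennreal (rr i ^ k * (cmod (fc \<mu> k))\<^sup>2 / real k) * indicator {..<i} k \<partial>count_space UNIV)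
        = (\<Sum>k. ennreal (rr i ^ k * (cmod (fc \<mu> k))\<^sup>2 / real k) * indicator {..<i} k)"
      by (rule nn_integral_count_space_nat)
    also have "\<dots> = (\<Sum>k<i. ennreal (rr i ^ k * (cmod (fc \<mu> k))\<^sup>2 / real k) * indicator {..<i} k)"
      by (rule suminf_finite) auto
    also have "\<dots> = (\<Sum>k<i. ennreal (rr i ^ k * (cmod (fc \<mu> k))\<^sup>2 / real k))"
      by (intro sum.cong) auto
    also have "\<dots> = ennreal (Ep i \<mu>)" unfolding Ep_def using rr_bounds(4) by (intro sum_ennreal) auto
    finally show ?thesis .
  qed
  ultimately show ?thesis by (simp add: en_def nn_integral_count_space_nat)
qed

lemma J_eq:
  assumes "0 \<le> Re d" "\<mu> \<in> M1"
  shows "J d \<mu> = enn2ereal (en \<mu>) + (enn2ereal (pot_nn d \<mu>) - ereal (cQ d))"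
  unfolding J_def using assms by (simp add: voiculescu_entropy_fourier eintegral_potential)

lemma Ji_mono:
  assumes "0 \<le> Re d" "\<mu> \<in> M1" "i \<le> j" shows "Ji i d \<mu> \<le> Ji j d \<mu>"
proof -
  have "(\<integral>z. Qa i d z \<partial>\<mu>) \<le> (\<integral>z. Qa j d z \<partial>\<mu>)"
    using assms Qa_mono[OF assms(1) _ assms(3)]
    by (intro integral_mono M1_integrable_continuous Qa_continuous) (auto simp: M1_space)
  moreover have "ln (rr i) \<le> ln (rr j)" using rr_bounds rr_mono[OF assms(3)] by (intro ln_mono) auto
  ultimately show ?thesis using Ep_mono[OF assms(3), of \<mu>] by (simp add: Ji_def)
qed

lemma Ji_tendsto:
  assumes "0 \<le> Re d" "\<mu> \<in> M1"
  shows "(\<lambda>i. ereal (Ji i d \<mu>)) \<longlonglongrightarrow> J d \<mu>"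
proof -
  have "(\<lambda>i. enn2ereal (ennreal (Ep i \<mu>))) \<longlonglongrightarrow> enn2ereal (en \<mu>)"
    by (intro tendsto_enn2erealI Ep_tendsto)
  then have 1: "(\<lambda>i. ereal (Ep i \<mu>)) \<longlonglongrightarrow> enn2ereal (en \<mu>)"
    by (simp add: enn2ereal_ennreal Ep_nonneg)
  have "0 \<le> cQ d + (\<integral>z. Qa i d z \<partial>\<mu>)" for i
  proof -
    interpret prob_space \<mu> using assms(2) by (rule M1_prob_space)
    have "(\<integral>z. - cQ d \<partial>\<mu>) \<le> (\<integral>z. Qa i d z \<partial>\<mu>)"
      using assms Qa_ge[OF assms(1)] by (intro integral_mono M1_integrable_continuous Qa_continuous) (auto simp: M1_space)
    then show ?thesis by (simp add: prob_space)
  qed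
  moreover have "(\<lambda>i. enn2ereal (ennreal (cQ d + (\<integral>z. Qa i d z \<partial>\<mu>)))) \<longlonglongrightarrow> enn2ereal (pot_nn d \<mu>)"
    by (intro tendsto_enn2erealI integral_Qa_tendsto assms)
  ultimately have 2: "(\<lambda>i. ereal (cQ d + (\<integral>z. Qa i d z \<partial>\<mu>))) \<longlonglongrightarrow> enn2ereal (pot_nn d \<mu>)"
    by (simp add: enn2ereal_ennreal)
  have 3: "(\<lambda>i. ereal (ln (rr i) / 2 - cQ d)) \<longlonglongrightarrow> ereal (0 / 2 - cQ d)"
    by (intro tendsto_intros tendsto_ereal ln_rr_tendsto) auto
  have "(\<lambda>i. ereal (Ep i \<mu>) + ereal (cQ d + (\<integral>z. Qa i d z \<partial>\<mu>)) + ereal (ln (rr i) / 2 - cQ d))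
      \<longlonglongrightarrow> enn2ereal (en \<mu>) + enn2ereal (pot_nn d \<mu>) + ereal (0 / 2 - cQ d)"
    using 1 2 3 by (intro tendsto_add_ereal_nonneg) auto
  moreover have "enn2ereal (en \<mu>) + enn2ereal (pot_nn d \<mu>) + ereal (0 / 2 - cQ d) = J d \<mu>"
    unfolding J_eq[OF assms] by (cases "enn2ereal (en \<mu>)"; cases "enn2ereal (pot_nn d \<mu>)") auto
  ultimately show ?thesis by (simp add: Ji_def algebra_simps)
qed

lemma Ji_le_J:
  assumes "0 \<le> Re d" "\<mu> \<in> M1" shows "ereal (Ji i d \<mu>) \<le> J d \<mu>"
  using Ji_tendsto[OF assms] Ji_mono[OF assms]
  by (intro incseq_le[of "\<lambda>i. ereal (Ji i d \<mu>)"]) (auto simp: incseq_def)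

lemma Ji_continuous: "continuous_map weak_topology euclideanreal (Ji i d)"
proof -
  have "continuous_map weak_topology euclideanreal (cmod \<circ> (\<lambda>\<mu>. fc \<mu> k))" for k
    by (rule continuous_map_compose[OF continuous_map_fc]) (auto intro!: continuous_intros)
  then have "continuous_map weak_topology euclideanreal (\<lambda>\<mu>. cmod (fc \<mu> k))" for k by (simp add: o_def)
  then have "continuous_map weak_topology euclideanreal (\<lambda>\<mu>. rr i ^ k / real k * (cmod (fc \<mu> k) * cmod (fc \<mu> k)))" for k
    by (intro continuous_map_real_mult continuous_map_canonical_const)
  then have "continuous_map weak_topology euclideanreal
      (\<lambda>\<mu>. (\<Sum>k<i. rr i ^ k / real k * (cmod (fc \<mu> k) * cmod (fc \<mu> k))) + ln (rr i) / 2 + (\<integral>z. Qa i d z \<partial>\<mu>))"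
    by (intro continuous_map_add continuous_map_sum continuous_map_canonical_const continuous_map_integral Qa_continuous) auto
  then show ?thesis by (simp add: Ji_def[abs_def] Ep_def power2_eq_square)
qed

lemma closedin_J_le:
  assumes "0 \<le> Re d" shows "closedin weak_topology {\<mu> \<in> M1. J d \<mu> \<le> ereal a}"
proof -
  have "closedin weak_topology {\<mu> \<in> topspace weak_topology. Ji i d \<mu> \<in> {..a}}" for i
    by (rule closedin_continuous_map_preimage[OF Ji_continuous]) auto
  then have "closedin weak_topology (\<Inter>i. {\<mu> \<in> M1. Ji i d \<mu> \<in> {..a}})"
    unfolding topspace_weak_topology by (intro closedin_INT) auto
  moreover have "(\<Inter>i. {\<mu> \<in> M1. Ji i d \<mu> \<in> {..a}}) = {\<mu> \<in> M1. J d \<mu> \<le> ereal a}"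
  proof (intro equalityI subsetI)
    fix \<mu> assume "\<mu> \<in> (\<Inter>i. {\<mu> \<in> M1. Ji i d \<mu> \<in> {..a}})"
    then have "\<mu> \<in> M1" "\<And>i. ereal (Ji i d \<mu>) \<le> ereal a" by auto
    then show "\<mu> \<in> {\<mu> \<in> M1. J d \<mu> \<le> ereal a}"
      using LIMSEQ_le_const2[OF Ji_tendsto[OF assms]] by blast
  next
    fix \<mu> assume "\<mu> \<in> {\<mu> \<in> M1. J d \<mu> \<le> ereal a}"
    then show "\<mu> \<in> (\<Inter>i. {\<mu> \<in> M1. Ji i d \<mu> \<in> {..a}})"
      using order_trans[OF Ji_le_J[OF assms]] by fastforce
  qed
  ultimately show ?thesis by simp
qed

text \<open>Since the approximants increase, compactness makes one of them exceed on all of a closed set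
  any level that the energy itself exceeds there.\<close>

lemma Ji_uniform_lower_bound:
  assumes "0 \<le> Re d" "closedin weak_topology F" "\<And>\<mu>. \<mu> \<in> F \<Longrightarrow> ereal a < J d \<mu>"
  obtains i where "\<And>\<mu>. \<mu> \<in> F \<Longrightarrow> a < Ji i d \<mu>"
proof -
  have FM: "F \<subseteq> M1" using closedin_subset[OF assms(2)] by (simp add: topspace_weak_topology)
  define U where "U i = {\<mu> \<in> M1. Ji i d \<mu> \<in> {a<..}}" for i
  have U: "openin weak_topology (U i)" for i
    unfolding U_def topspace_weak_topology[symmetric]
    by (rule openin_continuous_map_preimage[OF Ji_continuous]) auto
  have "F \<subseteq> (\<Union>i. U i)"
  proof
    fix \<mu> assume m: "\<mu> \<in> F"
    then have "\<forall>\<^sub>F i in sequentially. ereal a < ereal (Ji i d \<mu>)"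
      using FM assms(1,3) by (intro order_tendstoD(1)[OF Ji_tendsto]) auto
    then obtain i where "ereal a < ereal (Ji i d \<mu>)" unfolding eventually_sequentially by auto
    then show "\<mu> \<in> (\<Union>i. U i)" using m FM by (auto simp: U_def)
  qed
  moreover have "compactin weak_topology F"
    using assms(2) compact_space_weak_topology by (rule closedin_compact_space[rotated])
  ultimately have "\<exists>\<F>. finite \<F> \<and> \<F> \<subseteq> range U \<and> F \<subseteq> \<Union>\<F>"
    using U by (intro compactinD) auto
  then obtain \<F> where F: "finite \<F>" "\<F> \<subseteq> range U" "F \<subseteq> \<Union>\<F>" by blast
  then obtain I where I: "finite I" "\<F> = U ` I" by (meson finite_subset_image)
  show ?thesis
  proof (rule that[of "Max (insert 0 I)"])
    fix \<mu> assume m: "\<mu> \<in> F"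
    then obtain i where i: "i \<in> I" "\<mu> \<in> U i" using F I by blast
    have "Ji i d \<mu> \<le> Ji (Max (insert 0 I)) d \<mu>"
      using i I m FM assms(1) by (intro Ji_mono) auto
    then show "a < Ji (Max (insert 0 I)) d \<mu>" using i by (auto simp: U_def)
  qed
qed


section \<open>Abel means of the potential\<close>

lemma cmod_one_minus_half:
  assumes "z \<in> circle" "0 \<le> r" "r \<le> 1" shows "cmod (1 - z) / 2 \<le> cmod (1 - of_real r * z)"
proof -
  have "cmod (1 - z) \<le> cmod (1 - of_real r * z) + cmod (of_real (1 - r) * z)"
    using norm_triangle_ineq[of "1 - of_real r * z" "- (of_real (1 - r) * z)"] by (simp add: algebra_simps norm_minus_commute)
  also have "cmod (of_real (1 - r) * z) = 1 - r" using assms by (simp only: norm_mult norm_of_real) simp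
  also have "1 - r \<le> cmod (1 - of_real r * z)"
    using norm_triangle_ineq2[of 1 "of_real r * z"] assms by (simp add: norm_mult)
  finally show ?thesis by simp
qed

lemma cmod_rr_less_1: "z \<in> circle \<Longrightarrow> cmod (of_real (rr i) * z) < 1"
  using rr_bounds[of i] by (simp add: norm_mult)

definition KQ :: "complex \<Rightarrow> real"
  where "KQ d = 2 * Re d * ln 2 + 2 * \<bar>Im d\<bar> * pi"

text \<open>Moving a point of the circle towards the centre at most halves its distance to 1, so the
  potential, up to a constant, dominates its values at smaller radii.\<close>

lemma Qr_rr_bounds:
  assumes "0 \<le> Re d" "z \<in> circle" "z \<noteq> 1"
  shows "- KQ d \<le> Qr d (of_real (rr i) * z)" "Qr d (of_real (rr i) * z) \<le> Qr d z + KQ d"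
proof -
  define u where "u = of_real (rr i) * z"
  have u: "cmod u < 1" using cmod_rr_less_1[OF assms(2)] by (simp add: u_def)
  have uz: "1 - u \<noteq> 0" using one_minus_notin_nonpos(3)[OF u] .
  have b: "\<bar>Im d * Im (Ln (1 - v))\<bar> \<le> \<bar>Im d\<bar> * (pi / 2)" if "cmod v \<le> 1" "v \<noteq> 1" for v
    unfolding abs_mult using abs_Im_Ln_one_minus[OF that] by (intro mult_left_mono) auto
  have "cmod (1 - u) \<le> 2" using norm_triangle_ineq4[of 1 u] u by simp
  then have "ln (cmod (1 - u)) \<le> ln 2" using uz by simp
  then have 1: "Re d * ln (cmod (1 - u)) \<le> Re d * ln 2" using assms(1) by (intro mult_left_mono)
  show "- KQ d \<le> Qr d (of_real (rr i) * z)"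
    using 1 b[of u] u uz unfolding u_def[symmetric] Qr_eq Re_Ln[OF uz] KQ_def by (auto simp: abs_le_iff)
  have "cmod (1 - z) / 2 \<le> cmod (1 - u)"
    unfolding u_def using assms rr_bounds[of i] by (intro cmod_one_minus_half) auto
  then have "ln (cmod (1 - z) / 2) \<le> ln (cmod (1 - u))" using assms(3) by (intro ln_mono) auto
  then have "ln (cmod (1 - z)) - ln 2 \<le> ln (cmod (1 - u))" using assms(3) by (simp add: ln_div)
  then have 2: "Re d * (ln (cmod (1 - z)) - ln 2) \<le> Re d * ln (cmod (1 - u))" using assms(1) by (intro mult_left_mono)
  have z: "1 - z \<noteq> 0" using assms(3) by simp
  show "Qr d (of_real (rr i) * z) \<le> Qr d z + KQ d"
    using 2 b[of u] b[of z] u uz z assms(2) unfolding u_def[symmetric] Qr_eq Re_Ln[OF uz] Re_Ln[OF z] KQ_def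
    by (auto simp: abs_le_iff algebra_simps)
qed

lemma Ln_rr_tendsto:
  assumes "z \<in> circle" "z \<noteq> 1" shows "(\<lambda>i. Ln (1 - of_real (rr i) * z)) \<longlonglongrightarrow> Ln (1 - z)"
proof -
  have "(\<lambda>i. 1 - of_real (rr i) * z) \<longlonglongrightarrow> 1 - of_real 1 * z"
    by (intro tendsto_intros rr_tendsto)
  then have "(\<lambda>i. 1 - of_real (rr i) * z) \<longlonglongrightarrow> 1 - z" by simp
  then show ?thesis by (rule tendsto_Ln) (use Re_one_minus_pos[of z] assms in auto)
qed

lemma Qr_rr_tendsto:
  assumes "z \<in> circle" "z \<noteq> 1" shows "(\<lambda>i. Qr d (of_real (rr i) * z)) \<longlonglongrightarrow> Qr d z"
  unfolding Qr_def by (intro tendsto_mult tendsto_Re tendsto_const Ln_rr_tendsto assms)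

lemma Qr_rr_measurable [measurable]: "(\<lambda>z. Qr d (of_real (rr i) * z)) \<in> borel_measurable circle_borel"
  unfolding Qr_def[abs_def] by measurable

lemma integral_Qr_rr_tendsto:
  assumes "0 \<le> Re d" "\<mu> \<in> M1" "AE z in \<mu>. z \<noteq> 1" "integrable \<mu> (Qr d)"
  shows "(\<lambda>i. \<integral>z. Qr d (of_real (rr i) * z) \<partial>\<mu>) \<longlonglongrightarrow> (\<integral>z. Qr d z \<partial>\<mu>)"
proof (rule integral_dominated_convergence[where w = "\<lambda>z. \<bar>Qr d z\<bar> + KQ d"])
  interpret prob_space \<mu> using assms(2) by (rule M1_prob_space)
  have K: "0 \<le> KQ d" using assms(1) by (simp add: KQ_def)
  show "AE z in \<mu>. (\<lambda>i. Qr d (of_real (rr i) * z)) \<longlonglongrightarrow> Qr d z"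
    using assms(3) AE_space by eventually_elim (auto simp: M1_space[OF assms(2)] intro!: Qr_rr_tendsto)
  show "AE z in \<mu>. norm (Qr d (of_real (rr i) * z)) \<le> \<bar>Qr d z\<bar> + KQ d" for i
    using assms(3) AE_space
  proof eventually_elim
    case (elim z)
    then show ?case using Qr_rr_bounds[OF assms(1), of z i] K by (auto simp: M1_space[OF assms(2)])
  qed
  show "integrable \<mu> (\<lambda>z. \<bar>Qr d z\<bar> + KQ d)"
    using assms(4) by (intro Bochner_Integration.integrable_add integrable_abs integrable_const)
qed (use assms in \<open>auto simp: M1_measurable_cong\<close>)

lemma integrable_Qr_rr:
  assumes "\<mu> \<in> M1" shows "integrable \<mu> (\<lambda>z. Qr d (of_real (rr i) * z))"
proof (rule M1_integrable_continuous[OF assms])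
  show "continuous_on circle (\<lambda>z. Qr d (of_real (rr i) * z))"
    unfolding Qr_def
    using one_minus_notin_nonpos[OF cmod_rr_less_1[of _ i]] by (intro continuous_intros) auto
qed

text \<open>Fatou's lemma along the radii.\<close>

lemma integrable_Qr_if_Abel_bounded:
  assumes "0 \<le> Re d" "\<mu> \<in> M1" "AE z in \<mu>. z \<noteq> 1" "\<And>i. (\<integral>z. Qr d (of_real (rr i) * z) \<partial>\<mu>) \<le> C"
  shows "integrable \<mu> (Qr d)"
proof -
  interpret prob_space \<mu> using assms(2) by (rule M1_prob_space)
  have K: "0 \<le> KQ d" using assms(1) by (simp add: KQ_def)
  have C: "(\<integral>\<^sup>+z. ennreal (KQ d + Qr d (of_real (rr i) * z)) \<partial>\<mu>) \<le> ennreal (KQ d + C)" for i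
  proof -
    have "(\<integral>\<^sup>+z. ennreal (KQ d + Qr d (of_real (rr i) * z)) \<partial>\<mu>) = ennreal (\<integral>z. KQ d + Qr d (of_real (rr i) * z) \<partial>\<mu>)"
    proof (rule nn_integral_eq_integral)
      show "AE z in \<mu>. 0 \<le> KQ d + Qr d (of_real (rr i) * z)"
        using assms(3) AE_space
      proof eventually_elim
        case (elim z)
        then show ?case using Qr_rr_bounds(1)[OF assms(1), of z i] by (auto simp: M1_space[OF assms(2)])
      qed
    qed (use integrable_Qr_rr[OF assms(2)] in auto)
    also have "\<dots> \<le> ennreal (KQ d + C)"
      using assms(4)[of i] integrable_Qr_rr[OF assms(2), of d i] by (intro ennreal_leI) (simp add: prob_space)
    finally show ?thesis .
  qed
  have lim: "AE z in \<mu>. (\<lambda>i. Qr d (of_real (rr i) * z)) \<longlonglongrightarrow> Qr d z"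
    using assms(3) AE_space by eventually_elim (auto simp: M1_space[OF assms(2)] intro!: Qr_rr_tendsto)
  have "(\<integral>\<^sup>+z. ennreal (KQ d + Qr d z) \<partial>\<mu>) = (\<integral>\<^sup>+z. liminf (\<lambda>i. ennreal (KQ d + Qr d (of_real (rr i) * z))) \<partial>\<mu>)"
  proof (rule nn_integral_cong_AE)
    show "AE z in \<mu>. ennreal (KQ d + Qr d z) = liminf (\<lambda>i. ennreal (KQ d + Qr d (of_real (rr i) * z)))"
      using lim
    proof eventually_elim
      case (elim z)
      have "(\<lambda>i. ennreal (KQ d + Qr d (of_real (rr i) * z))) \<longlonglongrightarrow> ennreal (KQ d + Qr d z)"
        by (intro tendsto_ennrealI tendsto_intros elim)
      then show ?case by (rule lim_imp_Liminf[OF sequentially_bot, symmetric])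
    qed
  qed
  also have "\<dots> \<le> liminf (\<lambda>i. \<integral>\<^sup>+z. ennreal (KQ d + Qr d (of_real (rr i) * z)) \<partial>\<mu>)"
    by (rule nn_integral_liminf) (simp add: M1_measurable_cong[OF assms(2)])
  also have "\<dots> \<le> ennreal (KQ d + C)" using C by (intro Liminf_le) auto
  finally have fin: "(\<integral>\<^sup>+z. ennreal (KQ d + Qr d z) \<partial>\<mu>) < \<infinity>"
    using le_less_trans[OF _ ennreal_less_top] by simp
  have "AE z in \<mu>. 0 \<le> KQ d + Qr d z"
    using lim assms(3) AE_space
  proof eventually_elim
    case (elim z)
    have "- KQ d \<le> Qr d z"
      using elim Qr_rr_bounds(1)[OF assms(1), of z]
      by (intro LIMSEQ_le_const[OF elim(1)]) (auto simp: M1_space[OF assms(2)])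
    then show ?case by simp
  qed
  then have "integrable \<mu> (\<lambda>z. KQ d + Qr d z)"
    using fin by (intro integrableI_nonneg) (auto simp: M1_measurable_cong[OF assms(2)])
  then have "integrable \<mu> (\<lambda>z. (KQ d + Qr d z) - KQ d)"
    by (intro Bochner_Integration.integrable_diff integrable_const)
  then show ?thesis by simp
qed

lemma integral_Ln_sums:
  assumes "\<mu> \<in> M1" "0 \<le> r" "r < 1"
  shows "(\<lambda>k. - (of_real r ^ k * fc \<mu> k) / of_nat k) sums (\<integral>z. Ln (1 - of_real r * z) \<partial>\<mu>)"
    and "integrable \<mu> (\<lambda>z. Ln (1 - of_real r * z))"
proof -
  have b: "cmod (- ((of_real r * z) ^ k) / of_nat k) \<le> r ^ k" if "z \<in> circle" for z k
    using that assms by (cases "k = 0") (auto simp: norm_divide norm_power norm_mult power_mult_distrib field_simps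
        intro: mult_right_mono[of 1 "real k" "r ^ k", simplified])
  have s: "(\<lambda>k. - ((of_real r * z) ^ k) / of_nat k) sums Ln (1 - of_real r * z)" if "z \<in> circle" for z
    using that assms by (intro Ln_one_minus_sums) (simp add: norm_mult)
  have coef: "(\<integral>z. - ((of_real r * z) ^ k) / of_nat k \<partial>\<mu>) = - (of_real r ^ k * fc \<mu> k) / of_nat k" for k
  proof -
    have "(\<integral>z. - ((of_real r * z) ^ k) / of_nat k \<partial>\<mu>) = (\<integral>z. (- (of_real r ^ k) / of_nat k) * z ^ k \<partial>\<mu>)"
      by (intro Bochner_Integration.integral_cong) (auto simp: power_mult_distrib)
    also have "\<dots> = (- (of_real r ^ k) / of_nat k) * fc \<mu> k"
      unfolding fc_def by (rule integral_mult_right_zero)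
    finally show ?thesis by simp
  qed
  have eq: "(\<Sum>k. - ((of_real r * z) ^ k) / of_nat k) = Ln (1 - of_real r * z)" if "z \<in> space \<mu>" for z
    using s[of z] that by (auto simp: sums_iff M1_space[OF assms(1)])
  have "(\<lambda>k. \<integral>z. - ((of_real r * z) ^ k) / of_nat k \<partial>\<mu>) sums (\<integral>z. (\<Sum>k. - ((of_real r * z) ^ k) / of_nat k) \<partial>\<mu>)"
    and "integrable \<mu> (\<lambda>z. \<Sum>k. - ((of_real r * z) ^ k) / of_nat k)"
    using assms b by (intro M1_sums_integral[where b = "\<lambda>k. r ^ k"] summable_geometric; auto)+
  then show "(\<lambda>k. - (of_real r ^ k * fc \<mu> k) / of_nat k) sums (\<integral>z. Ln (1 - of_real r * z) \<partial>\<mu>)"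
    "integrable \<mu> (\<lambda>z. Ln (1 - of_real r * z))"
    unfolding coef using eq by (simp_all cong: Bochner_Integration.integral_cong Bochner_Integration.integrable_cong)
qed

lemma integral_Qr_eq_Ln:
  assumes "\<mu> \<in> M1" "0 \<le> r" "r < 1"
  shows "(\<integral>z. Qr d (of_real r * z) \<partial>\<mu>) = - 2 * Re (cnj d * (\<integral>z. Ln (1 - of_real r * z) \<partial>\<mu>))"
proof -
  have i: "integrable \<mu> (\<lambda>z. Ln (1 - of_real r * z))" by (rule integral_Ln_sums[OF assms])
  have "(\<integral>z. Qr d (of_real r * z) \<partial>\<mu>) = - 2 * (\<integral>z. Re (cnj d * Ln (1 - of_real r * z)) \<partial>\<mu>)"
    unfolding Qr_def by (rule integral_mult_right_zero)
  also have "(\<integral>z. Re (cnj d * Ln (1 - of_real r * z)) \<partial>\<mu>) = Re (\<integral>z. cnj d * Ln (1 - of_real r * z) \<partial>\<mu>)"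
    using i by (intro integral_Re) auto
  also have "(\<integral>z. cnj d * Ln (1 - of_real r * z) \<partial>\<mu>) = cnj d * (\<integral>z. Ln (1 - of_real r * z) \<partial>\<mu>)"
    by (rule integral_mult_right_zero)
  finally show ?thesis .
qed

lemma pot_nn_eq:
  assumes "0 \<le> Re d" "\<mu> \<in> M1" "AE z in \<mu>. z \<noteq> 1"
  shows "pot_nn d \<mu> = (\<integral>\<^sup>+z. ennreal (cQ d + Qr d z) \<partial>\<mu>)" and "AE z in \<mu>. 0 \<le> cQ d + Qr d z"
proof -
  show "pot_nn d \<mu> = (\<integral>\<^sup>+z. ennreal (cQ d + Qr d z) \<partial>\<mu>)"
    unfolding pot_nn_def
  proof (rule nn_integral_cong_AE)
    show "AE z in \<mu>. e2ennreal (ereal (cQ d) + potential d z) = ennreal (cQ d + Qr d z)"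
      using assms(3) AE_space by eventually_elim (simp add: potential_eq_Qr M1_space[OF assms(2)])
  qed
  show "AE z in \<mu>. 0 \<le> cQ d + Qr d z"
    using assms(3) AE_space
  proof eventually_elim
    case (elim z)
    then show ?case using Qr_ge[OF assms(1), of z] by (simp add: M1_space[OF assms(2)])
  qed
qed

lemma J_finite_energy:
  assumes "0 \<le> Re d" "\<mu> \<in> M1" "en \<mu> \<noteq> \<infinity>" "integrable \<mu> (Qr d)"
  shows "J d \<mu> = ereal (energy \<mu> + (\<integral>z. Qr d z \<partial>\<mu>))"
proof -
  interpret prob_space \<mu> using assms(2) by (rule M1_prob_space)
  have ae: "AE z in \<mu>. z \<noteq> 1" by (rule finite_energy_no_atom[OF assms(2,3)])
  have "pot_nn d \<mu> = ennreal (\<integral>z. cQ d + Qr d z \<partial>\<mu>)"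
    unfolding pot_nn_eq(1)[OF assms(1,2) ae] using assms(4) pot_nn_eq(2)[OF assms(1,2) ae]
    by (intro nn_integral_eq_integral) auto
  moreover have "0 \<le> (\<integral>z. cQ d + Qr d z \<partial>\<mu>)" using pot_nn_eq(2)[OF assms(1,2) ae] by (rule integral_nonneg_AE)
  moreover have "(\<integral>z. cQ d + Qr d z \<partial>\<mu>) = cQ d + (\<integral>z. Qr d z \<partial>\<mu>)" using assms(4) by (simp add: prob_space)
  ultimately show ?thesis
    unfolding J_eq[OF assms(1,2)] en_eq_energy[OF assms(3)] by (simp add: enn2ereal_ennreal energy_nonneg)
qed

lemma J_not_infinity:
  assumes "0 \<le> Re d" "\<mu> \<in> M1" "J d \<mu> \<noteq> \<infinity>"
  shows "en \<mu> \<noteq> \<infinity>" "integrable \<mu> (Qr d)"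
proof -
  interpret prob_space \<mu> using assms(2) by (rule M1_prob_space)
  have fin: "enn2ereal (en \<mu>) \<noteq> \<infinity>" "enn2ereal (pot_nn d \<mu>) \<noteq> \<infinity>"
    using assms(3) unfolding J_eq[OF assms(1,2)] by (auto simp: ereal_plus_eq_PInfty)
  then show en: "en \<mu> \<noteq> \<infinity>" by (metis enn2ereal_top infinity_ennreal_def)
  have ae: "AE z in \<mu>. z \<noteq> 1" by (rule finite_energy_no_atom[OF assms(2) en])
  have "pot_nn d \<mu> \<noteq> \<infinity>" using fin by (metis enn2ereal_top infinity_ennreal_def)
  then have "integrable \<mu> (\<lambda>z. cQ d + Qr d z)"
    unfolding pot_nn_eq(1)[OF assms(1,2) ae] using pot_nn_eq(2)[OF assms(1,2) ae]
    by (intro integrableI_nonneg) (auto simp: M1_measurable_cong[OF assms(2)] less_top)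
  then have "integrable \<mu> (\<lambda>z. (cQ d + Qr d z) - cQ d)"
    by (intro Bochner_Integration.integrable_diff integrable_const)
  then show "integrable \<mu> (Qr d)" by simp
qed

section \<open>Empirical measures and the weight as a function of them\<close>

lemma
  assumes "n \<ge> 1" "\<And>k. k < n \<Longrightarrow> z k \<in> circle"
  shows esd_eq_distr: "esd n z = distr (measure_pmf (pmf_of_set {..<n})) circle_borel (\<lambda>k. if k < n then z k else 1)"
    and esd_M1: "esd n z \<in> M1"
proof -
  let ?g = "\<lambda>k. if k < n then z k else 1"
  have g: "?g \<in> measure_pmf (pmf_of_set {..<n}) \<rightarrow>\<^sub>M circle_borel"
    unfolding measurable_pmf_measure1 using assms(2) by (auto simp: Pi_iff)
  have s: "sets (esd n z) = sets circle_borel"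
    unfolding esd_def using sets.sets_measure_of_eq[of circle_borel] by simp
  show eq: "esd n z = distr (measure_pmf (pmf_of_set {..<n})) circle_borel ?g"
  proof (rule measure_eqI)
    fix A assume "A \<in> sets (esd n z)"
    then have A: "A \<in> sets circle_borel" by (simp add: s)
    have ne: "{..<n} \<noteq> {}" using assms(1) by (auto simp: lessThan_empty_iff)
    have "emeasure (distr (measure_pmf (pmf_of_set {..<n})) circle_borel ?g) A
        = emeasure (measure_pmf (pmf_of_set {..<n})) (?g -` A)"
      using g A by (simp add: emeasure_distr)
    also have "\<dots> = ennreal (real (card ({..<n} \<inter> ?g -` A)) / real n)"
      using ne by (simp add: measure_pmf.emeasure_eq_measure measure_pmf_of_set)
    also have "{..<n} \<inter> ?g -` A = {k. k < n \<and> z k \<in> A}" by auto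
    also have "ennreal (real (card {k. k < n \<and> z k \<in> A}) / real n) = of_nat (card {k. k < n \<and> z k \<in> A}) / of_nat n"
      using assms(1) by (simp add: divide_ennreal ennreal_of_nat_eq_real_of_nat)
    finally show "emeasure (esd n z) A = emeasure (distr (measure_pmf (pmf_of_set {..<n})) circle_borel ?g) A"
      using emeasure_esd[OF assms A] by simp
  qed (simp add: s)
  show "esd n z \<in> M1"
    unfolding eq using g by (intro M1_I measure_pmf.prob_space_distr) auto
qed

lemma integral_esd:
  fixes f :: "complex \<Rightarrow> 'b::{banach, second_countable_topology}"
  assumes "n \<ge> 1" "\<And>k. k < n \<Longrightarrow> z k \<in> circle" "f \<in> borel_measurable circle_borel"
  shows "(\<integral>x. f x \<partial>esd n z) = (1 / real n) *\<^sub>R (\<Sum>k<n. f (z k))"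
proof -
  let ?g = "\<lambda>k. if k < n then z k else 1"
  have g: "?g \<in> measure_pmf (pmf_of_set {..<n}) \<rightarrow>\<^sub>M circle_borel"
    unfolding measurable_pmf_measure1 using assms(2) by (auto simp: Pi_iff)
  have ne: "{..<n} \<noteq> {}" using assms(1) by (auto simp: lessThan_empty_iff)
  have eq: "esd n z = distr (measure_pmf (pmf_of_set {..<n})) circle_borel ?g"
    by (rule esd_eq_distr[OF assms(1,2)])
  have "(\<integral>x. f x \<partial>esd n z) = (\<integral>k. f (?g k) \<partial>measure_pmf (pmf_of_set {..<n}))"
    unfolding eq using g assms(3) by (rule integral_distr)
  also have "\<dots> = (\<Sum>k<n. pmf (pmf_of_set {..<n}) k *\<^sub>R f (?g k))"
    using ne by (intro integral_measure_pmf) auto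
  also have "\<dots> = (\<Sum>k<n. (1 / real n) *\<^sub>R f (z k))"
    using ne by (intro sum.cong) auto
  finally show ?thesis by (simp only: scaleR_sum_right)
qed

lemma fc_esd:
  assumes "n \<ge> 1" "\<And>k. k < n \<Longrightarrow> z k \<in> circle"
  shows "fc (esd n z) k = (\<Sum>j<n. z j ^ k) / of_nat n"
  unfolding fc_def
  by (subst integral_esd[OF assms]) (auto intro!: borel_measurable_circle continuous_intros simp: scaleR_conv_of_real)

lemma space_PiM_M1:
  assumes "\<And>i. i \<in> I \<Longrightarrow> M i \<in> M1" "z \<in> space (Pi\<^sub>M I M)" "k \<in> I"
  shows "z k \<in> circle"
  using assms M1_space[OF assms(1)] by (auto simp: space_PiM PiE_iff)

lemma sets_PiM_M1: "(\<And>i. i \<in> I \<Longrightarrow> M i \<in> M1) \<Longrightarrow> sets (Pi\<^sub>M I M) = sets (Pi\<^sub>M I (\<lambda>_. circle_borel))"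
  by (intro sets_PiM_cong) (auto simp: M1_sets)

lemma measurable_PiM_M1: "(\<And>i. i \<in> I \<Longrightarrow> M i \<in> M1) \<Longrightarrow> measurable (Pi\<^sub>M I M) N = measurable (Pi\<^sub>M I (\<lambda>_. circle_borel)) N"
  by (intro measurable_cong_sets sets_PiM_M1) auto

lemma measurable_coordinate_circle [measurable (raw)]:
  "k \<in> I \<Longrightarrow> (\<lambda>z. z k) \<in> borel_measurable (Pi\<^sub>M I (\<lambda>_. circle_borel))"
  by (rule measurable_compose[OF measurable_component_singleton[where M = "\<lambda>_. circle_borel"] measurable_id_circle])

lemma esd_measurable:
  assumes "n \<ge> 1"
  shows "esd n \<in> Pi\<^sub>M {..<n} (\<lambda>_. circle_borel) \<rightarrow>\<^sub>M borel_of weak_topology"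
proof (rule measurable_borel_of_weak)
  fix z assume z: "z \<in> space (Pi\<^sub>M {..<n} (\<lambda>_. circle_borel))"
  then have "z k \<in> circle" if "k < n" for k using that by (auto simp: space_PiM PiE_iff)
  then show "esd n z \<in> M1" using assms by (intro esd_M1)
next
  fix k
  have "(\<lambda>z. (\<Sum>j<n. z j ^ k) / of_nat n) \<in> borel_measurable (Pi\<^sub>M {..<n} (\<lambda>_. circle_borel))"
    by measurable
  then show "(\<lambda>z. fc (esd n z) k) \<in> borel_measurable (Pi\<^sub>M {..<n} (\<lambda>_. circle_borel))"
    by (subst measurable_cong[of _ _ "\<lambda>z. (\<Sum>j<n. z j ^ k) / of_nat n"])
      (auto intro!: fc_esd assms simp: space_PiM PiE_iff)
qed

lemma sum_square_eq_pairs: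
  fixes g :: "nat \<Rightarrow> nat \<Rightarrow> real"
  assumes "\<And>j k. g j k = g k j"
  shows "(\<Sum>j<n. \<Sum>k<n. g j k) = (\<Sum>j<n. g j j) + 2 * (\<Sum>k<n. \<Sum>j<k. g j k)"
proof (induction n)
  case (Suc n)
  have "(\<Sum>j<Suc n. \<Sum>k<Suc n. g j k) = (\<Sum>j<n. \<Sum>k<n. g j k) + (\<Sum>j<n. g j n) + (\<Sum>k<n. g n k) + g n n"
    by (simp add: sum.distrib)
  also have "(\<Sum>k<n. g n k) = (\<Sum>j<n. g j n)" by (intro sum.cong assms refl)
  finally show ?case using Suc by simp
qed simp

text \<open>Configurations of positive weight: no coordinate sits at the singularity, no two coincide.\<close>

definition generic :: "nat \<Rightarrow> (nat \<Rightarrow> complex) \<Rightarrow> bool"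
  where "generic n z \<longleftrightarrow> (\<forall>k<n. z k \<noteq> 1) \<and> (\<forall>k<n. \<forall>j<k. z j \<noteq> z k)"

text \<open>The Hamiltonian: at generic configurations the weight is \<open>exp (- b n\<^sup>2
  H)\<close>.\<close>

definition H :: "complex \<Rightarrow> nat \<Rightarrow> (nat \<Rightarrow> complex) \<Rightarrow> real"
  where "H d n z = (\<Sum>k<n. Qr d (z k)) / real n - 2 / (real n)\<^sup>2 * (\<Sum>k<n. \<Sum>j<k. ln (cmod (z j - z k)))"

lemma one_minus_powr_mult:
  assumes "cmod v = 1" "v \<noteq> 1"
  shows "(1 - v) powr (cnj d * of_real b * of_nat n) * (1 - cnj v) powr (d * of_real b * of_nat n)
    = of_real (exp (- (b * real n * Qr d v)))"
proof -
  have nz: "1 - v \<noteq> 0" "1 - cnj v \<noteq> 0" using assms by (auto simp: complex_eq_iff)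
  have "Ln (1 - cnj v) = cnj (Ln (1 - v))"
    using cnj_Ln[of "1 - v"] Re_one_minus_pos(2)[of v] assms by simp
  then have "(1 - v) powr (cnj d * of_real b * of_nat n) * (1 - cnj v) powr (d * of_real b * of_nat n)
      = exp (of_real (b * real n) * (cnj d * Ln (1 - v) + cnj (cnj d * Ln (1 - v))))"
    using nz by (simp add: powr_def exp_add[symmetric] algebra_simps)
  also have "cnj d * Ln (1 - v) + cnj (cnj d * Ln (1 - v)) = of_real (- Qr d v)"
    unfolding complex_add_cnj Qr_def by simp
  also have "exp (of_real (b * real n) * of_real (- Qr d v)) = (of_real (exp (- (b * real n * Qr d v))) :: complex)"
    by (simp add: exp_of_real[symmetric])
  finally show ?thesis .
qed

lemma Re_hweight_generic:
  assumes "n \<ge> 1" "\<And>k. k < n \<Longrightarrow> z k \<in> circle" "generic n z"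
  shows "Re (hweight b d n z) = exp (- (b * (real n)\<^sup>2 * H d n z))"
proof -
  have "(\<Prod>k<n. (1 - z k) powr (cnj d * of_real b * of_nat n) * (1 - cnj (z k)) powr (d * of_real b * of_nat n))
      = (\<Prod>k<n. of_real (exp (- (b * real n * Qr d (z k)))))"
    using assms by (intro prod.cong one_minus_powr_mult) (auto simp: generic_def)
  also have "\<dots> = of_real (exp (\<Sum>k<n. - (b * real n * Qr d (z k))))"
    by (simp only: of_real_prod[symmetric] exp_sum[OF finite_lessThan])
  finally have 1: "(\<Prod>k<n. (1 - z k) powr (cnj d * of_real b * of_nat n) * (1 - cnj (z k)) powr (d * of_real b * of_nat n))
      = of_real (exp (\<Sum>k<n. - (b * real n * Qr d (z k))))" .
  have "(\<Prod>k<n. \<Prod>j<k. of_real (cmod (z j - z k) powr (2 * b))) = (\<Prod>k<n. \<Prod>j<k. (of_real (exp (2 * b * ln (cmod (z j - z k)))) :: complex))"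
    using assms(3) by (intro prod.cong) (auto simp: generic_def powr_def)
  also have "\<dots> = of_real (exp (\<Sum>k<n. \<Sum>j<k. 2 * b * ln (cmod (z j - z k))))"
    by (simp only: of_real_prod[symmetric] exp_sum[OF finite_lessThan])
  finally have 2: "(\<Prod>k<n. \<Prod>j<k. of_real (cmod (z j - z k) powr (2 * b))) = (of_real (exp (\<Sum>k<n. \<Sum>j<k. 2 * b * ln (cmod (z j - z k)))) :: complex)" .
  have "hweight b d n z = of_real (exp ((\<Sum>k<n. - (b * real n * Qr d (z k))) + (\<Sum>k<n. \<Sum>j<k. 2 * b * ln (cmod (z j - z k)))))"
    unfolding hweight_def 1 2 exp_add by simp
  also have "(\<Sum>k<n. - (b * real n * Qr d (z k))) + (\<Sum>k<n. \<Sum>j<k. 2 * b * ln (cmod (z j - z k))) = - (b * (real n)\<^sup>2 * H d n z)"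
  proof -
    have "(\<Sum>k<n. - (b * real n * Qr d (z k))) = - (b * real n * (\<Sum>k<n. Qr d (z k)))"
      by (simp add: sum_negf sum_distrib_left)
    moreover have "(\<Sum>k<n. \<Sum>j<k. 2 * b * ln (cmod (z j - z k))) = 2 * b * (\<Sum>k<n. \<Sum>j<k. ln (cmod (z j - z k)))"
      by (simp add: sum_distrib_left)
    ultimately show ?thesis using assms(1) by (simp add: H_def field_simps power2_eq_square)
  qed
  finally show ?thesis by simp
qed

lemma hweight_not_generic:
  assumes "b > 0" "\<not> generic n z"
  shows "hweight b d n z = 0"
proof -
  consider k where "k < n" "z k = 1" | k j where "k < n" "j < k" "z j = z k"
    using assms(2) unfolding generic_def by blast
  then show ?thesis
  proof cases
    case 1
    then have "(\<Prod>k<n. (1 - z k) powr (cnj d * of_real b * of_nat n) * (1 - cnj (z k)) powr (d * of_real b * of_nat n)) = 0"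
      by (intro prod_zero) (auto intro!: bexI[of _ k])
    then show ?thesis by (simp add: hweight_def)
  next
    case 2
    have "of_real (cmod (z j - z k) powr (2 * b)) = (0 :: complex)" using 2 by simp
    then have *: "(\<Prod>j<k. of_real (cmod (z j - z k) powr (2 * b))) = (0 :: complex)"
      by (rule prod_zero[OF finite_lessThan bexI]) (use 2 in simp)
    have "(\<Prod>k<n. \<Prod>j<k. of_real (cmod (z j - z k) powr (2 * b))) = (0 :: complex)"
      by (rule prod_zero[OF finite_lessThan bexI], rule *) (use 2 in simp)
    then show ?thesis by (simp add: hweight_def)
  qed
qed

text \<open>The finite-\<open>n\<close> Hamiltonian dominates the regularised energy of the empirical measure, up to the
  self-interaction of the \<open>n\<close> points, which the regularised kernel makes finite.\<close>

lemma H_ge_Ji: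
  assumes "0 \<le> Re d" "n \<ge> 1" "\<And>k. k < n \<Longrightarrow> z k \<in> circle" "generic n z"
  shows "Ji i d (esd n z) + ln (1 - rr i) / real n \<le> H d n z"
proof -
  let ?\<mu> = "esd n z"
  have m: "?\<mu> \<in> M1" using assms by (intro esd_M1)
  interpret pair_prob_space ?\<mu> ?\<mu> using m by (intro M1_pair_prob)
  have km: "(\<lambda>w. ker i (z' - w)) \<in> borel_measurable circle_borel" "(\<lambda>w. ker i (w - z')) \<in> borel_measurable circle_borel" for z'
    unfolding ker_def by measurable
  have "(\<integral>p. ker i (fst p - snd p) \<partial>(?\<mu> \<Otimes>\<^sub>M ?\<mu>)) = (\<integral>z'. (\<integral>w. ker i (z' - w) \<partial>?\<mu>) \<partial>?\<mu>)"
    using integral_fst'[OF integrable_ker[OF m]] by simp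
  also have "(\<lambda>z'. \<integral>w. ker i (z' - w) \<partial>?\<mu>) = (\<lambda>z'. (1 / real n) *\<^sub>R (\<Sum>k<n. ker i (z' - z k)))"
    using integral_esd[OF assms(2,3) km(1)] by (intro ext) simp
  also have "(\<integral>z'. (1 / real n) *\<^sub>R (\<Sum>k<n. ker i (z' - z k)) \<partial>?\<mu>) = (1 / real n) *\<^sub>R (\<Sum>j<n. (1 / real n) *\<^sub>R (\<Sum>k<n. ker i (z j - z k)))"
    using km(2) by (intro integral_esd assms) auto
  also have "\<dots> = (\<Sum>j<n. \<Sum>k<n. ker i (z j - z k)) / (real n)\<^sup>2"
    by (simp add: sum_divide_distrib[symmetric] sum_distrib_left[symmetric] power2_eq_square)
  finally have eq: "(\<Sum>j<n. \<Sum>k<n. ker i (z j - z k)) = (real n)\<^sup>2 * (- Er ?\<mu> (rr i) - ln (rr i) / 2)"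
    unfolding integral_ker[OF m] using assms(2) by (simp add: field_simps)
  have sym: "ker i (z j - z k) = ker i (z k - z j)" for j k by (simp add: ker_def norm_minus_commute)
  have k0: "ln (1 - rr i) \<le> ker i 0"
  proof -
    have "ker i (1 - 1) = ln (cmod (1 - of_real (rr i) * 1 * cnj 1)) - ln (rr i) / 2" by (rule ker_eq) auto
    also have "cmod (1 - of_real (rr i) * 1 * cnj 1) = 1 - rr i"
    proof -
      have "1 - of_real (rr i) * 1 * cnj 1 = (of_real (1 - rr i) :: complex)" by simp
      then show ?thesis using rr_bounds[of i] by (simp only: norm_of_real)
    qed
    finally show ?thesis using ln_rr_ge(2)[of i] by simp
  qed
  have "2 * (\<Sum>k<n. \<Sum>j<k. ln (cmod (z j - z k))) \<le> 2 * (\<Sum>k<n. \<Sum>j<k. ker i (z j - z k))"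
    using assms(4) by (intro mult_left_mono sum_mono ln_le_ker) (auto simp: generic_def)
  also have "\<dots> = (\<Sum>j<n. \<Sum>k<n. ker i (z j - z k)) - real n * ker i 0"
    using sum_square_eq_pairs[of "\<lambda>j k. ker i (z j - z k)" n, OF sym] by simp
  also have "\<dots> \<le> (real n)\<^sup>2 * (- Ep i ?\<mu> - ln (rr i) / 2) - real n * ln (1 - rr i)"
    unfolding eq using Ep_le_Er[OF m, of i] k0 by (intro diff_mono mult_left_mono) auto
  finally have "2 / (real n)\<^sup>2 * (\<Sum>k<n. \<Sum>j<k. ln (cmod (z j - z k)))
      \<le> ((real n)\<^sup>2 * (- Ep i ?\<mu> - ln (rr i) / 2) - real n * ln (1 - rr i)) / (real n)\<^sup>2"
    by (simp add: divide_right_mono)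
  also have "\<dots> = - Ep i ?\<mu> - ln (rr i) / 2 - ln (1 - rr i) / real n"
    using assms(2) by (simp add: field_simps power2_eq_square)
  finally have 1: "2 / (real n)\<^sup>2 * (\<Sum>k<n. \<Sum>j<k. ln (cmod (z j - z k))) \<le> - Ep i ?\<mu> - ln (rr i) / 2 - ln (1 - rr i) / real n" .
  have "(\<integral>x. Qa i d x \<partial>?\<mu>) = (\<Sum>k<n. Qa i d (z k)) / real n"
    using assms by (subst integral_esd) (auto intro!: borel_measurable_circle Qa_continuous)
  also have "\<dots> \<le> (\<Sum>k<n. Qr d (z k)) / real n"
    using assms by (intro divide_right_mono sum_mono Qa_le_Qr) (auto simp: generic_def)
  finally show ?thesis using 1 by (simp add: H_def Ji_def)
qed


section \<open>The large deviation upper bound\<close>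

text \<open>The unnormalised law of the empirical measure.\<close>

definition Zset :: "real \<Rightarrow> complex \<Rightarrow> nat \<Rightarrow> complex measure set \<Rightarrow> ennreal"
  where "Zset b d n A = (\<integral>\<^sup>+z. ennreal (Re (hweight b d n z)) * indicator A (esd n z) \<partial>haar_n n)"

lemma measurable_haar_n: "measurable (haar_n n) N = measurable (Pi\<^sub>M {..<n} (\<lambda>_. circle_borel)) N"
  unfolding haar_n_def by (rule measurable_PiM_M1) (rule haar_M1)

lemma prob_space_haar_n: "prob_space (haar_n n)"
  unfolding haar_n_def by (intro prob_space_PiM M1_prob_space haar_M1)

lemma space_haar_n: "z \<in> space (haar_n n) \<Longrightarrow> k < n \<Longrightarrow> z k \<in> circle"
  unfolding haar_n_def by (rule space_PiM_M1[of "{..<n}"]) (auto intro: haar_M1)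

lemma hweight_measurable: "(\<lambda>z. Re (hweight b d n z)) \<in> borel_measurable (Pi\<^sub>M {..<n} (\<lambda>_. circle_borel))"
proof -
  have p: "(\<lambda>v. v powr a) \<in> borel_measurable borel" for a :: complex
    unfolding powr_def by measurable
  show ?thesis unfolding hweight_def
    by (intro measurable_compose[OF _ borel_measurable_continuous_onI[of Re]] borel_measurable_times borel_measurable_prod
        measurable_compose[OF _ p] measurable_compose[OF _ borel_measurable_continuous_onI[of of_real]] continuous_intros)
      (measurable; auto)+
qed

text \<open>Haar measure being a probability measure, the pointwise bound on the weight already bounds the
  integral.\<close>

lemma Zset_upper_bound:
  assumes "b > 0" "0 \<le> Re d" "closedin weak_topology F" "\<And>\<mu>. \<mu> \<in> F \<Longrightarrow> ereal a < J d \<mu>"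
  obtains C where "C \<ge> 0" "\<And>n. n \<ge> 1 \<Longrightarrow> Zset b d n F \<le> ennreal (exp (- (b * (real n)\<^sup>2 * a) + b * real n * C))"
proof -
  obtain i where i: "\<And>\<mu>. \<mu> \<in> F \<Longrightarrow> a < Ji i d \<mu>" using Ji_uniform_lower_bound[OF assms(2-4)] by metis
  define C where "C = - ln (1 - rr i)"
  have "C \<ge> 0" unfolding C_def using rr_bounds[of i] by simp
  moreover have "Zset b d n F \<le> ennreal (exp (- (b * (real n)\<^sup>2 * a) + b * real n * C))" if n: "n \<ge> 1" for n
  proof -
    interpret prob_space "haar_n n" by (rule prob_space_haar_n)
    have "Zset b d n F \<le> (\<integral>\<^sup>+z. ennreal (exp (- (b * (real n)\<^sup>2 * a) + b * real n * C)) \<partial>haar_n n)"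
      unfolding Zset_def
    proof (rule nn_integral_mono)
      fix z assume z: "z \<in> space (haar_n n)"
      have zc: "z k \<in> circle" if "k < n" for k using space_haar_n[OF z that] .
      have "Re (hweight b d n z) \<le> exp (- (b * (real n)\<^sup>2 * a) + b * real n * C)" if F: "esd n z \<in> F"
      proof (cases "generic n z")
        case True
        have "a - C / real n \<le> H d n z" using H_ge_Ji[OF assms(2) n zc True, of i] i[OF F] by (simp add: C_def)
        then have "b * (real n)\<^sup>2 * (a - C / real n) \<le> b * (real n)\<^sup>2 * H d n z" using assms(1) by (intro mult_left_mono) auto
        moreover have "b * (real n)\<^sup>2 * (a - C / real n) = b * (real n)\<^sup>2 * a - b * real n * C"
          using n by (simp add: field_simps power2_eq_square)
        moreover have "Re (hweight b d n z) = exp (- (b * (real n)\<^sup>2 * H d n z))"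
          by (rule Re_hweight_generic[OF n zc True])
        ultimately show ?thesis by simp
      qed (use hweight_not_generic[OF assms(1), of n z d] in simp)
      then show "ennreal (Re (hweight b d n z)) * indicator F (esd n z) \<le> ennreal (exp (- (b * (real n)\<^sup>2 * a) + b * real n * C))"
        by (auto simp: indicator_def intro!: ennreal_leI)
    qed
    then show ?thesis by (simp add: emeasure_space_1)
  qed
  ultimately show ?thesis by (rule that)
qed

lemma J_gt_bound:
  assumes "0 \<le> Re d" "\<mu> \<in> M1" shows "ereal (- cQ d - 1) < J d \<mu>"
proof -
  interpret prob_space \<mu> using assms(2) by (rule M1_prob_space)
  have "0 \<le> enn2ereal (en \<mu>) + enn2ereal (pot_nn d \<mu>)" by simp
  then show ?thesis unfolding J_eq[OF assms]
    by (cases "enn2ereal (en \<mu>)"; cases "enn2ereal (pot_nn d \<mu>)") auto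
qed

lemma
  assumes "b > 0" "0 \<le> Re d" "n \<ge> 1"
  shows integrable_hweight: "integrable (haar_n n) (\<lambda>z. Re (hweight b d n z))"
    and Zset_M1: "Zset b d n M1 = ennreal (Znorm b d n)"
    and Znorm_nonneg: "0 \<le> Znorm b d n"
proof -
  have "closedin weak_topology M1" by (metis closedin_topspace topspace_weak_topology)
  from Zset_upper_bound[OF assms(1,2) this J_gt_bound[OF assms(2)]] obtain C where
    "Zset b d n M1 \<le> ennreal (exp (- (b * (real n)\<^sup>2 * (- cQ d - 1)) + b * real n * C))"
    using assms(3) by metis
  then have "Zset b d n M1 < \<infinity>" using le_less_trans[OF _ ennreal_less_top] by simp
  moreover have Z: "Zset b d n M1 = (\<integral>\<^sup>+z. ennreal (Re (hweight b d n z)) \<partial>haar_n n)"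
    unfolding Zset_def
  proof (rule nn_integral_cong)
    fix z assume "z \<in> space (haar_n n)"
    then have "esd n z \<in> M1" using assms(3) by (intro esd_M1 space_haar_n)
    then show "ennreal (Re (hweight b d n z)) * indicator M1 (esd n z) = ennreal (Re (hweight b d n z))" by simp
  qed
  moreover have nn: "AE z in haar_n n. 0 \<le> Re (hweight b d n z)"
    using space_haar_n by (intro AE_I2 hweight_nonneg(2)) auto
  ultimately show int: "integrable (haar_n n) (\<lambda>z. Re (hweight b d n z))"
    using hweight_measurable by (intro integrableI_nonneg) (auto simp: measurable_haar_n)
  show "Zset b d n M1 = ennreal (Znorm b d n)"
    unfolding Z Znorm_def using int nn by (rule nn_integral_eq_integral)
  show "0 \<le> Znorm b d n" unfolding Znorm_def using nn by (rule integral_nonneg_AE)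
qed

section \<open>Smoothing by Poisson kernels\<close>

lemma integral_power_cnj_haar:
  "(\<integral>z. z ^ j * cnj z ^ k \<partial>haar) = (if j = k then 1 else 0)"
proof -
  have sp: "z \<in> circle" if "z \<in> space haar" for z using that by (simp add: M1_space[OF haar_M1])
  have zz: "z * cnj z = 1" if "z \<in> circle" for z using that by (simp add: complex_norm_square[symmetric])
  have red: "z ^ (l + k) * cnj z ^ k = z ^ l" if "z \<in> circle" for z and l k :: nat
  proof -
    have "z ^ (l + k) * cnj z ^ k = z ^ l * (z * cnj z) ^ k" by (simp add: power_add power_mult_distrib)
    then show ?thesis using zz[OF that] by simp
  qed
  show ?thesis
  proof (cases "k \<le> j")
    case True
    then obtain l where l: "j = l + k" by (metis le_add_diff_inverse2)
    have "(\<integral>z. z ^ j * cnj z ^ k \<partial>haar) = fc haar l"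
      unfolding fc_def l by (intro Bochner_Integration.integral_cong refl red sp)
    then show ?thesis by (simp add: fc_haar l)
  next
    case False
    then obtain l where l: "k = l + j" "l \<noteq> 0" by (metis le_add_diff_inverse2 nat_le_linear add_0 order_refl)
    have "(\<integral>z. z ^ j * cnj z ^ k \<partial>haar) = (\<integral>z. cnj (z ^ l) \<partial>haar)"
    proof (intro Bochner_Integration.integral_cong refl)
      fix z assume "z \<in> space haar"
      then have "cnj (z ^ k * cnj z ^ j) = cnj (z ^ l)" unfolding l(1) by (simp only: red[OF sp])
      then show "z ^ j * cnj z ^ k = cnj (z ^ l)" by (simp add: mult.commute)
    qed
    also have "\<dots> = cnj (fc haar l)" unfolding fc_def by (rule Bochner_Integration.integral_cnj)
    finally show ?thesis using l by (simp add: fc_haar)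
  qed
qed

text \<open>A harmonic function with normalised value at the centre, as a density: its Fourier coefficients
  are read off its Taylor series.\<close>

lemma poisson_fourier:
  fixes a :: "nat \<Rightarrow> complex"
  assumes "summable (\<lambda>k. cmod (a k))" "a 0 = 1"
  shows "(\<integral>z. z ^ j * of_real (Re (2 * (\<Sum>k. a k * z ^ k) - 1)) \<partial>haar) = cnj (a j)"
    and "(\<lambda>z. Re (2 * (\<Sum>k. a k * z ^ k) - 1)) \<in> borel_measurable circle_borel"
    and "\<And>z. z \<in> circle \<Longrightarrow> \<bar>Re (2 * (\<Sum>k. a k * z ^ k) - 1)\<bar> \<le> 2 * (\<Sum>k. cmod (a k)) + 1"
proof -
  have sm: "summable (\<lambda>k. a k * z ^ k)" and nb: "cmod (\<Sum>k. a k * z ^ k) \<le> (\<Sum>k. cmod (a k))" if "z \<in> circle" for z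
  proof -
    have n: "norm (a k * z ^ k) = cmod (a k)" for k using that by (simp add: norm_mult norm_power)
    have "summable (\<lambda>k. norm (a k * z ^ k))" using assms(1) by (simp only: n)
    then show "summable (\<lambda>k. a k * z ^ k)" by (rule summable_norm_cancel)
    show "cmod (\<Sum>k. a k * z ^ k) \<le> (\<Sum>k. cmod (a k))"
      by (rule norm_suminf_le[OF _ assms(1)]) (simp only: n order_refl)
  qed
  show "(\<lambda>z. Re (2 * (\<Sum>k. a k * z ^ k) - 1)) \<in> borel_measurable circle_borel"
    by (intro measurable_compose[OF _ borel_measurable_continuous_onI[of Re]] continuous_intros) measurable
  show "\<bar>Re (2 * (\<Sum>k. a k * z ^ k) - 1)\<bar> \<le> 2 * (\<Sum>k. cmod (a k)) + 1" if "z \<in> circle" for z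
  proof -
    have "\<bar>Re (2 * (\<Sum>k. a k * z ^ k) - 1)\<bar> \<le> cmod (2 * (\<Sum>k. a k * z ^ k) - 1)" by (rule abs_Re_le_cmod)
    also have "\<dots> \<le> cmod (2 * (\<Sum>k. a k * z ^ k)) + 1" using norm_triangle_ineq4[of "2 * (\<Sum>k. a k * z ^ k)" 1] by simp
    finally show ?thesis using nb[OF that] by (simp add: norm_mult)
  qed
  define f where "f k z = a k * (z ^ (j + k)) + cnj (a k) * (z ^ j * cnj z ^ k)" for k and z :: complex
  have fs: "(\<Sum>k. f k z) = z ^ j * of_real (Re (2 * (\<Sum>k. a k * z ^ k) - 1)) + z ^ j" if "z \<in> circle" for z
  proof -
    have s: "(\<lambda>k. a k * z ^ k) sums (\<Sum>k. a k * z ^ k)" using sm[OF that] by (rule summable_sums)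
    have "(\<lambda>k. z ^ j * (a k * z ^ k + cnj (a k * z ^ k))) sums (z ^ j * ((\<Sum>k. a k * z ^ k) + cnj (\<Sum>k. a k * z ^ k)))"
      using s s[THEN sums_cnj[THEN iffD2]] by (intro sums_mult sums_add)
    moreover have "z ^ j * (a k * z ^ k + cnj (a k * z ^ k)) = f k z" for k
      by (simp add: f_def power_add algebra_simps)
    ultimately have "(\<Sum>k. f k z) = z ^ j * ((\<Sum>k. a k * z ^ k) + cnj (\<Sum>k. a k * z ^ k))" by (simp add: sums_iff)
    then show ?thesis unfolding complex_add_cnj by (simp add: algebra_simps)
  qed
  have fb: "norm (f k z) \<le> 2 * cmod (a k)" if "z \<in> circle" for k z
    unfolding f_def using that norm_triangle_ineq[of "a k * (z ^ (j + k))" "cnj (a k) * (z ^ j * cnj z ^ k)"]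
    by (simp add: norm_mult norm_power)
  have fm: "f k \<in> borel_measurable circle_borel" for k unfolding f_def
    by (intro borel_measurable_circle continuous_intros)
  have S: "(\<lambda>k. \<integral>z. f k z \<partial>haar) sums (\<integral>z. (\<Sum>k. f k z) \<partial>haar)" "integrable haar (\<lambda>z. \<Sum>k. f k z)"
    using M1_sums_integral[OF haar_M1 fm fb] assms(1) by (auto intro: summable_mult)
  have fint: "(\<integral>z. f k z \<partial>haar) = (if k = 0 then (if j = 0 then 1 else 0) else 0) + (if k = j then cnj (a j) else 0)" for k
  proof -
    have "(\<integral>z. f k z \<partial>haar) = a k * fc haar (j + k) + cnj (a k) * (\<integral>z. z ^ j * cnj z ^ k \<partial>haar)"
      unfolding f_def fc_def
      by (subst Bochner_Integration.integral_add) (auto intro!: M1_integrable_continuous haar_M1 continuous_intros)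
    then show ?thesis by (auto simp: fc_haar integral_power_cnj_haar assms(2))
  qed
  have "(\<lambda>k. \<integral>z. f k z \<partial>haar) sums ((if j = 0 then 1 else 0) + cnj (a j))"
    unfolding fint by (intro sums_add sums_single)
  then have 1: "(\<integral>z. (\<Sum>k. f k z) \<partial>haar) = (if j = 0 then 1 else 0) + cnj (a j)"
    using S(1) sums_unique2 by blast
  have "(\<integral>z. z ^ j * of_real (Re (2 * (\<Sum>k. a k * z ^ k) - 1)) \<partial>haar) = (\<integral>z. (\<Sum>k. f k z) - z ^ j \<partial>haar)"
    by (intro Bochner_Integration.integral_cong) (auto simp: fs M1_space[OF haar_M1])
  also have "\<dots> = (\<integral>z. (\<Sum>k. f k z) \<partial>haar) - fc haar j"
    unfolding fc_def using S(2) by (intro Bochner_Integration.integral_diff) (auto intro!: M1_integrable_continuous haar_M1 continuous_intros)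
  also have "\<dots> = cnj (a j)" unfolding 1 fc_haar by simp
  finally show "(\<integral>z. z ^ j * of_real (Re (2 * (\<Sum>k. a k * z ^ k) - 1)) \<partial>haar) = cnj (a j)" .
qed

lemma density_haar_M1:
  assumes "f \<in> borel_measurable circle_borel" "\<And>z. z \<in> circle \<Longrightarrow> 0 \<le> f z" "integrable haar f" "(\<integral>z. f z \<partial>haar) = 1"
  shows "density haar (\<lambda>z. ennreal (f z)) \<in> M1"
    and "fc (density haar (\<lambda>z. ennreal (f z))) k = (\<integral>z. z ^ k * of_real (f z) \<partial>haar)"
proof -
  have fm: "f \<in> borel_measurable haar" using assms(1) by (simp add: M1_measurable_cong[OF haar_M1])
  have nn: "AE z in haar. 0 \<le> f z" using assms(2) by (intro AE_I2) (auto simp: M1_space[OF haar_M1])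
  have "(\<integral>\<^sup>+z. ennreal (f z) \<partial>haar) = 1"
    using nn_integral_eq_integral[OF assms(3) nn] assms(4) by simp
  moreover have "emeasure (density haar (\<lambda>z. ennreal (f z))) (space haar) = (\<integral>\<^sup>+z. ennreal (f z) * indicator (space haar) z \<partial>haar)"
    using fm by (intro emeasure_density) auto
  moreover have "(\<integral>\<^sup>+z. ennreal (f z) * indicator (space haar) z \<partial>haar) = (\<integral>\<^sup>+z. ennreal (f z) \<partial>haar)"
    by (intro nn_integral_cong) simp
  ultimately show "density haar (\<lambda>z. ennreal (f z)) \<in> M1"
    by (intro M1_I prob_spaceI) (auto simp: M1_sets[OF haar_M1])
  have pm: "(\<lambda>z. z ^ k) \<in> borel_measurable haar"
    unfolding M1_measurable_cong[OF haar_M1] by (intro borel_measurable_circle continuous_intros)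
  show "fc (density haar (\<lambda>z. ennreal (f z))) k = (\<integral>z. z ^ k * of_real (f z) \<partial>haar)"
    unfolding fc_def by (subst integral_density[OF pm fm nn]) (simp add: scaleR_conv_of_real mult.commute)
qed

text \<open>The density of the convolution of \<open>\<mu>\<close> with the Poisson kernel of radius \<open>r\<close>.\<close>

definition poisson :: "complex measure \<Rightarrow> real \<Rightarrow> complex \<Rightarrow> real"
  where "poisson \<mu> r z = Re (2 * (\<Sum>k. of_real r ^ k * cnj (fc \<mu> k) * z ^ k) - 1)"

definition smoothed :: "complex measure \<Rightarrow> real \<Rightarrow> complex measure"
  where "smoothed \<mu> r = density haar (\<lambda>z. ennreal (poisson \<mu> r z))"

text \<open>Summing the geometric series under the integral exhibits the density as an average of
  Poisson kernels, which are nonnegative.\<close>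

lemma
  assumes "\<mu> \<in> M1" "0 \<le> r" "r < 1"
  shows smoothed_M1: "smoothed \<mu> r \<in> M1"
    and fc_smoothed: "fc (smoothed \<mu> r) k = of_real (r ^ k) * fc \<mu> k"
    and poisson_measurable: "poisson \<mu> r \<in> borel_measurable circle_borel"
    and poisson_bound: "\<exists>C. \<forall>z\<in>circle. poisson \<mu> r z \<le> C"
proof -
  define a where "a k = of_real r ^ k * cnj (fc \<mu> k)" for k
  have "cmod (a k) \<le> r ^ k" for k
  proof -
    have "r ^ k * cmod (fc \<mu> k) \<le> r ^ k * 1" using norm_fc_le_1[OF assms(1)] assms(2) by (intro mult_left_mono) auto
    then show ?thesis using assms(2) by (simp add: a_def norm_mult norm_power)
  qed
  then have sm: "summable (\<lambda>k. cmod (a k))"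
    using assms by (intro summable_comparison_test[OF _ summable_geometric[of r]]) auto
  have a0: "a 0 = 1" by (simp add: a_def fc_0 assms)
  have P: "poisson \<mu> r z = Re (2 * (\<Sum>k. a k * z ^ k) - 1)" for z by (simp add: poisson_def a_def)
  have Peta: "poisson \<mu> r = (\<lambda>z. Re (2 * (\<Sum>k. a k * z ^ k) - 1))" by (rule ext) (rule P)
  show m: "poisson \<mu> r \<in> borel_measurable circle_borel" unfolding Peta by (rule poisson_fourier(2)[OF sm a0])
  have bd: "\<bar>poisson \<mu> r z\<bar> \<le> 2 * (\<Sum>k. cmod (a k)) + 1" if "z \<in> circle" for z
    unfolding P by (rule poisson_fourier(3)[OF sm a0 that])
  then show "\<exists>C. \<forall>z\<in>circle. poisson \<mu> r z \<le> C" by (meson abs_le_D1)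
  have int: "integrable haar (poisson \<mu> r)" using bd by (intro M1_integrable_bounded[OF haar_M1 m]) auto
  have F: "(\<integral>z. z ^ j * of_real (poisson \<mu> r z) \<partial>haar) = of_real (r ^ j) * fc \<mu> j" for j
    unfolding P poisson_fourier(1)[OF sm a0] by (simp add: a_def)
  have "(\<integral>z. poisson \<mu> r z \<partial>haar) = 1"
  proof -
    have "complex_of_real (\<integral>z. poisson \<mu> r z \<partial>haar) = 1" using F[of 0] by (simp add: fc_0 assms)
    then show ?thesis by (simp only: of_real_eq_1_iff)
  qed
  moreover have "0 \<le> poisson \<mu> r z" if z: "z \<in> circle" for z
  proof -
    have lt: "cmod (of_real r * z * cnj w) < 1" if "w \<in> circle" for w using that z assms by (simp add: norm_mult)
    have g: "(\<lambda>k. (of_real r * z * cnj w) ^ k) sums (1 / (1 - of_real r * z * cnj w))" if "w \<in> circle" for w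
      using geometric_sums[OF lt[OF that]] .
    have "(\<lambda>k. \<integral>w. (of_real r * z * cnj w) ^ k \<partial>\<mu>) sums (\<integral>w. (\<Sum>k. (of_real r * z * cnj w) ^ k) \<partial>\<mu>)"
      and i: "integrable \<mu> (\<lambda>w. \<Sum>k. (of_real r * z * cnj w) ^ k)"
      using z assms by (intro M1_sums_integral[where b = "\<lambda>k. r ^ k"] summable_geometric;
        auto simp: norm_mult norm_power)+
    moreover have "(\<integral>w. (of_real r * z * cnj w) ^ k \<partial>\<mu>) = a k * z ^ k" for k
    proof -
      have "(\<integral>w. (of_real r * z * cnj w) ^ k \<partial>\<mu>) = (\<integral>w. (of_real r ^ k * z ^ k) * cnj (w ^ k) \<partial>\<mu>)"
        by (simp add: power_mult_distrib)
      also have "\<dots> = (of_real r ^ k * z ^ k) * (\<integral>w. cnj (w ^ k) \<partial>\<mu>)" by (rule integral_mult_right_zero)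
      also have "(\<integral>w. cnj (w ^ k) \<partial>\<mu>) = cnj (fc \<mu> k)" unfolding fc_def by (rule Bochner_Integration.integral_cnj)
      finally show ?thesis by (simp add: a_def)
    qed
    ultimately have "poisson \<mu> r z = Re (2 * (\<integral>w. (\<Sum>k. (of_real r * z * cnj w) ^ k) \<partial>\<mu>) - 1)"
      by (simp add: P sums_iff)
    also have "\<dots> = (\<integral>w. Re (2 * (\<Sum>k. (of_real r * z * cnj w) ^ k) - 1) \<partial>\<mu>)"
    proof -
      interpret prob_space \<mu> using assms(1) by (rule M1_prob_space)
      have "(\<integral>w. Re (2 * (\<Sum>k. (of_real r * z * cnj w) ^ k) - 1) \<partial>\<mu>) = Re (\<integral>w. 2 * (\<Sum>k. (of_real r * z * cnj w) ^ k) - 1 \<partial>\<mu>)"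
        using i by (intro integral_Re) auto
      also have "(\<integral>w. 2 * (\<Sum>k. (of_real r * z * cnj w) ^ k) - 1 \<partial>\<mu>) = 2 * (\<integral>w. (\<Sum>k. (of_real r * z * cnj w) ^ k) \<partial>\<mu>) - 1"
        using i by (simp add: prob_space)
      finally show ?thesis by simp
    qed
    also have "\<dots> \<ge> 0"
    proof (rule integral_nonneg_AE, rule AE_I2)
      fix w assume "w \<in> space \<mu>"
      then have w: "w \<in> circle" by (simp add: M1_space[OF assms(1)])
      define u where "u = of_real r * z * cnj w"
      have u: "cmod u < 1" using lt[OF w] by (simp add: u_def)
      have nz: "1 - u \<noteq> 0" using one_minus_notin_nonpos(3)[OF u] .
      have "2 * (1 / (1 - u)) - 1 = (1 + u) / (1 - u)" using nz by (simp add: field_simps)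
      also have "\<dots> = (1 + u) * cnj (1 - u) / (of_real ((cmod (1 - u))\<^sup>2))"
        using nz by (subst complex_div_cnj) (simp add: field_simps)
      finally have "Re (2 * (1 / (1 - u)) - 1) = Re ((1 + u) * cnj (1 - u)) / (cmod (1 - u))\<^sup>2" by (simp only: Re_divide_of_real)
      also have "Re ((1 + u) * cnj (1 - u)) = 1 - (cmod u)\<^sup>2" unfolding cmod_power2 by (simp add: power2_eq_square algebra_simps)
      finally have "Re (2 * (1 / (1 - u)) - 1) = (1 - (cmod u)\<^sup>2) / (cmod (1 - u))\<^sup>2" .
      moreover have "(cmod u)\<^sup>2 \<le> 1" using u by (simp add: power_le_one)
      ultimately have "0 \<le> Re (2 * (1 / (1 - u)) - 1)" by simp
      then show "0 \<le> Re (2 * (\<Sum>k. (of_real r * z * cnj w) ^ k) - 1)"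
        using sums_unique[OF g[OF w]] by (simp only: u_def)
    qed
    finally show ?thesis .
  qed
  ultimately show "smoothed \<mu> r \<in> M1" "fc (smoothed \<mu> r) k = of_real (r ^ k) * fc \<mu> k"
    unfolding smoothed_def using density_haar_M1[OF m _ int] F by auto
qed

lemma
  assumes "\<mu> \<in> M1" "en \<mu> \<noteq> \<infinity>" "0 \<le> r" "r < 1"
  shows en_smoothed: "en (smoothed \<mu> r) \<noteq> \<infinity>"
    and energy_smoothed_le: "energy (smoothed \<mu> r) \<le> energy \<mu>"
proof -
  have "en (smoothed \<mu> r) \<le> en \<mu>"
    unfolding en_def
  proof (intro suminf_le ennreal_leI divide_right_mono allI summableI)
    fix k
    have "r ^ k * cmod (fc \<mu> k) \<le> 1 * cmod (fc \<mu> k)" using assms by (intro mult_right_mono power_le_one) auto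
    then show "(cmod (fc (smoothed \<mu> r) k))\<^sup>2 \<le> (cmod (fc \<mu> k))\<^sup>2"
      using assms by (intro power_mono) (auto simp: fc_smoothed norm_mult norm_power)
  qed auto
  then show "en (smoothed \<mu> r) \<noteq> \<infinity>" "energy (smoothed \<mu> r) \<le> energy \<mu>"
    using assms(2) unfolding energy_def by (auto simp: top_unique less_top intro!: enn2real_mono)
qed

lemma Qr_bound_inside:
  assumes "cmod u \<le> r" "r < 1" shows "\<bar>Qr d u\<bar> \<le> 2 * cmod d / (1 - r)"
proof -
  have u: "cmod u < 1" and r: "0 \<le> r" using assms norm_ge_zero[of u] by linarith+
  have b: "cmod (- (u ^ k) / of_nat k) \<le> r ^ k" for k
  proof (cases "k = 0")
    case False
    have "cmod u ^ k / real k \<le> r ^ k / 1" using assms(1) False r by (intro frac_le power_mono) auto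
    then show ?thesis using False by (simp add: norm_divide norm_power)
  qed simp
  have "cmod (Ln (1 - u)) \<le> (\<Sum>k. r ^ k)"
    unfolding sums_unique[OF Ln_one_minus_sums[OF u]] using assms r by (intro norm_suminf_le b summable_geometric) auto
  also have "\<dots> = 1 / (1 - r)" using assms r by (simp add: suminf_geometric)
  finally have "cmod (Ln (1 - u)) \<le> 1 / (1 - r)" .
  then have "cmod d * cmod (Ln (1 - u)) \<le> cmod d * (1 / (1 - r))" by (intro mult_left_mono) auto
  moreover have "\<bar>Re (cnj d * Ln (1 - u))\<bar> \<le> cmod d * cmod (Ln (1 - u))"
    using abs_Re_le_cmod[of "cnj d * Ln (1 - u)"] by (simp add: norm_mult)
  ultimately show ?thesis by (simp add: Qr_def abs_mult)
qed

lemma integral_Qr_smoothed_scaled: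
  assumes "\<mu> \<in> M1" "0 \<le> r" "r < 1"
  shows "(\<integral>z. Qr d (of_real (rr i) * z) \<partial>smoothed \<mu> r) = (\<integral>z. Qr d (of_real (rr i * r) * z) \<partial>\<mu>)"
proof -
  have "rr i * r \<le> 1 * r" using rr_bounds[of i] assms by (intro mult_right_mono) auto
  then have rr: "0 \<le> rr i" "rr i < 1" "0 \<le> rr i * r" "rr i * r < 1" using rr_bounds[of i] assms by auto
  have "(\<integral>z. Ln (1 - of_real (rr i) * z) \<partial>smoothed \<mu> r) = (\<integral>z. Ln (1 - of_real (rr i * r) * z) \<partial>\<mu>)"
    using integral_Ln_sums(1)[OF smoothed_M1[OF assms] rr(1,2)] integral_Ln_sums(1)[OF assms(1) rr(3,4)]
    by (intro sums_unique2) (simp_all add: fc_smoothed assms power_mult_distrib algebra_simps)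
  then show ?thesis
    unfolding integral_Qr_eq_Ln[OF smoothed_M1[OF assms] rr(1,2)] integral_Qr_eq_Ln[OF assms(1) rr(3,4)] by simp
qed

text \<open>The Poisson kernel moves from the measure to the harmonic function \<open>Qr d\<close>,
  where it evaluates at radius \<open>r\<close>. At smaller radii this is a comparison of logarithmic
  series; the bound inside the disc lets the radius grow to 1.\<close>

lemma
  assumes "0 \<le> Re d" "\<mu> \<in> M1" "en \<mu> \<noteq> \<infinity>" "0 \<le> r" "r < 1"
  shows integrable_Qr_smoothed: "integrable (smoothed \<mu> r) (Qr d)"
    and integral_Qr_smoothed: "(\<integral>z. Qr d z \<partial>smoothed \<mu> r) = (\<integral>z. Qr d (of_real r * z) \<partial>\<mu>)"
proof -
  interpret prob_space \<mu> using assms(2) by (rule M1_prob_space)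
  have M: "smoothed \<mu> r \<in> M1" using assms by (intro smoothed_M1)
  have ae: "AE z in smoothed \<mu> r. z \<noteq> 1"
    by (rule finite_energy_no_atom[OF M en_smoothed[OF assms(2-5)]])
  have bd: "\<bar>Qr d (of_real (rr i * r) * z)\<bar> \<le> 2 * cmod d / (1 - r)" if "z \<in> circle" for i z
  proof (rule Qr_bound_inside[OF _ assms(5)])
    have "rr i * r \<le> 1 * r" using rr_bounds[of i] assms by (intro mult_right_mono) auto
    then show "cmod (of_real (rr i * r) * z) \<le> r" using that rr_bounds[of i] assms by (simp add: norm_mult)
  qed
  have m: "(\<lambda>z. Qr d (of_real s * z)) \<in> borel_measurable circle_borel" for s
    unfolding Qr_def[abs_def] by measurable
  have "(\<integral>z. Qr d (of_real (rr i) * z) \<partial>smoothed \<mu> r) \<le> 2 * cmod d / (1 - r)" for i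
  proof -
    have "integrable \<mu> (\<lambda>z. Qr d (of_real (rr i * r) * z))"
      by (rule M1_integrable_bounded[OF assms(2) m, where B = "2 * cmod d / (1 - r)"]) (simp only: real_norm_def bd)
    then have "(\<integral>z. Qr d (of_real (rr i * r) * z) \<partial>\<mu>) \<le> (\<integral>z. 2 * cmod d / (1 - r) \<partial>\<mu>)"
      using bd by (intro integral_mono integrable_const) (auto simp only: M1_space[OF assms(2)] dest: abs_le_D1)
    then show ?thesis using assms by (simp add: integral_Qr_smoothed_scaled prob_space)
  qed
  then show int: "integrable (smoothed \<mu> r) (Qr d)"
    by (rule integrable_Qr_if_Abel_bounded[OF assms(1) M ae])
  have "(\<lambda>i. \<integral>z. Qr d (of_real (rr i) * z) \<partial>smoothed \<mu> r) \<longlonglongrightarrow> (\<integral>z. Qr d z \<partial>smoothed \<mu> r)"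
    by (rule integral_Qr_rr_tendsto[OF assms(1) M ae int])
  moreover have "(\<lambda>i. \<integral>z. Qr d (of_real (rr i * r) * z) \<partial>\<mu>) \<longlonglongrightarrow> (\<integral>z. Qr d (of_real r * z) \<partial>\<mu>)"
  proof (rule integral_dominated_convergence[where w = "\<lambda>_. 2 * cmod d / (1 - r)"])
    show "AE z in \<mu>. (\<lambda>i. Qr d (of_real (rr i * r) * z)) \<longlonglongrightarrow> Qr d (of_real r * z)"
    proof (rule AE_I2)
      fix z assume "z \<in> space \<mu>"
      then have "cmod (of_real r * z) < 1" using assms by (simp add: norm_mult M1_space[OF assms(2)])
      then have n: "1 - of_real r * z \<notin> \<real>\<^sub>\<le>\<^sub>0" by (rule one_minus_notin_nonpos)
      have "(\<lambda>i. 1 - of_real (rr i * r) * z) \<longlonglongrightarrow> 1 - of_real (1 * r) * z"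
        by (intro tendsto_intros rr_tendsto)
      then have "(\<lambda>i. Ln (1 - of_real (rr i * r) * z)) \<longlonglongrightarrow> Ln (1 - of_real r * z)"
        using n by (intro tendsto_Ln) simp_all
      then show "(\<lambda>i. Qr d (of_real (rr i * r) * z)) \<longlonglongrightarrow> Qr d (of_real r * z)"
        unfolding Qr_def by (intro tendsto_mult tendsto_Re tendsto_const)
    qed
    show "(\<lambda>z. Qr d (of_real (rr i * r) * z)) \<in> borel_measurable \<mu>" for i
      unfolding M1_measurable_cong[OF assms(2)] by (rule m)
    show "AE z in \<mu>. norm (Qr d (of_real (rr i * r) * z)) \<le> 2 * cmod d / (1 - r)" for i
      using bd by (intro AE_I2) (simp only: M1_space[OF assms(2)] real_norm_def)
  qed (use m in \<open>auto simp: M1_measurable_cong[OF assms(2)]\<close>)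
  ultimately show "(\<integral>z. Qr d z \<partial>smoothed \<mu> r) = (\<integral>z. Qr d (of_real r * z) \<partial>\<mu>)"
    unfolding integral_Qr_smoothed_scaled[OF assms(2,4,5)] by (rule LIMSEQ_unique)
qed

text \<open>Smoothing does not increase the energy, and as the radius grows to 1 the Fourier
  coefficients and the potential term converge.\<close>

lemma smoothed_approximates:
  assumes "0 \<le> Re d" "openin weak_topology G" "\<mu> \<in> G" "J d \<mu> < ereal a"
  obtains i where "smoothed \<mu> (rr i) \<in> G" "J d (smoothed \<mu> (rr i)) < ereal a" "en (smoothed \<mu> (rr i)) \<noteq> \<infinity>"
    "integrable (smoothed \<mu> (rr i)) (Qr d)"
proof -
  have M: "\<mu> \<in> M1" using openin_subset[OF assms(2)] assms(3) by (auto simp: topspace_weak_topology)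
  have fin: "J d \<mu> \<noteq> \<infinity>" using assms(4) by auto
  note en = J_not_infinity[OF assms(1) M fin]
  have sM: "smoothed \<mu> (rr i) \<in> M1" for i using rr_bounds[of i] by (intro smoothed_M1 M) auto
  obtain N \<delta> where N: "\<delta> > 0" "\<And>\<nu>. \<nu> \<in> M1 \<Longrightarrow> (\<And>k. k \<le> N \<Longrightarrow> cmod (fc \<nu> k - fc \<mu> k) < \<delta>) \<Longrightarrow> \<nu> \<in> G"
    using weak_neighbourhood[OF assms(2,3)] by metis
  have "\<forall>\<^sub>F i in sequentially. \<forall>k\<in>{..N}. cmod (fc (smoothed \<mu> (rr i)) k - fc \<mu> k) < \<delta>"
    unfolding eventually_ball_finite_distrib[OF finite_atMost]
  proof
    fix k
    have "(\<lambda>i. of_real (rr i ^ k) * fc \<mu> k) \<longlonglongrightarrow> of_real (1 ^ k) * fc \<mu> k" by (intro tendsto_intros rr_tendsto)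
    then have "(\<lambda>i. fc (smoothed \<mu> (rr i)) k) \<longlonglongrightarrow> fc \<mu> k"
      using rr_bounds by (simp add: fc_smoothed[OF M])
    from tendstoD[OF this N(1)] show "\<forall>\<^sub>F i in sequentially. cmod (fc (smoothed \<mu> (rr i)) k - fc \<mu> k) < \<delta>"
      by (simp add: dist_norm)
  qed
  then have 1: "\<forall>\<^sub>F i in sequentially. smoothed \<mu> (rr i) \<in> G"
    by eventually_elim (auto intro: N(2)[OF sM])
  have "(\<lambda>i. energy \<mu> + (\<integral>z. Qr d (of_real (rr i) * z) \<partial>\<mu>)) \<longlonglongrightarrow> energy \<mu> + (\<integral>z. Qr d z \<partial>\<mu>)"
    by (intro tendsto_intros integral_Qr_rr_tendsto assms M en finite_energy_no_atom)
  moreover have "energy \<mu> + (\<integral>z. Qr d z \<partial>\<mu>) < a"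
    using assms(4) unfolding J_finite_energy[OF assms(1) M en] by simp
  ultimately have "\<forall>\<^sub>F i in sequentially. energy \<mu> + (\<integral>z. Qr d (of_real (rr i) * z) \<partial>\<mu>) < a"
    by (rule order_tendstoD(2))
  with 1 have "\<forall>\<^sub>F i in sequentially. smoothed \<mu> (rr i) \<in> G \<and> energy \<mu> + (\<integral>z. Qr d (of_real (rr i) * z) \<partial>\<mu>) < a"
    by eventually_elim simp
  then obtain i where i: "smoothed \<mu> (rr i) \<in> G" "energy \<mu> + (\<integral>z. Qr d (of_real (rr i) * z) \<partial>\<mu>) < a"
    unfolding eventually_sequentially by blast
  have r: "0 \<le> rr i" "rr i < 1" using rr_bounds[of i] by auto
  note e = en_smoothed[OF M en(1) r] integrable_Qr_smoothed[OF assms(1) M en(1) r]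
  have "J d (smoothed \<mu> (rr i)) = ereal (energy (smoothed \<mu> (rr i)) + (\<integral>z. Qr d (of_real (rr i) * z) \<partial>\<mu>))"
    unfolding J_finite_energy[OF assms(1) sM e] integral_Qr_smoothed[OF assms(1) M en(1) r] ..
  also have "\<dots> < ereal a" using energy_smoothed_le[OF M en(1) r] i(2) by simp
  finally show ?thesis using that[of i] i(1) e by simp
qed

section \<open>Independent samples from a measure of bounded density\<close>

lemma emeasure_PiM_pair:
  assumes "\<nu> \<in> M1" "i \<in> I" "j \<in> I" "i \<noteq> j"
  shows "distr (Pi\<^sub>M I (\<lambda>_. \<nu>)) (\<nu> \<Otimes>\<^sub>M \<nu>) (\<lambda>z. (z i, z j)) = \<nu> \<Otimes>\<^sub>M \<nu>"
proof (rule pair_measure_eqI[symmetric])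
  interpret prob_space \<nu> using assms(1) by (rule M1_prob_space)
  show "sigma_finite_measure \<nu>" "sigma_finite_measure \<nu>" by unfold_locales
  show "sets (\<nu> \<Otimes>\<^sub>M \<nu>) = sets (distr (Pi\<^sub>M I (\<lambda>_. \<nu>)) (\<nu> \<Otimes>\<^sub>M \<nu>) (\<lambda>z. (z i, z j)))" by simp
  fix A B assume AB: "A \<in> sets \<nu>" "B \<in> sets \<nu>"
  have m: "(\<lambda>z. (z i, z j)) \<in> Pi\<^sub>M I (\<lambda>_. \<nu>) \<rightarrow>\<^sub>M \<nu> \<Otimes>\<^sub>M \<nu>" using assms by measurable
  have "emeasure (distr (Pi\<^sub>M I (\<lambda>_. \<nu>)) (\<nu> \<Otimes>\<^sub>M \<nu>) (\<lambda>z. (z i, z j))) (A \<times> B)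
      = emeasure (Pi\<^sub>M I (\<lambda>_. \<nu>)) ((\<lambda>z. (z i, z j)) -` (A \<times> B) \<inter> space (Pi\<^sub>M I (\<lambda>_. \<nu>)))"
    using m AB by (intro emeasure_distr) auto
  also have "(\<lambda>z. (z i, z j)) -` (A \<times> B) \<inter> space (Pi\<^sub>M I (\<lambda>_. \<nu>))
      = prod_emb I (\<lambda>_. \<nu>) {i, j} (Pi\<^sub>E {i, j} (\<lambda>k. if k = i then A else B))"
    using assms AB[THEN sets.sets_into_space] by (auto simp: prod_emb_def space_PiM PiE_iff Pi_iff)
  also have "emeasure (Pi\<^sub>M I (\<lambda>_. \<nu>)) \<dots> = (\<Prod>k\<in>{i, j}. emeasure \<nu> (if k = i then A else B))"
    using assms AB by (intro emeasure_PiM_emb) (auto simp: prob_space_axioms)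
  also have "\<dots> = emeasure \<nu> A * emeasure \<nu> B" using assms(4) by simp
  finally show "emeasure \<nu> A * emeasure \<nu> B
      = emeasure (distr (Pi\<^sub>M I (\<lambda>_. \<nu>)) (\<nu> \<Otimes>\<^sub>M \<nu>) (\<lambda>z. (z i, z j))) (A \<times> B)" ..
qed

context
  fixes \<nu> :: "complex measure" and n :: nat and P :: "(nat \<Rightarrow> complex) measure"
  assumes \<nu>: "\<nu> \<in> M1"
  defines "P \<equiv> Pi\<^sub>M {..<n} (\<lambda>_. \<nu>)"
begin

lemma sample_prob_space: "prob_space P"
  unfolding P_def by (intro prob_space_PiM M1_prob_space \<nu>)

lemma sample_circle: "z \<in> space P \<Longrightarrow> k < n \<Longrightarrow> z k \<in> circle"
  unfolding P_def by (rule space_PiM_M1[of "{..<n}"]) (auto intro: \<nu>)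

lemma
  fixes f :: "complex \<Rightarrow> 'b::{banach, second_countable_topology}"
  assumes "k < n" "integrable \<nu> f"
  shows sample_integral1: "(\<integral>z. f (z k) \<partial>P) = (\<integral>x. f x \<partial>\<nu>)" and sample_integrable1: "integrable P (\<lambda>z. f (z k))"
proof -
  have d: "distr P \<nu> (\<lambda>z. z k) = \<nu>"
    unfolding P_def using assms by (intro distr_PiM_component M1_prob_space \<nu>) auto
  have m: "(\<lambda>z. z k) \<in> P \<rightarrow>\<^sub>M \<nu>" unfolding P_def using assms by (intro measurable_component_singleton) auto
  have f: "f \<in> borel_measurable \<nu>" using assms(2) by simp
  show "(\<integral>z. f (z k) \<partial>P) = (\<integral>x. f x \<partial>\<nu>)" using integral_distr[OF m f] unfolding d by simp
  show "integrable P (\<lambda>z. f (z k))" using integrable_distr_eq[OF m f] assms(2) unfolding d by simp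
qed

lemma
  fixes f :: "complex \<times> complex \<Rightarrow> 'b::{banach, second_countable_topology}"
  assumes "j < n" "k < n" "j \<noteq> k" "integrable (\<nu> \<Otimes>\<^sub>M \<nu>) f"
  shows sample_integral2: "(\<integral>z. f (z j, z k) \<partial>P) = (\<integral>p. f p \<partial>(\<nu> \<Otimes>\<^sub>M \<nu>))"
    and sample_integrable2: "integrable P (\<lambda>z. f (z j, z k))"
proof -
  have d: "distr P (\<nu> \<Otimes>\<^sub>M \<nu>) (\<lambda>z. (z j, z k)) = \<nu> \<Otimes>\<^sub>M \<nu>"
    unfolding P_def using assms by (intro emeasure_PiM_pair \<nu>) auto
  have m: "(\<lambda>z. (z j, z k)) \<in> P \<rightarrow>\<^sub>M \<nu> \<Otimes>\<^sub>M \<nu>" unfolding P_def using assms by (intro measurable_Pair measurable_component_singleton) auto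
  have f: "f \<in> borel_measurable (\<nu> \<Otimes>\<^sub>M \<nu>)" using assms(4) by simp
  show "(\<integral>z. f (z j, z k) \<partial>P) = (\<integral>p. f p \<partial>(\<nu> \<Otimes>\<^sub>M \<nu>))" using integral_distr[OF m f] unfolding d by simp
  show "integrable P (\<lambda>z. f (z j, z k))" using integrable_distr_eq[OF m f] assms(4) unfolding d by simp
qed

lemma sample_AE_generic:
  assumes "en \<nu> \<noteq> \<infinity>"
  shows "AE z in P. generic n z"
proof -
  have 1: "AE z in P. \<forall>k\<in>{..<n}. z k \<noteq> 1"
    unfolding P_def
    by (intro AE_finite_allI finite_lessThan AE_PiM_component M1_prob_space \<nu> finite_energy_no_atom assms)
  have "AE z in P. z j \<noteq> z k" if "k < n" "j < k" for j k
  proof -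
    have d: "distr P (\<nu> \<Otimes>\<^sub>M \<nu>) (\<lambda>z. (z j, z k)) = \<nu> \<Otimes>\<^sub>M \<nu>"
      unfolding P_def using that by (intro emeasure_PiM_pair \<nu>) auto
    have m: "(\<lambda>z. (z j, z k)) \<in> P \<rightarrow>\<^sub>M \<nu> \<Otimes>\<^sub>M \<nu>" unfolding P_def using that by (intro measurable_Pair measurable_component_singleton) auto
    have "AE p in distr P (\<nu> \<Otimes>\<^sub>M \<nu>) (\<lambda>z. (z j, z k)). fst p \<noteq> snd p"
      unfolding d by (rule AE_distinct[OF \<nu> assms])
    from AE_distrD[OF m this] show ?thesis by simp
  qed
  then have "AE z in P. \<forall>k\<in>{..<n}. \<forall>j\<in>{..<k}. z j \<noteq> z k"
    by (intro AE_finite_allI finite_lessThan) auto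
  with 1 show ?thesis by eventually_elim (auto simp: generic_def)
qed

text \<open>Each of the \<open>n (n - 1) / 2\<close> pairs contributes the energy; replacing \<open>(n -
  1) / n\<close> by 1 increases the mean because the energy is nonnegative.\<close>

lemma
  assumes "n \<ge> 1" "en \<nu> \<noteq> \<infinity>" "integrable \<nu> (Qr d)"
  shows sample_integrable_H: "integrable P (H d n)"
    and sample_integral_H: "(\<integral>z. H d n z \<partial>P) \<le> energy \<nu> + (\<integral>z. Qr d z \<partial>\<nu>)"
proof -
  let ?l = "\<lambda>p. ln (cmod (fst p - snd p))"
  have l: "integrable (\<nu> \<Otimes>\<^sub>M \<nu>) ?l" "(\<integral>p. ?l p \<partial>(\<nu> \<Otimes>\<^sub>M \<nu>)) = - energy \<nu>"
    using integrable_ln_diff[OF \<nu> assms(2)] integral_ln_diff[OF \<nu> assms(2)] by auto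
  have i1: "integrable P (\<lambda>z. Qr d (z k))" "(\<integral>z. Qr d (z k) \<partial>P) = (\<integral>z. Qr d z \<partial>\<nu>)" if "k < n" for k
    using sample_integrable1[OF that assms(3)] sample_integral1[OF that assms(3)] by auto
  have i2: "integrable P (\<lambda>z. ln (cmod (z j - z k)))" "(\<integral>z. ln (cmod (z j - z k)) \<partial>P) = - energy \<nu>" if "k < n" "j < k" for j k
    using sample_integrable2[OF _ that(1) _ l(1), of j] sample_integral2[OF _ that(1) _ l(1), of j] l(2) that by auto
  have s1: "integrable P (\<lambda>z. (\<Sum>k<n. Qr d (z k)) / real n)"
    by (intro integrable_divide Bochner_Integration.integrable_sum i1) auto
  have s2': "integrable P (\<lambda>z. \<Sum>j<k. ln (cmod (z j - z k)))" if "k < n" for k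
    using that by (intro Bochner_Integration.integrable_sum i2) auto
  have s2: "integrable P (\<lambda>z. 2 / (real n)\<^sup>2 * (\<Sum>k<n. \<Sum>j<k. ln (cmod (z j - z k))))"
    by (intro integrable_mult_right Bochner_Integration.integrable_sum s2') auto
  show "integrable P (H d n)" unfolding H_def[abs_def]
    by (rule Bochner_Integration.integrable_diff[OF s1 s2])
  have e2: "(\<integral>z. (\<Sum>k<n. \<Sum>j<k. ln (cmod (z j - z k))) \<partial>P) = (\<Sum>k<n. \<Sum>j<k. \<integral>z. ln (cmod (z j - z k)) \<partial>P)"
  proof -
    have "(\<integral>z. (\<Sum>k<n. \<Sum>j<k. ln (cmod (z j - z k))) \<partial>P) = (\<Sum>k<n. \<integral>z. (\<Sum>j<k. ln (cmod (z j - z k))) \<partial>P)"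
      by (intro Bochner_Integration.integral_sum s2') auto
    also have "\<dots> = (\<Sum>k<n. \<Sum>j<k. \<integral>z. ln (cmod (z j - z k)) \<partial>P)"
      by (intro sum.cong refl Bochner_Integration.integral_sum i2) auto
    finally show ?thesis .
  qed
  have e1: "(\<integral>z. (\<Sum>k<n. Qr d (z k)) \<partial>P) = (\<Sum>k<n. \<integral>z. Qr d (z k) \<partial>P)"
    by (intro Bochner_Integration.integral_sum i1) auto
  have "(\<integral>z. H d n z \<partial>P) = (\<Sum>k<n. \<integral>z. Qr d (z k) \<partial>P) / real n - 2 / (real n)\<^sup>2 * (\<Sum>k<n. \<Sum>j<k. \<integral>z. ln (cmod (z j - z k)) \<partial>P)"
    unfolding H_def Bochner_Integration.integral_diff[OF s1 s2] integral_divide_zero integral_mult_right_zero e1 e2 ..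
  also have "(\<Sum>k<n. \<integral>z. Qr d (z k) \<partial>P) = real n * (\<integral>z. Qr d z \<partial>\<nu>)" using i1(2) by simp
  also have "(\<Sum>k<n. \<Sum>j<k. \<integral>z. ln (cmod (z j - z k)) \<partial>P) = - energy \<nu> * (\<Sum>k<n. \<Sum>j<k. 1)"
  proof -
    have "(\<Sum>k<n. \<Sum>j<k. \<integral>z. ln (cmod (z j - z k)) \<partial>P) = (\<Sum>k<n. \<Sum>j<k. - energy \<nu> * 1)"
      using i2(2) by (intro sum.cong) auto
    then show ?thesis by (simp only: sum_distrib_left)
  qed
  also have "2 / (real n)\<^sup>2 * (- energy \<nu> * (\<Sum>k<n. \<Sum>j<k. 1)) = - energy \<nu> * ((real n * real n - real n) / (real n)\<^sup>2)"
    using sum_square_eq_pairs[of "\<lambda>_ _. 1" n] assms(1) by (simp add: field_simps)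
  finally have "(\<integral>z. H d n z \<partial>P) = (\<integral>z. Qr d z \<partial>\<nu>) + energy \<nu> * ((real n * real n - real n) / (real n)\<^sup>2)"
    using assms(1) by simp
  moreover have "(real n * real n - real n) / (real n)\<^sup>2 \<le> 1" using assms(1) by (simp add: power2_eq_square)
  ultimately show "(\<integral>z. H d n z \<partial>P) \<le> energy \<nu> + (\<integral>z. Qr d z \<partial>\<nu>)"
    using mult_left_mono[of _ 1 "energy \<nu>"] energy_nonneg[of \<nu>] by fastforce
qed

text \<open>The law of large numbers for the Fourier coefficients of the empirical measure, from their variances.\<close>

lemma sample_fc_variance:
  assumes "n \<ge> 1"
  shows "integrable P (\<lambda>z. (cmod (fc (esd n z) m - fc \<nu> m))\<^sup>2)"
    and "(\<integral>z. (cmod (fc (esd n z) m - fc \<nu> m))\<^sup>2 \<partial>P) \<le> 4 / real n"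
proof -
  interpret prob_space P by (rule sample_prob_space)
  interpret N: prob_space \<nu> using \<nu> by (rule M1_prob_space)
  interpret NN: pair_prob_space \<nu> \<nu> using \<nu> by (intro M1_pair_prob)
  define X where "X x = x ^ m - fc \<nu> m" for x :: complex
  have Xb: "cmod (X x) \<le> 2" if "x \<in> circle" for x
    using norm_triangle_ineq4[of "x ^ m" "fc \<nu> m"] norm_fc_le_1[OF \<nu>, of m] that by (simp add: X_def norm_power)
  have Xm: "X \<in> borel_measurable circle_borel"
    unfolding X_def[abs_def] by (intro borel_measurable_circle continuous_intros)
  have Xi: "integrable \<nu> X" using Xb by (intro M1_integrable_bounded[OF \<nu> Xm]) auto
  have X0: "(\<integral>x. X x \<partial>\<nu>) = 0"
    unfolding X_def
    by (subst Bochner_Integration.integral_diff) (auto intro!: M1_integrable_continuous \<nu> continuous_intros simp: fc_def N.prob_space)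
  have eq: "fc (esd n z) m - fc \<nu> m = (\<Sum>j<n. X (z j)) / of_nat n" if "z \<in> space P" for z
    using that sample_circle assms by (subst fc_esd) (auto simp: X_def sum_subtractf field_simps)
  have fi: "integrable (\<nu> \<Otimes>\<^sub>M \<nu>) (\<lambda>p. X (fst p) * cnj (X (snd p)))"
  proof (rule NN.P.integrable_const_bound[where B = 4])
    have "cmod (X (fst p)) * cmod (X (snd p)) \<le> 2 * 2" if "p \<in> circle \<times> circle" for p
      using that Xb by (intro mult_mono) auto
    then show "AE p in \<nu> \<Otimes>\<^sub>M \<nu>. cmod (X (fst p) * cnj (X (snd p))) \<le> 4"
      by (intro AE_I2) (auto simp: space_pair_measure M1_space[OF \<nu>] norm_mult)
    have "X \<in> borel_measurable borel" unfolding X_def[abs_def] by measurable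
    then show "(\<lambda>p. X (fst p) * cnj (X (snd p))) \<in> borel_measurable (\<nu> \<Otimes>\<^sub>M \<nu>)"
      unfolding M1_pair_measurable[OF \<nu> \<nu>] by measurable
  qed
  have f0: "(\<integral>p. X (fst p) * cnj (X (snd p)) \<partial>(\<nu> \<Otimes>\<^sub>M \<nu>)) = 0"
  proof -
    have "(\<integral>p. X (fst p) * cnj (X (snd p)) \<partial>(\<nu> \<Otimes>\<^sub>M \<nu>)) = (\<integral>x. (\<integral>y. X x * cnj (X y) \<partial>\<nu>) \<partial>\<nu>)"
      using NN.integral_fst'[OF fi] by simp
    also have "(\<lambda>x. \<integral>y. X x * cnj (X y) \<partial>\<nu>) = (\<lambda>x. 0)"
    proof
      fix x
      have "(\<integral>y. X x * cnj (X y) \<partial>\<nu>) = X x * (\<integral>y. cnj (X y) \<partial>\<nu>)" by (rule integral_mult_right_zero)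
      also have "(\<integral>y. cnj (X y) \<partial>\<nu>) = cnj (\<integral>y. X y \<partial>\<nu>)" by (rule Bochner_Integration.integral_cnj)
      finally show "(\<integral>y. X x * cnj (X y) \<partial>\<nu>) = 0" by (simp add: X0)
    qed
    finally show ?thesis by simp
  qed
  have g: "integrable \<nu> (\<lambda>x. X x * cnj (X x))"
  proof (rule M1_integrable_bounded[OF \<nu>, where B = 4])
    show "(\<lambda>x. X x * cnj (X x)) \<in> borel_measurable circle_borel"
      unfolding X_def[abs_def] by (intro borel_measurable_circle continuous_intros)
    show "cmod (X z * cnj (X z)) \<le> 4" if "z \<in> circle" for z
      using mult_mono[OF Xb[OF that] Xb[OF that]] by (simp add: norm_mult)
  qed
  have int: "integrable P (\<lambda>z. X (z j) * cnj (X (z k)))" if "j < n" "k < n" for j k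
    using sample_integrable1[OF that(1) g] sample_integrable2[OF that _ fi] by (cases "j = k") auto
  have val: "(\<integral>z. X (z j) * cnj (X (z k)) \<partial>P) = (if j = k then (\<integral>x. X x * cnj (X x) \<partial>\<nu>) else 0)" if "j < n" "k < n" for j k
    using sample_integral1[OF that(1) g] sample_integral2[OF that _ fi] f0 by auto
  have sq: "complex_of_real ((cmod (fc (esd n z) m - fc \<nu> m))\<^sup>2) = (\<Sum>j<n. \<Sum>k<n. X (z j) * cnj (X (z k))) / of_nat n ^ 2" if "z \<in> space P" for z
    unfolding complex_norm_square eq[OF that] by (simp add: sum_product power2_eq_square)
  have si: "integrable P (\<lambda>z. (\<Sum>j<n. \<Sum>k<n. X (z j) * cnj (X (z k))) / of_nat n ^ 2)"
    using int by (intro integrable_divide Bochner_Integration.integrable_sum) auto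
  then have "integrable P (\<lambda>z. Re ((\<Sum>j<n. \<Sum>k<n. X (z j) * cnj (X (z k))) / of_nat n ^ 2))" by (rule integrable_Re)
  moreover have req: "Re ((\<Sum>j<n. \<Sum>k<n. X (z j) * cnj (X (z k))) / of_nat n ^ 2) = (cmod (fc (esd n z) m - fc \<nu> m))\<^sup>2" if "z \<in> space P" for z
    using sq[OF that, symmetric] by (simp only: Re_complex_of_real)
  ultimately show "integrable P (\<lambda>z. (cmod (fc (esd n z) m - fc \<nu> m))\<^sup>2)"
    by (simp cong: Bochner_Integration.integrable_cong)
  have "(\<integral>z. (cmod (fc (esd n z) m - fc \<nu> m))\<^sup>2 \<partial>P) = (\<integral>z. Re ((\<Sum>j<n. \<Sum>k<n. X (z j) * cnj (X (z k))) / of_nat n ^ 2) \<partial>P)"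
    by (intro Bochner_Integration.integral_cong refl req[symmetric])
  also have "\<dots> = Re (\<integral>z. (\<Sum>j<n. \<Sum>k<n. X (z j) * cnj (X (z k))) / of_nat n ^ 2 \<partial>P)" using si by (rule integral_Re)
  also have "(\<integral>z. (\<Sum>j<n. \<Sum>k<n. X (z j) * cnj (X (z k))) / of_nat n ^ 2 \<partial>P) = (\<Sum>j<n. \<Sum>k<n. \<integral>z. X (z j) * cnj (X (z k)) \<partial>P) / of_nat n ^ 2"
  proof -
    have "(\<integral>z. (\<Sum>j<n. \<Sum>k<n. X (z j) * cnj (X (z k))) \<partial>P) = (\<Sum>j<n. \<integral>z. (\<Sum>k<n. X (z j) * cnj (X (z k))) \<partial>P)"
      using int by (intro Bochner_Integration.integral_sum Bochner_Integration.integrable_sum) auto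
    also have "\<dots> = (\<Sum>j<n. \<Sum>k<n. \<integral>z. X (z j) * cnj (X (z k)) \<partial>P)"
      using int by (intro sum.cong refl Bochner_Integration.integral_sum) auto
    finally show ?thesis unfolding integral_divide_zero by simp
  qed
  also have "(\<Sum>j<n. \<Sum>k<n. \<integral>z. X (z j) * cnj (X (z k)) \<partial>P) = of_nat n * (\<integral>x. X x * cnj (X x) \<partial>\<nu>)"
    using val by simp
  also have "Re (of_nat n * (\<integral>x. X x * cnj (X x) \<partial>\<nu>) / of_nat n ^ 2) = Re (\<integral>x. X x * cnj (X x) \<partial>\<nu>) / real n"
  proof -
    have "of_nat n * (\<integral>x. X x * cnj (X x) \<partial>\<nu>) / of_nat n ^ 2 = (\<integral>x. X x * cnj (X x) \<partial>\<nu>) / of_real (real n)"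
      using assms by (simp add: field_simps power2_eq_square)
    then show ?thesis by (simp only: Re_divide_of_real)
  qed
  also have "\<dots> \<le> 4 / real n"
  proof (rule divide_right_mono)
    have "Re (\<integral>x. X x * cnj (X x) \<partial>\<nu>) \<le> cmod (\<integral>x. X x * cnj (X x) \<partial>\<nu>)" by (rule complex_Re_le_cmod)
    also have "\<dots> \<le> (\<integral>x. cmod (X x * cnj (X x)) \<partial>\<nu>)" by (rule integral_norm_bound)
    also have "\<dots> \<le> (\<integral>x. 4 \<partial>\<nu>)"
    proof (rule integral_mono)
      show "cmod (X x * cnj (X x)) \<le> 4" if "x \<in> space \<nu>" for x
        using mult_mono[OF Xb Xb, of x x] that by (simp add: norm_mult M1_space[OF \<nu>])
    qed (use g in auto)
    finally show "Re (\<integral>x. X x * cnj (X x) \<partial>\<nu>) \<le> 4" by (simp add: N.prob_space)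
  qed simp
  finally show "(\<integral>z. (cmod (fc (esd n z) m - fc \<nu> m))\<^sup>2 \<partial>P) \<le> 4 / real n" .
qed

lemma sample_fc_deviation:
  assumes "n \<ge> 1" "\<eta> > 0"
  shows "measure P {z \<in> space P. \<eta>\<^sup>2 \<le> (\<Sum>m\<le>N. (cmod (fc (esd n z) m - fc \<nu> m))\<^sup>2)} \<le> 4 * (real N + 1) / \<eta>\<^sup>2 / real n"
proof -
  interpret prob_space P by (rule sample_prob_space)
  have int: "integrable P (\<lambda>z. \<Sum>m\<le>N. (cmod (fc (esd n z) m - fc \<nu> m))\<^sup>2)"
    using sample_fc_variance(1)[OF assms(1)] by (intro Bochner_Integration.integrable_sum) auto
  have "measure P {z \<in> space P. \<eta>\<^sup>2 \<le> (\<Sum>m\<le>N. (cmod (fc (esd n z) m - fc \<nu> m))\<^sup>2)}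
      \<le> (\<integral>z. (\<Sum>m\<le>N. (cmod (fc (esd n z) m - fc \<nu> m))\<^sup>2) \<partial>P) / \<eta>\<^sup>2"
    using assms by (intro integral_Markov_inequality_measure[OF int, of "space P"]) (auto intro!: AE_I2 sum_nonneg)
  also have "(\<integral>z. (\<Sum>m\<le>N. (cmod (fc (esd n z) m - fc \<nu> m))\<^sup>2) \<partial>P) = (\<Sum>m\<le>N. \<integral>z. (cmod (fc (esd n z) m - fc \<nu> m))\<^sup>2 \<partial>P)"
    using sample_fc_variance(1)[OF assms(1)] by (intro Bochner_Integration.integral_sum) auto
  also have "\<dots> \<le> (\<Sum>m\<le>N. 4 / real n)" by (intro sum_mono sample_fc_variance(2) assms(1))
  finally show ?thesis using assms by (simp add: divide_right_mono field_simps)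
qed

text \<open>A density bounded by \<open>C\<close> costs a factor \<open>C\<close> for each coordinate.\<close>

lemma sample_le_haar:
  assumes "\<And>g. g \<in> borel_measurable circle_borel \<Longrightarrow> (\<integral>\<^sup>+z. g z \<partial>\<nu>) \<le> ennreal C * (\<integral>\<^sup>+z. g z \<partial>haar)"
    and "f \<in> borel_measurable (Pi\<^sub>M {..<n} (\<lambda>_. circle_borel))"
  shows "(\<integral>\<^sup>+z. f z \<partial>P) \<le> ennreal C ^ n * (\<integral>\<^sup>+z. f z \<partial>haar_n n)"
proof -
  interpret N: prob_space \<nu> using \<nu> by (rule M1_prob_space)
  interpret h: prob_space haar using haar_M1 by (rule M1_prob_space)
  interpret N: product_sigma_finite "\<lambda>_::nat. \<nu>" by unfold_locales
  interpret h: product_sigma_finite "\<lambda>_::nat. haar" by unfold_locales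
  have sm: "measurable (Pi\<^sub>M I (\<lambda>_. \<nu>)) M = measurable (Pi\<^sub>M I (\<lambda>_. circle_borel)) M"
    "measurable (Pi\<^sub>M I (\<lambda>_. haar)) M = measurable (Pi\<^sub>M I (\<lambda>_. circle_borel)) M" for I :: "nat set" and M :: "ennreal measure"
    by (auto intro!: measurable_PiM_M1 \<nu> haar_M1)
  have "(\<integral>\<^sup>+z. f z \<partial>Pi\<^sub>M I (\<lambda>_. \<nu>)) \<le> ennreal C ^ card I * (\<integral>\<^sup>+z. f z \<partial>Pi\<^sub>M I (\<lambda>_. haar))"
    if "finite I" "f \<in> borel_measurable (Pi\<^sub>M I (\<lambda>_. circle_borel))" for I :: "nat set" and f
    using that
  proof (induction I arbitrary: f)
    case empty
    then show ?case by (simp add: N.nn_integral_empty h.nn_integral_empty)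
  next
    case (insert i I)
    note [measurable] = insert.prems
    interpret hI: prob_space "Pi\<^sub>M I (\<lambda>_. haar)" by (intro prob_space_PiM M1_prob_space haar_M1)
    interpret pair_sigma_finite "Pi\<^sub>M I (\<lambda>_. haar)" \<nu> by unfold_locales
    have upd: "(\<lambda>p. f ((fst p)(i := snd p))) \<in> borel_measurable (Pi\<^sub>M I (\<lambda>_. circle_borel) \<Otimes>\<^sub>M circle_borel)"
      by (rule measurable_compose[OF measurable_add_dim insert.prems, unfolded split_beta'])
    have fi: "f \<in> borel_measurable (Pi\<^sub>M (insert i I) (\<lambda>_. \<nu>))" "f \<in> borel_measurable (Pi\<^sub>M (insert i I) (\<lambda>_. haar))"
      using insert.prems by (simp_all add: sm)
    have sec1: "(\<lambda>y. f (x(i := y))) \<in> borel_measurable circle_borel" if "x \<in> space (Pi\<^sub>M I (\<lambda>_. circle_borel))" for x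
      using measurable_Pair2[OF upd that] by simp
    have inner: "(\<lambda>x. \<integral>\<^sup>+y. f (x(i := y)) \<partial>haar) \<in> borel_measurable (Pi\<^sub>M I (\<lambda>_. circle_borel))"
      using h.borel_measurable_nn_integral[of "\<lambda>x y. f (x(i := y))" "Pi\<^sub>M I (\<lambda>_. circle_borel)"] upd
      by (simp add: split_beta' measurable_cong_sets[OF sets_pair_measure_cong[OF refl M1_sets[OF haar_M1]] refl])
    have sp: "space (Pi\<^sub>M I (\<lambda>_. \<nu>)) = space (Pi\<^sub>M I (\<lambda>_. circle_borel))"
      by (auto simp: space_PiM M1_space[OF \<nu>])
    have "(\<integral>\<^sup>+z. f z \<partial>Pi\<^sub>M (insert i I) (\<lambda>_. \<nu>)) = (\<integral>\<^sup>+x. (\<integral>\<^sup>+y. f (x(i := y)) \<partial>\<nu>) \<partial>Pi\<^sub>M I (\<lambda>_. \<nu>))"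
      by (rule N.product_nn_integral_insert[OF insert.hyps fi(1)])
    also have "\<dots> \<le> (\<integral>\<^sup>+x. ennreal C * (\<integral>\<^sup>+y. f (x(i := y)) \<partial>haar) \<partial>Pi\<^sub>M I (\<lambda>_. \<nu>))"
      using assms(1) sec1 by (intro nn_integral_mono) (simp add: sp)
    also have "\<dots> = ennreal C * (\<integral>\<^sup>+x. (\<integral>\<^sup>+y. f (x(i := y)) \<partial>haar) \<partial>Pi\<^sub>M I (\<lambda>_. \<nu>))"
      using inner by (intro nn_integral_cmult) (simp add: sm)
    also have "\<dots> \<le> ennreal C * (ennreal C ^ card I * (\<integral>\<^sup>+x. (\<integral>\<^sup>+y. f (x(i := y)) \<partial>haar) \<partial>Pi\<^sub>M I (\<lambda>_. haar)))"
      by (intro mult_left_mono insert.IH inner) simp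
    also have "(\<integral>\<^sup>+x. (\<integral>\<^sup>+y. f (x(i := y)) \<partial>haar) \<partial>Pi\<^sub>M I (\<lambda>_. haar)) = (\<integral>\<^sup>+z. f z \<partial>Pi\<^sub>M (insert i I) (\<lambda>_. haar))"
      by (rule h.product_nn_integral_insert[OF insert.hyps fi(2), symmetric])
    finally show ?case using insert.hyps by (simp add: mult.assoc)
  qed
  from this[OF finite_lessThan assms(2)] show ?thesis by (simp add: P_def haar_n_def)
qed

end


section \<open>The large deviation lower bound\<close>

text \<open>Under independent samples from \<open>\<nu>\<close> the mean of the Hamiltonian is at most \<open>J \<nu>\<close>, while the law of
  large numbers and the regularised energy bound it from below by about \<open>J \<nu>\<close> with high probability. By
  Markov's inequality it then exceeds \<open>J \<nu>\<close> noticeably with probability at most \<open>2/5\<close>. Passing from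
  samples to Haar measure costs a factor exponential in \<open>n\<close> only.\<close>

lemma Zset_lower_bound_bounded_density:
  assumes b: "b > 0" and d: "0 \<le> Re d" and \<nu>: "\<nu> \<in> M1" "en \<nu> \<noteq> \<infinity>" "integrable \<nu> (Qr d)"
    and C: "\<And>g. g \<in> borel_measurable circle_borel \<Longrightarrow> (\<integral>\<^sup>+z. g z \<partial>\<nu>) \<le> ennreal C * (\<integral>\<^sup>+z. g z \<partial>haar)" "1 \<le> C"
    and G: "openin weak_topology G" "\<nu> \<in> G" and a: "J d \<nu> < ereal a"
  shows "\<forall>\<^sub>F n in sequentially. ennreal (exp (- (b * (real n)\<^sup>2 * a))) \<le> Zset b d n G"
proof -
  define Jr where "Jr = energy \<nu> + (\<integral>z. Qr d z \<partial>\<nu>)"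
  have J: "J d \<nu> = ereal Jr" unfolding Jr_def by (rule J_finite_energy[OF d \<nu>])
  define a' where "a' = (Jr + a) / 2"
  define \<epsilon> where "\<epsilon> = a' - Jr"
  \<comment> \<open>With an eighth the Markov estimate below reads \<open>5/4 \<epsilon> prob hi \<le> \<epsilon>/2\<close>.\<close>
  define \<delta> where "\<delta> = \<epsilon> / 8"
  have \<epsilon>: "\<epsilon> > 0" "a' < a" using a J by (auto simp: \<epsilon>_def a'_def)
  have "\<forall>\<^sub>F i in sequentially. ereal (Jr - \<delta>) < ereal (Ji i d \<nu>)"
    using \<epsilon> by (intro order_tendstoD(1)[OF Ji_tendsto[OF d \<nu>(1)]]) (simp add: J \<delta>_def)
  then obtain i where i: "Jr - \<delta> < Ji i d \<nu>" unfolding eventually_sequentially by auto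
  define G' where "G' = G \<inter> {\<mu> \<in> topspace weak_topology. Ji i d \<mu> \<in> {Jr - \<delta><..}}"
  have "openin weak_topology G'" unfolding G'_def
    by (intro openin_Int G openin_continuous_map_preimage[OF Ji_continuous]) auto
  moreover have "\<nu> \<in> G'" using G(2) \<nu>(1) i by (auto simp: G'_def topspace_weak_topology)
  ultimately obtain N \<eta> where N: "\<eta> > 0"
    "\<And>\<mu>. \<mu> \<in> M1 \<Longrightarrow> (\<And>k. k \<le> N \<Longrightarrow> cmod (fc \<mu> k - fc \<nu> k) < \<eta>) \<Longrightarrow> \<mu> \<in> G'"
    using weak_neighbourhood by metis
  define C1 where "C1 = - ln (1 - rr i)"
  \<comment> \<open>A lower bound of the Hamiltonian at all configurations, for use on the improbable set.\<close>
  define K where "K = cQ d - ln (rr 0) / 2 - ln (1 - rr 0)"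
  define D where "D = \<bar>K\<bar> + \<bar>Jr\<bar>"
  define c1 where "c1 = 4 * (real N + 1) / \<eta>\<^sup>2"
  have inv: "\<forall>\<^sub>F n in sequentially. c / real n \<le> e" if "e > 0" for c e :: real
  proof -
    have "(\<lambda>n. c / real n) \<longlonglongrightarrow> 0" by (rule lim_const_over_n)
    from order_tendstoD(2)[OF this that] show ?thesis by (rule eventually_mono) simp
  qed
  have "\<forall>\<^sub>F n in sequentially. (ln C + ln 2) / real n \<le> b * (a - a')"
    using b \<epsilon> by (intro inv) simp
  moreover have "\<forall>\<^sub>F n in sequentially. c1 / real n \<le> 1/10" "\<forall>\<^sub>F n in sequentially. D * c1 / real n \<le> \<epsilon> / 4"
    "\<forall>\<^sub>F n in sequentially. C1 / real n \<le> \<delta>"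
    using \<epsilon> by (intro inv; simp add: \<delta>_def)+
  ultimately show ?thesis using eventually_ge_at_top[of 1]
  proof eventually_elim
    case (elim n)
    note n = \<open>1 \<le> n\<close>
    define P where "P = Pi\<^sub>M {..<n} (\<lambda>_. \<nu>)"
    interpret prob_space P unfolding P_def by (rule sample_prob_space[OF \<nu>(1)])
    have circ: "z k \<in> circle" if "z \<in> space P" "k < n" for z k
      using sample_circle[OF \<nu>(1)] that unfolding P_def by blast
    have eM: "esd n z \<in> M1" if "z \<in> space P" for z using n circ[OF that] by (intro esd_M1)
    have Hint: "integrable P (H d n)" and HJ: "(\<integral>z. H d n z \<partial>P) \<le> Jr"
      using sample_integrable_H[OF \<nu>(1) n \<nu>(2,3)] sample_integral_H[OF \<nu>(1) n \<nu>(2,3)] by (simp_all add: P_def Jr_def)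
    note [measurable] = borel_measurable_integrable[OF Hint]
    have vm[measurable]: "(\<lambda>z. (cmod (fc (esd n z) m - fc \<nu> m))\<^sup>2) \<in> borel_measurable P" for m
      using sample_fc_variance(1)[OF \<nu>(1) n, of m] by (auto simp: P_def)
    have gen: "AE z in P. generic n z" unfolding P_def by (rule sample_AE_generic[OF \<nu>(1,2)])
    define bad where "bad = {z \<in> space P. \<eta>\<^sup>2 \<le> (\<Sum>m\<le>N. (cmod (fc (esd n z) m - fc \<nu> m))\<^sup>2)}"
    define hi where "hi = {z \<in> space P. a' < H d n z}"
    have sets[measurable]: "bad \<in> sets P" "hi \<in> sets P" unfolding bad_def hi_def by measurable
    have pbad: "prob bad \<le> c1 / real n"
      unfolding bad_def P_def c1_def by (rule sample_fc_deviation[OF \<nu>(1) n N(1)])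
    have notbad: "esd n z \<in> G'" if "z \<in> space P" "z \<notin> bad" for z
    proof (rule N(2)[OF eM[OF that(1)]])
      fix k assume "k \<le> N"
      then have "(cmod (fc (esd n z) k - fc \<nu> k))\<^sup>2 \<le> (\<Sum>m\<le>N. (cmod (fc (esd n z) m - fc \<nu> m))\<^sup>2)"
        by (intro member_le_sum[of k "{..N}" "\<lambda>m. (cmod (fc (esd n z) m - fc \<nu> m))\<^sup>2"]) auto
      also have "\<dots> < \<eta>\<^sup>2" using that by (auto simp: bad_def)
      finally show "cmod (fc (esd n z) k - fc \<nu> k) < \<eta>" using N(1) by (simp add: power_less_imp_less_base)
    qed
    have low: "- K \<le> H d n z" if z: "z \<in> space P" "generic n z" for z
    proof -
      interpret E: prob_space "esd n z" using eM[OF z(1)] by (rule M1_prob_space)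
      have "(\<integral>x. - cQ d \<partial>esd n z) \<le> (\<integral>x. Qa 0 d x \<partial>esd n z)"
        using Qa_ge[OF d] eM[OF z(1)] by (intro integral_mono M1_integrable_continuous Qa_continuous) (auto simp: M1_space)
      then have "- cQ d + ln (rr 0) / 2 \<le> Ji 0 d (esd n z)" using Ep_nonneg[of 0 "esd n z"] by (simp add: Ji_def E.prob_space)
      moreover have "ln (1 - rr 0) \<le> ln (1 - rr 0) / real n"
      proof -
        have "- ln (1 - rr 0) / real n \<le> - ln (1 - rr 0) / 1" using rr_bounds[of 0] n by (intro divide_left_mono) auto
        then show ?thesis by simp
      qed
      ultimately show ?thesis using H_ge_Ji[OF d n circ[OF z(1)] z(2), of 0] by (simp add: K_def)
    qed
    have usual: "Jr - 2 * \<delta> \<le> H d n z" if z: "z \<in> space P" "generic n z" "z \<notin> bad" for z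
    proof -
      have "Jr - \<delta> < Ji i d (esd n z)" using notbad[OF z(1,3)] by (simp add: G'_def)
      moreover have "- (C1 / real n) \<ge> - \<delta>" using elim by simp
      ultimately show ?thesis using H_ge_Ji[OF d n circ[OF z(1)] z(2), of i] by (simp add: C1_def)
    qed
    have ind: "integrable P (indicat_real hi)" "integrable P (indicat_real bad)"
      using sets by (simp_all add: emeasure_eq_measure)
    have "(\<integral>z. Jr - 2 * \<delta> + (\<epsilon> + 2 * \<delta>) * indicator hi z - D * indicator bad z \<partial>P) \<le> (\<integral>z. H d n z \<partial>P)"
    proof (rule integral_mono_AE)
      show "integrable P (\<lambda>z. Jr - 2 * \<delta> + (\<epsilon> + 2 * \<delta>) * indicator hi z - D * indicator bad z)"
        by (intro Bochner_Integration.integrable_add Bochner_Integration.integrable_diff integrable_mult_right integrable_const ind)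
      show "AE z in P. Jr - 2 * \<delta> + (\<epsilon> + 2 * \<delta>) * indicator hi z - D * indicator bad z \<le> H d n z"
        using gen AE_space
      proof eventually_elim
        case (elim z)
        have "\<epsilon> > 0" "\<delta> > 0" using \<epsilon> by (auto simp: \<delta>_def)
        then show ?case
          using low[OF elim(2,1)] usual[OF elim(2,1)] elim(2)
          by (cases "z \<in> hi"; cases "z \<in> bad") (auto simp: D_def hi_def \<epsilon>_def)
      qed
    qed (rule Hint)
    also have "(\<integral>z. Jr - 2 * \<delta> + (\<epsilon> + 2 * \<delta>) * indicator hi z - D * indicator bad z \<partial>P)
        = Jr - 2 * \<delta> + (\<epsilon> + 2 * \<delta>) * prob hi - D * prob bad"
    proof -
      have "hi \<inter> space P = hi" "bad \<inter> space P = bad" using sets by (simp_all add: sets.Int_space_eq2)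
      moreover have i1: "integrable P (\<lambda>z. (\<epsilon> + 2 * \<delta>) * indicat_real hi z)" "integrable P (\<lambda>z. D * indicat_real bad z)"
        by (intro integrable_mult_right ind)+
      have "integrable P (\<lambda>z. Jr - 2 * \<delta> + (\<epsilon> + 2 * \<delta>) * indicat_real hi z)"
        by (rule Bochner_Integration.integrable_add[OF integrable_const i1(1)])
      from Bochner_Integration.integral_diff[OF this i1(2)] Bochner_Integration.integral_add[OF integrable_const i1(1), of "Jr - 2 * \<delta>"]
      have "(\<integral>z. Jr - 2 * \<delta> + (\<epsilon> + 2 * \<delta>) * indicator hi z - D * indicator bad z \<partial>P)
          = (\<integral>z. Jr - 2 * \<delta> \<partial>P) + (\<integral>z. (\<epsilon> + 2 * \<delta>) * indicat_real hi z \<partial>P) - (\<integral>z. D * indicat_real bad z \<partial>P)"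
        by simp
      ultimately show ?thesis
        unfolding integral_mult_right_zero Bochner_Integration.integral_indicator by (simp add: prob_space)
    qed
    finally have "(\<epsilon> + 2 * \<delta>) * prob hi \<le> 2 * \<delta> + D * prob bad" using HJ by simp
    also have "D * prob bad \<le> D * (c1 / real n)" using pbad by (intro mult_left_mono) (auto simp: D_def)
    also have "D * (c1 / real n) \<le> \<epsilon> / 4" using elim by simp
    finally have "\<epsilon> * (5 / 4 * prob hi) \<le> \<epsilon> * (1 / 2)" by (simp add: \<delta>_def algebra_simps)
    then have phi: "prob hi \<le> 2/5" using \<epsilon>(1) by (subst (asm) mult_le_cancel_left_pos) auto
    define good where "good = space P - (hi \<union> bad)"
    have "prob (hi \<union> bad) \<le> prob hi + prob bad" by (rule measure_Un_le) (rule sets)+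
    also have "\<dots> \<le> 1/2" using phi order_trans[OF pbad \<open>c1 / real n \<le> 1/10\<close>] by linarith
    finally have "1/2 \<le> prob good" unfolding good_def using sets by (subst prob_compl) auto
    have [measurable]: "good \<in> sets P" unfolding good_def by measurable
    have gm: "(\<lambda>z. ennreal (Re (hweight b d n z)) * indicator G (esd n z)) \<in> borel_measurable (Pi\<^sub>M {..<n} (\<lambda>_. circle_borel))"
    proof -
      have "G \<in> sets (borel_of weak_topology)" using G(1) by (auto simp: sets_borel_of)
      then have "(\<lambda>z. indicator G (esd n z) :: ennreal) \<in> borel_measurable (Pi\<^sub>M {..<n} (\<lambda>_. circle_borel))"
        by (intro measurable_compose[OF esd_measurable[OF n]] borel_measurable_indicator)
      then show ?thesis using hweight_measurable by measurable
    qed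
    have "ennreal (exp (- (b * (real n)\<^sup>2 * a')) / 2) \<le> ennreal (exp (- (b * (real n)\<^sup>2 * a')) * prob good)"
      using \<open>1/2 \<le> prob good\<close> by (intro ennreal_leI) simp
    also have "\<dots> = (\<integral>\<^sup>+z. ennreal (exp (- (b * (real n)\<^sup>2 * a'))) * indicator good z \<partial>P)"
      by (simp add: nn_integral_cmult_indicator emeasure_eq_measure ennreal_mult)
    also have "\<dots> \<le> (\<integral>\<^sup>+z. ennreal (Re (hweight b d n z)) * indicator G (esd n z) \<partial>P)"
    proof (rule nn_integral_mono_AE)
      show "AE z in P. ennreal (exp (- (b * (real n)\<^sup>2 * a'))) * indicator good z \<le> ennreal (Re (hweight b d n z)) * indicator G (esd n z)"
        using gen AE_space
      proof eventually_elim
        case (elim z)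
        show ?case
        proof (cases "z \<in> good")
          case True
          then have "H d n z \<le> a'" "esd n z \<in> G" using notbad[of z] elim by (auto simp: good_def hi_def G'_def)
          moreover have "Re (hweight b d n z) = exp (- (b * (real n)\<^sup>2 * H d n z))"
            by (rule Re_hweight_generic[OF n circ[OF elim(2)] elim(1)])
          ultimately show ?thesis using b True by (auto intro!: ennreal_leI mult_left_mono)
        qed simp
      qed
    qed
    also have "\<dots> \<le> ennreal C ^ n * Zset b d n G"
      unfolding P_def Zset_def by (rule sample_le_haar[OF \<nu>(1) C(1) gm])
    finally have fin: "ennreal (exp (- (b * (real n)\<^sup>2 * a')) / 2) \<le> ennreal C ^ n * Zset b d n G" .
    have "ln C + ln 2 \<le> b * (a - a') * real n" using elim n by (simp add: field_simps)
    then have "(ln C + ln 2) * real n \<le> b * (a - a') * real n * real n" by (intro mult_right_mono) auto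
    then have 1: "real n * ln C + real n * ln 2 \<le> b * (real n)\<^sup>2 * a - b * (real n)\<^sup>2 * a'"
      by (simp add: algebra_simps power2_eq_square)
    have 2: "1 * ln 2 \<le> real n * ln (2::real)" using n by (intro mult_right_mono) auto
    have "real n * ln C + ln 2 \<le> b * (real n)\<^sup>2 * a - b * (real n)\<^sup>2 * a'"
      using 1 2 by linarith
    then have *: "exp (- (b * (real n)\<^sup>2 * a) + real n * ln C + ln 2) \<le> exp (- (b * (real n)\<^sup>2 * a'))" by simp
    have "C ^ n * exp (- (b * (real n)\<^sup>2 * a)) \<le> exp (- (b * (real n)\<^sup>2 * a')) / 2"
    proof -
      have "exp (real n * ln C) = C ^ n" "exp (ln 2) = (2::real)" using C(2) by (simp_all add: exp_of_nat_mult)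
      then have "exp (- (b * (real n)\<^sup>2 * a) + real n * ln C + ln 2) = exp (- (b * (real n)\<^sup>2 * a)) * C ^ n * 2"
        by (simp only: exp_add)
      then show ?thesis using * by (simp add: mult.commute)
    qed
    then have "ennreal (C ^ n * exp (- (b * (real n)\<^sup>2 * a))) \<le> ennreal C ^ n * Zset b d n G"
      using fin by (meson ennreal_leI order_trans)
    then have "ennreal (C ^ n) * ennreal (exp (- (b * (real n)\<^sup>2 * a))) \<le> ennreal (C ^ n) * Zset b d n G"
      using C(2) by (simp add: ennreal_mult ennreal_power)
    moreover have "0 < C ^ n" using C(2) by simp
    then have "ennreal (C ^ n) \<noteq> 0" "ennreal (C ^ n) \<noteq> top" by (simp_all only: ennreal_eq_0_iff not_le ennreal_neq_top not_False_eq_True)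
    ultimately show ?case by (metis ennreal_mult_le_mult_iff)
  qed
qed

text \<open>Smoothing supplies a measure of bounded density in the same open set and with energy below
  the same level.\<close>

lemma Zset_lower_bound:
  assumes "b > 0" "0 \<le> Re d" "openin weak_topology G" "\<mu> \<in> G" "J d \<mu> < ereal a"
  shows "\<forall>\<^sub>F n in sequentially. ennreal (exp (- (b * (real n)\<^sup>2 * a))) \<le> Zset b d n G"
proof -
  have M: "\<mu> \<in> M1" using openin_subset[OF assms(3)] assms(4) by (auto simp: topspace_weak_topology)
  obtain i where i: "smoothed \<mu> (rr i) \<in> G" "J d (smoothed \<mu> (rr i)) < ereal a" "en (smoothed \<mu> (rr i)) \<noteq> \<infinity>"
    "integrable (smoothed \<mu> (rr i)) (Qr d)"
    using smoothed_approximates[OF assms(2-5)] by metis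
  have r: "0 \<le> rr i" "rr i < 1" using rr_bounds[of i] by auto
  obtain C where C: "\<And>z. z \<in> circle \<Longrightarrow> poisson \<mu> (rr i) z \<le> C" using poisson_bound[OF M r] by blast
  have bd: "(\<integral>\<^sup>+z. g z \<partial>smoothed \<mu> (rr i)) \<le> ennreal (max 1 C) * (\<integral>\<^sup>+z. g z \<partial>haar)"
    if g: "g \<in> borel_measurable circle_borel" for g
  proof -
    have m: "poisson \<mu> (rr i) \<in> borel_measurable haar" "g \<in> borel_measurable haar"
      using g poisson_measurable[OF M r] by (simp_all add: M1_measurable_cong[OF haar_M1])
    have "(\<integral>\<^sup>+z. g z \<partial>smoothed \<mu> (rr i)) = (\<integral>\<^sup>+z. ennreal (poisson \<mu> (rr i) z) * g z \<partial>haar)"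
      unfolding smoothed_def using m by (intro nn_integral_density) auto
    also have "\<dots> \<le> (\<integral>\<^sup>+z. ennreal (max 1 C) * g z \<partial>haar)"
      using C by (intro nn_integral_mono mult_right_mono ennreal_leI) (auto simp: M1_space[OF haar_M1] le_max_iff_disj)
    also have "\<dots> = ennreal (max 1 C) * (\<integral>\<^sup>+z. g z \<partial>haar)" using m by (intro nn_integral_cmult)
    finally show ?thesis .
  qed
  show ?thesis
    by (rule Zset_lower_bound_bounded_density[OF assms(1,2) smoothed_M1[OF M r] i(3,4) bd _ assms(3) i(1,2)]) auto
qed

section \<open>Square roots in the right half plane\<close>

lemma csqrt_Re_Im:
  assumes "0 \<le> Re v" shows "\<bar>Im (csqrt v)\<bar> \<le> Re (csqrt v)"
proof -
  define p where "p = csqrt v"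
  have "p\<^sup>2 = v" by (simp add: p_def)
  then have "(Re p)\<^sup>2 - (Im p)\<^sup>2 = Re v" by (metis Re_power2)
  then have "(Im p)\<^sup>2 \<le> (Re p)\<^sup>2" using assms by simp
  moreover have "0 \<le> Re p" using csqrt_principal[of v] unfolding p_def by auto
  ultimately show ?thesis unfolding p_def[symmetric] by (metis abs_le_square_iff abs_of_nonneg)
qed

lemma csqrt_Re_Im_strict:
  assumes "0 < Re v" shows "\<bar>Im (csqrt v)\<bar> < Re (csqrt v)"
proof -
  define p where "p = csqrt v"
  have "p\<^sup>2 = v" by (simp add: p_def)
  then have "(Re p)\<^sup>2 - (Im p)\<^sup>2 = Re v" by (metis Re_power2)
  then have "(Im p)\<^sup>2 < (Re p)\<^sup>2" using assms by simp
  then have "\<bar>Im p\<bar> \<noteq> Re p" by (metis less_irrefl power2_abs)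
  moreover have "\<bar>Im p\<bar> \<le> Re p" unfolding p_def using assms by (intro csqrt_Re_Im) simp
  ultimately show ?thesis unfolding p_def[symmetric] by simp
qed

lemma Re_mult_sector:
  assumes "\<bar>Im p\<bar> \<le> Re p" "\<bar>Im q\<bar> \<le> Re q" shows "0 \<le> Re (p * q)" "0 \<le> Re (p * cnj q)"
proof -
  have "\<bar>Im p * Im q\<bar> \<le> Re p * Re q" unfolding abs_mult using assms by (intro mult_mono) auto
  then show "0 \<le> Re (p * q)" "0 \<le> Re (p * cnj q)" by (auto simp: abs_le_iff)
qed

lemma Re_mult_sector_strict:
  assumes "\<bar>Im p\<bar> < Re p" "\<bar>Im q\<bar> < Re q" shows "0 < Re (p * q)"
proof -
  have "\<bar>Im p * Im q\<bar> < Re p * Re q" unfolding abs_mult using assms by (intro mult_strict_mono) auto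
  then show ?thesis by (auto simp: abs_less_iff)
qed

text \<open>Roots of numbers in the right half plane lie in the sector \<open>|Im p| \<le> Re p\<close>,
  and there \<open>|p - q| \<le> |p + q|\<close>.\<close>

lemma csqrt_Hoelder:
  assumes "0 \<le> Re v" "0 \<le> Re w" shows "cmod (csqrt v - csqrt w) \<le> sqrt (cmod (v - w))"
proof -
  define p q where "p = csqrt v" "q = csqrt w"
  have "0 \<le> Re (p * cnj q)" unfolding p_q_def using assms by (intro Re_mult_sector csqrt_Re_Im)
  then have "(cmod (p - q))\<^sup>2 \<le> (cmod (p + q))\<^sup>2"
    unfolding cmod_power2 by (simp add: power2_eq_square algebra_simps)
  then have "cmod (p - q) \<le> cmod (p + q)" by (rule power2_le_imp_le) simp
  then have "cmod (p - q) * cmod (p - q) \<le> cmod (p - q) * cmod (p + q)" by (intro mult_left_mono) auto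
  also have "\<dots> = cmod (p\<^sup>2 - q\<^sup>2)" by (simp add: norm_mult[symmetric] power2_eq_square algebra_simps)
  also have "p\<^sup>2 - q\<^sup>2 = v - w" by (simp add: p_q_def)
  finally have "(cmod (p - q))\<^sup>2 \<le> cmod (v - w)" by (simp add: power2_eq_square)
  then show ?thesis unfolding p_q_def by (rule real_le_rsqrt)
qed

lemma csqrt_one_minus_cis:
  assumes "0 \<le> \<psi>" "\<psi> \<le> 2 * pi"
  shows "csqrt (1 - cis \<psi>) = of_real (sqrt (2 * sin (\<psi> / 2))) * cis ((\<psi> - pi) / 4)"
proof (cases "\<psi> = 0 \<or> \<psi> = 2 * pi")
  case True
  then show ?thesis by auto
next
  case False
  then have p: "0 < \<psi>" "\<psi> < 2 * pi" using assms by auto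
  have s: "sin (\<psi> / 2) > 0" using p by (intro sin_gt_zero) auto
  have c: "cos ((\<psi> - pi) / 4) > 0" using p by (intro cos_gt_zero_pi) auto
  show ?thesis
  proof (rule csqrt_unique)
    have "(of_real (sqrt (2 * sin (\<psi> / 2))) * cis ((\<psi> - pi) / 4))\<^sup>2
        = of_real ((sqrt (2 * sin (\<psi> / 2)))\<^sup>2) * (cis ((\<psi> - pi) / 4))\<^sup>2"
      by (simp add: power_mult_distrib)
    also have "(sqrt (2 * sin (\<psi> / 2)))\<^sup>2 = 2 * sin (\<psi> / 2)" using s by simp
    also have "(cis ((\<psi> - pi) / 4))\<^sup>2 = cis ((\<psi> - pi) / 2)"
      unfolding power2_eq_square cis_mult by (rule arg_cong[of _ _ cis]) (simp add: field_simps)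
    finally show "(of_real (sqrt (2 * sin (\<psi> / 2))) * cis ((\<psi> - pi) / 4))\<^sup>2 = 1 - cis \<psi>"
      by (simp only: one_minus_cis)
    show "0 < Re (of_real (sqrt (2 * sin (\<psi> / 2))) * cis ((\<psi> - pi) / 4)) \<or>
        Re (of_real (sqrt (2 * sin (\<psi> / 2))) * cis ((\<psi> - pi) / 4)) = 0 \<and>
        0 \<le> Im (of_real (sqrt (2 * sin (\<psi> / 2))) * cis ((\<psi> - pi) / 4))"
      using s c by simp
  qed
qed


section \<open>The Herglotz function of the equilibrium measure\<close>

text \<open>The support is the arc from \<open>phi1\<close> to \<open>2 pi + phi2\<close>; the gap around 1 has the end points \<open>cis phi1\<close>
  and \<open>cis phi2\<close>. On the circle \<open>(d + cnj d z) / (1 - z)\<close> is \<open>-\<i>\<close> times the angular derivative of the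
  potential, so the Euler-Lagrange equation says that adding it to the Herglotz function \<open>Fd\<close> of the
  measure gives a function that is real on the support; the sum is \<open>(1 + d) Sd / (1 - z)\<close>, with \<open>Sd\<close>
  the square root branching at the two end points. The imaginary part of \<open>Hd\<close> has the same boundary
  values as that of this sum.\<close>

definition phi1 :: "complex \<Rightarrow> real" where "phi1 d = xi_d d + theta_d d"
definition phi2 :: "complex \<Rightarrow> real" where "phi2 d = xi_d d - theta_d d"

definition Sd :: "complex \<Rightarrow> complex \<Rightarrow> complex"
  where "Sd d z = csqrt (1 - z * cis (- phi1 d)) * csqrt (1 - z * cis (- phi2 d))"

definition Fd :: "complex \<Rightarrow> complex \<Rightarrow> complex"
  where "Fd d z = ((1 + d) * Sd d z - d - cnj d * z) / (1 - z)"

definition Hd :: "complex \<Rightarrow> complex \<Rightarrow> complex"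
  where "Hd d z = ((1 + d) * Sd d z - d + cnj d * z) / (1 - z)"

context
  fixes d :: complex
  assumes d: "0 \<le> Re d"
begin

lemma one_plus_d: "1 + d \<noteq> 0" "1 + cnj d \<noteq> 0" "0 < cmod (1 + d)"
  using d by (auto simp: complex_eq_iff)

lemma phi_bounds: "0 \<le> phi1 d" "phi1 d < 2 * pi" "phi2 d \<le> 0" "- 2 * pi < phi2 d" "phi1 d - phi2 d < 2 * pi" "phi2 d \<le> phi1 d"
  using theta_d_eq(2,3)[OF d] xi_d_eq(2,3)[OF d] by (auto simp: phi1_def phi2_def)

lemma one_plus_d_polar: "1 + d = of_real (cmod (1 + d)) * cis (xi_d d / 2)"
  using one_plus_d(1) rcis_cmod_Arg[of "1 + d"] by (simp add: xi_d_eq(1)[OF d] rcis_def)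

lemma Re_factor_nonneg: "cmod z \<le> 1 \<Longrightarrow> 0 \<le> Re (1 - z * cis t)"
  using complex_Re_le_cmod[of "z * cis t"] by (simp add: norm_mult)

lemma Re_factor_pos: "cmod z < 1 \<Longrightarrow> 0 < Re (1 - z * cis t)"
  using complex_Re_le_cmod[of "z * cis t"] by (simp add: norm_mult)

lemma Re_Sd_nonneg: "cmod z \<le> 1 \<Longrightarrow> 0 \<le> Re (Sd d z)"
  unfolding Sd_def by (intro Re_mult_sector csqrt_Re_Im Re_factor_nonneg)

lemma Re_Sd_pos: "cmod z < 1 \<Longrightarrow> 0 < Re (Sd d z)"
  unfolding Sd_def by (intro Re_mult_sector_strict csqrt_Re_Im_strict Re_factor_pos)

text \<open>The end points enter only through their sum and product, which are rational in
  \<open>d\<close> and \<open>cnj d\<close>.\<close>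

lemma Sd_sq: "((1 + d) * Sd d z)\<^sup>2 = ((1 + d) - (1 + cnj d) * z)\<^sup>2 + 4 * of_real ((cmod d)\<^sup>2) * z"
proof -
  define u where "u = (1 + cnj d) / (1 + d)"
  have cx: "cis (- xi_d d) = u"
  proof -
    have "cis (- xi_d d) = cnj (cis (xi_d d))" by (simp add: cis_cnj)
    also have "\<dots> = u" unfolding xi_d_eq(4)[OF d] u_def by simp
    finally show ?thesis .
  qed
  have ct: "cos (theta_d d) = 1 - 2 * (cmod d)\<^sup>2 / (cmod (1 + d))\<^sup>2"
    using cos_double_sin[of "theta_d d / 2"] theta_d_eq(4)[OF d] by (simp add: norm_divide power_divide)
  have "cis (- phi1 d) + cis (- phi2 d) = cis (- xi_d d) * (cis (- theta_d d) + cis (theta_d d))"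
    by (simp add: phi1_def phi2_def cis_mult ring_distribs)
  also have "cis (- theta_d d) + cis (theta_d d) = of_real (2 * cos (theta_d d))" by (simp add: complex_eq_iff)
  finally have s: "cis (- phi1 d) + cis (- phi2 d) = u * of_real (2 * cos (theta_d d))" by (simp only: cx)
  have p: "cis (- phi1 d) * cis (- phi2 d) = u * u"
    unfolding cx[symmetric] cis_mult by (simp add: phi1_def phi2_def)
  have "(Sd d z)\<^sup>2 = (1 - z * cis (- phi1 d)) * (1 - z * cis (- phi2 d))"
    by (simp add: Sd_def power_mult_distrib)
  also have "\<dots> = 1 - z * (cis (- phi1 d) + cis (- phi2 d)) + z\<^sup>2 * (cis (- phi1 d) * cis (- phi2 d))"
    by (simp add: power2_eq_square algebra_simps)
  finally have S: "(Sd d z)\<^sup>2 = 1 - z * (u * of_real (2 * cos (theta_d d))) + z\<^sup>2 * (u * u)" by (simp only: s p)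
  have Au: "(1 + d) * u = 1 + cnj d" using one_plus_d by (simp add: u_def)
  have nn: "of_real ((cmod (1 + d))\<^sup>2) = (1 + d) * (1 + cnj d)" unfolding complex_norm_square by simp
  have "((1 + d) * Sd d z)\<^sup>2 = (1 + d)\<^sup>2 - z * ((1 + d) * ((1 + d) * u) * of_real (2 * cos (theta_d d))) + z\<^sup>2 * (((1 + d) * u) * ((1 + d) * u))"
    unfolding power_mult_distrib S by (simp add: power2_eq_square algebra_simps)
  also have "(1 + d) * ((1 + d) * u) * of_real (2 * cos (theta_d d)) = of_real (2 * ((cmod (1 + d))\<^sup>2 - 2 * (cmod d)\<^sup>2))"
  proof -
    have "(1 + d) * ((1 + d) * u) * of_real (2 * cos (theta_d d)) = of_real ((cmod (1 + d))\<^sup>2 * (2 * cos (theta_d d)))"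
      unfolding Au nn[symmetric] by simp
    also have "(cmod (1 + d))\<^sup>2 * (2 * cos (theta_d d)) = 2 * ((cmod (1 + d))\<^sup>2 - 2 * (cmod d)\<^sup>2)"
      unfolding ct using one_plus_d by (simp add: field_simps)
    finally show ?thesis .
  qed
  also have "of_real (2 * ((cmod (1 + d))\<^sup>2 - 2 * (cmod d)\<^sup>2)) = 2 * ((1 + d) * (1 + cnj d)) - 4 * of_real ((cmod d)\<^sup>2)"
    unfolding nn[symmetric] by simp
  finally show ?thesis unfolding Au by (simp add: power2_eq_square algebra_simps)
qed

text \<open>Boundary values of \<open>(1 + d) Sd / (1 - z)\<close>, with the angles from the two branch points reduced to
  \<open>[0, 2 pi]\<close>.\<close>

lemma boundary_value:
  assumes "0 \<le> \<psi>1" "\<psi>1 \<le> 2 * pi" "0 \<le> \<psi>2" "\<psi>2 \<le> 2 * pi" "0 < \<theta>" "\<theta> < 2 * pi"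
    and "cis \<psi>1 = cis (\<theta> - phi1 d)" "cis \<psi>2 = cis (\<theta> - phi2 d)"
  shows "(1 + d) * Sd d (cis \<theta>) / (1 - cis \<theta>)
    = of_real (cmod (1 + d) * sqrt (sin (\<psi>1 / 2) * sin (\<psi>2 / 2)) / sin (\<theta> / 2)) * cis ((\<psi>1 + \<psi>2 - 2 * (\<theta> - xi_d d)) / 4)"
proof -
  have s: "sin (\<theta> / 2) > 0" using assms by (intro sin_gt_zero) auto
  have "Sd d (cis \<theta>) = csqrt (1 - cis \<psi>1) * csqrt (1 - cis \<psi>2)"
    unfolding Sd_def cis_mult assms(7,8) by simp
  also have "\<dots> = of_real (sqrt (2 * sin (\<psi>1 / 2)) * sqrt (2 * sin (\<psi>2 / 2))) * (cis ((\<psi>1 - pi) / 4) * cis ((\<psi>2 - pi) / 4))"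
    unfolding csqrt_one_minus_cis[OF assms(1,2)] csqrt_one_minus_cis[OF assms(3,4)] by simp
  also have "sqrt (2 * sin (\<psi>1 / 2)) * sqrt (2 * sin (\<psi>2 / 2)) = 2 * sqrt (sin (\<psi>1 / 2) * sin (\<psi>2 / 2))"
    by (simp add: real_sqrt_mult)
  finally have S: "Sd d (cis \<theta>) = of_real (2 * sqrt (sin (\<psi>1 / 2) * sin (\<psi>2 / 2))) * (cis ((\<psi>1 - pi) / 4) * cis ((\<psi>2 - pi) / 4))" .
  have "(1 + d) * Sd d (cis \<theta>) / (1 - cis \<theta>)
      = (of_real (cmod (1 + d)) * of_real (2 * sqrt (sin (\<psi>1 / 2) * sin (\<psi>2 / 2))) / of_real (2 * sin (\<theta> / 2)))
        * (cis (xi_d d / 2) * (cis ((\<psi>1 - pi) / 4) * cis ((\<psi>2 - pi) / 4)) / cis ((\<theta> - pi) / 2))"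
  proof -
    have pol: "(1 + d) * Y = of_real (cmod (1 + d)) * cis (xi_d d / 2) * Y" for Y
      by (rule arg_cong[OF one_plus_d_polar, of "\<lambda>v. v * Y"])
    show ?thesis unfolding S one_minus_cis pol by (simp add: field_simps)
  qed
  also have "cis (xi_d d / 2) * (cis ((\<psi>1 - pi) / 4) * cis ((\<psi>2 - pi) / 4)) / cis ((\<theta> - pi) / 2)
      = cis ((\<psi>1 + \<psi>2 - 2 * (\<theta> - xi_d d)) / 4)"
    unfolding cis_mult cis_divide by (rule arg_cong[of _ _ cis]) (simp add: field_simps)
  also have "of_real (cmod (1 + d)) * of_real (2 * sqrt (sin (\<psi>1 / 2) * sin (\<psi>2 / 2))) / of_real (2 * sin (\<theta> / 2))
      = (of_real (cmod (1 + d) * sqrt (sin (\<psi>1 / 2) * sin (\<psi>2 / 2)) / sin (\<theta> / 2)) :: complex)"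
    by simp
  finally show ?thesis .
qed

lemma sin_product: "sin ((\<theta> - phi1 d) / 2) * sin ((\<theta> - phi2 d) / 2) = (sin ((\<theta> - xi_d d) / 2))\<^sup>2 - (sin (theta_d d / 2))\<^sup>2"
proof -
  define x y where "x = (\<theta> - xi_d d) / 2" "y = theta_d d / 2"
  have e: "(\<theta> - phi1 d) / 2 = x - y" "(\<theta> - phi2 d) / 2 = x + y" by (auto simp: phi1_def phi2_def x_y_def field_simps)
  have "sin (x - y) * sin (x + y) = (sin x)\<^sup>2 * (cos y)\<^sup>2 - (cos x)\<^sup>2 * (sin y)\<^sup>2"
    by (simp add: sin_add sin_diff power2_eq_square algebra_simps)
  also have "\<dots> = (sin x)\<^sup>2 - (sin y)\<^sup>2" unfolding cos_squared_eq by (simp add: algebra_simps)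
  finally show ?thesis unfolding e by (simp only: x_y_def)
qed

lemma boundary_value_support:
  assumes "phi1 d \<le> \<theta>" "\<theta> \<le> 2 * pi + phi2 d" "0 < \<theta>" "\<theta> < 2 * pi"
  shows "(1 + d) * Sd d (cis \<theta>) / (1 - cis \<theta>)
    = of_real (cmod (1 + d) * sqrt ((sin ((\<theta> - xi_d d) / 2))\<^sup>2 - (sin (theta_d d / 2))\<^sup>2) / sin (\<theta> / 2))"
  using boundary_value[of "\<theta> - phi1 d" "\<theta> - phi2 d" \<theta>] assms phi_bounds
  unfolding sin_product by (simp add: phi1_def phi2_def)

lemma boundary_value_left_gap:
  assumes "0 < \<theta>" "\<theta> < phi1 d"
  obtains x where "0 \<le> x" "(1 + d) * Sd d (cis \<theta>) / (1 - cis \<theta>) = \<i> * of_real x"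
proof -
  define \<psi>1 \<psi>2 where "\<psi>1 = \<theta> - phi1 d + 2 * pi" "\<psi>2 = \<theta> - phi2 d"
  have b: "0 \<le> \<psi>1" "\<psi>1 \<le> 2 * pi" "0 \<le> \<psi>2" "\<psi>2 \<le> 2 * pi" using assms phi_bounds by (auto simp: \<psi>1_\<psi>2_def)
  have t: "\<theta> < 2 * pi" using assms phi_bounds by simp
  have c: "cis \<psi>1 = cis (\<theta> - phi1 d)" unfolding \<psi>1_\<psi>2_def by (simp add: cis_mult[symmetric])
  have e: "(\<psi>1 + \<psi>2 - 2 * (\<theta> - xi_d d)) / 4 = pi / 2" by (simp add: \<psi>1_\<psi>2_def phi1_def phi2_def)
  have i: "cis (pi / 2) = \<i>" by (simp add: complex_eq_iff)
  have "(1 + d) * Sd d (cis \<theta>) / (1 - cis \<theta>)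
      = of_real (cmod (1 + d) * sqrt (sin (\<psi>1 / 2) * sin (\<psi>2 / 2)) / sin (\<theta> / 2)) * \<i>"
    using boundary_value[OF b assms(1) t c] unfolding e i by (simp only: \<psi>1_\<psi>2_def)
  moreover have "0 \<le> sin (\<psi>1 / 2)" "0 \<le> sin (\<psi>2 / 2)" "0 < sin (\<theta> / 2)"
    using b assms t by (auto intro!: sin_ge_zero sin_gt_zero)
  then have "0 \<le> cmod (1 + d) * sqrt (sin (\<psi>1 / 2) * sin (\<psi>2 / 2)) / sin (\<theta> / 2)" by simp
  ultimately show ?thesis using that by (metis mult.commute)
qed

lemma boundary_value_right_gap:
  assumes "2 * pi + phi2 d < \<theta>" "\<theta> < 2 * pi"
  obtains x where "0 \<le> x" "(1 + d) * Sd d (cis \<theta>) / (1 - cis \<theta>) = - \<i> * of_real x"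
proof -
  define \<psi>1 \<psi>2 where "\<psi>1 = \<theta> - phi1 d" "\<psi>2 = \<theta> - phi2 d - 2 * pi"
  have b: "0 \<le> \<psi>1" "\<psi>1 \<le> 2 * pi" "0 \<le> \<psi>2" "\<psi>2 \<le> 2 * pi" using assms phi_bounds by (auto simp: \<psi>1_\<psi>2_def)
  have t: "0 < \<theta>" using assms phi_bounds by simp
  have c: "cis \<psi>2 = cis (\<theta> - phi2 d)" unfolding \<psi>1_\<psi>2_def by (simp add: cis_divide[symmetric])
  have e: "(\<psi>1 + \<psi>2 - 2 * (\<theta> - xi_d d)) / 4 = - (pi / 2)" by (simp add: \<psi>1_\<psi>2_def phi1_def phi2_def)
  have i: "cis (- (pi / 2)) = - \<i>" by (simp add: complex_eq_iff)
  have "(1 + d) * Sd d (cis \<theta>) / (1 - cis \<theta>)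
      = of_real (cmod (1 + d) * sqrt (sin (\<psi>1 / 2) * sin (\<psi>2 / 2)) / sin (\<theta> / 2)) * (- \<i>)"
    using boundary_value[OF b t assms(2) _ c] unfolding e i by (simp only: \<psi>1_\<psi>2_def)
  moreover have "0 \<le> sin (\<psi>1 / 2)" "0 \<le> sin (\<psi>2 / 2)" "0 < sin (\<theta> / 2)"
    using b assms t by (auto intro!: sin_ge_zero sin_gt_zero)
  then have "0 \<le> cmod (1 + d) * sqrt (sin (\<psi>1 / 2) * sin (\<psi>2 / 2)) / sin (\<theta> / 2)" by simp
  ultimately show ?thesis using that by (metis mult.commute)
qed

lemma cmod_one_plus_alpha: "cmod (1 + alpha_d d) = 1 / cmod (1 + d)"
proof -
  have "1 + alpha_d d = 1 / cnj (1 + d)" using one_plus_d by (simp add: alpha_d_def field_simps)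
  then show ?thesis by (simp only: norm_divide complex_mod_cnj norm_one)
qed

lemma w_d_eq_Re:
  assumes "0 < \<theta>" "\<theta> < 2 * pi"
  shows "w_d d \<theta> = Re ((1 + d) * Sd d (cis \<theta>) / (1 - cis \<theta>))"
proof -
  consider "\<theta> < phi1 d" | "2 * pi + phi2 d < \<theta>" | "phi1 d \<le> \<theta>" "\<theta> \<le> 2 * pi + phi2 d" by linarith
  then show ?thesis
  proof cases
    case 1
    then have "w_d d \<theta> = 0" by (simp add: w_d_def phi1_def)
    moreover obtain x where "(1 + d) * Sd d (cis \<theta>) / (1 - cis \<theta>) = \<i> * of_real x"
      using boundary_value_left_gap[OF assms(1) 1] by blast
    ultimately show ?thesis by (simp only:) simp
  next
    case 2
    then have "w_d d \<theta> = 0" by (simp add: w_d_def phi2_def)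
    moreover obtain x where "(1 + d) * Sd d (cis \<theta>) / (1 - cis \<theta>) = - \<i> * of_real x"
      using boundary_value_right_gap[OF 2 assms(2)] by blast
    ultimately show ?thesis by (simp only:) simp
  next
    case 3
    have e: "sqrt ((sin ((\<theta> - xi_d d) / 2))\<^sup>2 - (sin (theta_d d / 2))\<^sup>2) = 0" if "\<theta> = phi1 d \<or> \<theta> = 2 * pi + phi2 d"
    proof -
      have "sin ((\<theta> - phi1 d) / 2) * sin ((\<theta> - phi2 d) / 2) = 0" using that by auto
      then show ?thesis unfolding sin_product by simp
    qed
    have "w_d d \<theta> = cmod (1 + d) * sqrt ((sin ((\<theta> - xi_d d) / 2))\<^sup>2 - (sin (theta_d d / 2))\<^sup>2) / sin (\<theta> / 2)"
    proof (cases "\<theta> = phi1 d \<or> \<theta> = 2 * pi + phi2 d")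
      case True
      then have "w_d d \<theta> = 0" by (auto simp: w_d_def phi1_def phi2_def)
      then show ?thesis using e[OF True] by simp
    next
      case False
      then have "theta_d d + xi_d d < \<theta>" "\<theta> < 2 * pi - theta_d d + xi_d d" using 3 by (auto simp: phi1_def phi2_def)
      then show ?thesis using one_plus_d by (simp add: w_d_def cmod_one_plus_alpha field_simps)
    qed
    then show ?thesis unfolding boundary_value_support[OF 3 assms] by simp
  qed
qed

lemma w_d_nonneg: "0 < \<theta> \<Longrightarrow> \<theta> < 2 * pi \<Longrightarrow> 0 \<le> w_d d \<theta>"
proof (cases "phi1 d < \<theta> \<and> \<theta> < 2 * pi + phi2 d")
  case True
  assume t: "0 < \<theta>" "\<theta> < 2 * pi"
  have "0 \<le> sin ((\<theta> - phi1 d) / 2) * sin ((\<theta> - phi2 d) / 2)"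
    using True t phi_bounds by (intro mult_nonneg_nonneg sin_ge_zero) auto
  then show ?thesis
    unfolding sin_product w_d_def using sin_gt_zero[of "\<theta> / 2"] t by simp
qed (auto simp: w_d_def phi1_def phi2_def)

text \<open>At 1 the square root has the value that cancels the pole of \<open>Fd\<close>.\<close>

lemma Sd_1: "(1 + d) * Sd d 1 = of_real (2 * Re d)"
proof -
  define x where "x = cmod (1 + d) * (sqrt (2 * sin (phi1 d / 2)) * sqrt (2 * sin (- phi2 d / 2)))"
  have s: "0 \<le> sin (phi1 d / 2)" "0 \<le> sin (- phi2 d / 2)"
    using phi_bounds by (intro sin_ge_zero; simp)+
  then have x0: "0 \<le> x" by (simp add: x_def)
  have "csqrt (1 - cis (- phi1 d)) = cnj (csqrt (1 - cis (phi1 d)))"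
  proof -
    have "1 - cis (- phi1 d) = cnj (1 - cis (phi1 d))" by (simp add: cis_cnj)
    moreover have "1 - cis (phi1 d) \<notin> \<real>\<^sub>\<le>\<^sub>0 \<or> 1 - cis (phi1 d) = 0"
      using Re_one_minus_pos(2)[of "cis (phi1 d)"] by (cases "cis (phi1 d) = 1") auto
    ultimately show ?thesis using cnj_csqrt[of "1 - cis (phi1 d)"] by auto
  qed
  also have "\<dots> = of_real (sqrt (2 * sin (phi1 d / 2))) * cis (- ((phi1 d - pi) / 4))"
    using phi_bounds by (simp add: csqrt_one_minus_cis cis_cnj)
  finally have 1: "csqrt (1 - cis (- phi1 d)) = of_real (sqrt (2 * sin (phi1 d / 2))) * cis (- ((phi1 d - pi) / 4))" .
  have 2: "csqrt (1 - cis (- phi2 d)) = of_real (sqrt (2 * sin (- phi2 d / 2))) * cis ((- phi2 d - pi) / 4)"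
    using phi_bounds by (intro csqrt_one_minus_cis) auto
  have "cis (xi_d d / 2) * (cis (- ((phi1 d - pi) / 4)) * cis ((- phi2 d - pi) / 4)) = cis 0"
    unfolding cis_mult by (rule arg_cong[of _ _ cis]) (simp add: phi1_def phi2_def field_simps)
  then have ph: "cis (xi_d d / 2) * (cis (- ((phi1 d - pi) / 4)) * cis ((- phi2 d - pi) / 4)) = 1" by simp
  have "(1 + d) * Sd d 1 = of_real x * (cis (xi_d d / 2) * (cis (- ((phi1 d - pi) / 4)) * cis ((- phi2 d - pi) / 4)))"
  proof -
    have "(1 + d) * Y = of_real (cmod (1 + d)) * cis (xi_d d / 2) * Y" for Y
      by (rule arg_cong[OF one_plus_d_polar, of "\<lambda>v. v * Y"])
    from this[of "csqrt (1 - cis (- phi1 d)) * csqrt (1 - cis (- phi2 d))"]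
    have "(1 + d) * Sd d 1 = of_real (cmod (1 + d)) * cis (xi_d d / 2) * (csqrt (1 - cis (- phi1 d)) * csqrt (1 - cis (- phi2 d)))"
      by (simp only: Sd_def mult_1)
    then show ?thesis unfolding 1 2 x_def by (simp only: of_real_mult mult_ac)
  qed
  then have eq: "(1 + d) * Sd d 1 = of_real x" unfolding ph by simp
  have "of_real (x\<^sup>2) = ((1 + d) - (1 + cnj d) * 1)\<^sup>2 + 4 * of_real ((cmod d)\<^sup>2) * 1"
    using Sd_sq[of 1] unfolding eq by simp
  also have "\<dots> = of_real ((2 * Re d)\<^sup>2)"
    unfolding complex_norm_square by (simp add: complex_eq_iff power2_eq_square algebra_simps)
  finally have "x\<^sup>2 = (2 * Re d)\<^sup>2" by (simp only: of_real_eq_iff)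
  then have "x = 2 * Re d" by (rule power2_eq_imp_eq) (use x0 d in auto)
  then show ?thesis by (simp add: eq)
qed

lemma csqrt_factor_le: "cmod z \<le> 1 \<Longrightarrow> cmod (csqrt (1 - z * cis t)) \<le> 2"
proof -
  assume "cmod z \<le> 1"
  then have "cmod (1 - z * cis t) \<le> 2" using norm_triangle_ineq4[of 1 "z * cis t"] by (simp add: norm_mult)
  then have "sqrt (cmod (1 - z * cis t)) \<le> sqrt 4" by (intro real_sqrt_le_mono) simp
  then show ?thesis by simp
qed

lemma csqrt_factor_Hoelder:
  assumes "cmod z \<le> 1" "cmod w \<le> 1"
  shows "cmod (csqrt (1 - z * cis t) - csqrt (1 - w * cis t)) \<le> sqrt (cmod (z - w))"
proof -
  have "cmod ((1 - z * cis t) - (1 - w * cis t)) = cmod (z - w)"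
    by (simp add: left_diff_distrib[symmetric] norm_mult norm_minus_commute)
  then show ?thesis using csqrt_Hoelder[OF Re_factor_nonneg[OF assms(1), of t] Re_factor_nonneg[OF assms(2), of t]] by simp
qed

lemma Sd_Hoelder:
  assumes "cmod z \<le> 1" "cmod w \<le> 1" shows "cmod (Sd d z - Sd d w) \<le> 4 * sqrt (cmod (z - w))"
proof -
  let ?p = "\<lambda>z. csqrt (1 - z * cis (- phi1 d))" and ?q = "\<lambda>z. csqrt (1 - z * cis (- phi2 d))"
  have "Sd d z - Sd d w = (?p z - ?p w) * ?q z + ?p w * (?q z - ?q w)" by (simp add: Sd_def algebra_simps)
  also have "cmod \<dots> \<le> cmod (?p z - ?p w) * cmod (?q z) + cmod (?p w) * cmod (?q z - ?q w)"
    by (rule order_trans[OF norm_triangle_ineq]) (simp add: norm_mult)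
  also have "\<dots> \<le> sqrt (cmod (z - w)) * 2 + 2 * sqrt (cmod (z - w))"
    using assms by (intro add_mono mult_mono csqrt_factor_Hoelder csqrt_factor_le) auto
  finally show ?thesis by simp
qed

lemma Sd_continuous: "continuous_on (cball 0 1) (Sd d)"
proof -
  have "continuous_on (cball 0 1) (\<lambda>z. csqrt (1 - z * cis t))" for t
    unfolding continuous_on_iff
  proof (intro ballI allI impI)
    fix z :: complex and e :: real assume z: "z \<in> cball 0 1" "e > 0"
    show "\<exists>\<delta>>0. \<forall>w\<in>cball 0 1. dist w z < \<delta> \<longrightarrow> dist (csqrt (1 - w * cis t)) (csqrt (1 - z * cis t)) < e"
    proof (intro exI[of _ "e\<^sup>2"] conjI ballI impI)
      fix w :: complex assume w: "w \<in> cball 0 1" "dist w z < e\<^sup>2"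
      have "dist (csqrt (1 - w * cis t)) (csqrt (1 - z * cis t)) \<le> sqrt (cmod (w - z))"
        unfolding dist_norm using w z by (intro csqrt_factor_Hoelder) auto
      also have "\<dots> < sqrt (e\<^sup>2)" using w(2) by (intro real_sqrt_less_mono) (simp add: dist_norm)
      finally show "dist (csqrt (1 - w * cis t)) (csqrt (1 - z * cis t)) < e" using z by simp
    qed (use z in simp)
  qed
  then show ?thesis unfolding Sd_def[abs_def] by (intro continuous_intros)
qed

text \<open>The numerator vanishes at 1, and is Hoelder continuous with exponent \<open>1/2\<close> as
  the square root is.\<close>

lemma Fd_bound: "\<exists>C\<ge>0. \<forall>z. cmod z \<le> 1 \<longrightarrow> z \<noteq> 1 \<longrightarrow> cmod (Fd d z) \<le> C / sqrt (cmod (1 - z))"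
proof (intro exI[of _ "4 * cmod (1 + d) + 2 * cmod d"] conjI allI impI)
  fix z assume z: "cmod z \<le> 1" "z \<noteq> 1"
  define t where "t = sqrt (cmod (1 - z))"
  have t0: "t > 0" using z by (simp add: t_def)
  have tt: "cmod (1 - z) = t * t" by (simp add: t_def)
  have "cmod (1 - z) \<le> 2" using norm_triangle_ineq4[of 1 z] z by simp
  then have "t \<le> sqrt 4" unfolding t_def by (intro real_sqrt_le_mono) simp
  then have t2: "t \<le> 2" by simp
  have "d + cnj d = of_real (2 * Re d)" by (simp add: complex_add_cnj)
  then have "(1 + d) * Sd d z - d - cnj d * z = (1 + d) * (Sd d z - Sd d 1) + cnj d * (1 - z)"
    using Sd_1 by (simp add: algebra_simps)
  also have "cmod \<dots> \<le> cmod (1 + d) * cmod (Sd d z - Sd d 1) + cmod d * cmod (1 - z)"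
    by (rule order_trans[OF norm_triangle_ineq]) (simp add: norm_mult)
  also have "\<dots> \<le> cmod (1 + d) * (4 * t) + cmod d * (2 * t)"
  proof (intro add_mono mult_left_mono)
    show "cmod (Sd d z - Sd d 1) \<le> 4 * t" using Sd_Hoelder[of z 1] z by (simp add: t_def norm_minus_commute)
    show "cmod (1 - z) \<le> 2 * t" unfolding tt using t2 t0 by (intro mult_right_mono) auto
  qed auto
  also have "\<dots> = (4 * cmod (1 + d) + 2 * cmod d) * t" by (simp add: algebra_simps)
  finally have N: "cmod ((1 + d) * Sd d z - d - cnj d * z) \<le> (4 * cmod (1 + d) + 2 * cmod d) * t" .
  have "cmod (Fd d z) \<le> ((4 * cmod (1 + d) + 2 * cmod d) * t) / (t * t)"
    unfolding Fd_def norm_divide tt using N t0 by (intro divide_right_mono) auto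
  then show "cmod (Fd d z) \<le> (4 * cmod (1 + d) + 2 * cmod d) / sqrt (cmod (1 - z))"
    unfolding t_def[symmetric] using t0 by simp
qed simp

lemma Sd_holomorphic: "Sd d holomorphic_on ball 0 1"
proof -
  have "1 - z * cis t \<notin> \<real>\<^sub>\<le>\<^sub>0" if "z \<in> ball 0 1" for z t
    using Re_factor_pos[of z t] that by (auto simp: complex_nonpos_Reals_iff)
  then show ?thesis unfolding Sd_def[abs_def] by (intro holomorphic_intros) auto
qed

lemma Fd_holomorphic: "Fd d holomorphic_on ball 0 1"
  unfolding Fd_def[abs_def] by (intro holomorphic_intros Sd_holomorphic) auto

lemma Fd_0: "Fd d 0 = 1" by (simp add: Fd_def Sd_def)

text \<open>On the circle \<open>(d + cnj d z) / (1 - z)\<close> is imaginary and \<open>(cnj d z - d) /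
  (1 - z)\<close> is real.\<close>

lemma Re_Fd_circle:
  assumes "0 < \<theta>" "\<theta> < 2 * pi" shows "Re (Fd d (cis \<theta>)) = w_d d \<theta>"
    and "Im (Hd d (cis \<theta>)) = Im ((1 + d) * Sd d (cis \<theta>) / (1 - cis \<theta>))"
proof -
  define z where "z = cis \<theta>"
  have zz: "z * cnj z = 1" by (simp add: z_def complex_norm_square[symmetric])
  have z1: "1 - z \<noteq> 0"
  proof -
    have "sin (\<theta> / 2) > 0" using assms by (intro sin_gt_zero) auto
    then show ?thesis unfolding z_def one_minus_cis by simp
  qed
  have q: "v / (1 - z) = v * cnj (1 - z) / of_real ((cmod (1 - z))\<^sup>2)" for v
    using z1 by (subst complex_div_cnj) (simp add: field_simps)
  have e1: "(d + cnj d * z) * cnj (1 - z) = d - d * cnj z + cnj (d * cnj z) - cnj d * (z * cnj z)" by (simp add: algebra_simps)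
  have e2: "(cnj d * z - d) * cnj (1 - z) = - d + d * cnj z + cnj (d * cnj z) - cnj d * (z * cnj z)" by (simp add: algebra_simps)
  have "Re ((d + cnj d * z) * cnj (1 - z)) = 0" unfolding e1 zz by simp
  then have 1: "Re ((d + cnj d * z) / (1 - z)) = 0" unfolding q Re_divide_of_real by simp
  have "Im ((cnj d * z - d) * cnj (1 - z)) = 0" unfolding e2 zz by simp
  then have 2: "Im ((cnj d * z - d) / (1 - z)) = 0" unfolding q Im_divide_of_real by simp
  have "Fd d z = (1 + d) * Sd d z / (1 - z) - (d + cnj d * z) / (1 - z)" unfolding Fd_def by (simp add: diff_divide_distrib add_divide_distrib)
  then show "Re (Fd d (cis \<theta>)) = w_d d \<theta>" using 1 w_d_eq_Re[OF assms] by (simp add: z_def)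
  have "Hd d z = (1 + d) * Sd d z / (1 - z) + (cnj d * z - d) / (1 - z)" unfolding Hd_def by (simp add: diff_divide_distrib add_divide_distrib)
  then show "Im (Hd d (cis \<theta>)) = Im ((1 + d) * Sd d (cis \<theta>) / (1 - cis \<theta>))" using 2 by (simp add: z_def)
qed

end

section \<open>The Fourier coefficients of the equilibrium measure\<close>

lemma sin_half_lower_bound:
  assumes "0 \<le> \<theta>" "\<theta> \<le> pi" shows "\<theta> / 4 \<le> sin (\<theta> / 2)"
proof (cases "\<theta> = 0")
  case False
  define x where "x = \<theta> / 4"
  have x: "0 < x" "x \<le> pi / 4" using assms False by (auto simp: x_def)
  have c4: "sqrt 2 / 2 \<le> cos t" if "0 \<le> t" "t \<le> pi / 4" for t
    using cos_monotone_0_pi_le[of t "pi / 4"] that by (simp add: cos_45)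
  obtain t where t: "0 < t" "t < x" "sin x - sin 0 = (x - 0) * cos t"
    using MVT2[OF x(1), of sin cos] by (auto intro!: derivative_eq_intros)
  have "x * (sqrt 2 / 2) \<le> sin x" using t c4[of t] x by (auto intro!: mult_left_mono)
  moreover have "0 \<le> sin x" using x by (intro sin_ge_zero) auto
  ultimately have "(x * (sqrt 2 / 2)) * (sqrt 2 / 2) \<le> sin x * cos x" using c4[of x] x
    by (intro mult_mono) auto
  moreover have "(x * (sqrt 2 / 2)) * (sqrt 2 / 2) = x / 2" by (simp add: mult.assoc)
  ultimately have "x / 2 \<le> sin x * cos x" by linarith
  moreover have "sin (\<theta> / 2) = 2 * (sin x * cos x)" using sin_double[of x] by (simp add: x_def)
  ultimately show ?thesis by (simp add: x_def)
qed simp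

lemma integrable_inverse_sqrt: "integrable haar (\<lambda>z. 1 / sqrt (cmod (1 - z)))"
proof (rule integrableI_nonneg)
  have m: "(\<lambda>z. 1 / sqrt (cmod (1 - z))) \<in> borel_measurable circle_borel" by measurable
  show "(\<lambda>z. 1 / sqrt (cmod (1 - z))) \<in> borel_measurable haar" using m by (simp add: M1_measurable_cong[OF haar_M1])
  define g where "g t = 1 / sqrt t + 1 / sqrt (2 * pi - t)" for t
  have gI: "(g has_integral ((2 * sqrt (2 * pi) - 2 * sqrt (2 * pi - 2 * pi)) - (2 * sqrt 0 - 2 * sqrt (2 * pi - 0)))) {0..2 * pi}"
    unfolding g_def
  proof (rule fundamental_theorem_of_calculus_interior)
    show "continuous_on {0..2 * pi} (\<lambda>t. 2 * sqrt t - 2 * sqrt (2 * pi - t))" by (intro continuous_intros)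
    show "((\<lambda>t. 2 * sqrt t - 2 * sqrt (2 * pi - t)) has_vector_derivative 1 / sqrt t + 1 / sqrt (2 * pi - t)) (at t)"
      if "t \<in> {0<..<2 * pi}" for t
      using that unfolding has_real_derivative_iff_has_vector_derivative[symmetric]
      by (auto intro!: derivative_eq_intros simp: field_simps)
  qed simp
  have g0: "0 \<le> indicator {0..2 * pi} t * g t" for t by (simp add: indicator_def g_def)
  have "(\<integral>\<^sup>+t. ennreal (indicator {0..2 * pi} t * g t) \<partial>lborel) < \<infinity>"
  proof -
    have "(\<lambda>t. if t \<in> {0..2 * pi} then g t else 0) = (\<lambda>t. indicator {0..2 * pi} t * g t)" by (auto simp: indicator_def)
    moreover have "((\<lambda>t. if t \<in> {0..2 * pi} then g t else 0) has_integral ((2 * sqrt (2 * pi) - 2 * sqrt (2 * pi - 2 * pi)) - (2 * sqrt 0 - 2 * sqrt (2 * pi - 0)))) UNIV"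
      using gI by (simp only: has_integral_restrict_UNIV)
    ultimately have "((\<lambda>t. indicator {0..2 * pi} t * g t) has_integral ((2 * sqrt (2 * pi) - 2 * sqrt (2 * pi - 2 * pi)) - (2 * sqrt 0 - 2 * sqrt (2 * pi - 0)))) UNIV"
      by (simp only:)
    then show ?thesis using g0
      by (subst nn_integral_has_integral_lborel) (auto simp: g_def)
  qed
  have le: "1 / sqrt (cmod (1 - cis t)) \<le> 2 * g t" if t: "0 < t" "t < 2 * pi" for t
  proof -
    have s: "sin (t / 2) > 0" using t by (intro sin_gt_zero) auto
    have c: "cmod (1 - cis t) = 2 * sin (t / 2)" unfolding one_minus_cis norm_mult using s by simp
    have half: "1 / sqrt (2 * sin (t / 2)) \<le> 2 / sqrt u" if u: "0 < u" "u / 4 \<le> sin (t / 2)" for u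
    proof -
      have "sqrt (u / 4) \<le> sqrt (2 * sin (t / 2))" using u by (intro real_sqrt_le_mono) simp
      then have "1 / sqrt (2 * sin (t / 2)) \<le> 1 / sqrt (u / 4)" using u by (intro divide_left_mono) (auto intro!: mult_pos_pos simp: s)
      then show ?thesis by (simp add: real_sqrt_divide)
    qed
    show ?thesis
    proof (cases "t \<le> pi")
      case True
      then show ?thesis using half[of t] sin_half_lower_bound[of t] t by (simp add: c g_def add_increasing2)
    next
      case False
      have "sin (t / 2) = sin ((2 * pi - t) / 2)" using sin_pi_minus[of "t / 2"] by (simp add: diff_divide_distrib)
      then show ?thesis using half[of "2 * pi - t"] sin_half_lower_bound[of "2 * pi - t"] t False by (simp add: c g_def add_increasing)
    qed
  qed
  have "(\<integral>\<^sup>+z. ennreal (1 / sqrt (cmod (1 - z))) \<partial>haar)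
      = ennreal (1 / (2*pi)) * (\<integral>\<^sup>+\<theta>. indicator {0..2*pi} \<theta> * ennreal (1 / sqrt (cmod (1 - cis \<theta>))) \<partial>lborel)"
    using m by (intro nn_integral_haar) measurable
  also have "\<dots> \<le> ennreal (1 / (2*pi)) * (\<integral>\<^sup>+\<theta>. ennreal 2 * ennreal (indicator {0..2*pi} \<theta> * g \<theta>) \<partial>lborel)"
  proof (intro mult_left_mono nn_integral_mono_AE)
    have "AE \<theta> in lborel. \<theta> \<noteq> 0" "AE \<theta> in lborel. \<theta> \<noteq> 2 * pi" by (rule AE_lborel_singleton)+
    then show "AE \<theta> in lborel. indicator {0..2*pi} \<theta> * ennreal (1 / sqrt (cmod (1 - cis \<theta>))) \<le> ennreal 2 * ennreal (indicator {0..2*pi} \<theta> * g \<theta>)"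
    proof eventually_elim
      case (elim \<theta>)
      show ?case
      proof (cases "\<theta> \<in> {0..2*pi}")
        case True
        then have "ennreal (1 / sqrt (cmod (1 - cis \<theta>))) \<le> ennreal (2 * g \<theta>)" using elim by (intro ennreal_leI le) auto
        then show ?thesis using True by (simp add: ennreal_mult' )
      qed simp
    qed
  qed simp
  also have "\<dots> = ennreal (1 / (2*pi)) * (ennreal 2 * (\<integral>\<^sup>+\<theta>. ennreal (indicator {0..2*pi} \<theta> * g \<theta>) \<partial>lborel))"
    by (subst nn_integral_cmult) (auto simp: g_def)
  also have "\<dots> < \<infinity>"
    using \<open>(\<integral>\<^sup>+t. ennreal (indicator {0..2 * pi} t * g t) \<partial>lborel) < \<infinity>\<close> by (simp add: ennreal_mult_less_top)
  finally show "(\<integral>\<^sup>+z. ennreal (1 / sqrt (cmod (1 - z))) \<partial>haar) < \<infinity>" .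
qed (auto intro!: AE_I2)

lemma haar_AE_neq_1: "AE z in haar. z \<noteq> 1"
  by (intro finite_energy_no_atom haar_M1) (simp add: en_haar)

definition cf :: "complex \<Rightarrow> nat \<Rightarrow> complex"
  where "cf d k = (deriv ^^ k) (\<lambda>z. (Fd d z + 1) / 2) 0 / fact k"

text \<open>A logarithmic potential of the equilibrium measure: \<open>Re (Lam d z)\<close> is the integral of
  \<open>ln |1 - z cnj w|\<close>, as \<open>cf\<close> are the conjugate Fourier coefficients.\<close>

definition Lam :: "complex \<Rightarrow> complex \<Rightarrow> complex"
  where "Lam d z = - (\<Sum>k. cf d k * z ^ k / of_nat k)"

context
  fixes d :: complex
  assumes d: "0 \<le> Re d"
begin

lemma cf_sums: "cmod z < 1 \<Longrightarrow> (\<lambda>k. cf d k * z ^ k) sums ((Fd d z + 1) / 2)"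
proof -
  assume z: "cmod z < 1"
  have "(\<lambda>z. (Fd d z + 1) / 2) holomorphic_on ball 0 1"
    by (intro holomorphic_intros Fd_holomorphic d) auto
  from holomorphic_power_series[OF this, of z] show ?thesis using z by (simp add: cf_def)
qed

lemma cf_0: "cf d 0 = 1" by (simp add: cf_def Fd_0[OF d])

lemma cf_abs_summable: "cmod z < 1 \<Longrightarrow> summable (\<lambda>k. cmod (cf d k * z ^ k))"
proof -
  assume z: "cmod z < 1"
  define r where "r = (1 + cmod z) / 2"
  have r: "cmod z < r" "r < 1" "0 \<le> r" using z by (auto simp: r_def)
  have "summable (\<lambda>k. cf d k * of_real r ^ k)" using cf_sums[of "of_real r"] r by (auto simp: sums_iff)
  then show ?thesis by (rule powser_insidea) (use r in simp)
qed

lemma w_d_measurable: "(\<lambda>z. w_d d (Arg2pi z)) \<in> borel_measurable circle_borel"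
proof -
  have "w_d d \<in> borel_measurable borel" unfolding w_d_def[abs_def] by measurable
  then show ?thesis by (rule measurable_compose[OF Arg2pi_measurable_circle])
qed

lemma Fd_radial_limit:
  assumes "z \<in> circle" "z \<noteq> 1"
  shows "(\<lambda>i. Fd d (of_real (rr i) * z)) \<longlonglongrightarrow> Fd d z"
proof -
  have r: "(\<lambda>i. of_real (rr i) * z) \<longlonglongrightarrow> z"
    using tendsto_mult[OF tendsto_of_real[OF rr_tendsto] tendsto_const[of z]] by simp
  have "(\<lambda>i. Sd d (of_real (rr i) * z)) \<longlonglongrightarrow> Sd d z"
    using assms cmod_rr_less_1[of z]
    by (intro continuous_on_tendsto_compose[OF Sd_continuous[OF d] r]) (auto intro!: always_eventually less_imp_le)
  then show ?thesis unfolding Fd_def using assms by (intro tendsto_intros r) auto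
qed

lemma Re_Fd_eq_w: "z \<in> circle \<Longrightarrow> z \<noteq> 1 \<Longrightarrow> Re (Fd d z) = w_d d (Arg2pi z)"
  using circle_cases_cis[of z] Re_Fd_circle(1)[OF d, of "Arg2pi z"] by metis

text \<open>The real part of \<open>Fd\<close> along circles of smaller radii has the Taylor
  coefficients as Fourier coefficients; the bound by \<open>|1 - z| powr (-1/2)\<close> dominates the
  passage to the boundary.\<close>

lemma
  shows integrable_w_d: "integrable haar (\<lambda>z. w_d d (Arg2pi z))"
    and fourier_w_d: "(\<integral>z. z ^ j * of_real (w_d d (Arg2pi z)) \<partial>haar) = cnj (cf d j)"
proof -
  obtain C where C: "C \<ge> 0" "\<And>z. cmod z \<le> 1 \<Longrightarrow> z \<noteq> 1 \<Longrightarrow> cmod (Fd d z) \<le> C / sqrt (cmod (1 - z))"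
    using Fd_bound[OF d] by metis
  define f where "f i z = Re (Fd d (of_real (rr i) * z))" for i z
  have fP: "f i z = Re (2 * (\<Sum>k. (cf d k * of_real (rr i) ^ k) * z ^ k) - 1)" if "z \<in> circle" for i z
  proof -
    have "(\<Sum>k. (cf d k * of_real (rr i) ^ k) * z ^ k) = (Fd d (of_real (rr i) * z) + 1) / 2"
      using cf_sums[OF cmod_rr_less_1[OF that, of i]] by (simp add: sums_iff power_mult_distrib mult.assoc)
    then have "2 * (\<Sum>k. (cf d k * of_real (rr i) ^ k) * z ^ k) = Fd d (of_real (rr i) * z) + 1"
      by (simp add: mult.commute)
    then have "2 * (\<Sum>k. (cf d k * of_real (rr i) ^ k) * z ^ k) - 1 = Fd d (of_real (rr i) * z)"
      by (simp only: add_diff_cancel_right')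
    then show ?thesis by (simp only: f_def)
  qed
  have sm: "summable (\<lambda>k. cmod (cf d k * of_real (rr i) ^ k))" for i
    using cf_abs_summable[of "of_real (rr i)"] rr_bounds[of i] by simp
  have a0: "cf d 0 * of_real (rr i) ^ 0 = 1" for i by (simp add: cf_0)
  have fm: "f i \<in> borel_measurable circle_borel" for i
    by (subst measurable_cong[OF fP]) (auto intro!: poisson_fourier(2)[OF sm a0])
  have ff: "(\<integral>z. z ^ j * of_real (f i z) \<partial>haar) = cnj (cf d j * of_real (rr i) ^ j)" for i j
  proof -
    have "(\<integral>z. z ^ j * of_real (f i z) \<partial>haar) = (\<integral>z. z ^ j * of_real (Re (2 * (\<Sum>k. (cf d k * of_real (rr i) ^ k) * z ^ k) - 1)) \<partial>haar)"
      by (intro Bochner_Integration.integral_cong refl) (simp only: fP M1_space[OF haar_M1])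
    then show ?thesis by (simp only: poisson_fourier(1)[OF sm a0])
  qed
  have bd: "\<bar>f i z\<bar> \<le> (2 * C) * (1 / sqrt (cmod (1 - z)))" if z: "z \<in> circle" "z \<noteq> 1" for i z
  proof -
    define u where "u = of_real (rr i) * z"
    have u: "cmod u < 1" unfolding u_def by (rule cmod_rr_less_1[OF z(1)])
    have "\<bar>f i z\<bar> \<le> cmod (Fd d u)" unfolding f_def u_def by (rule abs_Re_le_cmod)
    also have "\<dots> \<le> C / sqrt (cmod (1 - u))" using u by (intro C(2)) auto
    also have "\<dots> \<le> C / sqrt (cmod (1 - z) / 4)"
    proof (intro divide_left_mono C(1) real_sqrt_le_mono)
      have "cmod (1 - z) / 2 \<le> cmod (1 - u)" unfolding u_def using z rr_bounds[of i] by (intro cmod_one_minus_half) auto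
      then show "cmod (1 - z) / 4 \<le> cmod (1 - u)" using norm_ge_zero[of "1 - z"] by linarith
      have "1 - u \<noteq> 0" using u by auto
      then show "0 < sqrt (cmod (1 - u)) * sqrt (cmod (1 - z) / 4)" using z by simp
    qed
    finally show ?thesis by (simp add: real_sqrt_divide mult.commute)
  qed
  have lim: "AE z in haar. (\<lambda>i. f i z) \<longlonglongrightarrow> w_d d (Arg2pi z)"
    using haar_AE_neq_1 AE_space
  proof eventually_elim
    case (elim z)
    then have z: "z \<in> circle" "z \<noteq> 1" by (auto simp: M1_space[OF haar_M1])
    show ?case unfolding f_def Re_Fd_eq_w[OF z, symmetric] by (intro tendsto_Re Fd_radial_limit z)
  qed
  have wI: "integrable haar (\<lambda>z. (2 * C) * (1 / sqrt (cmod (1 - z))))"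
    using integrable_inverse_sqrt by (intro integrable_mult_right)
  show int: "integrable haar (\<lambda>z. w_d d (Arg2pi z))"
  proof (rule integrable_dominated_convergence[OF _ _ wI lim])
    show "AE z in haar. norm (f i z) \<le> (2 * C) * (1 / sqrt (cmod (1 - z)))" for i
      using haar_AE_neq_1 AE_space
    proof eventually_elim
      case (elim z)
      then show ?case using bd[of z i] by (simp only: real_norm_def M1_space[OF haar_M1] not_False_eq_True)
    qed
  qed (use w_d_measurable fm in \<open>auto simp: M1_measurable_cong[OF haar_M1]\<close>)
  have "(\<lambda>i. \<integral>z. z ^ j * of_real (f i z) \<partial>haar) \<longlonglongrightarrow> (\<integral>z. z ^ j * of_real (w_d d (Arg2pi z)) \<partial>haar)"
  proof (rule integral_dominated_convergence[OF _ _ wI])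
    have pm: "(\<lambda>z. z ^ j) \<in> borel_measurable circle_borel" by (intro borel_measurable_circle continuous_intros)
    show "(\<lambda>z. z ^ j * of_real (w_d d (Arg2pi z))) \<in> borel_measurable haar"
      unfolding M1_measurable_cong[OF haar_M1] using pm w_d_measurable by measurable
    show "(\<lambda>z. z ^ j * of_real (f i z)) \<in> borel_measurable haar" for i
      unfolding M1_measurable_cong[OF haar_M1] using pm fm[of i] by measurable
    show "AE z in haar. (\<lambda>i. z ^ j * complex_of_real (f i z)) \<longlonglongrightarrow> z ^ j * of_real (w_d d (Arg2pi z))"
      using lim by eventually_elim (intro tendsto_intros)
    show "AE z in haar. norm (z ^ j * complex_of_real (f i z)) \<le> (2 * C) * (1 / sqrt (cmod (1 - z)))" for i
      using haar_AE_neq_1 AE_space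
    proof eventually_elim
      case (elim z)
      then have z: "z \<in> circle" "z \<noteq> 1" by (auto simp: M1_space[OF haar_M1])
      have "norm (z ^ j * complex_of_real (f i z)) = \<bar>f i z\<bar>" using z by (simp add: norm_mult norm_power)
      then show ?case using bd[OF z, of i] by simp
    qed
  qed
  moreover have "(\<lambda>i. cnj (cf d j * of_real (rr i) ^ j)) \<longlonglongrightarrow> cnj (cf d j * of_real 1 ^ j)"
    by (intro tendsto_intros rr_tendsto)
  ultimately show "(\<integral>z. z ^ j * of_real (w_d d (Arg2pi z)) \<partial>haar) = cnj (cf d j)"
    unfolding ff using LIMSEQ_unique by fastforce
qed

text \<open>At \<open>d = 0\<close> the formula for the density gives the constant 1.\<close>

lemma mu_d_eq_density: "mu_d d = density haar (\<lambda>z. ennreal (w_d d (Arg2pi z)))"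
proof (cases "d = 0")
  case True
  have t0: "theta_d 0 = 0" using theta_d_eq(1)[of 0] by simp
  have x0: "xi_d 0 = 0" using xi_d_eq(1)[of 0] by simp
  have "AE z in haar. ennreal (w_d d (Arg2pi z)) = 1"
    using haar_AE_neq_1 AE_space
  proof eventually_elim
    case (elim z)
    then obtain t: "0 < Arg2pi z" "Arg2pi z < 2 * pi" using circle_cases_cis[of z] by (auto simp: M1_space[OF haar_M1])
    then have "sin (Arg2pi z / 2) > 0" by (intro sin_gt_zero) auto
    then show ?case using t True by (simp add: w_d_def t0 x0 alpha_d_def)
  qed
  then have "density haar (\<lambda>z. ennreal (w_d d (Arg2pi z))) = density haar (\<lambda>_. 1)"
    using w_d_measurable by (intro density_cong) (auto simp: M1_measurable_cong[OF haar_M1])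
  then show ?thesis using True by (simp add: mu_d_def density_1)
qed (simp add: mu_d_def)

lemma
  shows mu_d_M1: "mu_d d \<in> M1" and fc_mu_d: "fc (mu_d d) k = cnj (cf d k)"
proof -
  define w where "w z = (if z = 1 then 0 else w_d d (Arg2pi z))" for z
  have ae: "AE z in haar. w z = w_d d (Arg2pi z)" using haar_AE_neq_1 by eventually_elim (simp add: w_def)
  have wm: "w \<in> borel_measurable circle_borel" unfolding w_def[abs_def] using w_d_measurable by measurable
  have wm': "w \<in> borel_measurable haar" "(\<lambda>z. w_d d (Arg2pi z)) \<in> borel_measurable haar"
    using wm w_d_measurable by (simp_all add: M1_measurable_cong[OF haar_M1])
  have w0: "0 \<le> w z" if z: "z \<in> circle" for z
  proof (cases "z = 1")
    case False
    then obtain "0 < Arg2pi z" "Arg2pi z < 2 * pi" using circle_cases_cis[OF z] by blast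
    then show ?thesis using w_d_nonneg[OF d] False by (simp add: w_def)
  qed (simp add: w_def)
  have wi: "integrable haar w" using integrable_w_d integrable_cong_AE[OF wm' ae] by simp
  have fw: "(\<integral>z. z ^ j * of_real (w z) \<partial>haar) = cnj (cf d j)" for j
  proof -
    have pm: "(\<lambda>z. z ^ j) \<in> borel_measurable haar"
      unfolding M1_measurable_cong[OF haar_M1] by (intro borel_measurable_circle continuous_intros)
    have "(\<integral>z. z ^ j * of_real (w z) \<partial>haar) = (\<integral>z. z ^ j * of_real (w_d d (Arg2pi z)) \<partial>haar)"
    proof (rule integral_cong_AE)
      have "(\<lambda>x. complex_of_real x) \<in> borel_measurable borel"
        by (intro borel_measurable_continuous_onI continuous_intros)
      then show "(\<lambda>z. z ^ j * of_real (w z)) \<in> borel_measurable haar"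
        "(\<lambda>z. z ^ j * of_real (w_d d (Arg2pi z))) \<in> borel_measurable haar"
        using pm wm' by (intro borel_measurable_times; auto intro: measurable_compose)+
      show "AE z in haar. z ^ j * of_real (w z) = z ^ j * of_real (w_d d (Arg2pi z))"
        using ae by eventually_elim simp
    qed
    then show ?thesis by (simp only: fourier_w_d)
  qed
  have "complex_of_real (\<integral>z. w z \<partial>haar) = 1" using fw[of 0] by (simp add: cf_0)
  then have w1: "(\<integral>z. w z \<partial>haar) = 1" by (simp only: of_real_eq_1_iff)
  have eq: "mu_d d = density haar (\<lambda>z. ennreal (w z))"
    unfolding mu_d_eq_density using wm' ae by (intro density_cong) (auto elim: eventually_mono)
  show "mu_d d \<in> M1" "fc (mu_d d) k = cnj (cf d k)"
    unfolding eq using density_haar_M1[OF wm w0 wi w1] fw by auto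
qed

lemma Lam_sums: "cmod z < 1 \<Longrightarrow> (\<lambda>k. cf d k * z ^ k / of_nat k) sums (- Lam d z)"
proof -
  assume z: "cmod z < 1"
  have le: "cmod (cf d k * z ^ k / of_nat k) \<le> cmod (cf d k * z ^ k)" for k
  proof (cases "k = 0")
    case False
    then have "cmod (cf d k * z ^ k) / real k \<le> cmod (cf d k * z ^ k) / 1" by (intro divide_left_mono) auto
    then show ?thesis by (simp add: norm_divide)
  qed simp
  have "summable (\<lambda>k. cmod (cf d k * z ^ k / of_nat k))"
    using le by (intro summable_comparison_test[OF _ cf_abs_summable[OF z]]) auto
  then have "summable (\<lambda>k. cf d k * z ^ k / of_nat k)" by (rule summable_norm_cancel)
  then show ?thesis by (simp add: Lam_def summable_sums)
qed

lemma Lam_0: "Lam d 0 = 0"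
proof -
  have "cf d k * 0 ^ k / of_nat k = 0" for k by (cases k) auto
  then show ?thesis unfolding Lam_def by (simp only: suminf_zero minus_zero)
qed

lemma Lam_derivative:
  assumes "cmod z < 1"
  obtains D where "(Lam d has_field_derivative D) (at z)" "z * D = (1 - Fd d z) / 2"
proof -
  define b where "b k = cf d k / of_nat k" for k
  have bs: "summable (\<lambda>k. b k * x ^ k)" if "cmod x < 1" for x
    using Lam_sums[OF that] by (auto simp: b_def sums_iff)
  have df: "((\<lambda>x. \<Sum>k. b k * x ^ k) has_field_derivative (\<Sum>k. diffs b k * z ^ k)) (at z)"
    using assms by (intro termdiffs_strong'[where K = 1] bs) auto
  have "diffs b k = cf d (Suc k)" for k unfolding diffs_def b_def by (simp del: of_nat_Suc)
  then have df': "((\<lambda>x. \<Sum>k. b k * x ^ k) has_field_derivative (\<Sum>k. cf d (Suc k) * z ^ k)) (at z)" using df by simp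
  have "summable (\<lambda>k. cf d (Suc k) * z ^ k)"
    using termdiff_converges[OF assms, of b] bs \<open>\<And>k. diffs b k = cf d (Suc k)\<close> by (simp add: real_norm_def)
  then have "(\<lambda>k. z * (cf d (Suc k) * z ^ k)) sums (z * (\<Sum>k. cf d (Suc k) * z ^ k))" by (intro sums_mult summable_sums)
  then have "(\<lambda>k. cf d (Suc k) * z ^ Suc k) sums (z * (\<Sum>k. cf d (Suc k) * z ^ k))" by (simp add: mult_ac)
  then have "(\<lambda>k. cf d k * z ^ k) sums (z * (\<Sum>k. cf d (Suc k) * z ^ k) + cf d 0 * z ^ 0)" by (subst (asm) sums_Suc_iff) simp
  then have "(Fd d z + 1) / 2 = z * (\<Sum>k. cf d (Suc k) * z ^ k) + 1"
    using cf_sums[OF assms] sums_unique2 cf_0 by fastforce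
  then have e: "z * (- (\<Sum>k. cf d (Suc k) * z ^ k)) = (1 - Fd d z) / 2" by (simp add: field_simps)
  have "((\<lambda>x. - (\<Sum>k. b k * x ^ k)) has_field_derivative (- (\<Sum>k. cf d (Suc k) * z ^ k))) (at z)"
    by (rule DERIV_minus[OF df'])
  moreover have "(\<lambda>x. - (\<Sum>k. b k * x ^ k)) = Lam d" by (simp add: Lam_def[abs_def] b_def)
  ultimately show ?thesis using that e by simp
qed

end

section \<open>The potential of the equilibrium measure as a superposition\<close>

text \<open>Growing the total mass from 0 to 1 writes the equilibrium measure as an average over \<open>s\<close> of
  equilibrium measures of arcs. Here \<open>XX\<close> is the square of the branch function for \<open>d / s\<close>,
  and \<open>LL\<close> the logarithmic potential of the arc measure, which is elementary.\<close>

definition XX :: "complex \<Rightarrow> complex \<Rightarrow> complex \<Rightarrow> complex"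
  where "XX d s z = (((s + d) - (s + cnj d) * z)\<^sup>2 + 4 * (d * cnj d) * z) / (s + d)\<^sup>2"

definition LL :: "complex \<Rightarrow> complex \<Rightarrow> complex \<Rightarrow> complex"
  where "LL d s z = Ln ((1 + (s + cnj d) / (s + d) * z + csqrt (XX d s z)) / 2)"

text \<open>The derivative of \<open>LL\<close> in \<open>z\<close>.\<close>

definition LLz :: "complex \<Rightarrow> complex \<Rightarrow> complex \<Rightarrow> complex"
  where "LLz d s z = ((s + cnj d) / (s + d) + (2 * ((s + d) - (s + cnj d) * z) * (- (s + cnj d)) + 4 * (d * cnj d)) / (s + d)\<^sup>2 / (2 * csqrt (XX d s z)))
    / (1 + (s + cnj d) / (s + d) * z + csqrt (XX d s z))"

text \<open>The same potential in the form that makes sense up to the boundary.\<close>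

definition Lb :: "complex \<Rightarrow> complex \<Rightarrow> real \<Rightarrow> complex"
  where "Lb d z s = (if s = 0 then 0 else Ln ((1 + (of_real s + cnj d) / (of_real s + d) * z + Sd (d / of_real s) z) / 2))"

context
  fixes d :: complex
  assumes d: "0 \<le> Re d" and d0: "d \<noteq> 0"
begin

lemma s_plus_d: "0 \<le> s \<Longrightarrow> of_real s + d \<noteq> 0"
  using d d0 by (auto simp: complex_eq_iff)

lemma cmod_quot: "0 \<le> s \<Longrightarrow> cmod ((of_real s + cnj d) / (of_real s + d)) = 1"
proof -
  assume s: "0 \<le> s"
  have "of_real s + cnj d = cnj (of_real s + d)" by simp
  then have "cmod (of_real s + cnj d) = cmod (of_real s + d)" by (simp only: complex_mod_cnj)
  then show ?thesis using s_plus_d[OF s] by (simp add: norm_divide)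
qed

lemma Re_d_div: "0 < s \<Longrightarrow> 0 \<le> Re (d / of_real s)"
  using d by (simp add: Re_divide_of_real)

lemma Sd_scaled_sq:
  assumes "0 < s" shows "(Sd (d / of_real s) z)\<^sup>2 = XX d (of_real s) z"
proof -
  define a g S where "a = of_real s + d" "g = of_real s + cnj d" "S = Sd (d / of_real s) z"
  have s: "complex_of_real s \<noteq> 0" using assms by simp
  have a: "a \<noteq> 0" using s_plus_d[of s] assms by (simp add: a_g_S_def)
  have e: "1 + d / of_real s = a / of_real s" "1 + cnj (d / of_real s) = g / of_real s"
    using s by (simp_all add: a_g_S_def field_simps)
  have n: "of_real ((cmod (d / of_real s))\<^sup>2) = d * cnj d / (of_real s)\<^sup>2"
    unfolding complex_norm_square by (simp add: power2_eq_square)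
  have "(a / of_real s * S)\<^sup>2 = (a / of_real s - g / of_real s * z)\<^sup>2 + 4 * (d * cnj d / (of_real s)\<^sup>2) * z"
    using Sd_sq[OF Re_d_div[OF assms], of z] unfolding e n by (simp only: a_g_S_def)
  then have "(of_real s)\<^sup>2 * (a / of_real s * S)\<^sup>2 = (of_real s)\<^sup>2 * ((a / of_real s - g / of_real s * z)\<^sup>2 + 4 * (d * cnj d / (of_real s)\<^sup>2) * z)"
    by simp
  also have "(of_real s)\<^sup>2 * (a / of_real s * S)\<^sup>2 = (a * S)\<^sup>2"
    using s by (simp add: power_mult_distrib power_divide)
  also have "(of_real s)\<^sup>2 * ((a / of_real s - g / of_real s * z)\<^sup>2 + 4 * (d * cnj d / (of_real s)\<^sup>2) * z) = (a - g * z)\<^sup>2 + 4 * (d * cnj d) * z"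
    using s by (simp add: power2_eq_square field_simps)
  finally show ?thesis using a unfolding XX_def a_g_S_def[symmetric] by (simp add: field_simps power_mult_distrib)
qed

text \<open>In the disc the branch function has positive real part, so it is the principal root; at
  \<open>s = 0\<close> it degenerates to a polynomial.\<close>

lemma XX_root:
  assumes "0 \<le> s" "cmod z < 1"
  obtains Y where "Y\<^sup>2 = XX d (of_real s) z" "0 < Re Y" "csqrt (XX d (of_real s) z) = Y" "XX d (of_real s) z \<notin> \<real>\<^sub>\<le>\<^sub>0"
    "0 < s \<Longrightarrow> Y = Sd (d / of_real s) z" "s = 0 \<Longrightarrow> Y = 1 + cnj d / d * z"
proof -
  have *: "csqrt (Y\<^sup>2) = Y" "Y\<^sup>2 \<notin> \<real>\<^sub>\<le>\<^sub>0" if "0 < Re Y" for Y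
  proof -
    show c: "csqrt (Y\<^sup>2) = Y" using that by (intro csqrt_square) auto
    show "Y\<^sup>2 \<notin> \<real>\<^sub>\<le>\<^sub>0"
    proof
      assume "Y\<^sup>2 \<in> \<real>\<^sub>\<le>\<^sub>0"
      then have "Im (Y\<^sup>2) = 0" "Re (Y\<^sup>2) \<le> 0" by (auto simp: complex_nonpos_Reals_iff)
      then have "Re Y * Im Y = 0" "(Re Y)\<^sup>2 \<le> (Im Y)\<^sup>2" by (auto simp: Im_power2 Re_power2)
      then show False using that by auto
    qed
  qed
  show ?thesis
  proof (cases "s = 0")
    case False
    then have s: "0 < s" using assms by simp
    have sq: "(Sd (d / of_real s) z)\<^sup>2 = XX d (of_real s) z" by (rule Sd_scaled_sq[OF s])
    show ?thesis
      using that[OF sq] *[OF Re_Sd_pos[OF Re_d_div[OF s] assms(2)]] Re_Sd_pos[OF Re_d_div[OF s] assms(2)] False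
      unfolding sq by blast
  next
    case True
    define Y where "Y = 1 + cnj d / d * z"
    have "cmod (cnj d / d * z) < 1" using d0 assms(2) by (simp add: norm_mult norm_divide)
    then have Y: "0 < Re Y" using one_minus_notin_nonpos(1)[of "- (cnj d / d * z)"] by (simp add: Y_def)
    have "Y\<^sup>2 = XX d (of_real s) z" using d0 True by (simp add: Y_def XX_def field_simps power2_eq_square)
    then show ?thesis using that[of Y] *[OF Y] Y True by (simp add: Y_def)
  qed
qed

lemma LL_arg:
  assumes "0 \<le> s" "cmod z < 1"
  shows "0 < Re (1 + (of_real s + cnj d) / (of_real s + d) * z + csqrt (XX d (of_real s) z))"
proof -
  obtain Y where Y: "0 < Re Y" "csqrt (XX d (of_real s) z) = Y" using XX_root[OF assms] by metis
  have "cmod ((of_real s + cnj d) / (of_real s + d) * z) < 1"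
    unfolding norm_mult cmod_quot[OF assms(1)] using assms(2) by simp
  then have "0 < Re (1 - (- ((of_real s + cnj d) / (of_real s + d) * z)))"
    by (intro one_minus_notin_nonpos(1)) simp
  then show ?thesis using Y by simp
qed

lemma Re_pos_neq_0: "0 < Re v \<Longrightarrow> v \<noteq> 0" "0 < Re v \<Longrightarrow> v / 2 \<notin> \<real>\<^sub>\<le>\<^sub>0"
  by (auto simp: complex_nonpos_Reals_iff)

lemma LL_derivative:
  assumes "0 \<le> s" "cmod z < 1"
  shows "(LL d (of_real s) has_field_derivative LLz d (of_real s) z) (at z within A)"
proof -
  have a: "of_real s + d \<noteq> 0" by (rule s_plus_d[OF assms(1)])
  obtain Y where Y: "0 < Re Y" "csqrt (XX d (of_real s) z) = Y" "XX d (of_real s) z \<notin> \<real>\<^sub>\<le>\<^sub>0" using XX_root[OF assms] by metis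
  have dX: "(XX d (of_real s) has_field_derivative (2 * ((of_real s + d) - (of_real s + cnj d) * z) * (- (of_real s + cnj d)) + 4 * (d * cnj d)) / (of_real s + d)\<^sup>2) (at z within A)"
  proof -
    define a g where "a = of_real s + d" "g = of_real s + cnj d"
    have "((\<lambda>z. (a - g * z)\<^sup>2 + 4 * (d * cnj d) * z) has_field_derivative 2 * (a - g * z) * (- g) + 4 * (d * cnj d)) (at z within A)"
      by (auto intro!: derivative_eq_intros simp: algebra_simps)
    then show ?thesis unfolding XX_def[abs_def] a_g_def[symmetric] by (rule DERIV_cdivide)
  qed
  have dT: "((\<lambda>z. csqrt (XX d (of_real s) z)) has_field_derivative
      (2 * ((of_real s + d) - (of_real s + cnj d) * z) * (- (of_real s + cnj d)) + 4 * (d * cnj d)) / (of_real s + d)\<^sup>2 / (2 * csqrt (XX d (of_real s) z))) (at z within A)"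
    using has_field_derivative_csqrt'[OF dX Y(3)] by (simp add: field_simps)
  define u t' where "u = (of_real s + cnj d) / (of_real s + d)"
    "t' = (2 * ((of_real s + d) - (of_real s + cnj d) * z) * (- (of_real s + cnj d)) + 4 * (d * cnj d)) / (of_real s + d)\<^sup>2 / (2 * csqrt (XX d (of_real s) z))"
  have dN: "((\<lambda>z. (1 + u * z + csqrt (XX d (of_real s) z)) / 2) has_field_derivative (u + t') / 2) (at z within A)"
  proof -
    have *: "((\<lambda>z. (1 + u * z + t z) / 2) has_field_derivative (u + t') / 2) (at z within A)"
      if "(t has_field_derivative t') (at z within A)" for t t'
      by (rule DERIV_cdivide) (auto intro!: derivative_eq_intros that)
    show ?thesis by (rule *[OF dT[folded u_t'_def(2)]])
  qed
  have N: "0 < Re (1 + u * z + csqrt (XX d (of_real s) z))" using LL_arg[OF assms] unfolding u_t'_def(1) .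
  have "((\<lambda>z. Ln ((1 + u * z + csqrt (XX d (of_real s) z)) / 2)) has_field_derivative
      inverse ((1 + u * z + csqrt (XX d (of_real s) z)) / 2) * ((u + t') / 2)) (at z within A)"
    by (rule DERIV_chain2[OF has_field_derivative_Ln[OF Re_pos_neq_0(2)[OF N]] dN])
  also have "inverse ((1 + u * z + csqrt (XX d (of_real s) z)) / 2) * ((u + t') / 2) = (u + t') / (1 + u * z + csqrt (XX d (of_real s) z))"
  proof -
    have "inverse (m / 2) * (w / 2) = w / m" if "m \<noteq> 0" for m w :: complex using that by (simp add: field_simps)
    from this[OF Re_pos_neq_0(1)[OF N]] show ?thesis .
  qed
  finally show ?thesis unfolding LL_def[abs_def] LLz_def u_t'_def .
qed

text \<open>The derivatives of the arc potentials integrate to the derivative of the full one, because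
  \<open>((s + d) csqrt XX - d - cnj d z) / (1 - z)\<close> is a primitive in \<open>s\<close>.\<close>

lemma Herglotz_superposition:
  assumes "cmod z < 1"
  shows "((\<lambda>s. (1 - (of_real s + cnj d) / (of_real s + d) * z) / csqrt (XX d (of_real s) z)) has_integral Fd d z) {0..1::real}"
proof -
  define G where "G s = ((s + d) * csqrt (XX d s z) - d - cnj d * z) / (1 - z)" for s
  have z1: "1 - z \<noteq> 0" using assms by auto
  have "((\<lambda>s. (1 - (of_real s + cnj d) / (of_real s + d) * z) / csqrt (XX d (of_real s) z)) has_integral G (of_real 1) - G (of_real 0)) {0..1::real}"
  proof (rule fundamental_theorem_of_calculus)
    fix s :: real assume s: "s \<in> {0..1}"
    define \<sigma> where "\<sigma> = complex_of_real s"
    have a: "\<sigma> + d \<noteq> 0" using s_plus_d[of s] s by (simp add: \<sigma>_def)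
    obtain T where T: "T\<^sup>2 = XX d \<sigma> z" "0 < Re T" "csqrt (XX d \<sigma> z) = T" "XX d \<sigma> z \<notin> \<real>\<^sub>\<le>\<^sub>0"
      using XX_root[of s z] s assms unfolding \<sigma>_def by (metis atLeastAtMost_iff)
    have T0: "T \<noteq> 0" using T by auto
    define q where "q = ((\<sigma> + d) - (\<sigma> + cnj d) * z)\<^sup>2 + 4 * (d * cnj d) * z"
    define q' where "q' = 2 * ((\<sigma> + d) - (\<sigma> + cnj d) * z) * (1 - z)"
    have Tq: "T * T * ((\<sigma> + d) * (\<sigma> + d)) = q" using T(1) a by (simp add: XX_def q_def power2_eq_square)
    have dX: "((\<lambda>s. XX d s z) has_field_derivative (q' * (\<sigma> + d)\<^sup>2 - q * (2 * (\<sigma> + d))) / ((\<sigma> + d)\<^sup>2 * (\<sigma> + d)\<^sup>2)) (at \<sigma>)"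
    proof -
      have n: "((\<lambda>s. ((s + d) - (s + cnj d) * z)\<^sup>2 + 4 * (d * cnj d) * z) has_field_derivative q') (at \<sigma>)"
        unfolding q'_def by (auto intro!: derivative_eq_intros)
      have m: "((\<lambda>s. (s + d)\<^sup>2) has_field_derivative 2 * (\<sigma> + d)) (at \<sigma>)"
        by (auto intro!: derivative_eq_intros)
      show ?thesis
        unfolding XX_def[abs_def] using DERIV_divide[OF n m] a unfolding q_def[symmetric] by simp
    qed
    have "(G has_field_derivative (T + (\<sigma> + d) * ((q' * (\<sigma> + d)\<^sup>2 - q * (2 * (\<sigma> + d))) / ((\<sigma> + d)\<^sup>2 * (\<sigma> + d)\<^sup>2) / (2 * T))) / (1 - z)) (at \<sigma>)"
    proof -
      have *: "((\<lambda>s. ((s + d) * t s - d - cnj d * z) / (1 - z)) has_field_derivative (t \<sigma> + (\<sigma> + d) * t') / (1 - z)) (at \<sigma>)"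
        if "(t has_field_derivative t') (at \<sigma>)" for t t'
        by (rule DERIV_cdivide) (auto intro!: derivative_eq_intros that)
      have "((\<lambda>s. csqrt (XX d s z)) has_field_derivative
          (q' * (\<sigma> + d)\<^sup>2 - q * (2 * (\<sigma> + d))) / ((\<sigma> + d)\<^sup>2 * (\<sigma> + d)\<^sup>2) / (2 * csqrt (XX d \<sigma> z))) (at \<sigma>)"
        using has_field_derivative_csqrt'[OF dX T(4)] by (simp add: field_simps)
      from *[OF this] show ?thesis unfolding G_def[abs_def] T(3) .
    qed
    also have "(T + (\<sigma> + d) * ((q' * (\<sigma> + d)\<^sup>2 - q * (2 * (\<sigma> + d))) / ((\<sigma> + d)\<^sup>2 * (\<sigma> + d)\<^sup>2) / (2 * T))) / (1 - z)
        = (1 - (\<sigma> + cnj d) / (\<sigma> + d) * z) / T"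
    proof -
      have "(\<sigma> + d) * ((q' * (\<sigma> + d)\<^sup>2 - q * (2 * (\<sigma> + d))) / ((\<sigma> + d)\<^sup>2 * (\<sigma> + d)\<^sup>2) / (2 * T)) = q' / (2 * (\<sigma> + d) * T) - T"
      proof -
        have "m * ((q' * m\<^sup>2 - T * T * (m * m) * (2 * m)) / (m\<^sup>2 * m\<^sup>2) / (2 * T)) = q' / (2 * m * T) - T" if "m \<noteq> 0" for m
          using that T0 by (simp add: power2_eq_square field_simps)
        from this[OF a] show ?thesis unfolding Tq .
      qed
      moreover have "(T + (2 * (m - g * z) * (1 - z) / (2 * m * T) - T)) / (1 - z) = (1 - g / m * z) / T" if "m \<noteq> 0" for m g
      proof -
        have "(T + (2 * (m - g * z) * (1 - z) / (2 * m * T) - T)) / (1 - z) = (m - g * z) / (m * T)"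
          using z1 that T0 by (simp add: divide_simps)
        also have "\<dots> = (1 - g / m * z) / T" using that T0 by (simp add: field_simps)
        finally show ?thesis .
      qed
      ultimately show ?thesis unfolding q'_def using a by (simp only:)
    qed
    finally have "(G has_field_derivative (1 - (\<sigma> + cnj d) / (\<sigma> + d) * z) / T) (at \<sigma>)" .
    then have "((\<lambda>x. G (of_real x)) has_vector_derivative (1 - (\<sigma> + cnj d) / (\<sigma> + d) * z) / T) (at s within {0..1})"
      unfolding \<sigma>_def by (rule has_vector_derivative_real_field)
    then show "((\<lambda>x. G (of_real x)) has_vector_derivative (1 - (of_real s + cnj d) / (of_real s + d) * z) / csqrt (XX d (of_real s) z)) (at s within {0..1})"
      using T(3) by (simp add: \<sigma>_def)
  qed simp
  moreover have "G (of_real 1) = Fd d z"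
  proof -
    obtain T where "csqrt (XX d (of_real 1) z) = T" "(0::real) < 1 \<Longrightarrow> T = Sd (d / of_real 1) z"
      using XX_root[of 1 z] assms by (metis zero_le_one)
    then show ?thesis by (simp add: G_def Fd_def)
  qed
  moreover have "G (of_real 0) = 0"
  proof -
    obtain T where "csqrt (XX d (of_real 0) z) = T" "(0::real) = 0 \<Longrightarrow> T = 1 + cnj d / d * z"
      using XX_root[of 0 z] assms by (metis order_refl)
    then show ?thesis using d0 by (simp add: G_def field_simps)
  qed
  ultimately show ?thesis by simp
qed

lemma LLz_eq:
  assumes "0 \<le> s" "cmod z < 1" "z \<noteq> 0"
  shows "LLz d (of_real s) z = (1 - (1 - (of_real s + cnj d) / (of_real s + d) * z) / csqrt (XX d (of_real s) z)) / (2 * z)"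
proof -
  define a g where "a = of_real s + d" "g = of_real s + cnj d"
  have a: "a \<noteq> 0" using s_plus_d[OF assms(1)] by (simp add: a_g_def)
  obtain T where T: "T\<^sup>2 = XX d (of_real s) z" "0 < Re T" "csqrt (XX d (of_real s) z) = T"
    using XX_root[OF assms(1,2)] by metis
  have T0: "T \<noteq> 0" using T by auto
  define u D where "u = g / a" "D = 4 * (d * cnj d) / a\<^sup>2"
  have N: "1 + u * z + T \<noteq> 0" using Re_pos_neq_0(1)[OF LL_arg[OF assms(1,2)]] T(3) by (simp add: u_D_def a_g_def)
  have T2: "T * T = 1 - 2 * u * z + u * u * z * z + D * z"
    using T(1) a unfolding XX_def a_g_def[symmetric] by (simp add: u_D_def power2_eq_square field_simps)
  have X': "(2 * (a - g * z) * (- g) + 4 * (d * cnj d)) / a\<^sup>2 = - 2 * u + 2 * u * u * z + D"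
    using a by (simp add: u_D_def power2_eq_square field_simps)
  have "LLz d (of_real s) z = (u + (- 2 * u + 2 * u * u * z + D) / (2 * T)) / (1 + u * z + T)"
    unfolding LLz_def T(3) a_g_def[symmetric] X' u_D_def(1)[symmetric] by simp
  also have "\<dots> = (1 - (1 - u * z) / T) / (2 * z)"
  proof -
    have "(2 * T * u + (- 2 * u + 2 * u * u * z + D)) * z = 2 * T * u * z + (T * T + u * u * z * z - 1)"
      unfolding T2 by (simp add: algebra_simps)
    also have "\<dots> = (T - 1 + u * z) * (1 + u * z + T)" by (simp add: algebra_simps)
    finally have "(2 * T * u + (- 2 * u + 2 * u * u * z + D)) * z = (T - 1 + u * z) * (1 + u * z + T)" .
    then have "(2 * T * u + (- 2 * u + 2 * u * u * z + D)) / (1 + u * z + T) = (T - 1 + u * z) / z"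
      using N assms(3) by (simp add: divide_eq_eq eq_divide_eq mult.commute)
    moreover have "(u + (- 2 * u + 2 * u * u * z + D) / (2 * T)) / (1 + u * z + T)
        = ((2 * T * u + (- 2 * u + 2 * u * u * z + D)) / (1 + u * z + T)) / (2 * T)"
      using T0 by (simp add: field_simps)
    moreover have "(1 - (1 - u * z) / T) / (2 * z) = ((T - 1 + u * z) / z) / (2 * T)"
      using T0 assms(3) by (simp add: field_simps)
    ultimately show ?thesis by simp
  qed
  finally show ?thesis by (simp add: u_D_def a_g_def T(3))
qed

lemma LL_continuous: "cmod z < 1 \<Longrightarrow> continuous_on {0..1::real} (\<lambda>s. LL d (of_real s) z)"
proof -
  assume z: "cmod z < 1"
  have X: "continuous_on {0..1::real} (\<lambda>s. XX d (of_real s) z)"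
    unfolding XX_def using s_plus_d by (intro continuous_intros) auto
  have T: "continuous_on {0..1::real} (\<lambda>s. csqrt (XX d (of_real s) z))"
  proof (rule continuous_on_compose2[where t = "- \<real>\<^sub>\<le>\<^sub>0" and g = csqrt, OF _ X])
    show "continuous_on (- \<real>\<^sub>\<le>\<^sub>0) csqrt" by (rule continuous_on_csqrt)
    show "(\<lambda>s. XX d (of_real s) z) ` {0..1} \<subseteq> - \<real>\<^sub>\<le>\<^sub>0"
    proof (rule image_subsetI)
      fix s :: real assume s: "s \<in> {0..1}"
      show "XX d (of_real s) z \<in> - \<real>\<^sub>\<le>\<^sub>0" using XX_root[of s z thesis for thesis] s z by force
    qed
  qed
  show ?thesis unfolding LL_def
    by (intro continuous_on_Ln' continuous_intros T) (use s_plus_d Re_pos_neq_0(2)[OF LL_arg[OF _ z]] in auto)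
qed

text \<open>Both sides vanish at 0 and, differentiating under the integral sign, have the same
  derivative.\<close>

lemma Lam_superposition:
  assumes "cmod z < 1" shows "Lam d z = integral {0..1} (\<lambda>s. LL d (of_real s) z)"
proof -
  define M where "M z = integral {0..1::real} (\<lambda>s. LL d (of_real s) z)" for z
  have cX: "continuous_on (ball 0 1 \<times> {0..1::real}) (\<lambda>p. XX d (of_real (snd p)) (fst p))"
    unfolding XX_def using s_plus_d by (intro continuous_intros) auto
  have cT: "continuous_on (ball 0 1 \<times> {0..1::real}) (\<lambda>p. csqrt (XX d (of_real (snd p)) (fst p)))"
  proof (rule continuous_on_compose2[where t = "- \<real>\<^sub>\<le>\<^sub>0" and g = csqrt, OF _ cX])
    show "continuous_on (- \<real>\<^sub>\<le>\<^sub>0) csqrt" by (rule continuous_on_csqrt)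
    show "(\<lambda>p. XX d (of_real (snd p)) (fst p)) ` (ball 0 1 \<times> {0..1}) \<subseteq> - \<real>\<^sub>\<le>\<^sub>0"
    proof (rule image_subsetI)
      fix p :: "complex \<times> real" assume p: "p \<in> ball 0 1 \<times> {0..1}"
      show "XX d (of_real (snd p)) (fst p) \<in> - \<real>\<^sub>\<le>\<^sub>0" using XX_root[of "snd p" "fst p" thesis for thesis] p by force
    qed
  qed
  have Tn0: "csqrt (XX d (of_real s) x) \<noteq> 0" if "0 \<le> s" "cmod x < 1" for s x
    using XX_root[OF that] by (metis less_irrefl zero_complex.sel(1))
  have cf: "continuous_on (ball 0 1 \<times> {0..1::real}) (\<lambda>p. LLz d (of_real (snd p)) (fst p))"
    unfolding LLz_def
    by (intro continuous_intros cT) (use s_plus_d Tn0 Re_pos_neq_0(1)[OF LL_arg] in auto)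
  have MD: "(M has_field_derivative integral {0..1} (\<lambda>s. LLz d (of_real s) z)) (at z)" if z: "z \<in> ball 0 1" for z
  proof -
    have "((\<lambda>z. integral (cbox 0 1) (\<lambda>s. LL d (of_real s) z)) has_field_derivative integral (cbox 0 1) (\<lambda>s. LLz d (of_real s) z)) (at z within ball 0 1)"
    proof (rule leibniz_rule_field_derivative)
      show "((\<lambda>z. LL d (of_real t) z) has_field_derivative LLz d (of_real t) x) (at x within ball 0 1)"
        if "x \<in> ball 0 1" "t \<in> cbox 0 1" for x and t :: real
        using LL_derivative[of t x] that by simp
      show "(\<lambda>s. LL d (of_real s) x) integrable_on cbox 0 (1::real)" if "x \<in> ball 0 1" for x
        using LL_continuous[of x] that by (intro integrable_continuous) simp
      show "continuous_on (ball 0 1 \<times> cbox 0 1) (\<lambda>(x, t). LLz d (of_real t) x)"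
        using cf by (simp add: split_beta')
    qed (use z in auto)
    then show ?thesis using z by (simp add: M_def[abs_def] at_within_open[OF _ open_ball])
  qed
  have Mz: "z * integral {0..1} (\<lambda>s. LLz d (of_real s) z) = (1 - Fd d z) / 2" if z: "z \<in> ball 0 1" "z \<noteq> 0" for z
  proof -
    have "((\<lambda>s. (1 - (1 - (of_real s + cnj d) / (of_real s + d) * z) / csqrt (XX d (of_real s) z)) / (2 * z)) has_integral
        (1 - Fd d z) / (2 * z)) {0..1::real}"
      using has_integral_diff[OF has_integral_const_real[of "1::complex" 0 1] Herglotz_superposition[of z]] z
      by (intro has_integral_divide) simp
    then have "((\<lambda>s. LLz d (of_real s) z) has_integral (1 - Fd d z) / (2 * z)) {0..1::real}"
      by (rule has_integral_eq[rotated]) (use z LLz_eq in auto)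
    then show ?thesis using z by (simp add: integral_unique)
  qed
  have "\<exists>c. \<forall>x\<in>ball 0 1. Lam d x - M x = c"
  proof -
    have D0: "((\<lambda>x. Lam d x - M x) has_field_derivative 0) (at x)" if x: "x \<in> ball 0 1 - {0}" for x
    proof -
      obtain D where D: "(Lam d has_field_derivative D) (at x)" "x * D = (1 - Fd d x) / 2"
        using Lam_derivative[OF d, of x] x by auto
      have "x * integral {0..1} (\<lambda>s. LLz d (of_real s) x) = (1 - Fd d x) / 2" by (rule Mz) (use x in auto)
      with D(2) have "x * D = x * integral {0..1} (\<lambda>s. LLz d (of_real s) x)" by (simp only:)
      then have "D = integral {0..1} (\<lambda>s. LLz d (of_real s) x)" using x unfolding mult_cancel_left by simp
      then show ?thesis using DERIV_diff[OF D(1) MD[of x]] x by simp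
    qed
    have "continuous_on (ball 0 1) (\<lambda>x. Lam d x - M x)"
    proof (intro continuous_on_diff)
      show "continuous_on (ball 0 1) (Lam d)"
        using Lam_derivative[OF d] by (metis DERIV_isCont continuous_at_imp_continuous_on mem_ball_0)
      show "continuous_on (ball 0 1) M"
        using MD by (meson DERIV_isCont continuous_at_imp_continuous_on)
    qed
    from DERIV_zero_connected_constant[OF connected_ball open_ball finite.insertI[OF finite.emptyI, of 0] this] D0
    show ?thesis by (metis (no_types, lifting))
  qed
  then obtain c where c: "\<And>x. x \<in> ball 0 1 \<Longrightarrow> Lam d x - M x = c" by blast
  have "M 0 = 0"
  proof -
    have "LL d (of_real s) 0 = 0" if "s \<in> {0..1::real}" for s
      using s_plus_d[of s] that by (simp add: LL_def XX_def)
    then show ?thesis unfolding M_def by (subst integral_cong[of _ _ "\<lambda>_. 0"]) auto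
  qed
  then have "c = 0" using c[of 0] Lam_0[OF d] by simp
  then show ?thesis using c[of z] assms by (simp add: M_def)
qed

end

section \<open>Boundary values of the logarithmic potential\<close>

context
  fixes d :: complex
  assumes d: "0 \<le> Re d" and d0: "d \<noteq> 0"
begin

text \<open>The product with the conjugate root is \<open>4 (s\<^sup>2 + 2 s Re d) z / (s + d)\<^sup>2\<close>, so the argument of the
  logarithm vanishes at most quadratically as \<open>s\<close> tends to 0, uniformly up to the circle.\<close>

lemma Lb_arg_bounds:
  assumes s: "0 < s" "s \<le> 1" and z: "1/2 \<le> cmod z" "cmod z \<le> 1"
  defines "N \<equiv> 1 + (of_real s + cnj d) / (of_real s + d) * z + Sd (d / of_real s) z"
  shows "0 \<le> Re N" "s\<^sup>2 / (3 * (1 + cmod d)\<^sup>2) \<le> cmod N" "cmod N \<le> 6"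
proof -
  define a g S u where "a = of_real s + d" "g = of_real s + cnj d" "S = Sd (d / of_real s) z" "u = g / a"
  have a0: "a \<noteq> 0" using s_plus_d[OF d d0, of s] s by (simp add: a_g_S_u_def)
  have u1: "cmod u = 1" using cmod_quot[OF d d0, of s] s by (simp add: a_g_S_u_def)
  have uz: "cmod (u * z) \<le> 1" using u1 z by (simp add: norm_mult)
  have ds: "0 \<le> Re (d / of_real s)" by (rule Re_d_div[OF d d0 s(1)])
  have S4: "cmod S \<le> 4"
  proof -
    have "cmod S \<le> 2 * 2" unfolding a_g_S_u_def Sd_def norm_mult
      using z(2) by (intro mult_mono csqrt_factor_le[OF ds]) auto
    then show ?thesis by simp
  qed
  have N: "N = 1 + u * z + S" by (simp add: N_def a_g_S_u_def)
  have "Re (u * z) \<ge> - 1" using uz abs_Re_le_cmod[of "u * z"] by linarith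
  then show "0 \<le> Re N" using Re_Sd_nonneg[OF ds z(2)] by (simp add: N a_g_S_u_def)
  have t1: "cmod (1 + u * z) \<le> 2" using norm_triangle_ineq[of 1 "u * z"] uz by simp
  show "cmod N \<le> 6" unfolding N using norm_triangle_ineq[of "1 + u * z" S] t1 S4 by linarith
  have c6: "cmod (1 + u * z - S) \<le> 6" using norm_triangle_ineq4[of "1 + u * z" S] t1 S4 by linarith
  have "N * (1 + u * z - S) = (1 + u * z)\<^sup>2 - S\<^sup>2" unfolding N by (simp add: power2_eq_square algebra_simps)
  also have "S\<^sup>2 = ((a - g * z)\<^sup>2 + 4 * (d * cnj d) * z) / a\<^sup>2"
    unfolding a_g_S_u_def using Sd_scaled_sq[OF d d0 s(1), of z] by (simp add: XX_def)
  also have "(1 + u * z)\<^sup>2 - \<dots> = 4 * (g * a - d * cnj d) * z / a\<^sup>2"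
    using a0 unfolding a_g_S_u_def(4) by (simp add: power2_eq_square field_simps)
  also have "g * a - d * cnj d = of_real (s * s + 2 * s * Re d)"
    unfolding a_g_S_u_def by (simp add: complex_eq_iff algebra_simps)
  finally have "cmod (N * (1 + u * z - S)) = 4 * (s * s + 2 * s * Re d) * cmod z / (cmod a)\<^sup>2"
    using s d by (simp add: norm_mult norm_divide norm_power abs_of_nonneg del: of_real_add of_real_mult)
  moreover have "2 * s\<^sup>2 / (1 + cmod d)\<^sup>2 \<le> 4 * (s * s + 2 * s * Re d) * cmod z / (cmod a)\<^sup>2"
  proof (rule frac_le)
    have "(2::real) * s\<^sup>2 = 4 * (s * s) * (1 / 2)" by (simp add: power2_eq_square)
    also have "\<dots> \<le> 4 * (s * s + 2 * s * Re d) * cmod z" using s d z by (intro mult_mono) auto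
    finally show "2 * s\<^sup>2 \<le> 4 * (s * s + 2 * s * Re d) * cmod z" .
    have "cmod a \<le> 1 + cmod d" unfolding a_g_S_u_def(1) using norm_triangle_ineq[of "of_real s" d] s by simp
    then show "(cmod a)\<^sup>2 \<le> (1 + cmod d)\<^sup>2" by (intro power_mono) auto
    show "0 \<le> 4 * (s * s + 2 * s * Re d) * cmod z" using s d by (intro mult_nonneg_nonneg) auto
  qed (use a0 in simp)
  moreover have "cmod (N * (1 + u * z - S)) \<le> cmod N * 6" unfolding norm_mult using c6 by (intro mult_left_mono) auto
  ultimately have "2 * s\<^sup>2 / (1 + cmod d)\<^sup>2 \<le> cmod N * 6" by linarith
  then have "2 * s\<^sup>2 / (1 + cmod d)\<^sup>2 / 6 \<le> cmod N" by simp
  then show "s\<^sup>2 / (3 * (1 + cmod d)\<^sup>2) \<le> cmod N" by (simp add: field_simps)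
qed

lemma Lb_arg_notin:
  assumes s: "0 < s" "s \<le> 1" and z: "1/2 \<le> cmod z" "cmod z \<le> 1"
  shows "(1 + (of_real s + cnj d) / (of_real s + d) * z + Sd (d / of_real s) z) / 2 \<notin> \<real>\<^sub>\<le>\<^sub>0"
proof -
  define N where "N = 1 + (of_real s + cnj d) / (of_real s + d) * z + Sd (d / of_real s) z"
  note b = Lb_arg_bounds[OF assms, folded N_def]
  have "0 < s\<^sup>2 / (3 * (1 + cmod d)\<^sup>2)"
    using s by (intro add_pos_nonneg divide_pos_pos mult_pos_pos zero_less_power) auto
  then have "N \<noteq> 0" using b(2) by auto
  then show ?thesis unfolding N_def[symmetric] using b(1) by (auto simp: complex_nonpos_Reals_iff complex_eq_iff)
qed

definition Kb :: real where "Kb = 6 * (1 + cmod d)\<^sup>2 + 7"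

text \<open>By \<open>ln x \<le> x - 1\<close> at \<open>x = s powr (-1/2)\<close> the logarithmic
  singularity at \<open>s = 0\<close> has an integrable majorant, uniformly in \<open>z\<close>.\<close>

lemma Lb_bound:
  assumes s: "0 \<le> s" "s \<le> 1" and z: "1/2 \<le> cmod z" "cmod z \<le> 1"
  shows "cmod (Lb d z s) \<le> Kb + 4 * s powr (- (1/2))"
proof (cases "s = 0")
  case True
  then show ?thesis by (simp add: Lb_def Kb_def)
next
  case False
  then have s0: "0 < s" using s by simp
  define N where "N = 1 + (of_real s + cnj d) / (of_real s + d) * z + Sd (d / of_real s) z"
  note b = Lb_arg_bounds[OF s0 s(2) z, folded N_def]
  define m where "m = 6 * (1 + cmod d)\<^sup>2"
  have d1: "0 < 1 + cmod d" by (intro add_pos_nonneg) auto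
  have m0: "0 < m" unfolding m_def using d1 by (intro mult_pos_pos zero_less_power) auto
  define w where "w = cmod (N / 2)"
  have w1: "s\<^sup>2 / m \<le> w" using b(2) by (simp add: w_def m_def norm_divide field_simps)
  have sm: "0 < s\<^sup>2 / m" using s0 m0 by simp
  then have w0: "0 < w" using w1 by linarith
  have w3: "w \<le> 3" using b(3) by (simp add: w_def norm_divide)
  have up: "ln w \<le> 2" using ln_le_minus_one[OF w0] w3 by linarith
  have lo: "- (m + 4 * s powr (- (1/2))) \<le> ln w"
  proof -
    have "ln (s powr (- (1/2))) \<le> s powr (- (1/2)) - 1" using s0 by (intro ln_le_minus_one) simp
    then have ls: "- ln s \<le> 2 * s powr (- (1/2)) - 2" using s0 by (simp add: ln_powr)
    have "ln (s\<^sup>2 / m) \<le> ln w" using w1 sm by (intro ln_mono) auto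
    moreover have "ln (s\<^sup>2 / m) = 2 * ln s - ln m" using s0 m0 by (simp add: ln_div ln_realpow)
    moreover have "ln m \<le> m - 1" using m0 by (rule ln_le_minus_one)
    ultimately show ?thesis using ls by linarith
  qed
  have N0: "N / 2 \<noteq> 0" using w0 by (auto simp: w_def)
  have "cmod (Ln (N / 2)) \<le> \<bar>Re (Ln (N / 2))\<bar> + \<bar>Im (Ln (N / 2))\<bar>" by (rule cmod_le)
  also have "Re (Ln (N / 2)) = ln w" unfolding w_def by (rule Re_Ln[OF N0])
  also have "\<bar>Im (Ln (N / 2))\<bar> \<le> 4"
    using Im_Ln_le_pi[OF N0] mpi_less_Im_Ln[OF N0] pi_less_4 by linarith
  finally have "cmod (Ln (N / 2)) \<le> \<bar>ln w\<bar> + 4" by linarith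
  moreover have "\<bar>ln w\<bar> \<le> m + 2 + 4 * s powr (- (1/2))"
  proof -
    have "0 \<le> 4 * s powr (- (1/2))" by simp
    then show ?thesis using up lo m0 by (auto simp only: abs_le_iff)
  qed
  ultimately show ?thesis using False by (simp add: Lb_def N_def Kb_def m_def)
qed

lemma Kb_integrable: "(\<lambda>s. Kb + 4 * s powr (- (1/2))) integrable_on {0..1::real}"
proof -
  have p: "(\<lambda>s. s powr (- (1/2))) integrable_on {0..1::real}" by (rule integrable_on_powr_from_0) auto
  show ?thesis by (intro integrable_add integrable_on_mult_right integrable_const_ivl p)
qed

lemma LL_eq_Lb: "0 < s \<Longrightarrow> s \<le> 1 \<Longrightarrow> cmod z < 1 \<Longrightarrow> LL d (of_real s) z = Lb d z s"
proof -
  assume s: "0 < s" "s \<le> 1" and z: "cmod z < 1"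
  obtain Y where Y: "csqrt (XX d (of_real s) z) = Y" "Y = Sd (d / of_real s) z"
    using XX_root[OF d d0, of s z] s z by (metis less_imp_le)
  then show ?thesis using s by (simp add: LL_def Lb_def)
qed

lemma
  assumes "cmod z < 1"
  shows Lb_integrable: "Lb d z integrable_on {0..1}" and Lam_eq_Lb: "Lam d z = integral {0..1} (Lb d z)"
proof -
  have i: "(\<lambda>s. LL d (of_real s) z) integrable_on {0..1::real}"
    using LL_continuous[OF d d0 assms] by (rule integrable_continuous_real)
  have eq: "Lb d z s = LL d (of_real s) z" if "s \<in> {0..1} - {0}" for s
    using LL_eq_Lb[of s z] that assms by simp
  show "Lb d z integrable_on {0..1}" by (rule integrable_spike[OF i negligible_sing[of 0]]) (use eq in auto)
  have "integral {0..1} (\<lambda>s. LL d (of_real s) z) = integral {0..1} (Lb d z)"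
    by (rule integral_spike[OF negligible_sing[of 0]]) (use eq in auto)
  then show "Lam d z = integral {0..1} (Lb d z)" using Lam_superposition[OF d d0 assms] by simp
qed

lemma cmod_rr_mult: "z \<in> circle \<Longrightarrow> cmod (of_real (rr i) * z) = rr i"
  using rr_bounds[of i] by (simp add: norm_mult)

lemma Lb_rr_tendsto:
  assumes "z \<in> circle" "s \<in> {0..1}"
  shows "(\<lambda>i. Lb d (of_real (rr i) * z) s) \<longlonglongrightarrow> Lb d z s"
proof (cases "s = 0")
  case False
  then have s: "0 < s" "s \<le> 1" using assms by auto
  have zl: "(\<lambda>i. of_real (rr i) * z) \<longlonglongrightarrow> z"
    using tendsto_mult[OF tendsto_of_real[OF rr_tendsto] tendsto_const, of z] by simp
  have "(\<lambda>i. Sd (d / of_real s) (of_real (rr i) * z)) \<longlonglongrightarrow> Sd (d / of_real s) z"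
  proof (rule continuous_on_tendsto_compose[OF Sd_continuous[OF Re_d_div[OF d d0 s(1)]] zl])
    show "z \<in> cball 0 1" using assms by simp
    show "\<forall>\<^sub>F i in sequentially. of_real (rr i) * z \<in> cball 0 1"
      using cmod_rr_less_1[OF assms(1)] by (intro always_eventually allI) (simp add: less_imp_le)
  qed
  then have "(\<lambda>i. Ln ((1 + (of_real s + cnj d) / (of_real s + d) * (of_real (rr i) * z) + Sd (d / of_real s) (of_real (rr i) * z)) / 2))
      \<longlonglongrightarrow> Ln ((1 + (of_real s + cnj d) / (of_real s + d) * z + Sd (d / of_real s) z) / 2)"
    using assms by (intro tendsto_Ln tendsto_intros zl Lb_arg_notin s) auto
  then show ?thesis using False by (simp add: Lb_def)
qed (simp add: Lb_def)

lemma Lam_tendsto_Lb: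
  assumes "z \<in> circle"
  shows "(\<lambda>i. Lam d (of_real (rr i) * z)) \<longlonglongrightarrow> integral {0..1} (Lb d z)"
proof -
  have le: "norm (Lb d (of_real (rr i) * z) s) \<le> Kb + 4 * s powr (- (1/2))" if "s \<in> {0..1}" for i s
    using that rr_bounds[of i] cmod_rr_mult[OF assms] by (intro Lb_bound) auto
  have i: "Lb d (of_real (rr i) * z) integrable_on {0..1}" for i by (intro Lb_integrable cmod_rr_less_1 assms)
  note dc = dominated_convergence[where f = "\<lambda>i. Lb d (of_real (rr i) * z)" and g = "Lb d z", OF i Kb_integrable le]
  have "(\<lambda>i. integral {0..1} (Lb d (of_real (rr i) * z))) \<longlonglongrightarrow> integral {0..1} (Lb d z)"
    by (rule dc(2)) (use Lb_rr_tendsto[OF assms] in auto)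
  then show "(\<lambda>i. Lam d (of_real (rr i) * z)) \<longlonglongrightarrow> integral {0..1} (Lb d z)"
    using Lam_eq_Lb cmod_rr_less_1[OF assms] by simp
qed

lemma Lam_bound: "z \<in> circle \<Longrightarrow> cmod (Lam d (of_real (rr i) * z)) \<le> integral {0..1} (\<lambda>s. Kb + 4 * s powr (- (1/2)))"
  unfolding Lam_eq_Lb[OF cmod_rr_less_1]
  using rr_bounds[of i] cmod_rr_mult
  by (intro integral_norm_bound_integral Lb_integrable Kb_integrable Lb_bound cmod_rr_less_1) auto

end

text \<open>The radial boundary values of \<open>Lam\<close>; at \<open>d = 0\<close>, where the
  superposition degenerates, \<open>Lam\<close> vanishes.\<close>

definition Lamb :: "complex \<Rightarrow> complex \<Rightarrow> complex"
  where "Lamb d z = (if d = 0 then 0 else integral {0..1} (Lb d z))"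

lemma Lam_zero: assumes "cmod z < 1" shows "Lam 0 z = 0"
proof -
  have r: "0 \<le> Re (0::complex)" by simp
  have "cf 0 k = 0" if "k > 0" for k
  proof -
    have "cnj (cf 0 k) = 0" using fc_mu_d[OF r, of k] fc_haar[of k] that by (simp add: mu_d_def)
    then show ?thesis by simp
  qed
  then have "cf 0 k * z ^ k / of_nat k = 0" for k by (cases "k = 0") auto
  then show ?thesis unfolding Lam_def by (simp only: suminf_zero minus_zero)
qed

lemma Lam_radial_limit:
  assumes "0 \<le> Re d" "z \<in> circle"
  shows "(\<lambda>i. Lam d (of_real (rr i) * z)) \<longlonglongrightarrow> Lamb d z"
proof (cases "d = 0")
  case True
  then show ?thesis using Lam_zero[OF cmod_rr_less_1[OF assms(2)]] by (simp add: Lamb_def)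
next
  case False
  then show ?thesis using Lam_tendsto_Lb[OF assms(1) False assms(2)] by (simp add: Lamb_def)
qed

lemma Lam_bounded:
  assumes "0 \<le> Re d"
  obtains C where "\<And>z i. z \<in> circle \<Longrightarrow> cmod (Lam d (of_real (rr i) * z)) \<le> C"
proof (cases "d = 0")
  case True
  then show ?thesis using that[of 0] Lam_zero[OF cmod_rr_less_1] by simp
qed (use that Lam_bound[OF assms] in blast)

subsection \<open>The value at the singular point\<close>

lemma continuous_on_mult_Ln: "continuous_on {w. 0 \<le> Re w} (\<lambda>w. w * Ln w)"
proof -
  have "continuous (at w within {w. 0 \<le> Re w}) (\<lambda>w. w * Ln w)" if w: "0 \<le> Re w" for w
  proof (cases "w = 0")
    case False
    then have "w \<notin> \<real>\<^sub>\<le>\<^sub>0" using w by (auto simp: complex_nonpos_Reals_iff complex_eq_iff)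
    then show ?thesis by (intro continuous_intros)
  next
    case True
    have b: "norm (x * Ln x) \<le> 2 * sqrt (cmod x) + 4 * cmod x" if x: "cmod x < 1" for x
    proof (cases "x = 0")
      case False
      then have p: "0 < cmod x" by simp
      have "ln (1 / sqrt (cmod x)) \<le> 1 / sqrt (cmod x) - 1" using p by (intro ln_le_minus_one) simp
      then have "- ln (cmod x) \<le> 2 * (1 / sqrt (cmod x))" using p by (simp add: ln_div ln_sqrt)
      moreover have "ln (cmod x) \<le> 0" using x p by simp
      ultimately have l: "\<bar>ln (cmod x)\<bar> \<le> 2 * (1 / sqrt (cmod x))" by linarith
      have "cmod (Ln x) \<le> \<bar>Re (Ln x)\<bar> + \<bar>Im (Ln x)\<bar>" by (rule cmod_le)
      moreover have "\<bar>Im (Ln x)\<bar> \<le> 4" using Im_Ln_le_pi[OF False] mpi_less_Im_Ln[OF False] pi_less_4 by linarith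
      ultimately have "cmod (Ln x) \<le> 2 * (1 / sqrt (cmod x)) + 4" using l Re_Ln[OF False] by simp
      then have "cmod x * cmod (Ln x) \<le> cmod x * (2 * (1 / sqrt (cmod x)) + 4)" by (intro mult_left_mono) auto
      also have "\<dots> = 2 * (cmod x / sqrt (cmod x)) + 4 * cmod x" by (simp add: algebra_simps)
      also have "cmod x / sqrt (cmod x) = sqrt (cmod x)" by (simp add: real_div_sqrt)
      finally show ?thesis by (simp add: norm_mult)
    qed simp
    have "((\<lambda>x. x * Ln x) \<longlongrightarrow> 0) (at 0 within {w. 0 \<le> Re w})"
    proof (rule Lim_null_comparison)
      show "\<forall>\<^sub>F x in at 0 within {w. 0 \<le> Re w}. norm (x * Ln x) \<le> 2 * sqrt (cmod x) + 4 * cmod x"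
        using b unfolding eventually_at by (intro exI[of _ 1]) (auto simp: dist_norm)
      have "((\<lambda>x. 2 * sqrt (cmod x) + 4 * cmod x) \<longlongrightarrow> 2 * sqrt (cmod 0) + 4 * cmod 0) (at 0 within {w::complex. 0 \<le> Re w})"
        by (intro tendsto_intros)
      then show "((\<lambda>x. 2 * sqrt (cmod x) + 4 * cmod x) \<longlongrightarrow> 0) (at 0 within {w::complex. 0 \<le> Re w})" by simp
    qed
    then show ?thesis by (simp add: continuous_within True)
  qed
  then show ?thesis by (simp add: continuous_on_eq_continuous_within)
qed

lemma continuous_on_mult_Ln':
  assumes "continuous_on A f" "\<And>x. x \<in> A \<Longrightarrow> 0 \<le> Re (f x)"
  shows "continuous_on A (\<lambda>x. f x * Ln (f x))"
  by (rule continuous_on_compose2[OF continuous_on_mult_Ln assms(1)]) (use assms(2) in auto)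

lemma has_integral_Ln_shift:
  assumes "0 \<le> Re c"
  shows "((\<lambda>s. Ln (of_real s + c)) has_integral (1 + c) * Ln (1 + c) - c * Ln c - 1) {0..1::real}"
proof -
  define P where "P s = (of_real s + c) * Ln (of_real s + c) - (of_real s + c)" for s :: real
  have "((\<lambda>s. Ln (of_real s + c)) has_integral P 1 - P 0) {0..1}"
  proof (rule fundamental_theorem_of_calculus_interior)
    show "continuous_on {0..1} P" unfolding P_def
      by (intro continuous_intros continuous_on_mult_Ln') (use assms in auto)
    fix s :: real assume s: "s \<in> {0<..<1}"
    define w where "w = of_real s + c"
    have w: "w \<notin> \<real>\<^sub>\<le>\<^sub>0" "w \<noteq> 0" using s assms by (auto simp: complex_nonpos_Reals_iff complex_eq_iff w_def)
    have "((\<lambda>w. (w + c) * Ln (w + c) - (w + c)) has_field_derivative Ln w) (at (of_real s))"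
    proof -
      have h: "((\<lambda>w. w + c) has_field_derivative 1) (at (of_real s))" by (auto intro!: derivative_eq_intros)
      have L: "((\<lambda>w. Ln (w + c)) has_field_derivative inverse w * 1) (at (of_real s))"
        by (rule DERIV_chain2[OF _ h]) (use has_field_derivative_Ln[OF w(1)] w_def in simp)
      show ?thesis
        using DERIV_diff[OF DERIV_mult[OF h L] h] w(2) by (simp add: w_def)
    qed
    then show "(P has_vector_derivative Ln (of_real s + c)) (at s)"
      unfolding P_def[abs_def] w_def by (rule has_vector_derivative_real_field)
  qed simp
  also have "P 1 - P 0 = (1 + c) * Ln (1 + c) - c * Ln c - 1" by (simp add: P_def)
  finally show ?thesis .
qed

text \<open>At 1 the argument of the logarithm in \<open>Lb\<close> reduces to \<open>(s + 2 Re d) / (s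
  + d)\<close>.\<close>

lemma Lamb_1:
  assumes d: "0 \<le> Re d" and d0: "d \<noteq> 0"
  shows "Lamb d 1 = ((1 + of_real (2 * Re d)) * Ln (1 + of_real (2 * Re d)) - of_real (2 * Re d) * Ln (of_real (2 * Re d)))
     - ((1 + d) * Ln (1 + d) - d * Ln d)"
proof -
  define c where "c = complex_of_real (2 * Re d)"
  have c: "0 \<le> Re c" using d by (simp add: c_def)
  have "((\<lambda>s. Ln (of_real s + c) - Ln (of_real s + d)) has_integral
      ((1 + c) * Ln (1 + c) - c * Ln c - 1) - ((1 + d) * Ln (1 + d) - d * Ln d - 1)) {0..1::real}"
    by (intro has_integral_diff has_integral_Ln_shift d c)
  then have "(Lb d 1 has_integral ((1 + c) * Ln (1 + c) - c * Ln c - 1) - ((1 + d) * Ln (1 + d) - d * Ln d - 1)) {0..1::real}"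
  proof (rule has_integral_spike[OF negligible_sing[of 0], rotated])
    fix s :: real assume "s \<in> {0..1} - {0}"
    then have s: "0 < s" "s \<le> 1" by auto
    define m where "m = of_real s + d"
    have m: "m \<noteq> 0" "m \<notin> \<real>\<^sub>\<le>\<^sub>0" using s d by (auto simp: complex_nonpos_Reals_iff complex_eq_iff m_def)
    have "(1 + d / of_real s) * Sd (d / of_real s) 1 = of_real (2 * Re (d / of_real s))"
      by (rule Sd_1[OF Re_d_div[OF d d0 s(1)]])
    then have "m * Sd (d / of_real s) 1 = c"
      using s by (simp add: m_def c_def Re_divide_of_real field_simps)
    then have S: "Sd (d / of_real s) 1 = c / m" using m by (simp add: field_simps)
    have g: "of_real s + cnj d = 2 * of_real s + c - m" by (simp add: m_def c_def complex_eq_iff)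
    have "(1 + (of_real s + cnj d) / (of_real s + d) * 1 + Sd (d / of_real s) 1) / 2 = of_real (s + 2 * Re d) * inverse m"
      unfolding S g m_def[symmetric] using m by (simp add: field_simps c_def)
    also have "Ln \<dots> = Ln (of_real s + c) + Ln (inverse m)"
      using s d m Ln_times_of_real[of "s + 2 * Re d" "inverse m"] by (simp add: c_def)
    also have "Ln (inverse m) = - Ln m" by (rule Ln_inverse[OF m(2)])
    finally show "Lb d 1 s = Ln (of_real s + c) - Ln (of_real s + d)"
      using s unfolding Lb_def m_def by simp
  qed
  then have "integral {0..1} (Lb d 1) = ((1 + c) * Ln (1 + c) - c * Ln c - 1) - ((1 + d) * Ln (1 + d) - d * Ln d - 1)"
    by (rule integral_unique)
  then show ?thesis unfolding Lamb_def c_def using d0 by simp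
qed

section \<open>The variational condition on the circle\<close>

text \<open>Minus the total potential of the equilibrium measure in the external field.\<close>

definition VV :: "complex \<Rightarrow> complex \<Rightarrow> real"
  where "VV d z = 2 * Re (Lamb d z) - Qr d z"

lemma cis_neq_1: "0 < \<theta> \<Longrightarrow> \<theta> < 2 * pi \<Longrightarrow> cis \<theta> \<noteq> 1"
proof
  assume t: "0 < \<theta>" "\<theta> < 2 * pi" and "cis \<theta> = 1"
  then have "sin (\<theta> / 2) = 0" using one_minus_cis[of \<theta>] by simp
  moreover have "sin (\<theta> / 2) > 0" using t by (intro sin_gt_zero) auto
  ultimately show False by simp
qed

lemma rr_cis_neq_1: "0 < \<theta> \<Longrightarrow> \<theta> < 2 * pi \<Longrightarrow> 0 < r \<Longrightarrow> of_real r * cis \<theta> \<noteq> 1"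
proof
  assume t: "0 < \<theta>" "\<theta> < 2 * pi" "0 < r" and e: "of_real r * cis \<theta> = 1"
  have "cmod (of_real r * cis \<theta>) = 1" using e by simp
  then have "r = 1" using t by (simp add: norm_mult)
  then show False using e cis_neq_1[OF t(1,2)] by simp
qed

context
  fixes d :: complex
  assumes d: "0 \<le> Re d"
begin

lemma Hd_sign_left:
  assumes "0 < \<theta>" "\<theta> < 2 * pi" "\<theta> \<le> 2 * pi + phi2 d" shows "0 \<le> Im (Hd d (cis \<theta>))"
proof (cases "\<theta> < phi1 d")
  case True
  obtain x where "0 \<le> x" "(1 + d) * Sd d (cis \<theta>) / (1 - cis \<theta>) = \<i> * of_real x"
    using boundary_value_left_gap[OF d assms(1) True] .
  then show ?thesis unfolding Re_Fd_circle(2)[OF d assms(1,2)] by simp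
next
  case False
  then show ?thesis unfolding Re_Fd_circle(2)[OF d assms(1,2)]
    using boundary_value_support[OF d, of \<theta>] assms by simp
qed

lemma Hd_sign_right:
  assumes "0 < \<theta>" "\<theta> < 2 * pi" "phi1 d \<le> \<theta>" shows "Im (Hd d (cis \<theta>)) \<le> 0"
proof (cases "2 * pi + phi2 d < \<theta>")
  case True
  obtain x where "0 \<le> x" "(1 + d) * Sd d (cis \<theta>) / (1 - cis \<theta>) = - \<i> * of_real x"
    using boundary_value_right_gap[OF d True assms(2)] .
  then show ?thesis unfolding Re_Fd_circle(2)[OF d assms(1,2)] by simp
next
  case False
  then show ?thesis unfolding Re_Fd_circle(2)[OF d assms(1,2)]
    using boundary_value_support[OF d, of \<theta>] assms by simp
qed

text \<open>Inside the disc the angular derivative of minus the total potential is the imaginary part of \<open>Hd\<close>,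
  because \<open>z (Lam d)' = (1 - Fd) / 2\<close> and \<open>Hd = Fd + 2 cnj d z / (1 - z)\<close>.\<close>

lemma angular_derivative:
  assumes "0 < r" "r < 1"
  shows "((\<lambda>\<theta>. 2 * Re (Lam d (of_real r * cis \<theta>)) - Qr d (of_real r * cis \<theta>)) has_real_derivative
    Im (Hd d (of_real r * cis \<theta>))) (at \<theta>)"
proof -
  define G where "G z = 2 * (Lam d z + cnj d * Ln (1 - z))" for z
  define z where "z = of_real r * exp (\<i> * of_real \<theta>)"
  have z: "cmod z < 1" using assms by (simp add: z_def norm_mult)
  have z1: "1 - z \<noteq> 0" "1 - z \<notin> \<real>\<^sub>\<le>\<^sub>0" using one_minus_notin_nonpos[OF z] by auto
  obtain D where D: "(Lam d has_field_derivative D) (at z)" "z * D = (1 - Fd d z) / 2"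
    using Lam_derivative[OF d z] by metis
  have L: "((\<lambda>z. Ln (1 - z)) has_field_derivative inverse (1 - z) * (- 1)) (at z)"
  proof (rule DERIV_chain2[where f = Ln and g = "\<lambda>z. 1 - z", OF has_field_derivative_Ln[OF z1(2)]])
    show "((\<lambda>z. 1 - z) has_field_derivative - 1) (at z)" by (auto intro!: derivative_eq_intros)
  qed
  have G: "(G has_field_derivative 2 * (D + cnj d * (inverse (1 - z) * (- 1)))) (at z)"
    unfolding G_def[abs_def] by (intro DERIV_cmult DERIV_add D L)
  have E: "((\<lambda>w. of_real r * exp (\<i> * w)) has_field_derivative of_real r * (exp (\<i> * of_real \<theta>) * \<i>)) (at (of_real \<theta>))"
    by (auto intro!: derivative_eq_intros)
  have "((\<lambda>w. G (of_real r * exp (\<i> * w))) has_field_derivative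
      2 * (D + cnj d * (inverse (1 - z) * (- 1))) * (of_real r * (exp (\<i> * of_real \<theta>) * \<i>))) (at (of_real \<theta>))"
    by (rule DERIV_chain2[OF _ E]) (use G in \<open>simp only: z_def\<close>)
  also have "2 * (D + cnj d * (inverse (1 - z) * (- 1))) * (of_real r * (exp (\<i> * of_real \<theta>) * \<i>))
      = (2 * (z * D) - 2 * cnj d * z / (1 - z)) * \<i>"
    unfolding z_def[symmetric] mult.assoc[symmetric]
    by (simp add: divide_inverse algebra_simps z_def)
  also have "\<dots> = (1 - Hd d z) * \<i>"
  proof -
    have "Hd d z - Fd d z = 2 * cnj d * z / (1 - z)"
      unfolding Hd_def Fd_def diff_divide_distrib[symmetric] by (simp add: algebra_simps)
    moreover have "2 * ((1 - F) / 2) - (H - F) = 1 - H" for F H :: complex by (simp add: field_simps)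
    ultimately show ?thesis unfolding D(2) by metis
  qed
  finally have "((\<lambda>t. G (of_real r * exp (\<i> * of_real t))) has_vector_derivative (1 - Hd d z) * \<i>) (at \<theta>)"
    by (rule has_vector_derivative_real_field)
  from bounded_linear.has_vector_derivative[OF bounded_linear_Re this]
  have "((\<lambda>t. Re (G (of_real r * exp (\<i> * of_real t)))) has_real_derivative Im (Hd d z)) (at \<theta>)"
    unfolding has_real_derivative_iff_has_vector_derivative by simp
  moreover have "Re (G w) = 2 * Re (Lam d w) - Qr d w" for w by (simp add: G_def Qr_def)
  ultimately show ?thesis by (simp add: z_def cis_conv_exp)
qed

lemma VV_tendsto:
  assumes "z \<in> circle" "z \<noteq> 1"
  shows "(\<lambda>i. 2 * Re (Lam d (of_real (rr i) * z)) - Qr d (of_real (rr i) * z)) \<longlonglongrightarrow> VV d z"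
  unfolding VV_def by (intro tendsto_intros Lam_radial_limit Qr_rr_tendsto d assms)

text \<open>Away from 1 the angular derivatives converge uniformly as the radius grows to 1, so by the
  mean value theorem the sign of \<open>Im Hd\<close> on an arc of the circle determines the
  monotonicity of the boundary values. The factor \<open>\<sigma>\<close> covers both directions.\<close>

lemma VV_mono:
  assumes t: "0 < \<theta>1" "\<theta>1 \<le> \<theta>2" "\<theta>2 < 2 * pi"
    and s: "\<And>\<theta>. \<theta>1 \<le> \<theta> \<Longrightarrow> \<theta> \<le> \<theta>2 \<Longrightarrow> 0 \<le> \<sigma> * Im (Hd d (cis \<theta>))"
  shows "\<sigma> * VV d (cis \<theta>1) \<le> \<sigma> * VV d (cis \<theta>2)"
proof (cases "\<theta>1 = \<theta>2")
  case False
  define l where "l = \<theta>2 - \<theta>1"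
  have l: "0 < l" using t False by (simp add: l_def)
  define f where "f i \<theta> = 2 * Re (Lam d (of_real (rr i) * cis \<theta>)) - Qr d (of_real (rr i) * cis \<theta>)" for i \<theta>
  define g where "g p = \<sigma> * Im (Hd d (of_real (fst p) * cis (snd p)))" for p :: "real \<times> real"
  have cg: "continuous_on ({1/2..1} \<times> {\<theta>1..\<theta>2}) g"
  proof -
    have cz: "continuous_on ({1/2..1} \<times> {\<theta>1..\<theta>2}) (\<lambda>p. of_real (fst p) * cis (snd p))"
      unfolding cis_conv_exp by (intro continuous_intros)
    have cS: "continuous_on ({1/2..1} \<times> {\<theta>1..\<theta>2}) (\<lambda>p. Sd d (of_real (fst p) * cis (snd p)))"
      by (rule continuous_on_compose2[OF Sd_continuous[OF d] cz]) (auto simp: norm_mult)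
    have "1 - of_real (fst p) * cis (snd p) \<noteq> 0" if "p \<in> {1/2..1} \<times> {\<theta>1..\<theta>2}" for p :: "real \<times> real"
      using rr_cis_neq_1[of "snd p" "fst p"] that t by auto
    then show ?thesis unfolding g_def Hd_def by (intro continuous_intros cS cz) auto
  qed
  have uc: "uniformly_continuous_on ({1/2..1} \<times> {\<theta>1..\<theta>2}) g"
    by (intro compact_uniformly_continuous cg compact_Times compact_Icc)
  have main: "\<sigma> * VV d (cis \<theta>1) \<le> \<sigma> * VV d (cis \<theta>2) + l * e" if e: "0 < e" for e
  proof -
    obtain \<delta> where \<delta>: "0 < \<delta>" "\<And>p q. p \<in> {1/2..1} \<times> {\<theta>1..\<theta>2} \<Longrightarrow> q \<in> {1/2..1} \<times> {\<theta>1..\<theta>2} \<Longrightarrow> dist q p < \<delta> \<Longrightarrow> dist (g q) (g p) < e"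
      using uc e unfolding uniformly_continuous_on_def by blast
    have "\<forall>\<^sub>F i in sequentially. dist (rr i) 1 < \<delta>" using rr_tendsto \<delta>(1) by (rule tendstoD)
    then have ev: "\<forall>\<^sub>F i in sequentially. \<sigma> * f i \<theta>1 \<le> \<sigma> * f i \<theta>2 + l * e"
    proof eventually_elim
      fix i assume i: "dist (rr i) 1 < \<delta>"
      have "\<exists>z>\<theta>1. z < \<theta>2 \<and> \<sigma> * f i \<theta>2 - \<sigma> * f i \<theta>1 = (\<theta>2 - \<theta>1) * g (rr i, z)"
      proof (rule MVT2)
        show "\<theta>1 < \<theta>2" using l by (simp add: l_def)
        show "((\<lambda>\<theta>. \<sigma> * f i \<theta>) has_real_derivative g (rr i, x)) (at x)" for x
          unfolding f_def g_def using DERIV_cmult[OF angular_derivative[OF rr_bounds(3,2)], of \<sigma>] by simp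
      qed
      then obtain \<xi> where \<xi>: "\<theta>1 < \<xi>" "\<xi> < \<theta>2" "\<sigma> * f i \<theta>2 - \<sigma> * f i \<theta>1 = l * g (rr i, \<xi>)" by (auto simp: l_def)
      have "dist (g (rr i, \<xi>)) (g (1, \<xi>)) < e"
        using \<xi> i rr_bounds[of i] by (intro \<delta>(2)) (auto simp: dist_Pair_Pair)
      moreover have "0 \<le> g (1, \<xi>)" using s[of \<xi>] \<xi> by (simp add: g_def)
      ultimately have "- e \<le> g (rr i, \<xi>)" by (simp add: dist_real_def abs_less_iff)
      then have "l * (- e) \<le> l * g (rr i, \<xi>)" using l by (intro mult_left_mono) auto
      then show "\<sigma> * f i \<theta>1 \<le> \<sigma> * f i \<theta>2 + l * e" using \<xi>(3) by simp
    qed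
    have lim: "(\<lambda>i. f i \<theta>) \<longlonglongrightarrow> VV d (cis \<theta>)" if "\<theta>1 \<le> \<theta>" "\<theta> \<le> \<theta>2" for \<theta>
      unfolding f_def using that t cis_neq_1[of \<theta>] by (intro VV_tendsto) auto
    show ?thesis
      by (rule tendsto_le[OF _ _ _ ev]) (use t in \<open>auto intro!: tendsto_intros lim\<close>)
  qed
  show ?thesis
  proof (rule field_le_epsilon)
    fix e :: real assume "0 < e"
    then show "\<sigma> * VV d (cis \<theta>1) \<le> \<sigma> * VV d (cis \<theta>2) + e" using main[of "e / l"] l by simp
  qed
qed simp

text \<open>The imaginary part of \<open>Hd\<close> is nonnegative before the support, zero on it and
  nonpositive after it, so \<open>VV\<close> increases up to the support, is constant there and
  decreases afterwards.\<close>

lemma equilibrium_condition: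
  obtains L where "\<And>z. z \<in> circle \<Longrightarrow> z \<noteq> 1 \<Longrightarrow> VV d z \<le> L"
    and "\<And>\<theta>. 0 < \<theta> \<Longrightarrow> \<theta> < 2 * pi \<Longrightarrow> w_d d \<theta> \<noteq> 0 \<Longrightarrow> VV d (cis \<theta>) = L"
proof -
  have key: "VV d (cis \<theta>) \<le> VV d (cis \<phi>)"
    if p: "0 < \<phi>" "\<phi> < 2 * pi" "phi1 d \<le> \<phi>" "\<phi> \<le> 2 * pi + phi2 d" and t: "0 < \<theta>" "\<theta> < 2 * pi" for \<phi> \<theta>
  proof (cases "\<theta> \<le> \<phi>")
    case True
    then show ?thesis using VV_mono[of \<theta> \<phi> 1] Hd_sign_left p t by simp
  next
    case False
    then show ?thesis using VV_mono[of \<phi> \<theta> "- 1"] Hd_sign_right p t by simp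
  qed
  define \<phi> where "\<phi> = pi + xi_d d"
  have p: "0 < \<phi>" "\<phi> < 2 * pi" "phi1 d \<le> \<phi>" "\<phi> \<le> 2 * pi + phi2 d"
    using theta_d_eq[OF d] xi_d_eq[OF d] by (auto simp: \<phi>_def phi1_def phi2_def)
  show ?thesis
  proof (rule that[of "VV d (cis \<phi>)"])
    fix z :: complex assume "z \<in> circle" "z \<noteq> 1"
    then obtain "0 < Arg2pi z" "Arg2pi z < 2 * pi" "z = cis (Arg2pi z)" by (rule circle_cases_cis)
    then show "VV d z \<le> VV d (cis \<phi>)" using key[OF p, of "Arg2pi z"] by metis
  next
    fix \<theta> assume t: "0 < \<theta>" "\<theta> < 2 * pi" and w: "w_d d \<theta> \<noteq> 0"
    then have "phi1 d \<le> \<theta>" "\<theta> \<le> 2 * pi + phi2 d"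
      by (auto simp: w_d_def phi1_def phi2_def split: if_splits)
    then show "VV d (cis \<theta>) = VV d (cis \<phi>)" using key[OF p t] key[OF t _ _ p(1,2)] by simp
  qed
qed

section \<open>The equilibrium measure minimises the energy\<close>

lemma cmod_cf_le_1: "cmod (cf d k) \<le> 1"
  using norm_fc_le_1[OF mu_d_M1[OF d], of k] by (simp add: fc_mu_d[OF d])

lemma
  assumes "\<mu> \<in> M1"
  shows integral_Lam_sums: "(\<lambda>k. - (of_real (rr i) ^ k * cf d k * fc \<mu> k) / of_nat k) sums (\<integral>z. Lam d (of_real (rr i) * z) \<partial>\<mu>)"
    and integrable_Lam_rr: "integrable \<mu> (\<lambda>z. Lam d (of_real (rr i) * z))"
proof -
  define f where "f k z = - (cf d k * (of_real (rr i) * z) ^ k / of_nat k)" for k z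
  have fm: "f k \<in> borel_measurable circle_borel" for k
    unfolding f_def divide_inverse by (intro borel_measurable_circle continuous_intros)
  have fb: "norm (f k z) \<le> rr i ^ k" if "z \<in> circle" for k z
  proof (cases "k = 0")
    case True
    then show ?thesis using rr_bounds by (simp add: f_def)
  next
    case False
    have "norm (f k z) = cmod (cf d k) * rr i ^ k / real k"
      using that rr_bounds(4)[of i] by (simp add: f_def norm_mult norm_divide norm_power)
    also have "\<dots> \<le> 1 * rr i ^ k / 1"
      using False rr_bounds(4)[of i] cmod_cf_le_1 by (intro frac_le mult_right_mono) auto
    finally show ?thesis by simp
  qed
  have fs: "(\<Sum>k. f k z) = Lam d (of_real (rr i) * z)" if "z \<in> circle" for z
    using sums_minus[OF Lam_sums[OF d cmod_rr_less_1[OF that]], of i] by (simp add: f_def sums_iff)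
  note M = M1_sums_integral[OF assms fm fb summable_rr]
  have if_k: "(\<integral>z. f k z \<partial>\<mu>) = - (of_real (rr i) ^ k * cf d k * fc \<mu> k) / of_nat k" for k
  proof -
    have "(\<integral>z. f k z \<partial>\<mu>) = (\<integral>z. (- (of_real (rr i) ^ k * cf d k) / of_nat k) * z ^ k \<partial>\<mu>)"
      by (simp add: f_def power_mult_distrib algebra_simps)
    then show ?thesis by (simp add: fc_def)
  qed
  have eq: "(\<integral>z. (\<Sum>k. f k z) \<partial>\<mu>) = (\<integral>z. Lam d (of_real (rr i) * z) \<partial>\<mu>)"
    by (rule Bochner_Integration.integral_cong[OF refl]) (use fs M1_space[OF assms] in auto)
  show "(\<lambda>k. - (of_real (rr i) ^ k * cf d k * fc \<mu> k) / of_nat k) sums (\<integral>z. Lam d (of_real (rr i) * z) \<partial>\<mu>)"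
    using M(1) unfolding if_k eq .
  show "integrable \<mu> (\<lambda>z. Lam d (of_real (rr i) * z))"
    using M(2) by (rule Bochner_Integration.integrable_cong[THEN iffD1, rotated 2]) (use fs M1_space[OF assms] in auto)
qed

lemma
  assumes \<mu>: "\<mu> \<in> M1"
  shows integrable_Lamb: "integrable \<mu> (Lamb d)"
    and integral_Lam_tendsto: "(\<lambda>i. \<integral>z. Lam d (of_real (rr i) * z) \<partial>\<mu>) \<longlonglongrightarrow> (\<integral>z. Lamb d z \<partial>\<mu>)"
proof -
  obtain C where C: "\<And>z i. z \<in> circle \<Longrightarrow> cmod (Lam d (of_real (rr i) * z)) \<le> C" using Lam_bounded[OF d] by metis
  have m: "(\<lambda>z. Lam d (of_real (rr i) * z)) \<in> borel_measurable \<mu>" for i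
    using integrable_Lam_rr[OF \<mu>] by (rule borel_measurable_integrable)
  have lim: "(\<lambda>i. Lam d (of_real (rr i) * z)) \<longlonglongrightarrow> Lamb d z" if "z \<in> space \<mu>" for z
    using that M1_space[OF \<mu>] by (intro Lam_radial_limit d) auto
  have mL: "Lamb d \<in> borel_measurable \<mu>" by (rule borel_measurable_LIMSEQ_metric[OF m lim])
  have c: "integrable \<mu> (\<lambda>_. C)" using M1_prob_space[OF \<mu>] by (simp add: prob_space.finite_measure finite_measure.integrable_const)
  have b: "AE z in \<mu>. norm (Lam d (of_real (rr i) * z)) \<le> C" for i
    by (rule AE_I2) (use C M1_space[OF \<mu>] in auto)
  have l: "AE z in \<mu>. (\<lambda>i. Lam d (of_real (rr i) * z)) \<longlonglongrightarrow> Lamb d z" by (rule AE_I2[OF lim])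
  show "integrable \<mu> (Lamb d)" by (rule integrable_dominated_convergence[OF mL m c l b])
  show "(\<lambda>i. \<integral>z. Lam d (of_real (rr i) * z) \<partial>\<mu>) \<longlonglongrightarrow> (\<integral>z. Lamb d z \<partial>\<mu>)"
    by (rule integral_dominated_convergence[OF mL m c l b])
qed

lemma Er_mu_d: "Er (mu_d d) (rr i) = - Re (\<integral>z. Lam d (of_real (rr i) * z) \<partial>mu_d d)"
proof -
  have "- Re (- (of_real (rr i) ^ k * cf d k * fc (mu_d d) k) / of_nat k) = rr i ^ k * (cmod (fc (mu_d d) k))\<^sup>2 / real k" for k
  proof -
    have "of_real (rr i) ^ k * cf d k * fc (mu_d d) k = of_real (rr i ^ k * (cmod (fc (mu_d d) k))\<^sup>2)"
      unfolding fc_mu_d[OF d] complex_mod_cnj of_real_mult complex_norm_square by simp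
    then show ?thesis by (simp del: of_real_mult of_real_power)
  qed
  moreover have "(\<lambda>k. - Re (- (of_real (rr i) ^ k * cf d k * fc (mu_d d) k) / of_nat k)) sums - Re (\<integral>z. Lam d (of_real (rr i) * z) \<partial>mu_d d)"
    by (intro sums_minus sums_Re integral_Lam_sums mu_d_M1 d)
  ultimately have "(\<lambda>k. rr i ^ k * (cmod (fc (mu_d d) k))\<^sup>2 / real k) sums - Re (\<integral>z. Lam d (of_real (rr i) * z) \<partial>mu_d d)"
    by (simp only:)
  then show ?thesis unfolding Er_def by (rule sums_unique[symmetric])
qed

lemma en_mu_d_finite: "en (mu_d d) \<noteq> \<infinity>"
proof -
  obtain C where C: "\<And>z i. z \<in> circle \<Longrightarrow> cmod (Lam d (of_real (rr i) * z)) \<le> C" using Lam_bounded[OF d] by metis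
  note M = mu_d_M1[OF d]
  interpret P: prob_space "mu_d d" by (rule M1_prob_space[OF M])
  have "Er (mu_d d) (rr i) \<le> C" for i
  proof -
    have "Er (mu_d d) (rr i) \<le> cmod (\<integral>z. Lam d (of_real (rr i) * z) \<partial>mu_d d)"
      unfolding Er_mu_d using abs_Re_le_cmod[of "\<integral>z. Lam d (of_real (rr i) * z) \<partial>mu_d d"] by linarith
    also have "\<dots> \<le> (\<integral>z. cmod (Lam d (of_real (rr i) * z)) \<partial>mu_d d)" by (rule integral_norm_bound)
    also have "\<dots> \<le> (\<integral>z. C \<partial>mu_d d)"
      by (rule integral_mono) (use C M1_space[OF M] integrable_Lam_rr[OF M] in auto)
    finally show ?thesis by (simp add: P.prob_space)
  qed
  then have "ennreal (Er (mu_d d) (rr i)) \<le> ennreal C" for i by (rule ennreal_leI)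
  then have "en (mu_d d) \<le> ennreal C" using LIMSEQ_le_const2[OF Er_rr_tendsto[OF M]] by blast
  then show ?thesis using ennreal_less_top[of C] by (auto simp: top_unique)
qed

lemma integral_Qr_rr_mu_d: "(\<integral>z. Qr e (of_real (rr i) * z) \<partial>mu_d d) = - 2 * Re (e * Lam d (of_real (rr i)))"
proof -
  note M = mu_d_M1[OF d]
  have "cmod (of_real (rr i)) < 1" using rr_bounds[of i] by simp
  from sums_cnj[THEN iffD2, OF sums_minus[OF Lam_sums[OF d this]]]
  have "(\<lambda>k. - (of_real (rr i) ^ k * fc (mu_d d) k) / of_nat k) sums cnj (Lam d (of_real (rr i)))"
    by (simp add: fc_mu_d[OF d] mult.commute)
  then have "(\<integral>z. Ln (1 - of_real (rr i) * z) \<partial>mu_d d) = cnj (Lam d (of_real (rr i)))"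
    using integral_Ln_sums(1)[OF M rr_bounds(4,2)] by (rule sums_unique2[symmetric])
  then show ?thesis unfolding integral_Qr_eq_Ln[OF M rr_bounds(4,2)] by simp
qed

text \<open>At smaller radii the integral is a value of \<open>Lam\<close> on the real axis, which stays
  bounded up to 1.\<close>

lemma
  assumes e: "0 \<le> Re e"
  shows integrable_Qr_mu_d: "integrable (mu_d d) (Qr e)"
    and integral_Qr_mu_d: "(\<integral>z. Qr e z \<partial>mu_d d) = - 2 * Re (e * Lamb d 1)"
proof -
  note M = mu_d_M1[OF d]
  obtain C where C: "\<And>z i. z \<in> circle \<Longrightarrow> cmod (Lam d (of_real (rr i) * z)) \<le> C" using Lam_bounded[OF d] by metis
  have ae: "AE z in mu_d d. z \<noteq> 1" by (rule finite_energy_no_atom[OF M en_mu_d_finite])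
  have "(\<integral>z. Qr e (of_real (rr i) * z) \<partial>mu_d d) \<le> 2 * (cmod e * C)" for i
  proof -
    have "- 2 * Re (e * Lam d (of_real (rr i))) \<le> 2 * cmod (e * Lam d (of_real (rr i)))"
      using abs_Re_le_cmod[of "e * Lam d (of_real (rr i))"] by linarith
    also have "\<dots> \<le> 2 * (cmod e * C)" unfolding norm_mult using C[of 1 i] by (intro mult_left_mono) auto
    finally show ?thesis unfolding integral_Qr_rr_mu_d .
  qed
  then show i: "integrable (mu_d d) (Qr e)" by (rule integrable_Qr_if_Abel_bounded[OF e M ae])
  have "(\<lambda>i. Lam d (of_real (rr i))) \<longlonglongrightarrow> Lamb d 1" using Lam_radial_limit[OF d, of 1] by simp
  then have "(\<lambda>i. - 2 * Re (e * Lam d (of_real (rr i)))) \<longlonglongrightarrow> - 2 * Re (e * Lamb d 1)" by (intro tendsto_intros)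
  then show "(\<integral>z. Qr e z \<partial>mu_d d) = - 2 * Re (e * Lamb d 1)"
    using integral_Qr_rr_tendsto[OF e M ae i] unfolding integral_Qr_rr_mu_d by (metis LIMSEQ_unique)
qed

lemma Er_tendsto_energy:
  assumes "\<mu> \<in> M1" "en \<mu> \<noteq> \<infinity>" shows "(\<lambda>i. Er \<mu> (rr i)) \<longlonglongrightarrow> energy \<mu>"
proof (rule tendsto_ennrealD)
  show "(\<lambda>i. ennreal (Er \<mu> (rr i))) \<longlonglongrightarrow> ennreal (energy \<mu>)"
    using Er_rr_tendsto[OF assms(1)] en_eq_energy[OF assms(2)] by simp
  have "0 \<le> Er \<mu> (rr i)" for i
    unfolding Er_def using rr_bounds(4)[of i]
    by (intro suminf_nonneg Er_summable assms rr_bounds divide_nonneg_nonneg mult_nonneg_nonneg) auto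
  then show "\<forall>\<^sub>F i in sequentially. 0 \<le> Er \<mu> (rr i)" by simp
qed (rule energy_nonneg)

lemma Er_gap:
  assumes \<mu>: "\<mu> \<in> M1"
  shows "rr i ^ k * (cmod (fc \<mu> k - fc (mu_d d) k))\<^sup>2 / real k
    \<le> Er \<mu> (rr i) - Er (mu_d d) (rr i) + 2 * Re (\<integral>z. Lam d (of_real (rr i) * z) \<partial>\<mu>) - 2 * Re (\<integral>z. Lam d (of_real (rr i) * z) \<partial>mu_d d)"
proof -
  note M = mu_d_M1[OF d]
  define f where "f k = rr i ^ k * (cmod (fc \<mu> k - fc (mu_d d) k))\<^sup>2 / real k" for k
  have s: "(\<lambda>k. rr i ^ k * (cmod (fc \<nu> k))\<^sup>2 / real k) sums Er \<nu> (rr i)" if "\<nu> \<in> M1" for \<nu>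
    unfolding Er_def by (intro summable_sums Er_summable that rr_bounds)
  have "(\<lambda>k. rr i ^ k * (cmod (fc \<mu> k))\<^sup>2 / real k + rr i ^ k * (cmod (fc (mu_d d) k))\<^sup>2 / real k
        + 2 * Re (- (of_real (rr i) ^ k * cf d k * fc \<mu> k) / of_nat k))
      sums (Er \<mu> (rr i) + Er (mu_d d) (rr i) + 2 * Re (\<integral>z. Lam d (of_real (rr i) * z) \<partial>\<mu>))"
    by (intro sums_add sums_mult sums_Re s integral_Lam_sums M \<mu>)
  moreover have "rr i ^ k * (cmod (fc \<mu> k))\<^sup>2 / real k + rr i ^ k * (cmod (fc (mu_d d) k))\<^sup>2 / real k
        + 2 * Re (- (of_real (rr i) ^ k * cf d k * fc \<mu> k) / of_nat k) = f k" for k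
  proof -
    have "Re (- (of_real (rr i) ^ k * cf d k * fc \<mu> k) / of_nat k) = - (rr i ^ k * Re (cf d k * fc \<mu> k)) / real k"
      by (simp add: mult.assoc flip: of_real_power)
    moreover have "(cmod (fc \<mu> k - fc (mu_d d) k))\<^sup>2 = (cmod (fc \<mu> k))\<^sup>2 + (cmod (fc (mu_d d) k))\<^sup>2 - 2 * Re (cf d k * fc \<mu> k)"
      unfolding fc_mu_d[OF d] cmod_power2 by (simp add: power2_eq_square algebra_simps)
    moreover have "R * A / K + R * B / K + 2 * (- (R * X) / K) = R * (A + B - 2 * X) / K" for R A B X K :: real
      by (simp add: add_divide_distrib diff_divide_distrib algebra_simps)
    ultimately show ?thesis unfolding f_def by (simp only:)
  qed
  ultimately have F: "f sums (Er \<mu> (rr i) + Er (mu_d d) (rr i) + 2 * Re (\<integral>z. Lam d (of_real (rr i) * z) \<partial>\<mu>))" by simp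
  have "sum f {k} \<le> suminf f"
    using F rr_bounds(4)[of i] by (intro sum_le_suminf) (auto simp: sums_iff f_def)
  then have "f k \<le> Er \<mu> (rr i) + Er (mu_d d) (rr i) + 2 * Re (\<integral>z. Lam d (of_real (rr i) * z) \<partial>\<mu>)"
    using F by (simp add: sums_iff)
  then show ?thesis using Er_mu_d[of i] by (simp add: f_def)
qed

lemma AE_mu_d:
  assumes "\<And>\<theta>. 0 < \<theta> \<Longrightarrow> \<theta> < 2 * pi \<Longrightarrow> w_d d \<theta> \<noteq> 0 \<Longrightarrow> P (cis \<theta>)"
  shows "AE z in mu_d d. P z"
proof -
  have wm: "(\<lambda>z. ennreal (w_d d (Arg2pi z))) \<in> borel_measurable haar"
    unfolding M1_measurable_cong[OF haar_M1] using w_d_measurable[OF d] by measurable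
  have ae: "AE z in haar. 0 < ennreal (w_d d (Arg2pi z)) \<longrightarrow> P z"
    using haar_AE_neq_1 AE_space
  proof eventually_elim
    case (elim z)
    then have "z \<in> circle" "z \<noteq> 1" using M1_space[OF haar_M1] by auto
    then obtain "0 < Arg2pi z" "Arg2pi z < 2 * pi" "z = cis (Arg2pi z)" by (rule circle_cases_cis)
    then show ?case using assms[of "Arg2pi z"] by (metis ennreal_0 less_irrefl)
  qed
  show ?thesis unfolding mu_d_eq_density[OF d] AE_density[OF wm] using ae .
qed

text \<open>Completing the square in Fourier coefficients leaves the linear term, which is controlled by the
  variational condition; the remainder makes the minimiser unique.\<close>

lemma energy_gap:
  assumes \<mu>: "\<mu> \<in> M1" "en \<mu> \<noteq> \<infinity>" "integrable \<mu> (Qr d)"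
  shows "energy (mu_d d) + (\<integral>z. Qr d z \<partial>mu_d d) + (cmod (fc \<mu> k - fc (mu_d d) k))\<^sup>2 / real k \<le> energy \<mu> + (\<integral>z. Qr d z \<partial>\<mu>)"
proof -
  note M = mu_d_M1[OF d]
  obtain L where L: "\<And>z. z \<in> circle \<Longrightarrow> z \<noteq> 1 \<Longrightarrow> VV d z \<le> L"
    "\<And>\<theta>. 0 < \<theta> \<Longrightarrow> \<theta> < 2 * pi \<Longrightarrow> w_d d \<theta> \<noteq> 0 \<Longrightarrow> VV d (cis \<theta>) = L" using equilibrium_condition by metis
  have iV: "integrable \<nu> (VV d)" and eV: "(\<integral>z. VV d z \<partial>\<nu>) = 2 * Re (\<integral>z. Lamb d z \<partial>\<nu>) - (\<integral>z. Qr d z \<partial>\<nu>)"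
    if n: "\<nu> \<in> M1" "integrable \<nu> (Qr d)" for \<nu>
  proof -
    have iR: "integrable \<nu> (\<lambda>z. Re (Lamb d z))" using integrable_Lamb[OF n(1)] by (rule integrable_Re)
    show "integrable \<nu> (VV d)" unfolding VV_def[abs_def] using iR n(2) by simp
    show "(\<integral>z. VV d z \<partial>\<nu>) = 2 * Re (\<integral>z. Lamb d z \<partial>\<nu>) - (\<integral>z. Qr d z \<partial>\<nu>)"
      unfolding VV_def using iR n(2) integrable_Lamb[OF n(1)] by simp
  qed
  have "(\<integral>z. VV d z \<partial>\<mu>) \<le> L"
  proof -
    interpret P: prob_space \<mu> by (rule M1_prob_space[OF \<mu>(1)])
    have "(\<integral>z. VV d z \<partial>\<mu>) \<le> (\<integral>z. L \<partial>\<mu>)"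
    proof (rule integral_mono_AE[OF iV[OF \<mu>(1,3)]])
      show "AE z in \<mu>. VV d z \<le> L"
        using finite_energy_no_atom[OF \<mu>(1,2), of 1] AE_space
        by eventually_elim (use L(1) M1_space[OF \<mu>(1)] in auto)
    qed simp
    then show ?thesis by (simp add: P.prob_space)
  qed
  moreover have "(\<integral>z. VV d z \<partial>mu_d d) = L"
  proof -
    interpret P: prob_space "mu_d d" by (rule M1_prob_space[OF M])
    have "(\<integral>z. VV d z \<partial>mu_d d) = (\<integral>z. L \<partial>mu_d d)"
      using iV[OF M integrable_Qr_mu_d[OF d]] AE_mu_d[of "\<lambda>z. VV d z = L"] L(2)
      by (intro integral_cong_AE) auto
    then show ?thesis by (simp add: P.prob_space)
  qed
  moreover have "(cmod (fc \<mu> k - fc (mu_d d) k))\<^sup>2 / real k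
    \<le> energy \<mu> - energy (mu_d d) + 2 * Re (\<integral>z. Lamb d z \<partial>\<mu>) - 2 * Re (\<integral>z. Lamb d z \<partial>mu_d d)"
  proof (rule LIMSEQ_le)
    have "(\<lambda>i. rr i ^ k * (cmod (fc \<mu> k - fc (mu_d d) k))\<^sup>2 / real k) \<longlonglongrightarrow> 1 ^ k * (cmod (fc \<mu> k - fc (mu_d d) k))\<^sup>2 / real k"
      unfolding divide_inverse by (intro tendsto_intros rr_tendsto)
    then show "(\<lambda>i. rr i ^ k * (cmod (fc \<mu> k - fc (mu_d d) k))\<^sup>2 / real k) \<longlonglongrightarrow> (cmod (fc \<mu> k - fc (mu_d d) k))\<^sup>2 / real k"
      by simp
    show "(\<lambda>i. Er \<mu> (rr i) - Er (mu_d d) (rr i) + 2 * Re (\<integral>z. Lam d (of_real (rr i) * z) \<partial>\<mu>) - 2 * Re (\<integral>z. Lam d (of_real (rr i) * z) \<partial>mu_d d))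
      \<longlonglongrightarrow> energy \<mu> - energy (mu_d d) + 2 * Re (\<integral>z. Lamb d z \<partial>\<mu>) - 2 * Re (\<integral>z. Lamb d z \<partial>mu_d d)"
      by (intro tendsto_intros Er_tendsto_energy integral_Lam_tendsto \<mu> M en_mu_d_finite)
  qed (use Er_gap[OF \<mu>(1)] in blast)
  ultimately show ?thesis using eV[OF \<mu>(1,3)] eV[OF M integrable_Qr_mu_d[OF d]] by linarith
qed

end

section \<open>The minimal energy\<close>

text \<open>A primitive of \<open>z Ln z\<close>.\<close>

definition PsiB :: "complex \<Rightarrow> complex"
  where "PsiB z = z * (z * Ln z) / 2 - z * z / 4"

lemma PsiB_derivative:
  assumes "z \<notin> \<real>\<^sub>\<le>\<^sub>0" shows "(PsiB has_field_derivative z * Ln z) (at z)"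
proof -
  have z: "z \<noteq> 0" using assms by auto
  have "((\<lambda>z. z * (z * Ln z) / 2 - z * z / 4) has_field_derivative
      ((1 * (z * Ln z) + (1 * Ln z + inverse z * z) * z) / 2 - (1 * z + 1 * z) / 4)) (at z)"
    by (intro DERIV_diff DERIV_cdivide DERIV_mult DERIV_ident has_field_derivative_Ln assms)
  also have "((1 * (z * Ln z) + (1 * Ln z + inverse z * z) * z) / 2 - (1 * z + 1 * z) / 4) = z * Ln z"
    using z by (simp add: field_simps)
  finally show ?thesis unfolding PsiB_def[abs_def] .
qed

lemma continuous_on_PsiB:
  assumes "continuous_on A f" "\<And>x. x \<in> A \<Longrightarrow> 0 \<le> Re (f x)"
  shows "continuous_on A (\<lambda>x. PsiB (f x))"
  unfolding PsiB_def by (intro continuous_intros continuous_on_mult_Ln' assms) auto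

lemma has_integral_mult_Ln:
  assumes "0 \<le> Re c"
  shows "((\<lambda>x. (of_real x + c) * Ln (of_real x + c)) has_integral PsiB (1 + c) - PsiB c) {0..1::real}"
proof -
  have "((\<lambda>x. (of_real x + c) * Ln (of_real x + c)) has_integral PsiB (of_real 1 + c) - PsiB (of_real 0 + c)) {0..1::real}"
  proof (rule fundamental_theorem_of_calculus_interior)
    show "continuous_on {0..1::real} (\<lambda>x. PsiB (of_real x + c))"
      by (intro continuous_on_PsiB continuous_intros) (use assms in auto)
    fix s :: real assume s: "s \<in> {0<..<1}"
    have w: "of_real s + c \<notin> \<real>\<^sub>\<le>\<^sub>0" using s assms by (auto simp: complex_nonpos_Reals_iff complex_eq_iff)
    have "((\<lambda>w. PsiB (w + c)) has_field_derivative ((of_real s + c) * Ln (of_real s + c)) * 1) (at (of_real s))"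
      by (rule DERIV_chain2[where f = PsiB and g = "\<lambda>w. w + c", OF PsiB_derivative[OF w]]) (auto intro!: derivative_eq_intros)
    then show "((\<lambda>x. PsiB (of_real x + c)) has_vector_derivative (of_real s + c) * Ln (of_real s + c)) (at s)"
      by (intro has_vector_derivative_real_field) simp
  qed simp
  then show ?thesis by simp
qed

lemma Re_PsiB_cnj: "0 \<le> Re z \<Longrightarrow> Re (PsiB (cnj z)) = Re (PsiB z)"
proof (cases "z = 0")
  case False
  moreover assume "0 \<le> Re z"
  ultimately have "z \<notin> \<real>\<^sub>\<le>\<^sub>0" by (auto simp: complex_nonpos_Reals_iff complex_eq_iff)
  then have "PsiB (cnj z) = cnj (PsiB z)" by (simp add: PsiB_def cnj_Ln[symmetric])
  then show ?thesis by simp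
qed simp

text \<open>The integral of \<open>Re ((x + t c) Ln (x + t c))\<close> over \<open>x\<close> in
  \<open>[0, 1]\<close>.\<close>

definition RB :: "complex \<Rightarrow> real \<Rightarrow> real"
  where "RB c t = Re (PsiB (1 + of_real t * c) - PsiB (of_real t * c))"

lemma B_d_eq:
  assumes "0 \<le> Re d" shows "B_d d = RB 0 1 + RB (of_real (2 * Re d)) 1 - 2 * RB d 1"
proof -
  have real: "((\<lambda>x. (x + 2 * a) * ln (x + 2 * a)) has_integral RB (of_real (2 * a)) 1) {0..1::real}" if a: "0 \<le> a" for a
  proof -
    have "((\<lambda>x. Re ((of_real x + of_real (2 * a)) * Ln (of_real x + of_real (2 * a)))) has_integral RB (of_real (2 * a)) 1) {0..1::real}"
      unfolding RB_def using has_integral_Re[OF has_integral_mult_Ln[of "of_real (2 * a)"]] a by simp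
    then show ?thesis
    proof (rule has_integral_eq[rotated])
      fix x :: real assume x: "x \<in> {0..1}"
      show "Re ((of_real x + of_real (2 * a)) * Ln (of_real x + of_real (2 * a))) = (x + 2 * a) * ln (x + 2 * a)"
      proof (cases "x + 2 * a = 0")
        case False
        then have "0 < x + 2 * a" using x a by simp
        then have "Ln (of_real (x + 2 * a)) = of_real (ln (x + 2 * a))" by (rule Ln_of_real)
        then have "Re (of_real (x + 2 * a) * Ln (of_real (x + 2 * a))) = (x + 2 * a) * ln (x + 2 * a)" by simp
        then show ?thesis by (simp only: of_real_add)
      next
        case True
        then have "complex_of_real x + of_real (2 * a) = 0" by (simp only: of_real_add[symmetric] of_real_0)
        then show ?thesis using True by simp
      qed
    qed
  qed
  have i1: "((\<lambda>x::real. x * ln x + (x + 2 * Re d) * ln (x + 2 * Re d)) has_integral RB 0 1 + RB (of_real (2 * Re d)) 1) {0..1}"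
    using has_integral_add[OF real[of 0] real[OF assms]] by simp
  have i2: "((\<lambda>x::real. (of_real x + d) * Ln (of_real x + d) + (of_real x + cnj d) * Ln (of_real x + cnj d)) has_integral
      (PsiB (1 + d) - PsiB d) + (PsiB (1 + cnj d) - PsiB (cnj d))) {0..1}"
    using assms by (intro has_integral_add has_integral_mult_Ln) auto
  have "Re (PsiB (1 + cnj d)) = Re (PsiB (1 + d))" using Re_PsiB_cnj[of "1 + d"] assms by simp
  then have "Re ((PsiB (1 + d) - PsiB d) + (PsiB (1 + cnj d) - PsiB (cnj d))) = 2 * RB d 1"
    using Re_PsiB_cnj[OF assms] by (simp add: RB_def)
  then show ?thesis unfolding B_d_def integral_unique[OF i1] integral_unique[OF i2] by simp
qed

lemma RB_scale: "RB (of_real t * c) 1 = RB c t" by (simp add: RB_def)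

lemma RB_continuous: "0 \<le> Re c \<Longrightarrow> continuous_on {0..1} (RB c)"
  unfolding RB_def[abs_def] by (intro continuous_intros continuous_on_PsiB) auto

lemma RB_derivative:
  assumes "0 \<le> Re c" "0 < t"
  shows "(RB c has_real_derivative Re (c * ((1 + of_real t * c) * Ln (1 + of_real t * c) - of_real t * c * Ln (of_real t * c)))) (at t)"
proof (cases "c = 0")
  case True
  then show ?thesis by (simp add: RB_def[abs_def])
next
  case False
  have "0 < Re (1 + of_real t * c)" using assms by (simp add: add_pos_nonneg)
  then have w1: "1 + of_real t * c \<notin> \<real>\<^sub>\<le>\<^sub>0" unfolding complex_nonpos_Reals_iff by linarith
  have w2: "of_real t * c \<notin> \<real>\<^sub>\<le>\<^sub>0"
    using assms False by (auto simp: complex_nonpos_Reals_iff complex_eq_iff mult_le_0_iff)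
  have "((\<lambda>w. PsiB (1 + w * c) - PsiB (w * c)) has_field_derivative
     (1 + of_real t * c) * Ln (1 + of_real t * c) * c - of_real t * c * Ln (of_real t * c) * c) (at (of_real t))"
  proof (rule DERIV_diff)
    show "((\<lambda>w. PsiB (1 + w * c)) has_field_derivative (1 + of_real t * c) * Ln (1 + of_real t * c) * c) (at (of_real t))"
      by (rule DERIV_chain2[where f = PsiB and g = "\<lambda>w. 1 + w * c", OF PsiB_derivative[OF w1]])
        (auto intro!: derivative_eq_intros)
    show "((\<lambda>w. PsiB (w * c)) has_field_derivative of_real t * c * Ln (of_real t * c) * c) (at (of_real t))"
      by (rule DERIV_chain2[where f = PsiB and g = "\<lambda>w. w * c", OF PsiB_derivative[OF w2]])
        (auto intro!: derivative_eq_intros)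
  qed
  then have "((\<lambda>t. PsiB (1 + of_real t * c) - PsiB (of_real t * c)) has_vector_derivative
     (1 + of_real t * c) * Ln (1 + of_real t * c) * c - of_real t * c * Ln (of_real t * c) * c) (at t)"
    by (rule has_vector_derivative_real_field)
  from bounded_linear.has_vector_derivative[OF bounded_linear_Re this]
  show ?thesis
    unfolding has_real_derivative_iff_has_vector_derivative RB_def[abs_def]
    by (rule has_vector_derivative_eq_rhs) (simp add: algebra_simps)
qed

text \<open>The difference quotient lies between the subgradients at the two points.\<close>

lemma continuous_subgradient_derivative:
  fixes b g :: "real \<Rightarrow> real"
  assumes sub: "\<And>s t. s \<in> S \<Longrightarrow> t \<in> S \<Longrightarrow> (t - s) * g s \<le> b t - b s"
    and g: "continuous_on S g" and x: "x \<in> S"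
  shows "(b has_real_derivative g x) (at x within S)"
proof -
  have bd: "norm ((b y - b x) / (y - x) - g x) \<le> \<bar>g y - g x\<bar>" if y: "y \<in> S" "y \<noteq> x" for y
  proof -
    define q where "q = (b y - b x) / (y - x)"
    have q: "b y - b x = (y - x) * q" using y by (simp add: q_def)
    have 1: "(y - x) * g x \<le> (y - x) * q" using sub[OF x y(1)] q by simp
    have 2: "(y - x) * q \<le> (y - x) * g y" using sub[OF y(1) x] q by (simp add: algebra_simps)
    have "g x \<le> q \<and> q \<le> g y \<or> g y \<le> q \<and> q \<le> g x"
    proof (cases "x < y")
      case True
      then show ?thesis using 1 2 by (simp add: mult_le_cancel_left)
    next
      case False
      then have "y < x" using y by simp
      then show ?thesis using 1 2 by (simp add: mult_le_cancel_left)
    qed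
    then show ?thesis unfolding q_def[symmetric] by (auto simp: abs_if)
  qed
  have "((\<lambda>y. (b y - b x) / (y - x) - g x) \<longlongrightarrow> 0) (at x within S)"
  proof (rule Lim_null_comparison)
    show "\<forall>\<^sub>F y in at x within S. norm ((b y - b x) / (y - x) - g x) \<le> \<bar>g y - g x\<bar>"
      using bd unfolding eventually_at by (intro exI[of _ 1]) auto
    have "(g \<longlongrightarrow> g x) (at x within S)" using g x by (simp add: continuous_on_def)
    then have "((\<lambda>y. \<bar>g y - g x\<bar>) \<longlongrightarrow> \<bar>g x - g x\<bar>) (at x within S)" by (intro tendsto_intros)
    then show "((\<lambda>y. \<bar>g y - g x\<bar>) \<longlongrightarrow> 0) (at x within S)" by simp
  qed
  then show ?thesis unfolding has_field_derivative_iff by (rule LIM_zero_cancel)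
qed

text \<open>Scale the external field by \<open>t\<close>: minus the minimal energy is a supremum of affine functions of \<open>t\<close>
  with slopes \<open>- \<integral> Q\<close>, so its derivative is that slope at the minimiser, and this is the derivative
  of the explicit constant.\<close>

lemma minimal_energy:
  assumes d: "0 \<le> Re d"
  shows "energy (mu_d d) + (\<integral>z. Qr d z \<partial>mu_d d) = - B_d d"
proof -
  define \<nu> where "\<nu> t = mu_d (of_real t * d)" for t :: real
  define v where "v t = (\<integral>z. Qr d z \<partial>\<nu> t)" for t
  define b where "b t = - (energy (\<nu> t) + t * v t)" for t
  have td: "0 \<le> Re (of_real t * d)" if "0 \<le> t" for t using that d by simp
  have Qs: "Qr (of_real t * d) z = t * Qr d z" for t z by (simp add: Qr_def algebra_simps)
  have i: "integrable (\<nu> t) (Qr d)" if "0 \<le> t" for t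
    unfolding \<nu>_def by (rule integrable_Qr_mu_d[OF td[OF that] d])
  have gap: "energy (\<nu> t) + t * v t \<le> energy (\<nu> s) + t * v s" if "0 \<le> s" "0 \<le> t" for s t
  proof -
    have "integrable (\<nu> s) (Qr (of_real t * d))" unfolding Qs[abs_def] using i[OF that(1)] by simp
    from energy_gap[OF td[OF that(2)] _ _ this, of 0] show ?thesis
      using mu_d_M1[OF td[OF that(1)]] en_mu_d_finite[OF td[OF that(1)]] by (simp add: \<nu>_def Qs v_def)
  qed
  define Q where "Q t = ((1 + of_real t * of_real (2 * Re d)) * Ln (1 + of_real t * of_real (2 * Re d))
      - of_real t * of_real (2 * Re d) * Ln (of_real t * of_real (2 * Re d)))
     - ((1 + of_real t * d) * Ln (1 + of_real t * d) - of_real t * d * Ln (of_real t * d))" for t :: real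
  have v: "v t = - 2 * Re (d * Q t)" if t: "0 \<le> t" for t
  proof (cases "of_real t * d = 0")
    case False
    have "Lamb (of_real t * d) 1 = Q t" using Lamb_1[OF td[OF t] False] by (simp add: Q_def mult.left_commute)
    then show ?thesis unfolding v_def \<nu>_def integral_Qr_mu_d[OF td[OF t] d] by simp
  next
    case True
    then have "Lamb (of_real t * d) 1 = 0" by (simp add: Lamb_def)
    moreover have "d = 0 \<or> Q t = 0" using True by (auto simp: Q_def)
    ultimately show ?thesis unfolding v_def \<nu>_def integral_Qr_mu_d[OF td[OF t] d] by auto
  qed
  have cQ: "continuous_on {0..1} Q"
  proof -
    have 1: "continuous_on {0..1} (\<lambda>t. (1 + of_real t * c) * Ln (1 + of_real t * c))" if "0 \<le> Re c" for c
      by (rule continuous_on_mult_Ln') (auto intro!: continuous_intros simp: that)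
    have 2: "continuous_on {0..1} (\<lambda>t. (of_real t * c) * Ln (of_real t * c))" if "0 \<le> Re c" for c
      by (rule continuous_on_mult_Ln') (auto intro!: continuous_intros simp: that)
    show ?thesis unfolding Q_def by (intro continuous_on_diff 1 2) (use d in auto)
  qed
  have cv: "continuous_on {0..1} (\<lambda>t. - v t)"
  proof -
    have "continuous_on {0..1} (\<lambda>t. 2 * Re (d * Q t))" by (intro continuous_intros cQ)
    then show ?thesis by (rule continuous_on_cong[THEN iffD1, rotated 2]) (use v in auto)
  qed
  have bD: "(b has_real_derivative - v t) (at t within {0..1})" if t: "t \<in> {0..1}" for t
  proof (rule continuous_subgradient_derivative[OF _ cv t])
    fix s t :: real assume "s \<in> {0..1}" "t \<in> {0..1}"
    then show "(t - s) * - v s \<le> b t - b s" using gap[of s t] by (simp add: b_def algebra_simps)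
  qed
  define B where "B t = RB 0 1 + RB (of_real (2 * Re d)) t - 2 * RB d t" for t
  have Bt: "B_d (of_real t * d) = B t" if "0 \<le> t" for t
  proof -
    have "RB (of_real (2 * Re (of_real t * d))) 1 = RB (of_real (2 * Re d)) t"
    proof -
      have "complex_of_real (2 * Re (of_real t * d)) = of_real t * of_real (2 * Re d)" by simp
      then show ?thesis using RB_scale[of t "of_real (2 * Re d)"] by (simp only:)
    qed
    moreover have "RB (of_real t * d) 1 = RB d t" by (rule RB_scale)
    ultimately show ?thesis unfolding B_d_eq[OF td[OF that]] B_def by (simp only:)
  qed
  have BD: "(B has_real_derivative - v t) (at t)" if t: "0 < t" for t
  proof -
    define P where "P = (1 + of_real t * complex_of_real (2 * Re d)) * Ln (1 + of_real t * of_real (2 * Re d))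
      - of_real t * of_real (2 * Re d) * Ln (of_real t * of_real (2 * Re d))"
    define p where "p = (1 + of_real t * d) * Ln (1 + of_real t * d) - of_real t * d * Ln (of_real t * d)"
    have "(B has_real_derivative 0 + Re (of_real (2 * Re d) * P) - 2 * Re (d * p)) (at t)"
      unfolding B_def[abs_def] P_def p_def
      by (intro DERIV_diff DERIV_add DERIV_cmult DERIV_const RB_derivative t d) (use d in simp)
    moreover have IP: "Im P = 0"
    proof -
      have r: "Im (of_real y * Ln (of_real y)) = 0" if "0 \<le> y" for y :: real
        using that Ln_of_real[of y] by (cases "y = 0") auto
      have "P = of_real (1 + t * (2 * Re d)) * Ln (of_real (1 + t * (2 * Re d))) - of_real (t * (2 * Re d)) * Ln (of_real (t * (2 * Re d)))"
        by (simp add: P_def)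
      moreover have "Im (of_real (1 + t * (2 * Re d)) * Ln (of_real (1 + t * (2 * Re d)))) = 0"
        "Im (of_real (t * (2 * Re d)) * Ln (of_real (t * (2 * Re d)))) = 0" using t d by (intro r; simp)+
      ultimately show ?thesis by (simp only: minus_complex.sel diff_self)
    qed
    moreover have "Q t = P - p" by (simp add: Q_def P_def p_def)
    then have "v t = - 2 * Re (d * (P - p))" using v[of t] t by simp
    then have "- v t = 0 + Re (of_real (2 * Re d) * P) - 2 * Re (d * p)" using IP by (simp add: algebra_simps)
    ultimately show ?thesis by (simp only:)
  qed
  have "b 1 - B 1 = b 0 - B 0"
  proof (rule DERIV_isconst_end[of 0 1 "\<lambda>t. b t - B t"])
    have "continuous_on {0..1} b" using bD by (rule DERIV_continuous_on)
    moreover have "continuous_on {0..1} B" unfolding B_def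
      by (intro continuous_intros RB_continuous) (use d in auto)
    ultimately show "continuous_on {0..1} (\<lambda>t. b t - B t)" by (intro continuous_intros)
    fix t :: real assume t: "0 < t" "t < 1"
    have "at t within {0..1} = at t" using t by (intro at_within_interior) auto
    then have "(b has_real_derivative - v t) (at t)" using bD[of t] t by simp
    from DERIV_diff[OF this BD[OF t(1)]] show "((\<lambda>t. b t - B t) has_real_derivative 0) (at t)" by simp
  qed simp
  moreover have "b 0 = 0" by (simp add: b_def \<nu>_def mu_d_def energy_def en_haar)
  moreover have "B 0 = 0" by (simp add: B_def RB_def PsiB_def)
  moreover have "B 1 = B_d d" using Bt[of 1] by simp
  moreover have "b 1 = - (energy (mu_d d) + (\<integral>z. Qr d z \<partial>mu_d d))" by (simp add: b_def \<nu>_def v_def)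
  ultimately show ?thesis by simp
qed

lemma J_mu_d: "0 \<le> Re d \<Longrightarrow> J d (mu_d d) = ereal (- B_d d)"
  using J_finite_energy[OF _ mu_d_M1 en_mu_d_finite integrable_Qr_mu_d, of d d] minimal_energy[of d] by simp

lemma
  assumes d: "0 \<le> Re d" and \<mu>: "\<mu> \<in> M1"
  shows J_ge: "ereal (- B_d d) \<le> J d \<mu>" and J_eq_min_imp: "J d \<mu> = ereal (- B_d d) \<Longrightarrow> \<mu> = mu_d d"
proof -
  have gap: "- B_d d + (cmod (fc \<mu> k - fc (mu_d d) k))\<^sup>2 / real k \<le> energy \<mu> + (\<integral>z. Qr d z \<partial>\<mu>)"
    and Jf: "J d \<mu> = ereal (energy \<mu> + (\<integral>z. Qr d z \<partial>\<mu>))" if "J d \<mu> \<noteq> \<infinity>" for k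
    using energy_gap[OF d \<mu> J_not_infinity[OF d \<mu> that], of k] minimal_energy[OF d]
      J_finite_energy[OF d \<mu> J_not_infinity[OF d \<mu> that]] by simp_all
  show "ereal (- B_d d) \<le> J d \<mu>" using gap[of 0] Jf by (cases "J d \<mu> = \<infinity>") auto
  assume e: "J d \<mu> = ereal (- B_d d)"
  have "fc \<mu> k = fc (mu_d d) k" for k
  proof (cases "k = 0")
    case False
    have "(cmod (fc \<mu> k - fc (mu_d d) k))\<^sup>2 / real k \<le> 0" using gap[of k] Jf e by simp
    then show ?thesis using False by (simp add: divide_le_0_iff)
  qed (simp add: fc_0 \<mu> mu_d_M1[OF d])
  then show "\<mu> = mu_d d" by (intro fc_inj \<mu> mu_d_M1 d) auto
qed

section \<open>The large deviation principle\<close>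

context
  fixes b :: real and d :: complex
  assumes b: "0 < b" and d: "0 \<le> Re d"
begin

lemma I_d_eq_J: "I_d d \<mu> = J d \<mu> + ereal (B_d d)"
  by (simp add: I_d_def J_def)

lemma I_d_nonneg: "\<mu> \<in> M1 \<Longrightarrow> 0 \<le> I_d d \<mu>"
  using J_ge[OF d, of \<mu>] unfolding I_d_eq_J by (cases "J d \<mu>") auto

lemma I_d_le_iff: "I_d d \<mu> \<le> ereal a \<longleftrightarrow> J d \<mu> \<le> ereal (a - B_d d)"
  unfolding I_d_eq_J by (cases "J d \<mu>") auto

lemma closedin_I_d: "closedin weak_topology {\<mu> \<in> topspace weak_topology. I_d d \<mu> \<le> ereal a}"
  unfolding topspace_weak_topology I_d_le_iff by (rule closedin_J_le[OF d])

lemma rate_function_I_d: "rate_function weak_topology (I_d d)"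
  unfolding rate_function_def using closedin_I_d I_d_nonneg topspace_weak_topology by auto

lemma good_rate_function_I_d: "good_rate_function weak_topology (I_d d)"
  unfolding good_rate_function_def
  using rate_function_I_d closedin_compact_space[OF compact_space_weak_topology closedin_I_d] by auto

lemma I_d_zeros: "{\<mu> \<in> M1. I_d d \<mu> = 0} = {mu_d d}"
proof -
  have "I_d d \<mu> = 0 \<longleftrightarrow> J d \<mu> = ereal (- B_d d)" for \<mu>
    unfolding I_d_eq_J by (cases "J d \<mu>") auto
  then have eq: "{\<mu> \<in> M1. I_d d \<mu> = 0} = {\<mu> \<in> M1. J d \<mu> = ereal (- B_d d)}" by simp
  show ?thesis unfolding eq
  proof (rule set_eqI, rule iffI)
    show "\<mu> \<in> {mu_d d}" if "\<mu> \<in> {\<mu> \<in> M1. J d \<mu> = ereal (- B_d d)}" for \<mu>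
      using that J_eq_min_imp[OF d, of \<mu>] by simp
    show "\<mu> \<in> {\<mu> \<in> M1. J d \<mu> = ereal (- B_d d)}" if "\<mu> \<in> {mu_d d}" for \<mu>
      using that J_mu_d[OF d] mu_d_M1[OF d] by simp
  qed
qed

text \<open>Almost every configuration is generic, because Haar measure has finite energy.\<close>

lemma Znorm_pos:
  assumes "n \<ge> 1" shows "0 < Znorm b d n"
proof -
  have e: "en haar \<noteq> \<infinity>" by (simp add: en_haar)
  have g: "AE z in haar_n n. generic n z" unfolding haar_n_def by (rule sample_AE_generic[OF haar_M1 e])
  have pos: "AE z in haar_n n. 0 < Re (hweight b d n z)"
    using g AE_space
  proof eventually_elim
    case (elim z)
    then have "Re (hweight b d n z) = exp (- (b * (real n)\<^sup>2 * H d n z))"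
      using space_haar_n by (intro Re_hweight_generic assms) auto
    then show ?case by simp
  qed
  have nn: "AE z in haar_n n. 0 \<le> Re (hweight b d n z)" using pos by eventually_elim simp
  interpret P: prob_space "haar_n n" by (rule prob_space_haar_n)
  have "Znorm b d n \<noteq> 0"
  proof
    assume "Znorm b d n = 0"
    then have "AE z in haar_n n. Re (hweight b d n z) = 0"
      using integral_nonneg_eq_0_iff_AE[OF integrable_hweight[OF b d assms] nn] by (simp add: Znorm_def)
    with pos have "AE z in haar_n n. False" by eventually_elim simp
    then show False using P.prob_space by (simp add: P.AE_False)
  qed
  then show ?thesis using Znorm_nonneg[OF b d assms] by simp
qed

lemma emeasure_esd_law:
  assumes n: "n \<ge> 1" and A: "A \<in> sets (borel_of weak_topology)"
  shows "emeasure (esd_law b d n) A = Zset b d n A / ennreal (Znorm b d n)"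
proof -
  note Z = Znorm_pos[OF n]
  have hm: "(\<lambda>z. ennreal (Re (hweight b d n z) / Znorm b d n)) \<in> borel_measurable (haar_n n)"
    unfolding measurable_haar_n using hweight_measurable by measurable
  have em': "esd n \<in> haar_n n \<rightarrow>\<^sub>M borel_of weak_topology"
    unfolding measurable_haar_n by (rule esd_measurable[OF n])
  then have em: "esd n \<in> P_d b d n \<rightarrow>\<^sub>M borel_of weak_topology" unfolding P_d_def by simp
  have "emeasure (esd_law b d n) A = emeasure (P_d b d n) (esd n -` A \<inter> space (haar_n n))"
    unfolding esd_law_def emeasure_distr[OF em A] by (simp add: P_d_def)
  also have "\<dots> = (\<integral>\<^sup>+z. ennreal (Re (hweight b d n z) / Znorm b d n) * indicator (esd n -` A \<inter> space (haar_n n)) z \<partial>haar_n n)"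
    unfolding P_d_def using hm measurable_sets[OF em' A] by (rule emeasure_density)
  also have "\<dots> = (\<integral>\<^sup>+z. (ennreal (Re (hweight b d n z)) * indicator A (esd n z)) / ennreal (Znorm b d n) \<partial>haar_n n)"
  proof (rule nn_integral_cong)
    fix z assume z: "z \<in> space (haar_n n)"
    have "0 \<le> Re (hweight b d n z)" using space_haar_n[OF z] by (intro hweight_nonneg) auto
    then show "ennreal (Re (hweight b d n z) / Znorm b d n) * indicator (esd n -` A \<inter> space (haar_n n)) z
      = (ennreal (Re (hweight b d n z)) * indicator A (esd n z)) / ennreal (Znorm b d n)"
      using z Z by (simp add: divide_ennreal[symmetric] indicator_def)
  qed
  also have "\<dots> = Zset b d n A / ennreal (Znorm b d n)"
    unfolding Zset_def
  proof (rule nn_integral_divide)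
    have "(\<lambda>z. indicator A (esd n z) :: ennreal) \<in> borel_measurable (haar_n n)"
      using measurable_compose[OF em' borel_measurable_indicator[OF A]] .
    moreover have "(\<lambda>z. ennreal (Re (hweight b d n z))) \<in> borel_measurable (haar_n n)"
      unfolding measurable_haar_n using hweight_measurable by measurable
    ultimately show "(\<lambda>z. ennreal (Re (hweight b d n z)) * indicator A (esd n z)) \<in> borel_measurable (haar_n n)"
      by (rule borel_measurable_times_ennreal[rotated])
  qed
  finally show ?thesis .
qed

lemma prob_space_esd_law: "n \<ge> 1 \<Longrightarrow> prob_space (esd_law b d n)"
proof (rule prob_spaceI)
  assume n: "n \<ge> 1"
  have s: "space (esd_law b d n) = M1" by (simp add: esd_law_def space_borel_of topspace_weak_topology)
  have M: "M1 \<in> sets (borel_of weak_topology)"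
    using sets.top[of "borel_of weak_topology"] by (simp add: space_borel_of topspace_weak_topology)
  show "emeasure (esd_law b d n) (space (esd_law b d n)) = 1"
    unfolding s emeasure_esd_law[OF n M] Zset_M1[OF b d n]
    using Znorm_pos[OF n] by (simp add: divide_ennreal)
qed

lemma Zset_eq_measure:
  assumes n: "n \<ge> 1" and A: "A \<in> sets (borel_of weak_topology)"
  shows "Zset b d n A = ennreal (measure (esd_law b d n) A * Znorm b d n)"
proof -
  interpret P: prob_space "esd_law b d n" by (rule prob_space_esd_law[OF n])
  have Z: "ennreal (Znorm b d n) \<noteq> 0" "ennreal (Znorm b d n) \<noteq> \<infinity>" using Znorm_pos[OF n] by auto
  have "Zset b d n A / ennreal (Znorm b d n) * ennreal (Znorm b d n) = Zset b d n A"
    using Z by (simp add: ennreal_divide_times ennreal_mult_divide_eq)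
  then have "Zset b d n A = ennreal (measure (esd_law b d n) A) * ennreal (Znorm b d n)"
    using emeasure_esd_law[OF n A] by (simp add: P.emeasure_eq_measure)
  then show ?thesis using ennreal_mult[OF measure_nonneg Znorm_nonneg[OF b d n], of "esd_law b d n" A] by simp
qed

lemma const_over_n_tendsto: "(\<lambda>n. C / real n) \<longlonglongrightarrow> 0"
  by (rule lim_const_over_n)

text \<open>Both bounds on the unnormalised law, applied to the whole space; the minimum of
  \<open>J\<close> is \<open>- B_d d\<close>.\<close>

lemma free_energy_limit: "(\<lambda>n. 1 / ((real n)\<^sup>2 * b) * ln (Znorm b d n)) \<longlonglongrightarrow> B_d d"
proof (rule order_tendstoI)
  fix y assume y: "y < B_d d"
  have M: "openin weak_topology M1" using openin_topspace[of weak_topology] by (simp add: topspace_weak_topology)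
  define a where "a = - (y + B_d d) / 2"
  have "J d (mu_d d) < ereal a" using y by (simp add: J_mu_d[OF d] a_def field_simps)
  from Zset_lower_bound[OF b d M mu_d_M1[OF d] this]
  show "\<forall>\<^sub>F n in sequentially. y < 1 / ((real n)\<^sup>2 * b) * ln (Znorm b d n)"
    using eventually_ge_at_top[of 1]
  proof eventually_elim
    case (elim n)
    then have "exp (- (b * (real n)\<^sup>2 * a)) \<le> Znorm b d n"
      using Zset_M1[OF b d, of n] Znorm_nonneg[OF b d, of n] by (simp add: ennreal_le_iff)
    then have "- (b * (real n)\<^sup>2 * a) \<le> ln (Znorm b d n)" using Znorm_pos[of n] elim by (simp add: ln_ge_iff)
    then have "- a \<le> 1 / ((real n)\<^sup>2 * b) * ln (Znorm b d n)" using b elim by (simp add: field_simps)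
    moreover have "y < - a" using y by (simp add: a_def field_simps)
    ultimately show ?case by simp
  qed
next
  fix y assume y: "B_d d < y"
  have M: "closedin weak_topology M1" using closedin_topspace[of weak_topology] by (simp add: topspace_weak_topology)
  define a where "a = - (y + B_d d) / 2"
  have aJ: "ereal a < J d \<mu>" if "\<mu> \<in> M1" for \<mu>
  proof -
    have "ereal a < ereal (- B_d d)" using y by (simp add: a_def field_simps)
    then show ?thesis using J_ge[OF d that] by (rule less_le_trans)
  qed
  obtain C where C: "\<And>n. n \<ge> 1 \<Longrightarrow> Zset b d n M1 \<le> ennreal (exp (- (b * (real n)\<^sup>2 * a) + b * real n * C))"
    using Zset_upper_bound[OF b d M aJ] by metis
  have ya: "- a < y" using y by (simp add: a_def field_simps)
  have "(\<lambda>n. - a + C / real n) \<longlonglongrightarrow> - a + 0" by (intro tendsto_intros const_over_n_tendsto)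
  then have "\<forall>\<^sub>F n in sequentially. - a + C / real n < y" using ya by (simp add: order_tendsto_iff)
  then show "\<forall>\<^sub>F n in sequentially. 1 / ((real n)\<^sup>2 * b) * ln (Znorm b d n) < y"
    using eventually_ge_at_top[of 1]
  proof eventually_elim
    case (elim n)
    then have "Znorm b d n \<le> exp (- (b * (real n)\<^sup>2 * a) + b * real n * C)"
      using C[of n] Zset_M1[OF b d, of n] by (simp add: ennreal_le_iff)
    then have "ln (Znorm b d n) \<le> - (b * (real n)\<^sup>2 * a) + b * real n * C"
      using Znorm_pos[of n] elim by (metis ln_exp ln_le_cancel_iff exp_gt_zero)
    then have "1 / ((real n)\<^sup>2 * b) * ln (Znorm b d n) \<le> 1 / ((real n)\<^sup>2 * b) * (- (b * (real n)\<^sup>2 * a) + b * real n * C)"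
      using b by (intro mult_left_mono) auto
    also have "\<dots> = - a + C / real n" using b elim by (simp add: field_simps power2_eq_square)
    finally show ?case using elim by simp
  qed
qed

lemma elog_div:
  assumes "0 < u" shows "elog x / ereal u = (if 0 < x then ereal (ln x / u) else - \<infinity>)"
  using assms by (simp add: elog_def)

text \<open>Dividing by the partition function adds \<open>B_d d\<close> to the exponent, which turns
  \<open>J\<close> into the rate function.\<close>

lemma LDP_upper_bound:
  assumes F: "closedin weak_topology F"
  shows "limsup (\<lambda>n. elog (measure (esd_law b d n) F) / ereal (b * (real n)\<^sup>2)) \<le> - (INF \<mu>\<in>F. I_d d \<mu>)"
proof -
  define l where "l = limsup (\<lambda>n. elog (measure (esd_law b d n) F) / ereal (b * (real n)\<^sup>2))"
  define m0 where "m0 = (INF \<mu>\<in>F. I_d d \<mu>)"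
  have FM: "F \<subseteq> M1" using closedin_subset[OF F] by (simp add: topspace_weak_topology)
  have FB: "F \<in> sets (borel_of weak_topology)"
  proof -
    have "topspace weak_topology - F \<in> sets (borel_of weak_topology)"
      using F by (auto simp: sets_borel_of closedin_def)
    then have "space (borel_of weak_topology) - (topspace weak_topology - F) \<in> sets (borel_of weak_topology)"
      by (rule sets.compl_sets)
    then show ?thesis using FM by (simp add: space_borel_of topspace_weak_topology double_diff)
  qed
  have key: "l \<le> ereal (- c)" if c: "ereal c < m0" for c
  proof -
    define a where "a = c - B_d d"
    have aJ: "ereal a < J d \<mu>" if "\<mu> \<in> F" for \<mu>
    proof -
      have "ereal c < I_d d \<mu>" using c[unfolded m0_def] INF_lower[OF that, of "I_d d"] by (rule less_le_trans)
      then show ?thesis unfolding I_d_eq_J a_def by (cases "J d \<mu>") auto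
    qed
    obtain C where C: "\<And>n. n \<ge> 1 \<Longrightarrow> Zset b d n F \<le> ennreal (exp (- (b * (real n)\<^sup>2 * a) + b * real n * C))"
      using Zset_upper_bound[OF b d F aJ] by metis
    define x where "x n = - a + C / real n - 1 / ((real n)\<^sup>2 * b) * ln (Znorm b d n)" for n
    have "x \<longlonglongrightarrow> - a + 0 - B_d d" unfolding x_def by (intro tendsto_intros const_over_n_tendsto free_energy_limit)
    then have xl: "(\<lambda>n. ereal (x n)) \<longlonglongrightarrow> ereal (- c)" by (simp add: a_def)
    have "\<forall>\<^sub>F n in sequentially. elog (measure (esd_law b d n) F) / ereal (b * (real n)\<^sup>2) \<le> ereal (x n)"
      using eventually_ge_at_top[of 1]
    proof eventually_elim
      case (elim n)
      define m where "m = measure (esd_law b d n) F"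
      have u: "0 < b * (real n)\<^sup>2" using b elim by simp
      show ?case
      proof (cases "0 < m")
        case True
        have "m * Znorm b d n \<le> exp (- (b * (real n)\<^sup>2 * a) + b * real n * C)"
          using C[OF elim] Zset_eq_measure[OF elim FB] by (simp add: m_def ennreal_le_iff)
        moreover have "0 < m * Znorm b d n" using True Znorm_pos[OF elim] by simp
        ultimately have "ln (m * Znorm b d n) \<le> - (b * (real n)\<^sup>2 * a) + b * real n * C"
          by (metis ln_exp ln_le_cancel_iff exp_gt_zero)
        then have "ln m \<le> - (b * (real n)\<^sup>2 * a) + b * real n * C - ln (Znorm b d n)"
          using True Znorm_pos[OF elim] by (simp add: ln_mult)
        then have "ln m / (b * (real n)\<^sup>2) \<le> (- (b * (real n)\<^sup>2 * a) + b * real n * C - ln (Znorm b d n)) / (b * (real n)\<^sup>2)"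
          using u by (intro divide_right_mono) auto
        also have "\<dots> = x n" using b elim by (simp add: x_def field_simps power2_eq_square)
        finally show ?thesis using True unfolding elog_div[OF u] m_def[symmetric] by simp
      qed (simp add: elog_div[OF u] m_def[symmetric])
    qed
    then have "l \<le> limsup (\<lambda>n. ereal (x n))" unfolding l_def by (rule Limsup_mono)
    also have "\<dots> = ereal (- c)" by (rule lim_imp_Limsup[OF _ xl]) simp
    finally show ?thesis .
  qed
  have "m0 \<le> - l"
  proof (rule dense_le)
    fix y assume y: "y < m0"
    show "y \<le> - l"
    proof (cases y)
      case (real c)
      have "l \<le> ereal (- c)" by (rule key) (use y in \<open>simp only: real\<close>)
      then show ?thesis unfolding real by (cases l) auto
    next
      case PInf
      then show ?thesis using y by simp
    next
      case MInf
      then show ?thesis by simp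
    qed
  qed
  then have "- (- l) \<le> - m0" by (simp only: ereal_minus_le_minus)
  then show ?thesis unfolding l_def m0_def by simp
qed

lemma LDP_lower_bound:
  assumes G: "openin weak_topology G"
  shows "- (INF \<mu>\<in>G. I_d d \<mu>) \<le> liminf (\<lambda>n. elog (measure (esd_law b d n) G) / ereal (b * (real n)\<^sup>2))"
proof -
  define l where "l = liminf (\<lambda>n. elog (measure (esd_law b d n) G) / ereal (b * (real n)\<^sup>2))"
  have GB: "G \<in> sets (borel_of weak_topology)" using G by (auto simp: sets_borel_of)
  have low: "ereal (- a - B_d d) \<le> l" if \<mu>: "\<mu> \<in> G" and a: "J d \<mu> < ereal a" for \<mu> a
  proof -
    define x where "x n = - a - 1 / ((real n)\<^sup>2 * b) * ln (Znorm b d n)" for n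
    have "x \<longlonglongrightarrow> - a - B_d d" unfolding x_def by (intro tendsto_intros free_energy_limit)
    then have xl: "(\<lambda>n. ereal (x n)) \<longlonglongrightarrow> ereal (- a - B_d d)" by simp
    have "\<forall>\<^sub>F n in sequentially. ereal (x n) \<le> elog (measure (esd_law b d n) G) / ereal (b * (real n)\<^sup>2)"
      using Zset_lower_bound[OF b d G \<mu> a] eventually_ge_at_top[of 1]
    proof eventually_elim
      case (elim n)
      define m where "m = measure (esd_law b d n) G"
      have u: "0 < b * (real n)\<^sup>2" using b elim by simp
      have mZ: "exp (- (b * (real n)\<^sup>2 * a)) \<le> m * Znorm b d n"
        using elim Zset_eq_measure[OF elim(2) GB] Znorm_pos[OF elim(2)] by (simp add: m_def ennreal_le_iff)
      then have "0 < m * Znorm b d n" using exp_gt_zero less_le_trans by blast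
      then have m0: "0 < m" using Znorm_pos[OF elim(2)] by (simp add: zero_less_mult_iff)
      have "- (b * (real n)\<^sup>2 * a) \<le> ln (m * Znorm b d n)" using mZ \<open>0 < m * Znorm b d n\<close> by (simp add: ln_ge_iff)
      then have "- (b * (real n)\<^sup>2 * a) - ln (Znorm b d n) \<le> ln m"
        using m0 Znorm_pos[OF elim(2)] by (simp add: ln_mult)
      then have "(- (b * (real n)\<^sup>2 * a) - ln (Znorm b d n)) / (b * (real n)\<^sup>2) \<le> ln m / (b * (real n)\<^sup>2)"
        using u by (intro divide_right_mono) auto
      moreover have "(- (b * (real n)\<^sup>2 * a) - ln (Znorm b d n)) / (b * (real n)\<^sup>2) = x n"
        using b elim by (simp add: x_def field_simps power2_eq_square)
      ultimately show ?case using m0 unfolding elog_div[OF u] m_def[symmetric] by simp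
    qed
    then have "liminf (\<lambda>n. ereal (x n)) \<le> l" unfolding l_def by (rule Liminf_mono)
    moreover have "liminf (\<lambda>n. ereal (x n)) = ereal (- a - B_d d)" by (rule lim_imp_Liminf[OF _ xl]) simp
    ultimately show ?thesis by simp
  qed
  have "- l \<le> (INF \<mu>\<in>G. I_d d \<mu>)"
  proof (rule INF_greatest)
    fix \<mu> assume \<mu>: "\<mu> \<in> G"
    have M: "\<mu> \<in> M1" using openin_subset[OF G] \<mu> by (auto simp: topspace_weak_topology)
    show "- l \<le> I_d d \<mu>"
    proof (cases "J d \<mu>")
      case (real j)
      show ?thesis
      proof (rule ereal_le_epsilon2)
        fix e :: real assume e: "0 < e"
        have "ereal (- (j + e) - B_d d) \<le> l" using low[OF \<mu>, of "j + e"] real e by simp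
        then have "- l \<le> - ereal (- (j + e) - B_d d)" by (simp only: ereal_minus_le_minus)
        also have "\<dots> = I_d d \<mu> + ereal e" unfolding I_d_eq_J real by simp
        finally show "- l \<le> I_d d \<mu> + ereal e" .
      qed
    next
      case MInf
      then show ?thesis using J_ge[OF d M] by simp
    qed (simp add: I_d_eq_J)
  qed
  then show ?thesis unfolding l_def[symmetric] by (metis ereal_minus_le_minus ereal_uminus_uminus)
qed

lemma LDP_esd_law: "LDP weak_topology (esd_law b d) (\<lambda>n. b * (real n)\<^sup>2) (I_d d)"
  unfolding LDP_def
proof (intro conjI allI impI)
  show "Hausdorff_space weak_topology" by (rule Hausdorff_weak_topology)
  show "prob_space (esd_law b d n)" if "1 \<le> n" for n by (rule prob_space_esd_law[OF that])
  show "sets (esd_law b d n) = sets (borel_of weak_topology)" for n by (simp add: esd_law_def)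
  show "filterlim (\<lambda>n. b * (real n)\<^sup>2) at_top sequentially"
    by (intro filterlim_tendsto_pos_mult_at_top[OF tendsto_const b] filterlim_pow_at_top filterlim_real_sequentially) simp
qed (intro rate_function_I_d LDP_upper_bound LDP_lower_bound; assumption?)+

end

theorem theorem5p5:
  fixes \<beta> \<beta>' :: real and d :: complex
  assumes "\<beta> > 0" and "\<beta>' = \<beta> / 2" and "Re d \<ge> 0"
  shows "(\<lambda>n. 1 / ((real n)\<^sup>2 * \<beta>') * ln (Znorm \<beta>' d n)) \<longlonglongrightarrow> B_d d
         \<and> LDP weak_topology (esd_law \<beta>' d) (\<lambda>n. \<beta>' * (real n)\<^sup>2) (I_d d)
         \<and> good_rate_function weak_topology (I_d d)
         \<and> {\<mu> \<in> M1. I_d d \<mu> = 0} = {mu_d d}"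
proof -
  have b: "0 < \<beta>'" using assms by simp
  show ?thesis
    using free_energy_limit[OF b assms(3)] LDP_esd_law[OF b assms(3)]
      good_rate_function_I_d[OF b assms(3)] I_d_zeros[OF b assms(3)] by blast
qed

end
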